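(* Let $(M_1,\tilde g_1)$ and $(M_2,\tilde g_2)$ be pseudo-Riemannian manifolds with cometrics $g_1,g_2$, let $\Pi_i$ be a bivector field on $M_i$ ($i=1,2$), let $f$ be a positive smooth function on $M_1$ and $\mu$ a smooth function on $M_1$. If $f$ is a Casimir function (of $\Pi_1$) and $\mu$ is a nonzero essentially constant function, then the triple $(M_1\times M_2,g^f,\Pi^\mu)$ is Ricci flat if and only if $(M_1,g_1,\Pi_1)$ and $(M_2,g_2,\Pi_2)$ are Ricci flat.
   Context: For a bivector field $\Pi$ on $M$, the anchor map $\sharp_\Pi:T^*M\to TM$ is given by $\beta(\sharp_\Pi(\alpha))=\Pi(\alpha,\beta)$, and the Koszul bracket of 1-forms is $[\alpha,\beta]_\Pi=\mathcal L_{\sharp_\Pi(\alpha)}\beta-\mathcal L_{\sharp_\Pi(\beta)}\alpha-d(\Pi(\alpha,\beta))$. A function $\varphi$ is Casimir if $\sharp_\Pi(d\varphi)=0$. A function is essentially constant if it is constant on each connected component. A contravariant connection with respect to $\Pi$ is an $\mathbb R$-bilinear map $\mathcal D:\Gamma(T^*M)\times\Gamma(T^*M)\to\Gamma(T^*M)$ with $\mathcal D_{\varphi\alpha}\beta=\varphi\mathcal D_\alpha\beta$ and $\mathcal D_\alpha(\varphi\beta)=\varphi\mathcal D_\alpha\beta+\sharp_\Pi(\alpha)(\varphi)\beta$ for all smooth functions $\varphi$. The cometric of a pseudo-Riemannian metric $\tilde g$ is the induced metric $g$ on $T^*M$. The Levi-Civita contravariant connection of $(g,\Pi)$ is the unique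 contravariant connection with respect to $\Pi$ satisfying $\sharp_\Pi(\alpha).g(\beta,\gamma)=g(\mathcal D_\alpha\beta,\gamma)+g(\beta,\mathcal D_\alpha\gamma)$ and $\mathcal D_\alpha\beta-\mathcal D_\beta\alpha=[\alpha,\beta]_\Pi$. Its curvature is $\mathcal R(\alpha,\beta)=\mathcal D_\alpha\mathcal D_\beta-\mathcal D_\beta\mathcal D_\alpha-\mathcal D_{[\alpha,\beta]_\Pi}$. The Ricci curvature of $(M,g,\Pi)$ at $p\in M$ is defined by $r_p(\theta_p,\eta_p)=\sum_{i=1}^n g_p(\mathcal R_p(\theta_p,e_i)e_i,\eta_p)$ for cotangent vectors $\theta_p,\eta_p$ at $p$, where $\{e_1,\dots,e_n\}$ is a local orthonormal basis of 1-forms with respect to $g$. The triple $(M,g,\Pi)$ is Ricci flat if $r=0$. With $\sigma_i:M_1\times M_2\to M_i$ the projections, lifts of functions and forms are $\omega_1^h=\sigma_1^*\omega_1$, $\omega_2^v=\sigma_2^*\omega_2$. For all 1-forms $\alpha_i,\beta_i$ on $M_i$ ($i=1,2$), the warped bivector field $\Pi^\mu$ on $M_1\times M_2$ is determined by $\Pi^\mu(\alpha_1^h,\beta_1^h)=\Pi_1(\alpha_1,\beta_1)^h$, $\Pi^\mu(\alpha_2^v,\beta_2^v)=\mu^h\Pi_2(\alpha_2,\beta_2)^v$, $\Pi^\mu(\alpha_1^h,\beta_2^v)=0$, and the contravariant warped metric $g^f$ by $g^f(\alpha_1^h,\beta_1^h)=g_1(\alpha_1,\beta_1)^h$, $g^f(\alpha_2^v,\beta_2^v)=f^hg_2(\alpha_2,\beta_2)^v$,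 $g^f(\alpha_1^h,\alpha_2^v)=0$.
   Formalization: The Ricci sum carries the signs g(e_i,e_i)=±1, since for an indefinite metric the unsigned sum depends on the orthonormal basis; as the bivector fields need not be Poisson, Ricci flat means that the sum vanishes for every local orthonormal basis of 1-forms. *)

theory Defs
  imports "HOL-Analysis.Analysis" "HOL-Library.Function_Algebras"
begin

text \<open>
  Sums, differences and zeros of functions (hence of tangent vectors, covectors and 1-forms, which
  are all represented as functions) are the pointwise ones of \<^theory>\<open>HOL-Library.Function_Algebras\<close>.
\<close>

section \<open>Smooth manifolds\<close>

primrec Ck_on :: "nat \<Rightarrow> ('a::euclidean_space \<Rightarrow> 'b::euclidean_space) \<Rightarrow> 'a set \<Rightarrow> bool" where
  "Ck_on 0 f S \<longleftrightarrow> continuous_on S f"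
| "Ck_on (Suc k) f S \<longleftrightarrow>
     (\<forall>x\<in>S. f differentiable (at x)) \<and> (\<forall>v. Ck_on k (\<lambda>x. frechet_derivative f (at x) v) S)"

text \<open>Only used for open \<^term>\<open>S\<close>.\<close>

definition smooth_on :: "('a::euclidean_space \<Rightarrow> 'b::euclidean_space) \<Rightarrow> 'a set \<Rightarrow> bool" where
  "smooth_on f S \<longleftrightarrow> (\<forall>k. Ck_on k f S)"

text \<open>
  The points of a manifold are the elements of a type, which carries the topology; the smooth
  structure is given by an atlas (not necessarily maximal) of charts \<open>(U, \<phi>)\<close> with values in a
  Euclidean space. The values of \<open>\<phi>\<close> outside \<open>U\<close> are irrelevant.
\<close>

type_synonym ('m, 'e) atlas = "('m set \<times> ('m \<Rightarrow> 'e)) set"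

definition chart :: "'m::topological_space set \<Rightarrow> ('m \<Rightarrow> 'e::euclidean_space) \<Rightarrow> bool" where
  "chart U \<phi> \<longleftrightarrow> open U \<and> open (\<phi> ` U) \<and> homeomorphism U (\<phi> ` U) \<phi> (inv_into U \<phi>)"

definition smooth_manifold ::
  "('m::{t2_space, second_countable_topology}, 'e::euclidean_space) atlas \<Rightarrow> bool" where
  "smooth_manifold A \<longleftrightarrow>
     (\<forall>(U, \<phi>)\<in>A. chart U \<phi>) \<and>
     (\<Union>(U, \<phi>)\<in>A. U) = UNIV \<and>
     (\<forall>(U, \<phi>)\<in>A. \<forall>(V, \<psi>)\<in>A. smooth_on (\<psi> \<circ> inv_into U \<phi>) (\<phi> ` (U \<inter> V)))"

definition prod_atlas ::
  "('m1, 'e1) atlas \<Rightarrow> ('m2, 'e2) atlas \<Rightarrow> ('m1 \<times> 'm2, 'e1 \<times> 'e2) atlas" where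
  "prod_atlas A1 A2 =
     {(U \<times> V, map_prod \<phi> \<psi>) | U \<phi> V \<psi>. (U, \<phi>) \<in> A1 \<and> (V, \<psi>) \<in> A2}"

definition smooth_functions :: "('m, 'e::euclidean_space) atlas \<Rightarrow> ('m \<Rightarrow> real) set" where
  "smooth_functions A = {\<phi>. \<forall>(U, \<kappa>)\<in>A. smooth_on (\<phi> \<circ> inv_into U \<kappa>) (\<kappa> ` U)}"


section \<open>Tangent vectors, covectors, vector fields and 1-forms\<close>

text \<open>
  Tangent vectors at \<open>p\<close> are the derivations at \<open>p\<close> of the algebra of smooth functions. To make
  equality of tangent vectors (covectors) meaningful they are set to 0 outside their domain, i.e.
  on functions that are not smooth (on arguments that are not tangent vectors at \<open>p\<close>).
\<close>

type_synonym 'm tvec = "('m \<Rightarrow> real) \<Rightarrow> real"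
type_synonym 'm covec = "'m tvec \<Rightarrow> real"
type_synonym 'm form = "'m \<Rightarrow> 'm covec"

text \<open>Here \<^term>\<open>V\<close> is a linear space of real-valued functions.\<close>

definition linear_form :: "('x \<Rightarrow> real) set \<Rightarrow> (('x \<Rightarrow> real) \<Rightarrow> real) \<Rightarrow> bool" where
  "linear_form V L \<longleftrightarrow>
     (\<forall>v\<in>V. \<forall>w\<in>V. L (v + w) = L v + L w) \<and>
     (\<forall>c. \<forall>v\<in>V. L (\<lambda>x. c * v x) = c * L v)"

definition bilinear_form ::
  "('x \<Rightarrow> real) set \<Rightarrow> (('x \<Rightarrow> real) \<Rightarrow> ('x \<Rightarrow> real) \<Rightarrow> real) \<Rightarrow> bool" where
  "bilinear_form V B \<longleftrightarrow>
     (\<forall>v\<in>V. linear_form V (\<lambda>w. B v w)) \<and> (\<forall>w\<in>V. linear_form V (\<lambda>v. B v w))"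

definition tangent_space :: "('m, 'e::euclidean_space) atlas \<Rightarrow> 'm \<Rightarrow> 'm tvec set" where
  "tangent_space A p =
     {v. linear_form (smooth_functions A) v \<and>
         (\<forall>\<phi>\<in>smooth_functions A. \<forall>\<psi>\<in>smooth_functions A.
            v (\<lambda>x. \<phi> x * \<psi> x) = \<phi> p * v \<psi> + \<psi> p * v \<phi>) \<and>
         (\<forall>\<phi>. \<phi> \<notin> smooth_functions A \<longrightarrow> v \<phi> = 0)}"

definition cotangent_space :: "('m, 'e::euclidean_space) atlas \<Rightarrow> 'm \<Rightarrow> 'm covec set" where
  "cotangent_space A p =
     {a. linear_form (tangent_space A p) a \<and> (\<forall>v. v \<notin> tangent_space A p \<longrightarrow> a v = 0)}"

definition vector_field :: "('m, 'e::euclidean_space) atlas \<Rightarrow> ('m \<Rightarrow> 'm tvec) \<Rightarrow> bool" where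
  "vector_field A X \<longleftrightarrow>
     (\<forall>p. X p \<in> tangent_space A p) \<and>
     (\<forall>\<phi>\<in>smooth_functions A. (\<lambda>p. X p \<phi>) \<in> smooth_functions A)"

definition one_form :: "('m, 'e::euclidean_space) atlas \<Rightarrow> 'm form \<Rightarrow> bool" where
  "one_form A \<alpha> \<longleftrightarrow>
     (\<forall>p. \<alpha> p \<in> cotangent_space A p) \<and>
     (\<forall>X. vector_field A X \<longrightarrow> (\<lambda>p. \<alpha> p (X p)) \<in> smooth_functions A)"

definition fscale :: "('m \<Rightarrow> real) \<Rightarrow> 'm form \<Rightarrow> 'm form" where
  "fscale \<phi> \<alpha> = (\<lambda>p v. \<phi> p * \<alpha> p v)"

definition differential :: "('m, 'e::euclidean_space) atlas \<Rightarrow> ('m \<Rightarrow> real) \<Rightarrow> 'm form" where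
  "differential A \<phi> = (\<lambda>p v. if v \<in> tangent_space A p then v \<phi> else 0)"

definition lie_bracket ::
  "('m, 'e::euclidean_space) atlas \<Rightarrow> ('m \<Rightarrow> 'm tvec) \<Rightarrow> ('m \<Rightarrow> 'm tvec) \<Rightarrow> 'm \<Rightarrow> 'm tvec" where
  "lie_bracket A X Y =
     (\<lambda>p \<phi>. if \<phi> \<in> smooth_functions A
        then X p (\<lambda>q. Y q \<phi>) - Y p (\<lambda>q. X q \<phi>) else 0)"

text \<open>\<open>(L\<^sub>X \<beta>)(Y) = X(\<beta>(Y)) - \<beta>([X,Y])\<close> for all vector fields \<open>Y\<close>.\<close>

definition lie_derivative ::
  "('m, 'e::euclidean_space) atlas \<Rightarrow> ('m \<Rightarrow> 'm tvec) \<Rightarrow> 'm form \<Rightarrow> 'm form" where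
  "lie_derivative A X \<beta> =
     (THE \<gamma>. one_form A \<gamma> \<and>
        (\<forall>Y. vector_field A Y \<longrightarrow>
           (\<forall>p. \<gamma> p (Y p) = X p (\<lambda>q. \<beta> q (Y q)) - \<beta> p (lie_bracket A X Y p))))"

definition pullback ::
  "('m, 'e::euclidean_space) atlas \<Rightarrow> ('n, 'd::euclidean_space) atlas \<Rightarrow> ('m \<Rightarrow> 'n) \<Rightarrow>
   'n form \<Rightarrow> 'm form" where
  "pullback A B \<sigma> \<omega> =
     (\<lambda>p v. if v \<in> tangent_space A p
        then \<omega> (\<sigma> p) (\<lambda>\<phi>. if \<phi> \<in> smooth_functions B then v (\<phi> \<circ> \<sigma>) else 0) else 0)"

abbreviation hlift ::
  "('m1, 'e1::euclidean_space) atlas \<Rightarrow> ('m2, 'e2::euclidean_space) atlas \<Rightarrow>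
   'm1 form \<Rightarrow> ('m1 \<times> 'm2) form" where
  "hlift A1 A2 \<equiv> pullback (prod_atlas A1 A2) A1 fst"

abbreviation vlift ::
  "('m1, 'e1::euclidean_space) atlas \<Rightarrow> ('m2, 'e2::euclidean_space) atlas \<Rightarrow>
   'm2 form \<Rightarrow> ('m1 \<times> 'm2) form" where
  "vlift A1 A2 \<equiv> pullback (prod_atlas A1 A2) A2 snd"


section \<open>Metrics and bivector fields\<close>

definition pseudo_riemannian_metric ::
  "('m, 'e::euclidean_space) atlas \<Rightarrow> ('m \<Rightarrow> 'm tvec \<Rightarrow> 'm tvec \<Rightarrow> real) \<Rightarrow> bool" where
  "pseudo_riemannian_metric A gt \<longleftrightarrow>
     (\<forall>p. bilinear_form (tangent_space A p) (gt p) \<and>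
        (\<forall>v\<in>tangent_space A p. \<forall>w\<in>tangent_space A p. gt p v w = gt p w v) \<and>
        (\<forall>v\<in>tangent_space A p. (\<forall>w\<in>tangent_space A p. gt p v w = 0) \<longrightarrow> v = 0)) \<and>
     (\<forall>X Y. vector_field A X \<longrightarrow> vector_field A Y \<longrightarrow>
        (\<lambda>p. gt p (X p) (Y p)) \<in> smooth_functions A)"

text \<open>The same on the cotangent bundle.\<close>

definition contravariant_metric ::
  "('m, 'e::euclidean_space) atlas \<Rightarrow> ('m \<Rightarrow> 'm covec \<Rightarrow> 'm covec \<Rightarrow> real) \<Rightarrow> bool" where
  "contravariant_metric A g \<longleftrightarrow>
     (\<forall>p. bilinear_form (cotangent_space A p) (g p) \<and>
        (\<forall>a\<in>cotangent_space A p. \<forall>b\<in>cotangent_space A p. g p a b = g p b a) \<and>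
        (\<forall>a\<in>cotangent_space A p. (\<forall>b\<in>cotangent_space A p. g p a b = 0) \<longrightarrow> a = 0)) \<and>
     (\<forall>\<alpha> \<beta>. one_form A \<alpha> \<longrightarrow> one_form A \<beta> \<longrightarrow>
        (\<lambda>p. g p (\<alpha> p) (\<beta> p)) \<in> smooth_functions A)"

definition metric_sharp ::
  "('m, 'e::euclidean_space) atlas \<Rightarrow> ('m \<Rightarrow> 'm tvec \<Rightarrow> 'm tvec \<Rightarrow> real) \<Rightarrow>
   'm \<Rightarrow> 'm covec \<Rightarrow> 'm tvec" where
  "metric_sharp A gt p a =
     (THE v. v \<in> tangent_space A p \<and> (\<forall>w\<in>tangent_space A p. gt p v w = a w))"

definition cometric ::
  "('m, 'e::euclidean_space) atlas \<Rightarrow> ('m \<Rightarrow> 'm tvec \<Rightarrow> 'm tvec \<Rightarrow> real) \<Rightarrow>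
   'm \<Rightarrow> 'm covec \<Rightarrow> 'm covec \<Rightarrow> real" where
  "cometric A gt p a b = gt p (metric_sharp A gt p a) (metric_sharp A gt p b)"

text \<open>No Jacobi identity: a bivector field need not be Poisson.\<close>

definition bivector_field ::
  "('m, 'e::euclidean_space) atlas \<Rightarrow> ('m \<Rightarrow> 'm covec \<Rightarrow> 'm covec \<Rightarrow> real) \<Rightarrow> bool" where
  "bivector_field A P \<longleftrightarrow>
     (\<forall>p. bilinear_form (cotangent_space A p) (P p) \<and>
        (\<forall>a\<in>cotangent_space A p. P p a a = 0)) \<and>
     (\<forall>\<alpha> \<beta>. one_form A \<alpha> \<longrightarrow> one_form A \<beta> \<longrightarrow>
        (\<lambda>p. P p (\<alpha> p) (\<beta> p)) \<in> smooth_functions A)"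

definition anchor ::
  "('m, 'e::euclidean_space) atlas \<Rightarrow> ('m \<Rightarrow> 'm covec \<Rightarrow> 'm covec \<Rightarrow> real) \<Rightarrow>
   'm form \<Rightarrow> 'm \<Rightarrow> 'm tvec" where
  "anchor A P \<alpha> =
     (\<lambda>p. THE v. v \<in> tangent_space A p \<and> (\<forall>b\<in>cotangent_space A p. b v = P p (\<alpha> p) b))"

definition casimir ::
  "('m, 'e::euclidean_space) atlas \<Rightarrow> ('m \<Rightarrow> 'm covec \<Rightarrow> 'm covec \<Rightarrow> real) \<Rightarrow>
   ('m \<Rightarrow> real) \<Rightarrow> bool" where
  "casimir A P \<phi> \<longleftrightarrow> \<phi> \<in> smooth_functions A \<and> anchor A P (differential A \<phi>) = 0"

definition essentially_constant :: "('m::topological_space \<Rightarrow> real) \<Rightarrow> bool" where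
  "essentially_constant \<phi> \<longleftrightarrow> (\<forall>C\<in>components UNIV. \<phi> constant_on C)"

definition koszul_bracket ::
  "('m, 'e::euclidean_space) atlas \<Rightarrow> ('m \<Rightarrow> 'm covec \<Rightarrow> 'm covec \<Rightarrow> real) \<Rightarrow>
   'm form \<Rightarrow> 'm form \<Rightarrow> 'm form" where
  "koszul_bracket A P \<alpha> \<beta> =
     lie_derivative A (anchor A P \<alpha>) \<beta> - lie_derivative A (anchor A P \<beta>) \<alpha>
     - differential A (\<lambda>p. P p (\<alpha> p) (\<beta> p))"


section \<open>Contravariant connections and Ricci curvature\<close>

text \<open>
  A map \<open>\<Gamma>(T\<^sup>*M) \<times> \<Gamma>(T\<^sup>*M) \<rightarrow> \<Gamma>(T\<^sup>*M)\<close> is represented by a function that is 0 unless both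
  arguments are 1-forms.
\<close>

definition contravariant_connection ::
  "('m, 'e::euclidean_space) atlas \<Rightarrow> ('m \<Rightarrow> 'm covec \<Rightarrow> 'm covec \<Rightarrow> real) \<Rightarrow>
   ('m form \<Rightarrow> 'm form \<Rightarrow> 'm form) \<Rightarrow> bool" where
  "contravariant_connection A P D \<longleftrightarrow>
     (\<forall>\<alpha> \<beta>. one_form A \<alpha> \<longrightarrow> one_form A \<beta> \<longrightarrow> one_form A (D \<alpha> \<beta>)) \<and>
     (\<forall>\<alpha> \<beta>. \<not> (one_form A \<alpha> \<and> one_form A \<beta>) \<longrightarrow> D \<alpha> \<beta> = 0) \<and>
     (\<forall>\<alpha> \<alpha>' \<beta>. one_form A \<alpha> \<longrightarrow> one_form A \<alpha>' \<longrightarrow> one_form A \<beta> \<longrightarrow>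
        D (\<alpha> + \<alpha>') \<beta> = D \<alpha> \<beta> + D \<alpha>' \<beta> \<and> D \<beta> (\<alpha> + \<alpha>') = D \<beta> \<alpha> + D \<beta> \<alpha>') \<and>
     (\<forall>c \<alpha> \<beta>. one_form A \<alpha> \<longrightarrow> one_form A \<beta> \<longrightarrow>
        D (fscale (\<lambda>_. c) \<alpha>) \<beta> = fscale (\<lambda>_. c) (D \<alpha> \<beta>) \<and>
        D \<alpha> (fscale (\<lambda>_. c) \<beta>) = fscale (\<lambda>_. c) (D \<alpha> \<beta>)) \<and>
     (\<forall>\<phi>\<in>smooth_functions A. \<forall>\<alpha> \<beta>. one_form A \<alpha> \<longrightarrow> one_form A \<beta> \<longrightarrow>
        D (fscale \<phi> \<alpha>) \<beta> = fscale \<phi> (D \<alpha> \<beta>) \<and>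
        D \<alpha> (fscale \<phi> \<beta>) = fscale \<phi> (D \<alpha> \<beta>) + fscale (\<lambda>p. anchor A P \<alpha> p \<phi>) \<beta>)"

definition levi_civita ::
  "('m, 'e::euclidean_space) atlas \<Rightarrow> ('m \<Rightarrow> 'm covec \<Rightarrow> 'm covec \<Rightarrow> real) \<Rightarrow>
   ('m \<Rightarrow> 'm covec \<Rightarrow> 'm covec \<Rightarrow> real) \<Rightarrow> 'm form \<Rightarrow> 'm form \<Rightarrow> 'm form" where
  "levi_civita A g P =
     (THE D. contravariant_connection A P D \<and>
        (\<forall>\<alpha> \<beta> \<gamma>. one_form A \<alpha> \<longrightarrow> one_form A \<beta> \<longrightarrow> one_form A \<gamma> \<longrightarrow>
           (\<forall>p. anchor A P \<alpha> p (\<lambda>q. g q (\<beta> q) (\<gamma> q)) =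
              g p (D \<alpha> \<beta> p) (\<gamma> p) + g p (\<beta> p) (D \<alpha> \<gamma> p))) \<and>
        (\<forall>\<alpha> \<beta>. one_form A \<alpha> \<longrightarrow> one_form A \<beta> \<longrightarrow>
           D \<alpha> \<beta> - D \<beta> \<alpha> = koszul_bracket A P \<alpha> \<beta>))"

definition curvature ::
  "('m, 'e::euclidean_space) atlas \<Rightarrow> ('m \<Rightarrow> 'm covec \<Rightarrow> 'm covec \<Rightarrow> real) \<Rightarrow>
   ('m \<Rightarrow> 'm covec \<Rightarrow> 'm covec \<Rightarrow> real) \<Rightarrow> 'm form \<Rightarrow> 'm form \<Rightarrow> 'm form \<Rightarrow> 'm form" where
  "curvature A g P \<alpha> \<beta> \<gamma> =
     (let D = levi_civita A g P
      in D \<alpha> (D \<beta> \<gamma>) - D \<beta> (D \<alpha> \<gamma>) - D (koszul_bracket A P \<alpha> \<beta>) \<gamma>)"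

text \<open>
  A local orthonormal basis of 1-forms near \<open>p\<close> is represented by globally defined 1-forms
  \<open>e 1, \<dots>, e n\<close> (where \<open>n\<close> is the dimension) that are orthonormal on an open neighbourhood of \<open>p\<close>;
  since connections are local operators, extending a local frame from a smaller neighbourhood to
  all of the manifold with a cut-off function changes nothing at \<open>p\<close>. As the metric may be
  indefinite, orthonormal means \<open>g(e\<^sub>i, e\<^sub>j) = 0\<close> for \<open>i \<noteq> j\<close> and \<open>g(e\<^sub>i, e\<^sub>i) = 1\<close> or \<open>-1\<close>.
\<close>

definition orthonormal_frame_at ::
  "('m::topological_space, 'e::euclidean_space) atlas \<Rightarrow>
   ('m \<Rightarrow> 'm covec \<Rightarrow> 'm covec \<Rightarrow> real) \<Rightarrow> 'm \<Rightarrow> (nat \<Rightarrow> 'm form) \<Rightarrow> bool" where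
  "orthonormal_frame_at A g p e \<longleftrightarrow>
     (\<forall>i\<in>{1..DIM('e)}. one_form A (e i)) \<and>
     (\<exists>U. open U \<and> p \<in> U \<and>
        (\<forall>q\<in>U. \<forall>i\<in>{1..DIM('e)}. \<forall>j\<in>{1..DIM('e)}.
           if i = j then \<bar>g q (e i q) (e j q)\<bar> = 1 else g q (e i q) (e j q) = 0))"

text \<open>
  \<open>r\<^sub>p(\<theta>\<^sub>p, \<eta>\<^sub>p) = \<Sum>\<^sub>i \<epsilon>\<^sub>i g\<^sub>p(R\<^sub>p(\<theta>\<^sub>p, e\<^sub>i)e\<^sub>i, \<eta>\<^sub>p)\<close>, with the covectors at \<open>p\<close> given as the values of
  1-forms. The signs \<open>\<epsilon>\<^sub>i = g(e\<^sub>i, e\<^sub>i)\<close>, which are all 1 in the Riemannian case, make the sum a trace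
  for an indefinite metric; without them it would depend on the choice of the basis at \<open>p\<close>.
\<close>

definition ricci ::
  "('m, 'e::euclidean_space) atlas \<Rightarrow> ('m \<Rightarrow> 'm covec \<Rightarrow> 'm covec \<Rightarrow> real) \<Rightarrow>
   ('m \<Rightarrow> 'm covec \<Rightarrow> 'm covec \<Rightarrow> real) \<Rightarrow> (nat \<Rightarrow> 'm form) \<Rightarrow> 'm \<Rightarrow>
   'm form \<Rightarrow> 'm form \<Rightarrow> real" where
  "ricci A g P e p \<theta> \<eta> =
     (\<Sum>i\<in>{1..DIM('e)}. g p (e i p) (e i p) * g p (curvature A g P \<theta> (e i) (e i) p) (\<eta> p))"

text \<open>
  If \<open>P\<close> is not Poisson, the curvature is not tensorial in its last argument and \<^const>\<open>ricci\<close> may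
  depend on the derivatives of the frame; Ricci flatness therefore refers to all frames.
\<close>

definition ricci_flat ::
  "('m::topological_space, 'e::euclidean_space) atlas \<Rightarrow>
   ('m \<Rightarrow> 'm covec \<Rightarrow> 'm covec \<Rightarrow> real) \<Rightarrow> ('m \<Rightarrow> 'm covec \<Rightarrow> 'm covec \<Rightarrow> real) \<Rightarrow> bool" where
  "ricci_flat A g P \<longleftrightarrow>
     (\<forall>p e \<theta> \<eta>. orthonormal_frame_at A g p e \<longrightarrow> one_form A \<theta> \<longrightarrow> one_form A \<eta> \<longrightarrow>
        ricci A g P e p \<theta> \<eta> = 0)"


section \<open>Warped products\<close>

text \<open>
  The lifted 1-forms span every cotangent space of the product, so each of the following two
  predicates determines its last argument on cotangent vectors.
\<close>

definition warped_bivector ::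
  "('m1, 'e1::euclidean_space) atlas \<Rightarrow> ('m2, 'e2::euclidean_space) atlas \<Rightarrow>
   ('m1 \<Rightarrow> 'm1 covec \<Rightarrow> 'm1 covec \<Rightarrow> real) \<Rightarrow> ('m2 \<Rightarrow> 'm2 covec \<Rightarrow> 'm2 covec \<Rightarrow> real) \<Rightarrow>
   ('m1 \<Rightarrow> real) \<Rightarrow>
   ('m1 \<times> 'm2 \<Rightarrow> ('m1 \<times> 'm2) covec \<Rightarrow> ('m1 \<times> 'm2) covec \<Rightarrow> real) \<Rightarrow> bool" where
  "warped_bivector A1 A2 P1 P2 \<mu> P \<longleftrightarrow>
     bivector_field (prod_atlas A1 A2) P \<and>
     (\<forall>\<alpha>1 \<beta>1 \<alpha>2 \<beta>2 p1 p2. one_form A1 \<alpha>1 \<longrightarrow> one_form A1 \<beta>1 \<longrightarrow> one_form A2 \<alpha>2 \<longrightarrow> one_form A2 \<beta>2 \<longrightarrow>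
        P (p1, p2) (hlift A1 A2 \<alpha>1 (p1, p2)) (hlift A1 A2 \<beta>1 (p1, p2))
          = P1 p1 (\<alpha>1 p1) (\<beta>1 p1) \<and>
        P (p1, p2) (vlift A1 A2 \<alpha>2 (p1, p2)) (vlift A1 A2 \<beta>2 (p1, p2))
          = \<mu> p1 * P2 p2 (\<alpha>2 p2) (\<beta>2 p2) \<and>
        P (p1, p2) (hlift A1 A2 \<alpha>1 (p1, p2)) (vlift A1 A2 \<beta>2 (p1, p2)) = 0)"

definition warped_metric ::
  "('m1, 'e1::euclidean_space) atlas \<Rightarrow> ('m2, 'e2::euclidean_space) atlas \<Rightarrow>
   ('m1 \<Rightarrow> 'm1 covec \<Rightarrow> 'm1 covec \<Rightarrow> real) \<Rightarrow> ('m2 \<Rightarrow> 'm2 covec \<Rightarrow> 'm2 covec \<Rightarrow> real) \<Rightarrow>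
   ('m1 \<Rightarrow> real) \<Rightarrow>
   ('m1 \<times> 'm2 \<Rightarrow> ('m1 \<times> 'm2) covec \<Rightarrow> ('m1 \<times> 'm2) covec \<Rightarrow> real) \<Rightarrow> bool" where
  "warped_metric A1 A2 g1 g2 f g \<longleftrightarrow>
     contravariant_metric (prod_atlas A1 A2) g \<and>
     (\<forall>\<alpha>1 \<beta>1 \<alpha>2 \<beta>2 p1 p2. one_form A1 \<alpha>1 \<longrightarrow> one_form A1 \<beta>1 \<longrightarrow> one_form A2 \<alpha>2 \<longrightarrow> one_form A2 \<beta>2 \<longrightarrow>
        g (p1, p2) (hlift A1 A2 \<alpha>1 (p1, p2)) (hlift A1 A2 \<beta>1 (p1, p2))
          = g1 p1 (\<alpha>1 p1) (\<beta>1 p1) \<and>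
        g (p1, p2) (vlift A1 A2 \<alpha>2 (p1, p2)) (vlift A1 A2 \<beta>2 (p1, p2))
          = f p1 * g2 p2 (\<alpha>2 p2) (\<beta>2 p2) \<and>
        g (p1, p2) (hlift A1 A2 \<alpha>1 (p1, p2)) (vlift A1 A2 \<alpha>2 (p1, p2)) = 0)"

end

theory Submission
  imports Defs
begin

text \<open>
  Since \<open>f\<close> is Casimir and \<open>\<mu>\<close> is locally constant, the Koszul formula, tested against lifted
  1-forms (which span every cotangent space), shows that the Levi-Civita contravariant connection \<open>D\<close>
  of the warped product splits: \<open>D\<close> of horizontal lifts is the lift of the connection of the first factor,
  \<open>D\<close> of vertical lifts is \<open>\<mu>\<close> times the lift of that of the second, and the mixed terms vanish. Hence, in
  a frame made of the lifts \<open>e\<^sub>i\<^sup>h\<close> and \<open>f\<^sup>-\<^sup>1\<^sup>/\<^sup>2 e'\<^sub>j\<^sup>v\<close> of orthonormal frames, the Ricci curvature is block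
  diagonal with blocks \<open>r\<^sub>1\<close> and \<open>\<mu>\<^sup>2 r\<^sub>2\<close>.

  It remains to pass from such frames to arbitrary ones. The curvature fails to be tensorial in its last
  argument by \<open>T(\<alpha>, \<beta>) = [#\<alpha>, #\<beta>] - #[\<alpha>, \<beta>]\<close>. Rotating two members of a frame by an angle that is a
  given function changes the Ricci curvature by a multiple of \<open>T\<close>, so if it vanishes for all frames then
  \<open>T = 0\<close>. If both factors are Ricci flat, \<open>T\<close> therefore vanishes on the factors, hence on the product,
  where the Ricci curvature then does not depend on the frame.
\<close>

section \<open>Calculus of smooth functions\<close>

text \<open>All forms, fields and frames live on the whole manifold, and the Lie derivative, the
  anchor, the cometric and the connection are definite descriptions, so each needs an existence and
  uniqueness proof before it can be computed. Tangent vectors are derivations; that they are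
  combinations of coordinate derivatives rests on Hadamard's lemma and cut-off functions.
  Tensoriality takes the place of local computation: multiplying by a bump function that is 1 at p
  turns a coordinate expansion near p into a global one. Identities of Koszul brackets then need
  checking on exact forms only, where the bracket is the differential of P(d\<phi>, d\<psi>).

  The metrics are indefinite. Gram-Schmidt may run into null vectors, so a non-null vector is first
  found in each orthogonal complement. Likewise the rotation that exposes T is circular or
  hyperbolic, depending on the signs of the two frame members; a rational parametrisation serves
  both.

  From the product to the second factor, a single x with \<mu>(x) nonzero is enough: the points (x,
  z) lie over all z, and the vertical block there is \<mu>(x)^2 r_2.\<close>

lemma has_derivative_cong_open:
  assumes "open S" "x \<in> S" "\<And>y. y \<in> S \<Longrightarrow> f y = g y"
  shows "(f has_derivative D) (at x) \<longleftrightarrow> (g has_derivative D) (at x)"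
  using has_derivative_transform_within_open[of f D x UNIV S g]
    has_derivative_transform_within_open[of g D x UNIV S f] assms by auto

lemma frechet_derivative_cong_open:
  assumes "open S" "x \<in> S" "\<And>y. y \<in> S \<Longrightarrow> f y = g y"
  shows "frechet_derivative f (at x) = frechet_derivative g (at x)"
  unfolding frechet_derivative_def using has_derivative_cong_open[OF assms] by simp

lemma Ck_on_cong:
  assumes "open S" "\<And>x. x \<in> S \<Longrightarrow> f x = g x"
  shows "Ck_on k f S \<longleftrightarrow> Ck_on k g S"
  using assms(2)
proof (induction k arbitrary: f g)
  case 0
  then show ?case by (simp cong: continuous_on_cong)
next
  case (Suc k)
  have "f differentiable at x \<longleftrightarrow> g differentiable at x" if "x \<in> S" for x
    using has_derivative_cong_open[OF assms(1) that Suc.prems] by (auto simp: differentiable_def)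
  moreover have "Ck_on k (\<lambda>x. frechet_derivative f (at x) v) S
      \<longleftrightarrow> Ck_on k (\<lambda>x. frechet_derivative g (at x) v) S" for v
    by (rule Suc.IH) (simp add: frechet_derivative_cong_open[OF assms(1) _ Suc.prems])
  ultimately show ?case by simp
qed

lemma Ck_on_subset: "Ck_on k f T \<Longrightarrow> S \<subseteq> T \<Longrightarrow> Ck_on k f S"
  by (induction k arbitrary: f) (auto intro: continuous_on_subset)

lemma Ck_on_open_local:
  assumes "\<And>x. x \<in> S \<Longrightarrow> \<exists>T. open T \<and> x \<in> T \<and> Ck_on k f T"
  shows "Ck_on k f S"
  using assms
proof (induction k arbitrary: f)
  case 0
  then show ?case
    using continuous_on_eq_continuous_at by (auto intro!: continuous_at_imp_continuous_on)
next
  case (Suc k)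
  have "f differentiable at x" if "x \<in> S" for x
    using Suc.prems[OF that] by auto
  moreover have "Ck_on k (\<lambda>x. frechet_derivative f (at x) v) S" for v
  proof (rule Suc.IH)
    fix x assume "x \<in> S"
    then show "\<exists>T. open T \<and> x \<in> T \<and> Ck_on k (\<lambda>x. frechet_derivative f (at x) v) T"
      using Suc.prems[of x] by auto
  qed
  ultimately show ?case by simp
qed

text \<open>The recursion asks for continuity only at its end, after all derivatives have been
  taken, so the orders are not nested by definition. Continuity of \<open>f\<close> itself comes
  from differentiability.\<close>

lemma Ck_on_SucD: "Ck_on (Suc k) f S \<Longrightarrow> Ck_on k f S"
proof (induction k arbitrary: f)
  case 0
  then show ?case
    by (auto intro!: continuous_at_imp_continuous_on differentiable_imp_continuous_within)
next
  case (Suc k)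
  have "Ck_on k (\<lambda>x. frechet_derivative f (at x) v) S" for v
    using Suc.prems Suc.IH Ck_on.simps(2)[of "Suc k" f S] by blast
  then show ?case using Suc.prems Ck_on.simps(2)[of k f S] Ck_on.simps(2)[of "Suc k" f S] by blast
qed

text \<open>Lets the derivative be supplied as a formula. The closure proofs below give the formula,
  and their induction hypothesis treats it for each fixed direction \<open>v\<close>.\<close>

lemma Ck_on_SucI:
  assumes "open S" "\<And>x. x \<in> S \<Longrightarrow> (f has_derivative f' x) (at x)"
    "\<And>v. Ck_on k (\<lambda>x. f' x v) S"
  shows "Ck_on (Suc k) f S"
proof -
  have "f' x = frechet_derivative f (at x)" if "x \<in> S" for x
    using frechet_derivative_at assms(2)[OF that] .
  then have "Ck_on k (\<lambda>x. frechet_derivative f (at x) v) S" for v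
    using Ck_on_cong[OF assms(1), of "\<lambda>x. f' x v" "\<lambda>x. frechet_derivative f (at x) v"] assms(3) 
    by metis
  then show ?thesis using assms(2) by (auto simp: differentiable_def)
qed

lemma Ck_on_SucE:
  assumes "Ck_on (Suc k) f S" "x \<in> S"
  shows "(f has_derivative frechet_derivative f (at x)) (at x)"
  using assms by (simp add: frechet_derivative_works)

lemma Ck_on_const: "open S \<Longrightarrow> Ck_on k (\<lambda>_. c) S"
proof (induction k arbitrary: c)
  case (Suc k)
  then show ?case by (intro Ck_on_SucI[where f' = "\<lambda>_ _. 0"]) auto
qed auto

lemma Ck_on_bounded_linear:
  assumes "bounded_linear L" "open S"
  shows "Ck_on k L S"
proof (cases k)
  case 0
  then show ?thesis using assms by (simp add: linear_continuous_on)
next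
  case (Suc j)
  show ?thesis unfolding Suc
    using assms by (intro Ck_on_SucI[where f' = "\<lambda>_. L"])
      (auto intro: bounded_linear_imp_has_derivative Ck_on_const)
qed

lemma Ck_on_linear_compose:
  assumes "bounded_linear L" "open S" "Ck_on k f S"
  shows "Ck_on k (\<lambda>x. L (f x)) S"
  using assms(3)
proof (induction k arbitrary: f)
  case 0
  then show ?case using assms by (simp add: bounded_linear.continuous_on)
next
  case (Suc k)
  then show ?case
    by (intro Ck_on_SucI[where f' = "\<lambda>x v. L (frechet_derivative f (at x) v)"])
      (auto intro!: assms bounded_linear.has_derivative[OF assms(1)] Ck_on_SucE Suc)
qed

lemma Ck_on_add:
  assumes "open S" "Ck_on k f S" "Ck_on k g S"
  shows "Ck_on k (\<lambda>x. f x + g x) S"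
  using assms(2,3)
proof (induction k arbitrary: f g)
  case 0
  then show ?case by (simp add: continuous_on_add)
next
  case (Suc k)
  then show ?case
    by (intro Ck_on_SucI[where f' = "\<lambda>x v. frechet_derivative f (at x) v + frechet_derivative g (at x) v"])
      (auto intro!: assms has_derivative_add Ck_on_SucE Suc)
qed

text \<open>One product rule serves products of reals, scalar multiples and inner products. The
  regularity of \<open>f\<close> and \<open>g\<close> themselves, needed next to that of their
  derivatives, is \<open>Ck_on_SucD\<close>.\<close>

lemma Ck_on_bilinear:
  assumes "bounded_bilinear B" "open S" "Ck_on k f S" "Ck_on k g S"
  shows "Ck_on k (\<lambda>x. B (f x) (g x)) S"
  using assms(3,4)
proof (induction k arbitrary: f g)
  case 0
  then show ?case using bounded_bilinear.continuous_on[OF assms(1)] by simp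
next
  case (Suc k)
  note pr = Suc.prems[THEN Ck_on_SucD] Suc.prems[unfolded Ck_on.simps(2), THEN conjunct2, rule_format]
  show ?case
    by (rule Ck_on_SucI[where f' = "\<lambda>x v. B (f x) (frechet_derivative g (at x) v)
          + B (frechet_derivative f (at x) v) (g x)"])
      (intro assms bounded_bilinear.FDERIV[OF assms(1)] Ck_on_add Suc.IH Ck_on_SucE[OF Suc.prems(1)]
        Ck_on_SucE[OF Suc.prems(2)] pr | assumption)+
qed

lemma Ck_on_sum:
  assumes "open S" "\<And>i. i \<in> I \<Longrightarrow> Ck_on k (f i) S"
  shows "Ck_on k (\<lambda>x. \<Sum>i\<in>I. f i x) S"
  using assms(2) by (induction I rule: infinite_finite_induct)
    (auto intro!: Ck_on_const Ck_on_add assms(1))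

lemma linear_basis_expansion:
  fixes L :: "'a::euclidean_space \<Rightarrow> 'b::real_vector"
  assumes "linear L"
  shows "L v = (\<Sum>b\<in>Basis. (v \<bullet> b) *\<^sub>R L b)"
proof -
  have "L v = L (\<Sum>b\<in>Basis. (v \<bullet> b) *\<^sub>R b)" by (simp add: euclidean_representation)
  also have "\<dots> = (\<Sum>b\<in>Basis. (v \<bullet> b) *\<^sub>R L b)"
    using assms by (simp add: linear_sum linear_scale)
  finally show ?thesis .
qed

lemma Ck_on_compose:
  assumes "open S" "open T" "Ck_on k f T" "Ck_on k g S" "g ` S \<subseteq> T"
  shows "Ck_on k (\<lambda>x. f (g x)) S"
  using assms(3,4)
proof (induction k arbitrary: f)
  case 0
  then show ?case using continuous_on_compose2[of T f S g] assms(5) by simp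
next
  case (Suc k)
  let ?f = "\<lambda>x. frechet_derivative f (at x)" and ?g = "\<lambda>x. frechet_derivative g (at x)"
  have df: "(f has_derivative ?f (g x)) (at (g x))" and dg: "(g has_derivative ?g x) (at x)"
    if "x \<in> S" for x
    using Suc.prems that assms(5) by (auto intro!: Ck_on_SucE)
  \<comment> \<open>The direction \<open>?g x v\<close> varies with \<open>x\<close>, while
    \<open>Ck_on\<close> controls derivatives in fixed directions; expanding it in
    \<open>Basis\<close> separates the two dependences.\<close>
  have ex: "?f (g x) (?g x v) = (\<Sum>b\<in>Basis. (?g x v \<bullet> b) *\<^sub>R ?f (g x) b)" if "x \<in> S" for x v
    using df[OF that] by (intro linear_basis_expansion has_derivative_linear)
  show ?case
  proof (rule Ck_on_SucI[OF assms(1)])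
    show "((\<lambda>x. f (g x)) has_derivative (\<lambda>v. \<Sum>b\<in>Basis. (?g x v \<bullet> b) *\<^sub>R ?f (g x) b)) (at x)"
      if "x \<in> S" for x
      using has_derivative_compose[OF dg[OF that] df[OF that]] ex[OF that] by simp
    show "Ck_on k (\<lambda>x. \<Sum>b\<in>Basis. (?g x v \<bullet> b) *\<^sub>R ?f (g x) b) S" for v
      using Suc.prems Ck_on_SucD[OF Suc.prems(2)]
      by (intro Ck_on_sum Ck_on_bilinear[OF bounded_bilinear_scaleR] assms(1) Suc.IH
          Ck_on_linear_compose[OF bounded_linear_inner_left]) auto
  qed
qed

section \<open>Smooth maps between open sets of Euclidean spaces\<close>

lemma smooth_on_cong:
  "open S \<Longrightarrow> (\<And>x. x \<in> S \<Longrightarrow> f x = g x) \<Longrightarrow> smooth_on f S \<longleftrightarrow> smooth_on g S"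
  unfolding smooth_on_def using Ck_on_cong by blast

lemma smooth_on_subset: "smooth_on f T \<Longrightarrow> S \<subseteq> T \<Longrightarrow> smooth_on f S"
  unfolding smooth_on_def using Ck_on_subset by blast

lemma smooth_on_local:
  assumes "\<And>x. x \<in> S \<Longrightarrow> \<exists>T. open T \<and> x \<in> T \<and> smooth_on f T"
  shows "smooth_on f S"
  using assms unfolding smooth_on_def by (meson Ck_on_open_local)

lemma smooth_on_const: "open S \<Longrightarrow> smooth_on (\<lambda>_. c) S"
  by (simp add: smooth_on_def Ck_on_const)

lemma smooth_on_bounded_linear: "bounded_linear L \<Longrightarrow> open S \<Longrightarrow> smooth_on L S"
  by (simp add: smooth_on_def Ck_on_bounded_linear)

lemma smooth_on_linear_compose:
  "bounded_linear L \<Longrightarrow> open S \<Longrightarrow> smooth_on f S \<Longrightarrow> smooth_on (\<lambda>x. L (f x)) S"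
  by (simp add: smooth_on_def Ck_on_linear_compose)

lemma smooth_on_add:
  "open S \<Longrightarrow> smooth_on f S \<Longrightarrow> smooth_on g S \<Longrightarrow> smooth_on (\<lambda>x. f x + g x) S"
  by (simp add: smooth_on_def Ck_on_add)

lemma smooth_on_bilinear:
  "bounded_bilinear B \<Longrightarrow> open S \<Longrightarrow> smooth_on f S \<Longrightarrow> smooth_on g S
    \<Longrightarrow> smooth_on (\<lambda>x. B (f x) (g x)) S"
  by (simp add: smooth_on_def Ck_on_bilinear)

lemmas smooth_on_mult = smooth_on_bilinear[OF bounded_bilinear_mult]

lemma smooth_on_compose:
  "open S \<Longrightarrow> open T \<Longrightarrow> smooth_on f T \<Longrightarrow> smooth_on g S \<Longrightarrow> g ` S \<subseteq> T
    \<Longrightarrow> smooth_on (\<lambda>x. f (g x)) S"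
  unfolding smooth_on_def using Ck_on_compose by blast

lemma smooth_on_Pair:
  fixes f :: "'a::euclidean_space \<Rightarrow> 'b::euclidean_space" and g :: "'a \<Rightarrow> 'c::euclidean_space"
  assumes "open S" "smooth_on f S" "smooth_on g S"
  shows "smooth_on (\<lambda>x. (f x, g x)) S"
proof -
  have "bounded_linear (\<lambda>x::'b. (x, 0::'c))" "bounded_linear (\<lambda>x::'c. (0::'b, x))"
    by (auto intro!: bounded_linear_Pair bounded_linear_ident bounded_linear_zero)
  then have "smooth_on (\<lambda>x. (f x, 0) + (0, g x)) S"
    using assms by (intro smooth_on_add smooth_on_linear_compose[of "\<lambda>x. (x, 0)"]
        smooth_on_linear_compose[of "Pair 0"])
  then show ?thesis by simp
qed

lemma smooth_on_derivative:
  "smooth_on f S \<Longrightarrow> smooth_on (\<lambda>x. frechet_derivative f (at x) v) S"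
  unfolding smooth_on_def using Ck_on.simps(2) by blast

lemma smooth_on_has_derivative:
  "smooth_on f S \<Longrightarrow> x \<in> S \<Longrightarrow> (f has_derivative frechet_derivative f (at x)) (at x)"
  unfolding smooth_on_def using Ck_on_SucE by blast

lemma smooth_on_continuous: "smooth_on f S \<Longrightarrow> continuous_on S f"
  unfolding smooth_on_def using Ck_on.simps(1) by blast

lemma Ck_on_real_SucI:
  fixes f :: "real \<Rightarrow> real"
  assumes "open S" "\<And>x. x \<in> S \<Longrightarrow> (f has_real_derivative f' x) (at x)" "Ck_on k f' S"
  shows "Ck_on (Suc k) f S"
proof (rule Ck_on_SucI[OF assms(1), where f' = "\<lambda>x v. f' x * v"])
  show "(f has_derivative (*) (f' x)) (at x)" if "x \<in> S" for x
    using assms(2)[OF that] by (simp add: has_field_derivative_def)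
  show "Ck_on k (\<lambda>x. f' x * v) S" for v
    by (rule Ck_on_bilinear[OF bounded_bilinear_mult assms(1,3) Ck_on_const[OF assms(1)]])
qed

lemma smooth_on_powr: "smooth_on (\<lambda>x::real. x powr a) {0<..}"
proof -
  \<comment> \<open>The functions c x^a are closed under differentiation, so the claim is proved for
    all \<open>a\<close> and \<open>c\<close> at once.\<close>
  have "Ck_on k (\<lambda>x::real. c * x powr a) {0<..}" for k c
  proof (induction k arbitrary: a c)
    case 0
    then show ?case by (auto intro!: continuous_intros)
  next
    case (Suc k)
    show ?case
      by (rule Ck_on_real_SucI[where f' = "\<lambda>x. (c * a) * x powr (a - 1)"])
        (auto intro!: derivative_eq_intros Suc)
  qed
  from this[of _ 1] show ?thesis by (simp add: smooth_on_def)
qed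

section \<open>Bump functions\<close>

text \<open>For n = 0 this is the classical smooth function all of whose derivatives vanish at 0.
  The powers in the denominator are included because the derivative of a member of the family is a
  combination of members.\<close>

definition flat :: "nat \<Rightarrow> real \<Rightarrow> real" where
  "flat n x = (if x \<le> 0 then 0 else exp (- (1 / x)) / x ^ n)"

lemma flat_pos: "x > 0 \<Longrightarrow> flat n x > 0" and flat_nonneg: "flat n x \<ge> 0"
  and flat_nonpos: "x \<le> 0 \<Longrightarrow> flat n x = 0"
  by (auto simp: flat_def)

lemma flat_tendsto_0: "(flat n \<longlongrightarrow> 0) (at 0)"
proof -
  \<comment> \<open>With y = 1/x this is the decay of y^n / exp y at infinity.\<close>
  have "((\<lambda>x::real. inverse x ^ n / exp (inverse x)) \<longlongrightarrow> 0) (at_right 0)"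
    by (rule filterlim_compose[OF tendsto_power_div_exp_0 filterlim_inverse_at_top_right])
  moreover have "\<forall>\<^sub>F x in at_right 0. inverse x ^ n / exp (inverse x) = flat n x"
    by (auto simp: eventually_at_right_less flat_def exp_minus field_simps
        intro!: eventually_mono[OF eventually_at_right_less])
  ultimately have R: "(flat n \<longlongrightarrow> 0) (at_right 0)"
    by (rule Lim_transform_eventually)
  have L: "(flat n \<longlongrightarrow> 0) (at_left 0)"
    by (rule tendsto_eventually) (auto simp: flat_def eventually_at_filter)
  show ?thesis using L R by (simp add: filterlim_at_split)
qed

lemma flat_has_derivative:
  "(flat n has_real_derivative flat (n + 2) x - n * flat (n + 1) x) (at x)"
proof -
  consider "x > 0" | "x < 0" | "x = 0" by linarith
  then show ?thesis
  proof cases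
    case 1
    have pow: "x ^ n = x * x ^ (n - Suc 0)" if "n \<noteq> 0" using that by (simp add: power_eq_if)
    have "((\<lambda>x. exp (- (1 / x)) / x ^ n) has_real_derivative
        flat (n + 2) x - n * flat (n + 1) x) (at x)"
      using 1 by (cases "n = 0") (auto intro!: derivative_eq_intros simp: pow flat_def field_simps power2_eq_square)
    then show ?thesis
      by (rule has_field_derivative_transform_within_open[where S = "{0<..}"])
        (use 1 in \<open>auto simp: flat_def\<close>)
  next
    case 2
    have "((\<lambda>x. 0) has_real_derivative flat (n + 2) x - n * flat (n + 1) x) (at x)"
      using 2 by (simp add: flat_def)
    then show ?thesis
      by (rule has_field_derivative_transform_within_open[where S = "{..<0}"])
        (use 2 in \<open>auto simp: flat_def\<close>)
  next
    case 3
    \<comment> \<open>The difference quotient of \<open>flat n\<close> at 0 is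
      \<open>flat (Suc n)\<close>.\<close>
    have "((\<lambda>h. flat n h / h) \<longlongrightarrow> 0) (at 0)"
      by (rule Lim_transform_eventually[OF flat_tendsto_0[of "Suc n"]])
        (auto simp: eventually_at_filter flat_def field_simps)
    then show ?thesis using 3 by (simp add: DERIV_def flat_nonpos)
  qed
qed

lemma smooth_on_flat: "smooth_on (flat n) UNIV"
proof -
  have "Ck_on k (flat n) UNIV" for k n
  proof (induction k arbitrary: n)
    case 0
    show ?case
      by (auto intro!: continuous_at_imp_continuous_on DERIV_isCont[OF flat_has_derivative])
  next
    case (Suc k)
    show ?case
    proof (rule Ck_on_real_SucI[OF open_UNIV flat_has_derivative])
      have "Ck_on k (\<lambda>x. flat (n + 2) x + - real n * flat (n + 1) x) UNIV"
        by (intro Ck_on_add Ck_on_bilinear[OF bounded_bilinear_mult] Ck_on_const open_UNIV Suc.IH)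
      then show "Ck_on k (\<lambda>x. flat (n + 2) x - n * flat (n + 1) x) UNIV" by simp
    qed
  qed
  then show ?thesis by (simp add: smooth_on_def)
qed

lemma smooth_bump:
  fixes c :: "'a::euclidean_space"
  assumes "0 < r"
  obtains B :: "'a \<Rightarrow> real" where "smooth_on B UNIV" "\<And>x. dist c x \<le> r \<Longrightarrow> B x = 1"
    "\<And>x. dist c x \<ge> 2 * r \<Longrightarrow> B x = 0" "\<And>x. 0 \<le> B x" "\<And>x. B x \<le> 1"
proof -
  define s where "s x = (x - c) \<bullet> (x - c)" for x
  have s: "s x = (dist c x)\<^sup>2" for x
    by (simp add: s_def dist_norm norm_minus_commute[of c] power2_norm_eq_inner)
  have lin: "smooth_on (\<lambda>x. x + - c) (UNIV :: 'a set)"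
    by (intro smooth_on_add smooth_on_const smooth_on_bounded_linear bounded_linear_ident open_UNIV)
  have "smooth_on (\<lambda>x. (x + - c) \<bullet> (x + - c)) UNIV"
    by (intro smooth_on_bilinear[OF bounded_bilinear_inner] lin open_UNIV)
  then have sm: "smooth_on s UNIV" unfolding s_def by simp
  have aff: "smooth_on (\<lambda>x. a + b * s x) UNIV" for a b :: real
    by (intro smooth_on_add smooth_on_mult smooth_on_const open_UNIV sm)
  have fl: "smooth_on (\<lambda>x. flat 0 (a + b * s x)) UNIV" for a b :: real
    by (rule smooth_on_compose[OF open_UNIV open_UNIV smooth_on_flat aff]) simp
  \<comment> \<open>\<open>N\<close> is positive exactly at distance less than 2r from
    \<open>c\<close>, and \<open>M\<close> exactly at distance more than r. They have no common
    zero, and N / (N + M) is 1 on the inner ball and 0 off the outer one.\<close>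
  define N where "N x = flat 0 (4 * r\<^sup>2 + - 1 * s x)" for x
  define M where "M x = flat 0 (- (r\<^sup>2) + 1 * s x)" for x
  have NM: "N x + M x > 0" for x
  proof (cases "s x < 4 * r\<^sup>2")
    case True
    then have "0 < N x" by (simp add: N_def flat_pos)
    then show ?thesis by (intro add_pos_nonneg) (simp_all add: M_def flat_nonneg)
  next
    case False
    moreover have "0 < r\<^sup>2" using assms by simp
    ultimately have "s x > r\<^sup>2" by linarith
    then have "0 < M x" by (simp add: M_def flat_pos)
    then show ?thesis by (intro add_nonneg_pos) (simp_all add: N_def flat_nonneg)
  qed
  \<comment> \<open>The quotient is written with \<open>powr\<close> so that its smoothness follows
    from \<open>smooth_on_powr\<close>.\<close>
  define B where "B x = N x * (N x + M x) powr (- 1)" for x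
  have B: "B x = N x / (N x + M x)" for x
    using NM[of x] by (simp add: B_def powr_minus field_simps)
  show thesis
  proof
    have "smooth_on N UNIV" "smooth_on M UNIV" unfolding N_def M_def by (rule fl)+
    then show "smooth_on B UNIV" unfolding B_def
      by (intro smooth_on_mult open_UNIV
          smooth_on_compose[OF _ _ smooth_on_powr, of UNIV "\<lambda>x. N x + M x"] smooth_on_add)
        (use NM in auto)
    show "B x = 1" if "dist c x \<le> r" for x
    proof -
      have "s x \<le> r\<^sup>2" unfolding s using that by (simp add: power_mono)
      then have "M x = 0" by (simp add: M_def flat_nonpos)
      then show ?thesis using NM[of x] by (simp add: B)
    qed
    show "B x = 0" if "dist c x \<ge> 2 * r" for x
    proof -
      have "s x \<ge> (2 * r)\<^sup>2" unfolding s using that assms by (intro power_mono) auto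
      then have "N x = 0" by (simp add: N_def flat_nonpos power_mult_distrib)
      then show ?thesis by (simp add: B)
    qed
    show "0 \<le> B x" "B x \<le> 1" for x
      using NM[of x] flat_nonneg by (auto simp: B N_def M_def divide_le_eq_1)
  qed
qed

section \<open>Hadamard's lemma\<close>

lemma segment_in_ball:
  fixes c y :: "'a::real_normed_vector"
  assumes "y \<in> ball c r" "t \<in> {0..1}"
  shows "c + t *\<^sub>R (y - c) \<in> ball c r"
proof -
  have "norm (t *\<^sub>R (y - c)) \<le> norm (y - c)" using assms(2) by (simp add: mult_left_le_one_le)
  then show ?thesis using assms(1) by (simp add: dist_norm norm_minus_commute)
qed

text \<open>Differentiation under the integral sign. By the chain rule each derivative contributes a
  factor \<open>t\<close> and replaces \<open>H\<close> by a directional derivative, so the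
  induction runs over all \<open>m\<close> and \<open>H\<close>.\<close>

lemma smooth_on_segment_integral:
  fixes H :: "'a::euclidean_space \<Rightarrow> real"
  assumes "smooth_on H (ball c r)"
  shows "smooth_on (\<lambda>y. integral {0..1} (\<lambda>t. t ^ m * H (c + t *\<^sub>R (y - c)))) (ball c r)"
proof -
  have "Ck_on k (\<lambda>y. integral (cbox 0 1) (\<lambda>t. t ^ m * H (c + t *\<^sub>R (y - c)))) (ball c r)" for k
    using assms
  proof (induction k arbitrary: m H)
    have co: "continuous_on (ball c r \<times> cbox 0 1) (\<lambda>(y, t). t ^ m * H (c + t *\<^sub>R (y - c)))"
      if H: "smooth_on H (ball c r)" for m and H :: "'a \<Rightarrow> real"
      unfolding split_def using segment_in_ball[of _ c r]
      by (intro continuous_intros continuous_on_compose2[OF smooth_on_continuous[OF H]]) auto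
    {
      case 0
      then show ?case using integral_continuous_on_param[OF co] by simp
    next
      case (Suc k)
      let ?D = "\<lambda>y v. frechet_derivative H (at y) v"
      let ?I = "\<lambda>y. integral (cbox 0 1) (\<lambda>t::real. t ^ m * H (c + t *\<^sub>R (y - c)))"
      let ?J = "\<lambda>y v. integral (cbox 0 1) (\<lambda>t::real. t ^ Suc m * ?D (c + t *\<^sub>R (y - c)) v)"
      \<comment> \<open>The Leibniz rule wants the derivative as a continuous family of bounded
        linear maps. \<open>Blinfun\<close> is meaningful where \<open>bl\<close> applies: for
        \<open>y\<close> in the ball and \<open>t\<close> in the unit interval.\<close>
      let ?f = "\<lambda>y (t::real). Blinfun (\<lambda>v. t ^ Suc m * ?D (c + t *\<^sub>R (y - c)) v)"
      have bl: "bounded_linear (\<lambda>v. t ^ Suc m * ?D (c + t *\<^sub>R (y - c)) v)"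
        if "y \<in> ball c r" "t \<in> cbox 0 1" for y and t :: real
        using smooth_on_has_derivative[OF Suc.prems segment_in_ball[OF that(1)]] that(2)
        by (intro bounded_linear_const_mult has_derivative_bounded_linear) auto
      have cf: "continuous_on (ball c r \<times> cbox 0 1) (\<lambda>(y, t). ?f y t)"
      proof (rule continuous_on_blinfun_componentwise)
        fix i :: 'a
        have "continuous_on (ball c r \<times> cbox 0 1) (\<lambda>(y, t). t ^ Suc m * ?D (c + t *\<^sub>R (y - c)) i)"
          by (intro co smooth_on_derivative Suc.prems)
        then show "continuous_on (ball c r \<times> cbox 0 1) (\<lambda>x. blinfun_apply (case x of (y, t) \<Rightarrow> ?f y t) i)"
          by (rule continuous_on_eq) (use bl in \<open>auto simp: bounded_linear_Blinfun_apply\<close>)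
      qed
      have der: "(?I has_derivative ?J y) (at y)" if y: "y \<in> ball c r" for y
      proof -
        have der0: "(?I has_derivative integral (cbox 0 1) (?f y)) (at y within ball c r)"
        proof (rule leibniz_rule[OF _ _ cf y convex_ball])
          fix z and t :: real assume z: "z \<in> ball c r" "t \<in> cbox 0 1"
          have t: "t \<in> {0..1}" using z(2) by simp
          have "((\<lambda>y. t ^ m * H (c + t *\<^sub>R (y - c))) has_derivative
              (\<lambda>v. t ^ m * ?D (c + t *\<^sub>R (z - c)) (t *\<^sub>R v))) (at z within ball c r)"
            by (rule derivative_eq_intros refl
                has_derivative_compose[OF _ smooth_on_has_derivative[OF Suc.prems]] segment_in_ball z t)+
              (auto simp: scaleR_right_diff_distrib)
          moreover have "?D (c + t *\<^sub>R (z - c)) (t *\<^sub>R v) = t * ?D (c + t *\<^sub>R (z - c)) v" for v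
            using has_derivative_linear[OF smooth_on_has_derivative[OF Suc.prems segment_in_ball[OF z(1) t]]]
            by (simp add: linear_scale)
          then have "(\<lambda>v. t ^ m * ?D (c + t *\<^sub>R (z - c)) (t *\<^sub>R v)) = blinfun_apply (?f z t)"
            unfolding bounded_linear_Blinfun_apply[OF bl[OF z]] by (simp add: fun_eq_iff)
          ultimately show "((\<lambda>y. t ^ m * H (c + t *\<^sub>R (y - c))) has_derivative blinfun_apply (?f z t))
              (at z within ball c r)"
            by simp
        next
          fix z assume z: "z \<in> ball c r"
          have "continuous_on (cbox 0 1) (\<lambda>t::real. case (z, t) of (y, t) \<Rightarrow> t ^ m * H (c + t *\<^sub>R (y - c)))"
            by (rule continuous_on_compose2[OF co[OF Suc.prems]])
              (use z in \<open>auto intro!: continuous_intros\<close>)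
          then have "continuous_on (cbox 0 1) (\<lambda>t::real. t ^ m * H (c + t *\<^sub>R (z - c)))" by simp
          then show "(\<lambda>t::real. t ^ m * H (c + t *\<^sub>R (z - c))) integrable_on cbox 0 1"
            by (rule integrable_continuous)
        qed
        have int: "?f y integrable_on cbox 0 1"
        proof (rule integrable_continuous)
          have "continuous_on (cbox 0 1) (\<lambda>t. case (y, t) of (y, t) \<Rightarrow> ?f y t)"
            by (rule continuous_on_compose2[OF cf]) (use y in \<open>auto intro!: continuous_intros\<close>)
          then show "continuous_on (cbox 0 1) (?f y)" by simp
        qed
        have ap: "blinfun_apply (integral (cbox 0 1) (?f y)) v = ?J y v" for v
          unfolding blinfun_apply_integral[OF int]
          by (rule integral_cong) (subst bounded_linear_Blinfun_apply[OF bl[OF y]], assumption, rule refl)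
        have "blinfun_apply (integral (cbox 0 1) (?f y)) = ?J y" using ap by blast
        with der0 show ?thesis using y by (simp add: at_within_open[OF y open_ball])
      qed
      show ?case
        by (rule Ck_on_SucI[OF open_ball der Suc.IH[OF smooth_on_derivative[OF Suc.prems]]])
    }
  qed
  then show ?thesis by (simp add: smooth_on_def)
qed

text \<open>The fundamental theorem of calculus along the segment from \<open>c\<close> to
  \<open>y\<close>; \<open>G b\<close> is the mean of the partial derivative in direction
  \<open>b\<close> over that segment.\<close>

lemma hadamard:
  fixes F :: "'a::euclidean_space \<Rightarrow> real"
  assumes F: "smooth_on F (ball c r)" and r: "0 < r"
  obtains G :: "'a \<Rightarrow> 'a \<Rightarrow> real" where "\<And>b. smooth_on (G b) (ball c r)"
    "\<And>y. y \<in> ball c r \<Longrightarrow> F y = F c + (\<Sum>b\<in>Basis. ((y - c) \<bullet> b) * G b y)"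
    "\<And>b. G b c = frechet_derivative F (at c) b"
proof
  let ?D = "\<lambda>y v. frechet_derivative F (at y) v"
  let ?G = "\<lambda>b y. integral {0..1} (\<lambda>t. t ^ 0 * ?D (c + t *\<^sub>R (y - c)) b)"
  show "smooth_on (?G b) (ball c r)" for b
    by (rule smooth_on_segment_integral[OF smooth_on_derivative[OF F]])
  show "?G b c = ?D c b" for b by simp
  fix y assume y: "y \<in> ball c r"
  have der: "(F has_derivative ?D (c + t *\<^sub>R (y - c))) (at (c + t *\<^sub>R (y - c)))" if "t \<in> {0..1}" for t
    using smooth_on_has_derivative[OF F segment_in_ball[OF y that]] .
  have "((\<lambda>t. F (c + t *\<^sub>R (y - c))) has_vector_derivative ?D (c + t *\<^sub>R (y - c)) (y - c))
      (at t within {0..1})" if "t \<in> {0..1}" for t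
  proof -
    have "((\<lambda>t. F (c + t *\<^sub>R (y - c))) has_derivative (\<lambda>h. ?D (c + t *\<^sub>R (y - c)) (h *\<^sub>R (y - c))))
        (at t within {0..1})"
      by (rule has_derivative_compose[of "\<lambda>t. c + t *\<^sub>R (y - c)" "\<lambda>h. h *\<^sub>R (y - c)" t "{0..1}" F,
            OF _ der[OF that]]) (auto intro!: derivative_eq_intros)
    then show ?thesis
      using has_derivative_linear[OF der[OF that]]
      by (simp add: has_vector_derivative_def linear_scale)
  qed
  then have "((\<lambda>t. ?D (c + t *\<^sub>R (y - c)) (y - c)) has_integral F (c + 1 *\<^sub>R (y - c)) - F (c + 0 *\<^sub>R (y - c))) {0..1}"
    by (intro fundamental_theorem_of_calculus) auto
  then have "F y - F c = integral {0..1} (\<lambda>t. ?D (c + t *\<^sub>R (y - c)) (y - c))"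
    by (simp add: integral_unique)
  also have "\<dots> = integral {0..1} (\<lambda>t. \<Sum>b\<in>Basis. ((y - c) \<bullet> b) * ?D (c + t *\<^sub>R (y - c)) b)"
    using linear_basis_expansion[OF has_derivative_linear[OF der], of _ "y - c"]
    by (intro integral_cong) simp
  also have "\<dots> = (\<Sum>b\<in>Basis. integral {0..1} (\<lambda>t. ((y - c) \<bullet> b) * ?D (c + t *\<^sub>R (y - c)) b))"
  proof (rule integral_sum)
    fix b
    have "continuous_on {0..1} (\<lambda>t. ?D (c + t *\<^sub>R (y - c)) b)"
      using segment_in_ball[OF y]
      by (intro continuous_on_compose2[OF smooth_on_continuous[OF smooth_on_derivative[OF F]]]
          continuous_intros) auto
    then show "(\<lambda>t. ((y - c) \<bullet> b) * ?D (c + t *\<^sub>R (y - c)) b) integrable_on {0..1}"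
      by (intro integrable_continuous_interval continuous_intros)
  qed simp
  finally show "F y = F c + (\<Sum>b\<in>Basis. ((y - c) \<bullet> b) * ?G b y)" by simp
qed

section \<open>Spaces of functions and linear forms\<close>

text \<open>Smooth functions, tangent spaces and cotangent spaces are all sets of real functions of
  this kind, so one notion covers the three levels.\<close>

definition fsubspace :: "('x \<Rightarrow> real) set \<Rightarrow> bool" where
  "fsubspace V \<longleftrightarrow> 0 \<in> V \<and> (\<forall>v\<in>V. \<forall>w\<in>V. v + w \<in> V) \<and> (\<forall>c. \<forall>v\<in>V. (\<lambda>x. c * v x) \<in> V)"

lemma fsubspace_sum:
  assumes "fsubspace V" "\<And>i. i \<in> I \<Longrightarrow> v i \<in> V"
  shows "(\<lambda>x. \<Sum>i\<in>I. c i * v i x) \<in> V"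
  using assms(2)
proof (induction I rule: infinite_finite_induct)
  case (insert i I)
  have "(\<lambda>x. c i * v i x) + (\<lambda>x. \<Sum>i\<in>I. c i * v i x) \<in> V"
    using insert assms(1) by (auto simp: fsubspace_def)
  moreover have "(\<lambda>x. c i * v i x) + (\<lambda>x. \<Sum>i\<in>I. c i * v i x) = (\<lambda>x. \<Sum>i\<in>insert i I. c i * v i x)"
    using insert by (simp add: fun_eq_iff)
  ultimately show ?case by simp
qed (use assms(1) in \<open>auto simp: fsubspace_def zero_fun_def\<close>)

lemma fsubspace_scale: "fsubspace V \<Longrightarrow> v \<in> V \<Longrightarrow> (\<lambda>x. c * v x) \<in> V"
  and fsubspace_add: "fsubspace V \<Longrightarrow> v \<in> V \<Longrightarrow> w \<in> V \<Longrightarrow> v + w \<in> V"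
  and fsubspace_0: "fsubspace V \<Longrightarrow> 0 \<in> V"
  by (auto simp: fsubspace_def)

lemma fsubspace_diff: 
  assumes "fsubspace V" "v \<in> V" "w \<in> V" shows "v - w \<in> V"
proof -
  have eq: "v - w = v + (\<lambda>x. (-1) * w x)" by (auto simp: fun_eq_iff)
  show ?thesis unfolding eq by (intro fsubspace_add fsubspace_scale assms)
qed

lemma linear_form_add: "linear_form V L \<Longrightarrow> v \<in> V \<Longrightarrow> w \<in> V \<Longrightarrow> L (v + w) = L v + L w"
  and linear_form_scale: "linear_form V L \<Longrightarrow> v \<in> V \<Longrightarrow> L (\<lambda>x. c * v x) = c * L v"
  by (auto simp: linear_form_def)

lemma linear_form_0:
  assumes "fsubspace V" "linear_form V L" shows "L 0 = 0"
  using linear_form_scale[OF assms(2) fsubspace_0[OF assms(1)], of 0] by (simp add: zero_fun_def)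

lemma linear_form_diff:
  assumes "fsubspace V" "linear_form V L" "v \<in> V" "w \<in> V" shows "L (v - w) = L v - L w"
  using linear_form_add[OF assms(2) fsubspace_diff[OF assms(1,3,4)] assms(4)] by simp

lemma linear_form_sum:
  assumes "fsubspace V" "linear_form V L" "\<And>i. i \<in> I \<Longrightarrow> v i \<in> V"
  shows "L (\<lambda>x. \<Sum>i\<in>I. c i * v i x) = (\<Sum>i\<in>I. c i * L (v i))"
  using assms(3)
proof (induction I rule: infinite_finite_induct)
  case (insert i I)
  have "L (\<lambda>x. \<Sum>i\<in>insert i I. c i * v i x) = L ((\<lambda>x. c i * v i x) + (\<lambda>x. \<Sum>i\<in>I. c i * v i x))"
    using insert by (intro arg_cong[of _ _ L]) (simp add: fun_eq_iff)
  also have "\<dots> = c i * L (v i) + L (\<lambda>x. \<Sum>i\<in>I. c i * v i x)"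
    using insert.prems
    by (subst linear_form_add[OF assms(2)])
      (simp_all add: fsubspace_scale fsubspace_sum linear_form_scale[OF assms(2)] assms(1))
  finally show ?case using insert by simp
qed (use linear_form_0[OF assms(1,2)] in \<open>auto simp: zero_fun_def\<close>)

lemma bilinear_form_left: "bilinear_form V B \<Longrightarrow> w \<in> V \<Longrightarrow> linear_form V (\<lambda>v. B v w)"
  and bilinear_form_right: "bilinear_form V B \<Longrightarrow> v \<in> V \<Longrightarrow> linear_form V (B v)"
  by (auto simp: bilinear_form_def)

section \<open>Smooth functions on manifolds\<close>

locale manifold =
  fixes A :: "('m::{t2_space, second_countable_topology}, 'e::euclidean_space) atlas"
  assumes smooth_manifold: "smooth_manifold A"
begin

lemma chart_at: obtains U \<kappa> where "(U, \<kappa>) \<in> A" "p \<in> U"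
proof -
  have "p \<in> (\<Union>(U, \<phi>)\<in>A. U)" using smooth_manifold by (simp add: smooth_manifold_def)
  then show thesis using that by auto
qed

lemma chart_facts:
  assumes "(U, \<kappa>) \<in> A"
  shows "open U" "open (\<kappa> ` U)" "continuous_on U \<kappa>" "continuous_on (\<kappa> ` U) (inv_into U \<kappa>)"
    "inj_on \<kappa> U" "\<And>p. p \<in> U \<Longrightarrow> inv_into U \<kappa> (\<kappa> p) = p"
    "\<And>x. x \<in> \<kappa> ` U \<Longrightarrow> \<kappa> (inv_into U \<kappa> x) = x \<and> inv_into U \<kappa> x \<in> U"
proof -
  have c: "chart U \<kappa>" using smooth_manifold assms by (auto simp: smooth_manifold_def)
  then show "open U" "open (\<kappa> ` U)" "continuous_on U \<kappa>" "continuous_on (\<kappa> ` U) (inv_into U \<kappa>)"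
    by (auto simp: chart_def homeomorphism_def)
  show *: "inv_into U \<kappa> (\<kappa> p) = p" if "p \<in> U" for p
    using c that by (auto simp: chart_def homeomorphism_def)
  show "inj_on \<kappa> U" using * by (rule inj_on_inverseI)
  show "\<kappa> (inv_into U \<kappa> x) = x \<and> inv_into U \<kappa> x \<in> U" if "x \<in> \<kappa> ` U" for x
    using that by (simp add: f_inv_into_f inv_into_into)
qed

lemma chart_image_open:
  assumes "(U, \<kappa>) \<in> A" "open W" shows "open (\<kappa> ` (U \<inter> W))"
proof -
  have "\<kappa> ` (U \<inter> W) = \<kappa> ` U \<inter> inv_into U \<kappa> -` W"
    using chart_facts(6,7)[OF assms(1)] by (auto simp: image_iff; metis)
  then show ?thesis
    using continuous_open_preimage[OF chart_facts(4,2)[OF assms(1)] assms(2)] by simp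
qed

lemma chart_preimage_open:
  assumes "(U, \<kappa>) \<in> A" "open N" shows "open (U \<inter> \<kappa> -` N)"
  using continuous_open_preimage[OF chart_facts(3,1)[OF assms(1)] assms(2)] .

lemma transition_smooth:
  assumes "(U, \<kappa>) \<in> A" "(V, \<psi>) \<in> A"
  shows "smooth_on (\<psi> \<circ> inv_into U \<kappa>) (\<kappa> ` (U \<inter> V))"
  using smooth_manifold assms unfolding smooth_manifold_def by fast

lemma smooth_functionsD:
  "\<phi> \<in> smooth_functions A \<Longrightarrow> (U, \<kappa>) \<in> A \<Longrightarrow> smooth_on (\<phi> \<circ> inv_into U \<kappa>) (\<kappa> ` U)"
  unfolding smooth_functions_def by fast

text \<open>One chart about each point suffices, because the transition maps carry smoothness near
  the point to every other chart.\<close>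

lemma smooth_functionsI:
  assumes "\<And>p. \<exists>U \<kappa> W. (U, \<kappa>) \<in> A \<and> p \<in> U \<and> p \<in> W \<and> open W
      \<and> smooth_on (\<phi> \<circ> inv_into U \<kappa>) (\<kappa> ` (U \<inter> W))"
  shows "\<phi> \<in> smooth_functions A"
proof -
  have "smooth_on (\<phi> \<circ> inv_into V \<psi>) (\<psi> ` V)" if V: "(V, \<psi>) \<in> A" for V \<psi>
  proof (rule smooth_on_local)
    fix x assume x: "x \<in> \<psi> ` V"
    define p where "p = inv_into V \<psi> x"
    have p: "p \<in> V" "\<psi> p = x" using chart_facts(7)[OF V x] by (auto simp: p_def)
    obtain U \<kappa> W where U: "(U, \<kappa>) \<in> A" "p \<in> U" "p \<in> W" "open W"
      "smooth_on (\<phi> \<circ> inv_into U \<kappa>) (\<kappa> ` (U \<inter> W))"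
      using assms by blast
    let ?S = "\<psi> ` (V \<inter> (U \<inter> W))"
    have oS: "open ?S" using chart_image_open[OF V] chart_facts(1)[OF U(1)] U(4) by blast
    have "smooth_on (\<kappa> \<circ> inv_into V \<psi>) ?S"
      by (rule smooth_on_subset[OF transition_smooth[OF V U(1)]]) auto
    moreover have "(\<kappa> \<circ> inv_into V \<psi>) ` ?S \<subseteq> \<kappa> ` (U \<inter> W)"
      using chart_facts(6)[OF V] by auto
    ultimately have sm: "smooth_on (\<lambda>y. (\<phi> \<circ> inv_into U \<kappa>) ((\<kappa> \<circ> inv_into V \<psi>) y)) ?S"
      using smooth_on_compose[OF oS chart_image_open[OF U(1,4)] U(5)] by blast
    have eq: "(\<phi> \<circ> inv_into U \<kappa>) ((\<kappa> \<circ> inv_into V \<psi>) y) = (\<phi> \<circ> inv_into V \<psi>) y" if "y \<in> ?S" for y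
      using that chart_facts(6)[OF V] chart_facts(6)[OF U(1)] by auto
    have "smooth_on (\<phi> \<circ> inv_into V \<psi>) ?S"
      by (rule iffD1[OF smooth_on_cong[OF oS eq] sm])
    then show "\<exists>T. open T \<and> x \<in> T \<and> smooth_on (\<phi> \<circ> inv_into V \<psi>) T"
      using oS p U(2,3) by blast
  qed
  then show ?thesis unfolding smooth_functions_def by fast
qed

lemma smooth_functions_local:
  assumes "\<And>p. \<exists>W \<psi>. open W \<and> p \<in> W \<and> \<psi> \<in> smooth_functions A \<and> (\<forall>q\<in>W. \<phi> q = \<psi> q)"
  shows "\<phi> \<in> smooth_functions A"
proof (rule smooth_functionsI)
  fix p
  obtain W \<psi> where W: "open W" "p \<in> W" "\<psi> \<in> smooth_functions A" "\<forall>q\<in>W. \<phi> q = \<psi> q"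
    using assms by blast
  obtain U \<kappa> where U: "(U, \<kappa>) \<in> A" "p \<in> U" by (rule chart_at)
  have "smooth_on (\<psi> \<circ> inv_into U \<kappa>) (\<kappa> ` (U \<inter> W))"
    by (rule smooth_on_subset[OF smooth_functionsD[OF W(3) U(1)]]) auto
  moreover have "(\<psi> \<circ> inv_into U \<kappa>) x = (\<phi> \<circ> inv_into U \<kappa>) x" if "x \<in> \<kappa> ` (U \<inter> W)" for x
    using that W(4) chart_facts(6)[OF U(1)] by auto
  ultimately have "smooth_on (\<phi> \<circ> inv_into U \<kappa>) (\<kappa> ` (U \<inter> W))"
    using smooth_on_cong[OF chart_image_open[OF U(1) W(1)]] by metis
  then show "\<exists>U \<kappa> W. (U, \<kappa>) \<in> A \<and> p \<in> U \<and> p \<in> W \<and> open W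
      \<and> smooth_on (\<phi> \<circ> inv_into U \<kappa>) (\<kappa> ` (U \<inter> W))"
    using U W by blast
qed

lemma smooth_const [simp]: "(\<lambda>_. c) \<in> smooth_functions A"
  unfolding smooth_functions_def using chart_facts(2)
  by (auto simp: comp_def intro!: smooth_on_const)

lemma smooth_add: "\<phi> \<in> smooth_functions A \<Longrightarrow> \<psi> \<in> smooth_functions A \<Longrightarrow> (\<lambda>x. \<phi> x + \<psi> x) \<in> smooth_functions A"
  unfolding smooth_functions_def using chart_facts(2)
  by (auto simp: comp_def intro!: smooth_on_add)

lemma smooth_mult: "\<phi> \<in> smooth_functions A \<Longrightarrow> \<psi> \<in> smooth_functions A \<Longrightarrow> (\<lambda>x. \<phi> x * \<psi> x) \<in> smooth_functions A"
  unfolding smooth_functions_def using chart_facts(2)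
  by (auto simp: comp_def intro!: smooth_on_mult)

lemma smooth_uminus: "\<phi> \<in> smooth_functions A \<Longrightarrow> (\<lambda>x. - \<phi> x) \<in> smooth_functions A"
  using smooth_mult[OF smooth_const, of \<phi> "-1"] by simp

lemma smooth_diff: "\<phi> \<in> smooth_functions A \<Longrightarrow> \<psi> \<in> smooth_functions A \<Longrightarrow> (\<lambda>x. \<phi> x - \<psi> x) \<in> smooth_functions A"
  using smooth_add[OF _ smooth_uminus, of \<phi> \<psi>] by simp

lemma smooth_sum:
  "(\<And>i. i \<in> I \<Longrightarrow> \<phi> i \<in> smooth_functions A) \<Longrightarrow> (\<lambda>x. \<Sum>i\<in>I. \<phi> i x) \<in> smooth_functions A"
  by (induction I rule: infinite_finite_induct) (auto intro: smooth_add)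

lemmas smooth_intros = smooth_const smooth_add smooth_mult smooth_uminus smooth_diff smooth_sum

lemma smooth_powr:
  assumes "\<phi> \<in> smooth_functions A" "\<And>x. \<phi> x > 0"
  shows "(\<lambda>x. \<phi> x powr a) \<in> smooth_functions A"
  unfolding smooth_functions_def using chart_facts(2) smooth_functionsD[OF assms(1)] assms(2)
  by (auto simp: comp_def intro!: smooth_on_compose[OF _ _ smooth_on_powr])

lemma fsubspace_smooth: "fsubspace (smooth_functions A)"
  by (auto simp: fsubspace_def zero_fun_def plus_fun_def intro: smooth_intros)

lemma smooth_continuous:
  assumes "\<phi> \<in> smooth_functions A" shows "continuous_on UNIV \<phi>"
proof (rule continuous_at_imp_continuous_on, rule ballI)
  fix p
  obtain U \<kappa> where U: "(U, \<kappa>) \<in> A" "p \<in> U" by (rule chart_at)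
  have "continuous_on U (\<lambda>q. (\<phi> \<circ> inv_into U \<kappa>) (\<kappa> q))"
    by (rule continuous_on_compose2[OF smooth_on_continuous[OF smooth_functionsD[OF assms U(1)]]])
      (use chart_facts(3)[OF U(1)] in auto)
  then have "continuous_on U \<phi>"
    by (rule continuous_on_eq) (use chart_facts(6)[OF U(1)] in auto)
  then show "isCont \<phi> p" using U chart_facts(1)[OF U(1)] continuous_on_eq_continuous_at by blast
qed

lemma smooth_open_positive: "\<phi> \<in> smooth_functions A \<Longrightarrow> open {x. \<phi> x > c}"
  using smooth_continuous open_Collect_less continuous_on_const by blast

text \<open>The part of \<open>U\<close> with coordinates in \<open>K\<close> is compact, hence
  closed in a Hausdorff space. Its complement is an open neighbourhood of every point outside
  \<open>U\<close>, and the function is 0 on it.\<close>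

lemma smooth_extension:
  assumes U: "(U, \<kappa>) \<in> A" and F: "smooth_on F (\<kappa> ` U)" and K: "compact K" "K \<subseteq> \<kappa> ` U"
    and F0: "\<And>x. x \<in> \<kappa> ` U \<Longrightarrow> x \<notin> K \<Longrightarrow> F x = 0"
  shows "(\<lambda>q. if q \<in> U then F (\<kappa> q) else 0) \<in> smooth_functions A" (is "?\<phi> \<in> _")
proof (rule smooth_functionsI)
  fix p
  show "\<exists>U \<kappa> W. (U, \<kappa>) \<in> A \<and> p \<in> U \<and> p \<in> W \<and> open W
      \<and> smooth_on (?\<phi> \<circ> inv_into U \<kappa>) (\<kappa> ` (U \<inter> W))"
  proof (cases "p \<in> U")
    case True
    have "smooth_on (?\<phi> \<circ> inv_into U \<kappa>) (\<kappa> ` U)"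
      by (subst smooth_on_cong[OF chart_facts(2)[OF U], of _ F])
        (use F chart_facts(7)[OF U] in auto)
    then show ?thesis using U True by (intro exI[of _ U] exI[of _ \<kappa>] exI[of _ UNIV]) auto
  next
    case False
    obtain V \<psi> where V: "(V, \<psi>) \<in> A" "p \<in> V" by (rule chart_at)
    let ?L = "inv_into U \<kappa> ` K"
    have "compact ?L"
      using K compact_continuous_image continuous_on_subset[OF chart_facts(4)[OF U]] by blast
    then have oW: "open (- ?L)" by (simp add: compact_imp_closed open_Compl)
    have pL: "p \<in> - ?L" using False K(2) chart_facts(7)[OF U] by auto
    have z: "?\<phi> q = 0" if "q \<in> - ?L" for q
    proof (cases "q \<in> U")
      case True
      then have "\<kappa> q \<notin> K" using that chart_facts(6)[OF U True] by (metis ComplD imageI)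
      then show ?thesis using F0 by simp
    qed simp
    have "(?\<phi> \<circ> inv_into V \<psi>) x = 0" if x: "x \<in> \<psi> ` (V \<inter> - ?L)" for x
    proof -
      obtain q where "q \<in> V" "q \<in> - ?L" "x = \<psi> q" using x by blast
      then show ?thesis using z[of q] chart_facts(6)[OF V(1), of q] by (simp only: comp_def)
    qed
    then have "smooth_on (?\<phi> \<circ> inv_into V \<psi>) (\<psi> ` (V \<inter> - ?L))"
      by (rule iffD2[OF smooth_on_cong[OF chart_image_open[OF V(1) oW], where g = "\<lambda>_. 0"]
            smooth_on_const[OF chart_image_open[OF V(1) oW]]])
    then show ?thesis using V pL oW by blast
  qed
qed

lemma ball_in_chart:
  assumes "(U, \<kappa>) \<in> A" "p \<in> U" "open W" "p \<in> W"
  obtains r where "0 < r" "cball (\<kappa> p) r \<subseteq> \<kappa> ` (U \<inter> W)"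
  using chart_image_open[OF assms(1,3)] assms(2,4) that open_contains_cball[of "\<kappa> ` (U \<inter> W)"]
  by (metis IntI imageI)

lemma chart_ball_open:
  assumes "(U, \<kappa>) \<in> A" shows "open {q \<in> U. dist c (\<kappa> q) < r}"
  using chart_preimage_open[OF assms open_ball[of c r]] by (simp add: vimage_def Int_def)

lemma bump_function:
  assumes "open W" "p \<in> W"
  obtains \<zeta> V where "\<zeta> \<in> smooth_functions A" "open V" "p \<in> V" "V \<subseteq> W" "\<And>q. q \<in> V \<Longrightarrow> \<zeta> q = 1"
    "\<And>q. q \<notin> W \<Longrightarrow> \<zeta> q = 0" "\<And>q. 0 \<le> \<zeta> q" "\<And>q. \<zeta> q \<le> 1"
proof -
  obtain U \<kappa> where U: "(U, \<kappa>) \<in> A" "p \<in> U" by (rule chart_at)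
  obtain r where r: "0 < r" "cball (\<kappa> p) r \<subseteq> \<kappa> ` (U \<inter> W)"
    by (rule ball_in_chart[OF U assms])
  obtain B :: "'e \<Rightarrow> real" where B: "smooth_on B UNIV" "\<And>x. dist (\<kappa> p) x \<le> r / 2 \<Longrightarrow> B x = 1"
    "\<And>x. dist (\<kappa> p) x \<ge> 2 * (r / 2) \<Longrightarrow> B x = 0" "\<And>x. 0 \<le> B x" "\<And>x. B x \<le> 1"
    using smooth_bump[of "r / 2" "\<kappa> p"] r(1) by auto
  let ?\<zeta> = "\<lambda>q. if q \<in> U then B (\<kappa> q) else 0"
  let ?V = "{q \<in> U. dist (\<kappa> p) (\<kappa> q) < r / 2}"
  show thesis
  proof (rule that[of ?\<zeta> ?V])
    show "?\<zeta> \<in> smooth_functions A"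
      by (rule smooth_extension[OF U(1) smooth_on_subset[OF B(1)] compact_cball[of "\<kappa> p" r]])
        (use r B(3) in auto)
    show "open ?V" by (rule chart_ball_open[OF U(1)])
    show "p \<in> ?V" using U r by simp
    have in_W: "q \<in> W" if "q \<in> U" "dist (\<kappa> p) (\<kappa> q) \<le> r" for q
      using that r(2) inj_onD[OF chart_facts(5)[OF U(1)]] by (force simp: subset_iff)
    then show "?V \<subseteq> W" using r(1) by auto
    show "?\<zeta> q = 0" if "q \<notin> W" for q
      using in_W[of q] that B(3)[of "\<kappa> q"] by fastforce
  qed (use B in auto)
qed

lemma local_inverse_sqrt:
  assumes "\<psi> \<in> smooth_functions A" "\<psi> p > 0"
  obtains u W where "u \<in> smooth_functions A" "open W" "p \<in> W" "\<And>q. q \<in> W \<Longrightarrow> (u q)\<^sup>2 * \<psi> q = 1"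
proof -
  obtain \<zeta> V where \<zeta>: "\<zeta> \<in> smooth_functions A" "open V" "p \<in> V" "V \<subseteq> {x. \<psi> x > 0}"
    "\<And>q. q \<in> V \<Longrightarrow> \<zeta> q = 1" "\<And>q. q \<notin> {x. \<psi> x > 0} \<Longrightarrow> \<zeta> q = 0" "\<And>q. 0 \<le> \<zeta> q" "\<And>q. \<zeta> q \<le> 1"
    using bump_function[OF smooth_open_positive[OF assms(1)], of p 0] assms(2) by blast
  \<comment> \<open>\<open>\<psi>\<close> may be 0 or negative away from \<open>p\<close>. Blending
    it with the constant 1 gives a function that is positive everywhere and agrees with
    \<open>\<psi>\<close> on \<open>V\<close>.\<close>
  define \<eta> where "\<eta> q = \<zeta> q * \<psi> q + (1 - \<zeta> q)" for q
  have pos: "\<eta> q > 0" for q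
  proof (cases "\<psi> q > 0")
    case True
    then show ?thesis using \<zeta>(7,8)[of q] 
      by (cases "\<zeta> q = 1") (auto simp: \<eta>_def intro!: add_nonneg_pos)
  qed (use \<zeta>(6)[of q] in \<open>simp add: \<eta>_def\<close>)
  have sm: "\<eta> \<in> smooth_functions A"
    unfolding \<eta>_def by (intro smooth_intros \<zeta> assms)
  show thesis
  proof (rule that[of "\<lambda>q. \<eta> q powr (- 1/2)" V])
    show "(\<eta> q powr (- 1/2))\<^sup>2 * \<psi> q = 1" if "q \<in> V" for q
    proof -
      have "(\<eta> q powr (- 1/2))\<^sup>2 = \<eta> q powr (- 1)"
        using pos[of q] by (simp add: power2_eq_square powr_add[symmetric])
      then show ?thesis using \<zeta>(5)[OF that] \<zeta>(4) that pos[of q]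
        by (auto simp: \<eta>_def powr_minus field_simps)
    qed
  qed (use smooth_powr[OF sm pos] \<zeta> in auto)
qed

section \<open>Tangent vectors\<close>

lemma tangentD:
  assumes "v \<in> tangent_space A p"
  shows "linear_form (smooth_functions A) v" "\<And>\<phi>. \<phi> \<notin> smooth_functions A \<Longrightarrow> v \<phi> = 0"
    "\<And>\<phi> \<psi>. \<phi> \<in> smooth_functions A \<Longrightarrow> \<psi> \<in> smooth_functions A
      \<Longrightarrow> v (\<lambda>x. \<phi> x * \<psi> x) = \<phi> p * v \<psi> + \<psi> p * v \<phi>"
    "\<And>\<phi> \<psi>. \<phi> \<in> smooth_functions A \<Longrightarrow> \<psi> \<in> smooth_functions A \<Longrightarrow> v (\<lambda>x. \<phi> x + \<psi> x) = v \<phi> + v \<psi>"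
    "\<And>\<phi> \<psi>. \<phi> \<in> smooth_functions A \<Longrightarrow> \<psi> \<in> smooth_functions A \<Longrightarrow> v (\<lambda>x. \<phi> x - \<psi> x) = v \<phi> - v \<psi>"
proof -
  show *: "linear_form (smooth_functions A) v" using assms by (simp add: tangent_space_def)
  fix \<phi> \<psi> assume "\<phi> \<in> smooth_functions A" "\<psi> \<in> smooth_functions A"
  then show "v (\<lambda>x. \<phi> x + \<psi> x) = v \<phi> + v \<psi>" "v (\<lambda>x. \<phi> x - \<psi> x) = v \<phi> - v \<psi>"
    using linear_form_add[OF *, of \<phi> \<psi>] linear_form_diff[OF fsubspace_smooth *, of \<phi> \<psi>]
    by (simp_all add: plus_fun_def fun_diff_def)
qed (use assms in \<open>auto simp: tangent_space_def\<close>)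

lemma fsubspace_tangent: "fsubspace (tangent_space A p)"
  by (auto simp: fsubspace_def tangent_space_def linear_form_def algebra_simps)

lemma fsubspace_cotangent: "fsubspace (cotangent_space A p)"
  by (auto simp: fsubspace_def cotangent_space_def linear_form_def algebra_simps)

lemma tangent_const:
  assumes "v \<in> tangent_space A p" shows "v (\<lambda>_. c) = 0"
proof -
  have "v (\<lambda>_. 1) = 0" using tangentD(3)[OF assms, of "\<lambda>_. 1" "\<lambda>_. 1"] by simp
  then show ?thesis using linear_form_scale[OF tangentD(1)[OF assms], of "\<lambda>_. 1" c] by simp
qed

lemma tangent_local:
  assumes v: "v \<in> tangent_space A p" and sm: "\<phi> \<in> smooth_functions A" "\<psi> \<in> smooth_functions A"
    and W: "open W" "p \<in> W" "\<And>q. q \<in> W \<Longrightarrow> \<phi> q = \<psi> q"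
  shows "v \<phi> = v \<psi>"
proof -
  obtain \<zeta> V where \<zeta>: "\<zeta> \<in> smooth_functions A" "p \<in> V" "\<And>q. q \<in> V \<Longrightarrow> \<zeta> q = 1"
    "\<And>q. q \<notin> W \<Longrightarrow> \<zeta> q = 0"
    using bump_function[OF W(1,2)] by metis
  have d: "(\<lambda>x. \<phi> x - \<psi> x) \<in> smooth_functions A" by (intro smooth_intros sm)
  \<comment> \<open>The cut-off difference is the zero function. By the Leibniz rule at
    \<open>p\<close>, where the difference is 0 and \<open>\<zeta>\<close> is 1, the cut-off does
    not change the value of \<open>v\<close>.\<close>
  have "(\<lambda>x. \<zeta> x * (\<phi> x - \<psi> x)) = (\<lambda>_. 0)" using \<zeta>(4) W(3) by fastforce
  then have "0 = v (\<lambda>x. \<zeta> x * (\<phi> x - \<psi> x))" using tangent_const[OF v] by simp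
  also have "\<dots> = v (\<lambda>x. \<phi> x - \<psi> x)"
    using tangentD(3)[OF v \<zeta>(1) d] \<zeta>(2,3) W by simp
  finally show ?thesis using tangentD(5)[OF v sm] by simp
qed

lemma tangent_sum:
  assumes "v \<in> tangent_space A p" "\<And>i. i \<in> I \<Longrightarrow> \<phi> i \<in> smooth_functions A"
  shows "v (\<lambda>x. \<Sum>i\<in>I. \<phi> i x) = (\<Sum>i\<in>I. v (\<phi> i))"
  using linear_form_sum[OF fsubspace_smooth tangentD(1)[OF assms(1)], of I \<phi> "\<lambda>_. 1"] assms(2)
  by simp

text \<open>The chart is part of the statement, as the coordinates of a product manifold are compared
  with those of its factors.\<close>

lemma local_frame_chart:
  assumes U: "(U, \<kappa>) \<in> A" "p \<in> U"
  obtains \<zeta> W x X where "\<zeta> \<in> smooth_functions A" "open W" "p \<in> W" "W \<subseteq> U" "\<And>q. q \<in> W \<Longrightarrow> \<zeta> q = 1"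
    "\<And>b. x b \<in> smooth_functions A" "\<And>b q. q \<in> W \<Longrightarrow> x b q = \<kappa> q \<bullet> b" "\<And>b. vector_field A (X b)"
    "\<And>b q \<phi>. q \<in> W \<Longrightarrow> \<phi> \<in> smooth_functions A
      \<Longrightarrow> X b q \<phi> = frechet_derivative (\<phi> \<circ> inv_into U \<kappa>) (at (\<kappa> q)) b"
    "\<And>q v \<phi>. v \<in> tangent_space A q \<Longrightarrow> \<zeta> q * v \<phi> = (\<Sum>b\<in>Basis. v (x b) * X b q \<phi>)"
    "\<And>q b c. q \<in> W \<Longrightarrow> b \<in> Basis \<Longrightarrow> c \<in> Basis \<Longrightarrow> X b q (x c) = (if b = c then 1 else 0)"
proof -
  let ?c = "\<kappa> p"
  obtain r' where r': "0 < r'" "cball ?c r' \<subseteq> \<kappa> ` (U \<inter> UNIV)"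
    using ball_in_chart[OF U open_UNIV] by blast
  \<comment> \<open>\<open>B2\<close> cuts off between r and 2r, \<open>B1\<close> between 3r and
    6r. Around a point at distance less than 2r, a ball of radius r still lies where
    \<open>B1\<close> is 1, so that the functions \<open>x b\<close> are the coordinates on
    it.\<close>
  define r where "r = r' / 6"
  have r: "0 < r" "cball ?c (6 * r) \<subseteq> \<kappa> ` U" using r' by (auto simp: r_def)
  obtain B1 :: "'e \<Rightarrow> real" where B1: "smooth_on B1 UNIV" "\<And>x. dist ?c x \<le> 3 * r \<Longrightarrow> B1 x = 1"
    "\<And>x. dist ?c x \<ge> 2 * (3 * r) \<Longrightarrow> B1 x = 0"
    using smooth_bump[of "3 * r" ?c] r(1) by (metis mult_pos_pos zero_less_numeral)
  obtain B2 :: "'e \<Rightarrow> real" where B2: "smooth_on B2 UNIV" "\<And>x. dist ?c x \<le> r \<Longrightarrow> B2 x = 1"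
    "\<And>x. dist ?c x \<ge> 2 * r \<Longrightarrow> B2 x = 0"
    using smooth_bump[OF r(1), of ?c] by metis
  let ?W = "{q \<in> U. dist ?c (\<kappa> q) < r}"
  define \<zeta> where "\<zeta> q = (if q \<in> U then B2 (\<kappa> q) else 0)" for q
  define x where "x b q = (if q \<in> U then B1 (\<kappa> q) * (\<kappa> q \<bullet> b) else 0)" for b q
  let ?D = "\<lambda>\<phi> q b. frechet_derivative (\<phi> \<circ> inv_into U \<kappa>) (at (\<kappa> q)) b"
  define X where "X b q \<phi> = (if \<phi> \<in> smooth_functions A \<and> q \<in> U then B2 (\<kappa> q) * ?D \<phi> q b else 0)" for b q \<phi>
  note ou = chart_facts(2)[OF U(1)]
  have sx: "x b \<in> smooth_functions A" for b
    unfolding x_def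
    by (rule smooth_extension[OF U(1) smooth_on_mult[OF ou smooth_on_subset[OF B1(1)]
          smooth_on_bounded_linear[OF bounded_linear_inner_left ou]] compact_cball r(2)])
      (auto intro: B1(3))
  have sc: "\<zeta> \<in> smooth_functions A"
    unfolding \<zeta>_def
    by (rule smooth_extension[OF U(1) smooth_on_subset[OF B2(1)] compact_cball r(2)])
      (use r in \<open>auto intro!: B2(3)\<close>)
  have hd: "((\<phi> \<circ> inv_into U \<kappa>) has_derivative ?D \<phi> q) (at (\<kappa> q))"
    if "\<phi> \<in> smooth_functions A" "q \<in> U" for \<phi> q
    using smooth_on_has_derivative[OF smooth_functionsD[OF that(1) U(1)]] that(2) by blast
  have Xt: "X b q \<in> tangent_space A q" for b q
  proof (cases "q \<in> U")
    case False
    then show ?thesis by (simp add: X_def tangent_space_def linear_form_def)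
  next
    case True
    have eq: "frechet_derivative F (at y) = F'" if "(F has_derivative F') (at y)"
      for F :: "'e \<Rightarrow> real" and F' y using frechet_derivative_at[OF that] by simp
    have add: "?D (\<phi> + \<psi>) q b = ?D \<phi> q b + ?D \<psi> q b"
      if "\<phi> \<in> smooth_functions A" "\<psi> \<in> smooth_functions A" for \<phi> \<psi>
      using eq[OF has_derivative_add[OF hd[OF that(1) True] hd[OF that(2) True]]]
      by (simp add: comp_def)
    have mult: "?D (\<lambda>x. \<phi> x * \<psi> x) q b = \<phi> q * ?D \<psi> q b + \<psi> q * ?D \<phi> q b"
      if "\<phi> \<in> smooth_functions A" "\<psi> \<in> smooth_functions A" for \<phi> \<psi>
      using eq[OF has_derivative_mult[OF hd[OF that(1) True] hd[OF that(2) True]]]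
        chart_facts(6)[OF U(1) True]
      by (simp add: comp_def)
    have const: "?D (\<lambda>_. c) q b = 0" for c
      by (simp add: comp_def)
    have scale: "?D (\<lambda>x. c * \<phi> x) q b = c * ?D \<phi> q b" if "\<phi> \<in> smooth_functions A" for c \<phi>
      using mult[OF smooth_const that] const by simp
    show ?thesis
      using True add mult scale fsubspace_add[OF fsubspace_smooth] smooth_mult
      by (auto simp: tangent_space_def linear_form_def X_def algebra_simps smooth_mult)
  qed
  have Xv: "vector_field A (X b)" for b
  proof -
    have "(\<lambda>q. X b q \<phi>) \<in> smooth_functions A" if \<phi>: "\<phi> \<in> smooth_functions A" for \<phi>
    proof -
      have "(\<lambda>q. if q \<in> U then B2 (\<kappa> q) * frechet_derivative (\<phi> \<circ> inv_into U \<kappa>) (at (\<kappa> q)) b else 0)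
          \<in> smooth_functions A"
        by (rule smooth_extension[OF U(1) smooth_on_mult[OF ou smooth_on_subset[OF B2(1)]
              smooth_on_derivative[OF smooth_functionsD[OF \<phi> U(1)]]] compact_cball r(2)])
          (use r in \<open>auto intro!: B2(3)\<close>)
      then show ?thesis using \<phi> by (simp add: X_def)
    qed
    then show ?thesis using Xt by (simp add: vector_field_def)
  qed
  have main: "\<zeta> q * v \<phi> = (\<Sum>b\<in>Basis. v (x b) * X b q \<phi>)" if v: "v \<in> tangent_space A q" for q v \<phi>
  proof (cases "\<phi> \<in> smooth_functions A \<and> q \<in> U \<and> dist ?c (\<kappa> q) < 2 * r")
    case False
    then have "\<phi> \<notin> smooth_functions A \<or> q \<notin> U \<or> B2 (\<kappa> q) = 0" using B2(3)[of "\<kappa> q"] by force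
    then have "X b q \<phi> = 0" "\<zeta> q * v \<phi> = 0" for b
      by (auto simp: X_def \<zeta>_def tangentD(2)[OF v])
    then show ?thesis by simp
  next
    case True
    then have \<phi>: "\<phi> \<in> smooth_functions A" and q: "q \<in> U" and dq: "dist ?c (\<kappa> q) < 2 * r" by auto
    let ?F = "\<phi> \<circ> inv_into U \<kappa>"
    have near: "dist ?c y < 3 * r" if "dist (\<kappa> q) y < r" for y
      using dist_triangle[of ?c y "\<kappa> q"] that dq by linarith
    have sub: "ball (\<kappa> q) r \<subseteq> \<kappa> ` U" using near r by (force simp: subset_iff)
    \<comment> \<open>Hadamard's lemma at \<kappa>(q) writes \<open>\<phi>\<close> near
      \<open>q\<close> as a constant plus products whose first factors vanish at \<open>q\<close>.
      The Leibniz rule then leaves only the coordinate derivatives of \<open>\<phi>\<close>.\<close>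
    obtain G :: "'e \<Rightarrow> 'e \<Rightarrow> real" where G: "\<And>b. smooth_on (G b) (ball (\<kappa> q) r)"
      "\<And>y. y \<in> ball (\<kappa> q) r \<Longrightarrow> ?F y = ?F (\<kappa> q) + (\<Sum>b\<in>Basis. ((y - \<kappa> q) \<bullet> b) * G b y)"
      "\<And>b. G b (\<kappa> q) = frechet_derivative ?F (at (\<kappa> q)) b"
      using hadamard[OF smooth_on_subset[OF smooth_functionsD[OF \<phi> U(1)] sub] r(1)] by blast
    obtain B :: "'e \<Rightarrow> real" where B: "smooth_on B UNIV" "\<And>x. dist (\<kappa> q) x \<le> r / 4 \<Longrightarrow> B x = 1"
      "\<And>x. dist (\<kappa> q) x \<ge> 2 * (r / 4) \<Longrightarrow> B x = 0"
      using smooth_bump[of "r / 4" "\<kappa> q"] r(1) by (metis divide_pos_pos zero_less_numeral)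
    \<comment> \<open>The Hadamard coefficients exist only near \<open>q\<close>; cut off, they
      become global smooth functions to which \<open>v\<close> can be applied.\<close>
    define H where "H b q' = (if q' \<in> U then B (\<kappa> q') * G b (\<kappa> q') else 0)" for b q'
    have sH: "H b \<in> smooth_functions A" for b
      unfolding H_def
    proof (rule smooth_extension[OF U(1) _ compact_cball[of "\<kappa> q" "r / 2"]])
      show "smooth_on (\<lambda>y. B y * G b y) (\<kappa> ` U)"
      proof (rule smooth_on_local)
        fix y assume y: "y \<in> \<kappa> ` U"
        show "\<exists>T. open T \<and> y \<in> T \<and> smooth_on (\<lambda>y. B y * G b y) T"
        proof (cases "dist (\<kappa> q) y < r")
          case True
          have "smooth_on (\<lambda>y. B y * G b y) (ball (\<kappa> q) r)"
            by (intro smooth_on_mult open_ball smooth_on_subset[OF B(1)] G) auto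
          then show ?thesis using True by (intro exI[of _ "ball (\<kappa> q) r"]) auto
        next
          case False
          have o: "open (- cball (\<kappa> q) (r / 2))" by (simp add: open_Compl)
          have "B y * G b y = 0" if "y \<in> - cball (\<kappa> q) (r / 2)" for y
            using that B(3)[of y] by simp
          then have "smooth_on (\<lambda>y. B y * G b y) (- cball (\<kappa> q) (r / 2))"
            by (rule iffD2[OF smooth_on_cong[OF o, where g = "\<lambda>_. 0"] smooth_on_const[OF o]])
          then show ?thesis using False r(1)
            by (intro exI[of _ "- cball (\<kappa> q) (r / 2)"]) (auto simp: open_Compl)
        qed
      qed
      show "cball (\<kappa> q) (r / 2) \<subseteq> \<kappa> ` U" using sub r(1) by (force simp: subset_iff)
    qed (auto simp: B(3))
    let ?x = "\<lambda>b q'. x b q' - x b q"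
    have sx': "?x b \<in> smooth_functions A" for b by (intro smooth_intros sx)
    have eq: "\<phi> q' = \<phi> q + (\<Sum>b\<in>Basis. ?x b q' * H b q')"
      if q': "q' \<in> U" "dist (\<kappa> q) (\<kappa> q') < r / 4" for q'
    proof -
      have d: "dist (\<kappa> q) (\<kappa> q') < r" using q' r(1) by linarith
      have "\<phi> q' = ?F (\<kappa> q')" using chart_facts(6)[OF U(1) q'(1)] by simp
      also have "\<dots> = ?F (\<kappa> q) + (\<Sum>b\<in>Basis. ((\<kappa> q' - \<kappa> q) \<bullet> b) * G b (\<kappa> q'))"
        using G(2) d by simp
      also have "?F (\<kappa> q) = \<phi> q" using chart_facts(6)[OF U(1) q] by simp
      also have "(\<Sum>b\<in>Basis. ((\<kappa> q' - \<kappa> q) \<bullet> b) * G b (\<kappa> q')) = (\<Sum>b\<in>Basis. ?x b q' * H b q')"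
        using near[of "\<kappa> q'"] near[of "\<kappa> q"] d B(2)[of "\<kappa> q'"] q q' r(1)
        by (intro sum.cong) (auto simp: x_def H_def B1(2) inner_diff_left)
      finally show ?thesis .
    qed
    have sS: "(\<lambda>q'. \<Sum>b\<in>Basis. ?x b q' * H b q') \<in> smooth_functions A"
      by (intro smooth_sum smooth_mult sH sx')
    have "v \<phi> = v (\<lambda>q'. \<phi> q + (\<Sum>b\<in>Basis. ?x b q' * H b q'))"
    proof (rule tangent_local[OF v \<phi> smooth_add[OF smooth_const sS]
          chart_ball_open[OF U(1), of "\<kappa> q" "r / 4"]])
      show "q \<in> {q' \<in> U. dist (\<kappa> q) (\<kappa> q') < r / 4}" using q r(1) by simp
    qed (use eq in blast)
    also have "\<dots> = v (\<lambda>q'. \<Sum>b\<in>Basis. ?x b q' * H b q')"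
      using tangentD(4)[OF v smooth_const sS] tangent_const[OF v] by simp
    also have "\<dots> = (\<Sum>b\<in>Basis. v (\<lambda>q'. ?x b q' * H b q'))"
      by (intro tangent_sum[OF v] smooth_mult sH sx')
    also have "\<dots> = (\<Sum>b\<in>Basis. H b q * v (x b))"
      using tangentD(3)[OF v sx' sH] tangentD(5)[OF v sx smooth_const] tangent_const[OF v] by simp
    also have "\<dots> = (\<Sum>b\<in>Basis. ?D \<phi> q b * v (x b))"
      using q B(2)[of "\<kappa> q"] r(1) G(3) by (simp add: H_def)
    finally have "v \<phi> = (\<Sum>b\<in>Basis. ?D \<phi> q b * v (x b))" .
    then show ?thesis using \<phi> q by (simp add: X_def \<zeta>_def sum_distrib_left algebra_simps)
  qed
  have Xx: "X b q \<phi> = ?D \<phi> q b" if "q \<in> ?W" "\<phi> \<in> smooth_functions A" for b q \<phi>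
    using that B2(2)[of "\<kappa> q"] by (simp add: X_def)
  have delta: "X b q (x c) = (if b = c then 1 else 0)" if q: "q \<in> ?W" and bc: "b \<in> Basis" "c \<in> Basis" for b q c
  proof -
    have o: "open (ball ?c (3 * r))" "\<kappa> q \<in> ball ?c (3 * r)" using q r(1) by auto
    have "(x c \<circ> inv_into U \<kappa>) y = y \<bullet> c" if "y \<in> ball ?c (3 * r)" for y
      using that r chart_facts(7)[OF U(1), of y] B1(2)[of y] by (force simp: x_def subset_iff)
    then have "?D (x c) q b = frechet_derivative (\<lambda>y. y \<bullet> c) (at (\<kappa> q)) b"
      using frechet_derivative_cong_open[OF o] by metis
    also have "\<dots> = b \<bullet> c"
      using frechet_derivative_at[OF bounded_linear_imp_has_derivative[OF bounded_linear_inner_left, of c]]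
      by metis
    finally show ?thesis using Xx[OF q sx] bc by (simp add: inner_Basis)
  qed
  show thesis
  proof (rule that[OF sc chart_ball_open[OF U(1)] _ _ _ sx _ Xv Xx main delta])
    show "x b q = \<kappa> q \<bullet> b" if "q \<in> ?W" for b q
      using that B1(2)[of "\<kappa> q"] r(1) by (simp add: x_def)
  qed (use U(2) r(1) B2(2) in \<open>auto simp: \<zeta>_def\<close>)
qed

end

section \<open>Vector fields and 1-forms\<close>

definition vscale :: "('m \<Rightarrow> real) \<Rightarrow> ('m \<Rightarrow> 'm tvec) \<Rightarrow> 'm \<Rightarrow> 'm tvec" where
  "vscale \<phi> X = (\<lambda>p \<psi>. \<phi> p * X p \<psi>)"

context manifold
begin

abbreviation "SF \<equiv> smooth_functions A"
abbreviation "TS \<equiv> tangent_space A"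
abbreviation "CS \<equiv> cotangent_space A"
abbreviation "VF \<equiv> vector_field A"
abbreviation "FORM \<equiv> one_form A"
abbreviation "d \<equiv> differential A"

text \<open>Coordinate functions and fields made global by a cut-off. The expansion of tangent
  vectors holds at every point of the manifold, with the factor \<open>\<zeta>\<close>, and not only
  on \<open>W\<close>; this is what lets tensoriality be proved with global fields and
  forms.\<close>

definition frame_at where
  "frame_at p \<zeta> W x X \<longleftrightarrow> \<zeta> \<in> SF \<and> open W \<and> p \<in> W \<and> (\<forall>q\<in>W. \<zeta> q = 1) \<and>
    (\<forall>b. x b \<in> SF) \<and> (\<forall>b. VF (X b)) \<and>
    (\<forall>q. \<forall>v\<in>TS q. \<forall>\<phi>. \<zeta> q * v \<phi> = (\<Sum>b\<in>(Basis::'e set). v (x b) * X b q \<phi>)) \<and>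
    (\<forall>q\<in>W. \<forall>b\<in>Basis. \<forall>c\<in>Basis. X b q (x c) = (if b = c then 1 else 0))"

lemma frame_exists: "\<exists>\<zeta> W x X. frame_at p \<zeta> W x X"
proof -
  obtain U \<kappa> where U: "(U, \<kappa>) \<in> A" "p \<in> U" by (rule chart_at)
  show ?thesis
  proof (rule local_frame_chart[OF U])
    fix \<zeta> W x X
    assume a: "\<zeta> \<in> SF" "open W" "p \<in> W" "W \<subseteq> U" "\<And>q. q \<in> W \<Longrightarrow> \<zeta> q = 1"
      "\<And>b. x b \<in> SF" "\<And>b q. q \<in> W \<Longrightarrow> x b q = \<kappa> q \<bullet> b" "\<And>b. VF (X b)"
      "\<And>b q \<phi>. q \<in> W \<Longrightarrow> \<phi> \<in> SF \<Longrightarrow> X b q \<phi> = frechet_derivative (\<phi> \<circ> inv_into U \<kappa>) (at (\<kappa> q)) b"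
      "\<And>q v \<phi>. v \<in> TS q \<Longrightarrow> \<zeta> q * v \<phi> = (\<Sum>b\<in>Basis. v (x b) * X b q \<phi>)"
      "\<And>q b c. q \<in> W \<Longrightarrow> b \<in> Basis \<Longrightarrow> c \<in> Basis \<Longrightarrow> X b q (x c) = (if b = c then 1 else 0)"
    have "frame_at p \<zeta> W x X"
      unfolding frame_at_def
      apply (rule conjI, fact a)
      apply (rule conjI, fact a)
      apply (rule conjI, fact a)
      apply (rule conjI, intro ballI, fact a)
      apply (rule conjI, intro allI, fact a)
      apply (rule conjI, intro allI, fact a)
      apply (rule conjI)
      subgoal using a(10) by blast
      subgoal using a(11) by blast
      done
    then show "\<exists>\<zeta> W x X. frame_at p \<zeta> W x X" by (intro exI)
  qed
qed

lemma frame_atD: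
  assumes "frame_at p \<zeta> W x X"
  shows "\<zeta> \<in> SF" "open W" "p \<in> W" "\<And>q. q \<in> W \<Longrightarrow> \<zeta> q = 1" "\<And>b. x b \<in> SF" "\<And>b. VF (X b)"
    "\<And>q v \<phi>. v \<in> TS q \<Longrightarrow> \<zeta> q * v \<phi> = (\<Sum>b\<in>Basis. v (x b) * X b q \<phi>)"
    "\<And>q b c. q \<in> W \<Longrightarrow> b \<in> Basis \<Longrightarrow> c \<in> Basis \<Longrightarrow> X b q (x c) = (if b = c then 1 else 0)"
proof -
  show "\<zeta> \<in> SF" "open W" "p \<in> W" "\<And>q. q \<in> W \<Longrightarrow> \<zeta> q = 1" "\<And>b. x b \<in> SF" "\<And>b. VF (X b)"
    using assms unfolding frame_at_def by (elim conjE; blast)+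
  have 1: "\<forall>q. \<forall>v\<in>TS q. \<forall>\<phi>. \<zeta> q * v \<phi> = (\<Sum>b\<in>(Basis::'e set). v (x b) * X b q \<phi>)"
    using assms unfolding frame_at_def by (elim conjE)
  have 2: "\<forall>q\<in>W. \<forall>b\<in>Basis. \<forall>c\<in>Basis. X b q (x c) = (if b = c then 1 else 0)"
    using assms unfolding frame_at_def by (elim conjE)
  show "\<And>q v \<phi>. v \<in> TS q \<Longrightarrow> \<zeta> q * v \<phi> = (\<Sum>b\<in>Basis. v (x b) * X b q \<phi>)"
    by (rule 1[THEN spec, THEN bspec, THEN spec])
  show "\<And>q b c. q \<in> W \<Longrightarrow> b \<in> Basis \<Longrightarrow> c \<in> Basis \<Longrightarrow> X b q (x c) = (if b = c then 1 else 0)"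
    by (rule 2[THEN bspec, THEN bspec, THEN bspec])
qed

lemma frame_tangent:
  assumes "frame_at p \<zeta> W x X" "q \<in> W" "v \<in> TS q"
  shows "v = (\<lambda>\<phi>. \<Sum>b\<in>Basis. v (x b) * X b q \<phi>)"
proof
  fix \<phi> show "v \<phi> = (\<Sum>b\<in>Basis. v (x b) * X b q \<phi>)"
    using frame_atD(4)[OF assms(1,2)] frame_atD(7)[OF assms(1,3), of \<phi>] by simp
qed

lemma VF_tangent: "VF X \<Longrightarrow> X p \<in> TS p"
  and VF_smooth: "VF X \<Longrightarrow> \<phi> \<in> SF \<Longrightarrow> (\<lambda>p. X p \<phi>) \<in> SF"
  by (auto simp: vector_field_def)

lemma VF_add: "VF X \<Longrightarrow> VF Y \<Longrightarrow> VF (X + Y)"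
  by (simp add: vector_field_def fsubspace_add[OF fsubspace_tangent] smooth_add)

lemma VF_scale: "\<phi> \<in> SF \<Longrightarrow> VF X \<Longrightarrow> VF (vscale \<phi> X)"
  by (simp add: vector_field_def vscale_def fsubspace_scale[OF fsubspace_tangent] smooth_mult)

lemma VF_sum: "(\<And>i. i \<in> I \<Longrightarrow> VF (X i)) \<Longrightarrow> VF (\<lambda>p \<phi>. \<Sum>i\<in>I. c i * X i p \<phi>)"
  by (simp add: vector_field_def fsubspace_sum[OF fsubspace_tangent] smooth_sum smooth_mult)

text \<open>The coordinate fields of a frame are global, so they may be combined with the
  coefficients of \<open>v\<close> as constants.\<close>

lemma VF_extension:
  assumes "v \<in> TS p" obtains X where "VF X" "X p = v"
proof -
  obtain \<zeta> W x X where fr: "frame_at p \<zeta> W x X" using frame_exists by metis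
  show thesis
  proof
    show "VF (\<lambda>q \<phi>. \<Sum>b\<in>Basis. v (x b) * X b q \<phi>)" using frame_atD(6)[OF fr] by (intro VF_sum)
    show "(\<lambda>\<phi>. \<Sum>b\<in>Basis. v (x b) * X b p \<phi>) = v"
      by (rule frame_tangent[OF fr frame_atD(3)[OF fr] assms, symmetric])
  qed
qed

lemma cotangentD: "a \<in> CS p \<Longrightarrow> linear_form (TS p) a" "a \<in> CS p \<Longrightarrow> v \<notin> TS p \<Longrightarrow> a v = 0"
  by (auto simp: cotangent_space_def)

lemma FORM_cotangent: "FORM \<alpha> \<Longrightarrow> \<alpha> p \<in> CS p"
  and FORM_smooth: "FORM \<alpha> \<Longrightarrow> VF X \<Longrightarrow> (\<lambda>p. \<alpha> p (X p)) \<in> SF"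
  by (auto simp: one_form_def)

lemma FORM_add: "FORM \<alpha> \<Longrightarrow> FORM \<beta> \<Longrightarrow> FORM (\<alpha> + \<beta>)"
  by (simp add: one_form_def fsubspace_add[OF fsubspace_cotangent] smooth_add)

lemma FORM_diff: "FORM \<alpha> \<Longrightarrow> FORM \<beta> \<Longrightarrow> FORM (\<alpha> - \<beta>)"
  by (simp add: one_form_def fsubspace_diff[OF fsubspace_cotangent] smooth_diff)

lemma FORM_scale: "\<phi> \<in> SF \<Longrightarrow> FORM \<alpha> \<Longrightarrow> FORM (fscale \<phi> \<alpha>)"
  by (simp add: one_form_def fscale_def fsubspace_scale[OF fsubspace_cotangent] smooth_mult)

lemma FORM_0: "FORM 0"
  using fsubspace_0[OF fsubspace_cotangent] by (simp add: one_form_def)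

lemma FORM_sum: "(\<And>i. i \<in> I \<Longrightarrow> FORM (\<alpha> i)) \<Longrightarrow> FORM (\<Sum>i\<in>I. \<alpha> i)"
  by (induction I rule: infinite_finite_induct) (auto intro: FORM_0 FORM_add)

lemma differential_eval: "v \<in> TS p \<Longrightarrow> d \<phi> p v = v \<phi>"
  by (simp add: differential_def)

lemma differential_VF: "VF X \<Longrightarrow> d \<phi> p (X p) = X p \<phi>"
  by (simp add: differential_eval VF_tangent)

lemma differential_cotangent: "d \<phi> p \<in> CS p"
  unfolding cotangent_space_def linear_form_def
  using fsubspace_tangent[of p] by (auto simp: differential_def fsubspace_def)

lemma FORM_differential: "\<phi> \<in> SF \<Longrightarrow> FORM (d \<phi>)"
  by (simp add: one_form_def differential_cotangent differential_VF VF_smooth)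

lemma sum_form_apply: "(\<Sum>i\<in>I. \<alpha> i) p v = (\<Sum>i\<in>I. \<alpha> i p v)"
  for \<alpha> :: "'i \<Rightarrow> 'x form"
  by (induction I rule: infinite_finite_induct) auto

lemma covector_frame:
  assumes fr: "frame_at p \<zeta> W x X" and "q \<in> W" "a \<in> CS q"
  shows "a = (\<lambda>v. \<Sum>b\<in>Basis. a (X b q) * d (x b) q v)"
proof
  fix v show "a v = (\<Sum>b\<in>Basis. a (X b q) * d (x b) q v)"
  proof (cases "v \<in> TS q")
    case True
    have "a v = a (\<lambda>\<phi>. \<Sum>b\<in>Basis. v (x b) * X b q \<phi>)"
      by (rule arg_cong[OF frame_tangent[OF fr assms(2) True]])
    also have "\<dots> = (\<Sum>b\<in>Basis. v (x b) * a (X b q))"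
      by (rule linear_form_sum[OF fsubspace_tangent cotangentD(1)[OF assms(3)]])
        (use VF_tangent[OF frame_atD(6)[OF fr]] in auto)
    finally show ?thesis using True by (simp add: differential_eval mult.commute)
  qed (simp add: cotangentD(2)[OF assms(3)] differential_def)
qed

lemma FORM_extension:
  assumes "a \<in> CS p" obtains \<alpha> where "FORM \<alpha>" "\<alpha> p = a"
proof -
  obtain \<zeta> W x X where fr: "frame_at p \<zeta> W x X" using frame_exists by metis
  show thesis
  proof
    show "FORM (\<Sum>b\<in>Basis. fscale (\<lambda>_. a (X b p)) (d (x b)))"
      using frame_atD(5)[OF fr] by (intro FORM_sum FORM_scale FORM_differential) auto
    show "(\<Sum>b\<in>Basis. fscale (\<lambda>_. a (X b p)) (d (x b))) p = a"
    proof
      fix v show "(\<Sum>b\<in>Basis. fscale (\<lambda>_. a (X b p)) (d (x b))) p v = a v"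
        using fun_cong[OF covector_frame[OF fr frame_atD(3)[OF fr] assms], of v]
        by (simp add: sum_form_apply fscale_def)
    qed
  qed
qed

lemma covector_eqI:
  assumes "a \<in> CS p" "b \<in> CS p" "\<And>X. VF X \<Longrightarrow> a (X p) = b (X p)"
  shows "a = b"
proof
  fix v show "a v = b v"
  proof (cases "v \<in> TS p")
    case True
    then show ?thesis using VF_extension assms(3) by metis
  qed (simp add: cotangentD(2)[OF assms(1)] cotangentD(2)[OF assms(2)])
qed

lemma FORM_eqI:
  assumes "FORM \<alpha>" "FORM \<beta>" "\<And>X p. VF X \<Longrightarrow> \<alpha> p (X p) = \<beta> p (X p)"
  shows "\<alpha> = \<beta>"
  using covector_eqI[OF FORM_cotangent[OF assms(1)] FORM_cotangent[OF assms(2)]] assms(3) by blast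

lemma FORM_tangent_add: "FORM \<alpha> \<Longrightarrow> v \<in> TS p \<Longrightarrow> w \<in> TS p \<Longrightarrow> \<alpha> p (v + w) = \<alpha> p v + \<alpha> p w"
  and FORM_tangent_diff: "FORM \<alpha> \<Longrightarrow> v \<in> TS p \<Longrightarrow> w \<in> TS p \<Longrightarrow> \<alpha> p (v - w) = \<alpha> p v - \<alpha> p w"
  and FORM_tangent_scale: "FORM \<alpha> \<Longrightarrow> v \<in> TS p \<Longrightarrow> \<alpha> p (\<lambda>\<phi>. c * v \<phi>) = c * \<alpha> p v"
  using linear_form_add linear_form_diff[OF fsubspace_tangent] linear_form_scale
    cotangentD(1)[OF FORM_cotangent] by blast+

section \<open>Tensoriality\<close>

text \<open>\<open>fscale \<zeta> \<alpha>\<close> is a global combination of the differentials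
  \<open>d (x b)\<close> with smooth coefficients, and the factor \<open>\<zeta>\<close> is 1 at
  \<open>p\<close>.\<close>

lemma form_tensorial:
  fixes F :: "'m form \<Rightarrow> real"
  assumes fr: "frame_at p \<zeta> W x X"
    and add: "\<And>\<alpha> \<beta>. FORM \<alpha> \<Longrightarrow> FORM \<beta> \<Longrightarrow> F (\<alpha> + \<beta>) = F \<alpha> + F \<beta>"
    and scale: "\<And>\<phi> \<alpha>. \<phi> \<in> SF \<Longrightarrow> FORM \<alpha> \<Longrightarrow> F (fscale \<phi> \<alpha>) = \<phi> p * F \<alpha>"
    and \<alpha>: "FORM \<alpha>"
  shows "F \<alpha> = (\<Sum>b\<in>Basis. \<alpha> p (X b p) * F (d (x b)))"
proof -
  note f = frame_atD[OF fr]
  have sx: "(\<lambda>q. \<alpha> q (X b q)) \<in> SF" for b using FORM_smooth[OF \<alpha> f(6)] .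
  have eq: "fscale \<zeta> \<alpha> = (\<Sum>b\<in>Basis. fscale (\<lambda>q. \<alpha> q (X b q)) (d (x b)))"
  proof (rule FORM_eqI)
    show "FORM (\<Sum>b\<in>Basis. fscale (\<lambda>q. \<alpha> q (X b q)) (d (x b)))"
      by (rule FORM_sum[OF FORM_scale[OF sx FORM_differential[OF f(5)]]])
    fix Y q assume Y: "VF Y"
    have "fscale \<zeta> \<alpha> q (Y q) = \<alpha> q (\<lambda>\<phi>. \<zeta> q * Y q \<phi>)"
      using FORM_tangent_scale[OF \<alpha> VF_tangent[OF Y]] by (simp add: fscale_def)
    also have "\<dots> = \<alpha> q (\<lambda>\<phi>. \<Sum>b\<in>Basis. Y q (x b) * X b q \<phi>)"
      by (intro arg_cong[of _ _ "\<alpha> q"] ext f(7) VF_tangent Y)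
    also have "\<dots> = (\<Sum>b\<in>Basis. Y q (x b) * \<alpha> q (X b q))"
      by (rule linear_form_sum[OF fsubspace_tangent cotangentD(1)[OF FORM_cotangent[OF \<alpha>]]])
        (use VF_tangent[OF f(6)] in auto)
    finally show "fscale \<zeta> \<alpha> q (Y q) = (\<Sum>b\<in>Basis. fscale (\<lambda>q. \<alpha> q (X b q)) (d (x b))) q (Y q)"
      by (simp add: sum_form_apply fscale_def differential_VF[OF Y] mult.commute)
  qed (rule FORM_scale[OF f(1) \<alpha>])
  have F0: "F 0 = 0" using add[OF FORM_0 FORM_0] by simp
  have Fsum: "F (\<Sum>i\<in>I. \<beta> i) = (\<Sum>i\<in>I. F (\<beta> i))" if "\<And>i. FORM (\<beta> i)" for I :: "'e set" and \<beta>
    using that by (induction I rule: infinite_finite_induct) (auto simp: F0 add FORM_sum)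
  have "F \<alpha> = F (fscale \<zeta> \<alpha>)" using scale[OF f(1) \<alpha>] f(4)[OF f(3)] by simp
  also have "\<dots> = (\<Sum>b\<in>Basis. F (fscale (\<lambda>q. \<alpha> q (X b q)) (d (x b))))"
    unfolding eq by (rule Fsum[OF FORM_scale[OF sx FORM_differential[OF f(5)]]])
  also have "\<dots> = (\<Sum>b\<in>Basis. \<alpha> p (X b p) * F (d (x b)))"
    using scale[OF sx FORM_differential[OF f(5)]] by simp
  finally show ?thesis .
qed

lemma form_tensorial_cong:
  fixes F :: "'m form \<Rightarrow> real"
  assumes "\<And>\<alpha> \<beta>. FORM \<alpha> \<Longrightarrow> FORM \<beta> \<Longrightarrow> F (\<alpha> + \<beta>) = F \<alpha> + F \<beta>"
    "\<And>\<phi> \<alpha>. \<phi> \<in> SF \<Longrightarrow> FORM \<alpha> \<Longrightarrow> F (fscale \<phi> \<alpha>) = \<phi> p * F \<alpha>"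
    and "FORM \<alpha>" "FORM \<beta>" "\<alpha> p = \<beta> p"
  shows "F \<alpha> = F \<beta>"
proof -
  obtain \<zeta> W x X where fr: "frame_at p \<zeta> W x X" using frame_exists by metis
  show ?thesis using form_tensorial[OF fr, of F] assms by simp
qed

text \<open>Reduces identities that are linear over functions to exact forms, on which the Koszul
  bracket has a closed formula.\<close>

lemma form_tensorial_zero:
  fixes F :: "'m form \<Rightarrow> real"
  assumes "\<And>\<alpha> \<beta>. FORM \<alpha> \<Longrightarrow> FORM \<beta> \<Longrightarrow> F (\<alpha> + \<beta>) = F \<alpha> + F \<beta>"
    "\<And>\<phi> \<alpha>. \<phi> \<in> SF \<Longrightarrow> FORM \<alpha> \<Longrightarrow> F (fscale \<phi> \<alpha>) = \<phi> p * F \<alpha>"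
    "\<And>\<phi>. \<phi> \<in> SF \<Longrightarrow> F (d \<phi>) = 0" and "FORM \<alpha>"
  shows "F \<alpha> = 0"
proof -
  obtain \<zeta> W x X where fr: "frame_at p \<zeta> W x X" using frame_exists by metis
  show ?thesis using form_tensorial[OF fr, of F] assms frame_atD(5)[OF fr] by simp
qed

text \<open>The argument of \<open>form_tensorial\<close>, for vector fields in place of
  1-forms.\<close>

lemma field_tensorial_cong:
  fixes F :: "('m \<Rightarrow> 'm tvec) \<Rightarrow> real"
  assumes add: "\<And>X Y. VF X \<Longrightarrow> VF Y \<Longrightarrow> F (X + Y) = F X + F Y"
    and scale: "\<And>\<phi> X. \<phi> \<in> SF \<Longrightarrow> VF X \<Longrightarrow> F (vscale \<phi> X) = \<phi> p * F X"
    and "VF Y" "VF Z" "Y p = Z p"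
  shows "F Y = F Z"
proof -
  obtain \<zeta> W x X where fr: "frame_at p \<zeta> W x X" using frame_exists by metis
  note f = frame_atD[OF fr]
  have V0: "VF (0 :: 'm \<Rightarrow> 'm tvec)"
    using VF_scale[OF smooth_const[of 0] f(6)] by (simp add: vscale_def zero_fun_def)
  have F0: "F 0 = 0" using add[OF V0 V0] by simp
  have Vsum: "VF (\<Sum>i\<in>I. Y i)" if "\<And>i. VF (Y i)" for I :: "'e set" and Y
    using that by (induction I rule: infinite_finite_induct) (auto intro: VF_add V0)
  have Fsum: "F (\<Sum>i\<in>I. Y i) = (\<Sum>i\<in>I. F (Y i))" if "\<And>i. VF (Y i)" for I :: "'e set" and Y
    using that by (induction I rule: infinite_finite_induct) (auto simp: F0 add Vsum)
  have app: "(\<Sum>i\<in>I. Y i) q \<phi> = (\<Sum>i\<in>I. Y i q \<phi>)" for I :: "'e set" and Y :: "'e \<Rightarrow> 'm \<Rightarrow> 'm tvec" and q \<phi>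
    by (induction I rule: infinite_finite_induct) auto
  have "F Y = (\<Sum>b\<in>Basis. Y p (x b) * F (X b))" if Y: "VF Y" for Y
  proof -
    have eq: "vscale \<zeta> Y = (\<Sum>b\<in>Basis. vscale (\<lambda>q. Y q (x b)) (X b))"
    proof (intro ext)
      fix q \<phi> show "vscale \<zeta> Y q \<phi> = (\<Sum>b\<in>Basis. vscale (\<lambda>q. Y q (x b)) (X b)) q \<phi>"
        using f(7)[OF VF_tangent[OF Y], of q \<phi>] by (simp add: app vscale_def)
    qed
    have "F Y = F (vscale \<zeta> Y)" using scale[OF f(1) Y] f(4)[OF f(3)] by simp
    also have "\<dots> = (\<Sum>b\<in>Basis. F (vscale (\<lambda>q. Y q (x b)) (X b)))"
      unfolding eq by (rule Fsum[OF VF_scale[OF VF_smooth[OF Y f(5)] f(6)]])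
    also have "\<dots> = (\<Sum>b\<in>Basis. Y p (x b) * F (X b))"
      using scale[OF VF_smooth[OF Y f(5)] f(6)] by simp
    finally show ?thesis .
  qed
  then show ?thesis using assms by simp
qed

text \<open>Linearity over functions makes \<open>F\<close> depend only on the value of the field at
  the point, so any extension of a tangent vector to a field may be used to define the covector.
  Unique existence is the shape that the definite description in \<open>lie_derivative\<close>
  needs.\<close>

lemma form_of_functional:
  fixes F :: "('m \<Rightarrow> 'm tvec) \<Rightarrow> 'm \<Rightarrow> real"
  assumes add: "\<And>X Y p. VF X \<Longrightarrow> VF Y \<Longrightarrow> F (X + Y) p = F X p + F Y p"
    and scale: "\<And>\<phi> X p. \<phi> \<in> SF \<Longrightarrow> VF X \<Longrightarrow> F (vscale \<phi> X) p = \<phi> p * F X p"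
    and smooth: "\<And>X. VF X \<Longrightarrow> F X \<in> SF"
  shows "\<exists>!\<gamma>. FORM \<gamma> \<and> (\<forall>Y. VF Y \<longrightarrow> (\<forall>p. \<gamma> p (Y p) = F Y p))"
proof (rule ex_ex1I, rule exI)
  define ext where "ext p v = (SOME Y. VF Y \<and> Y p = v)" for p v
  define \<gamma> where "\<gamma> p v = (if v \<in> TS p then F (ext p v) p else 0)" for p v
  have ext: "VF (ext p v)" "ext p v p = v" if "v \<in> TS p" for p v
    using someI_ex[of "\<lambda>Y. VF Y \<and> Y p = v"] VF_extension[OF that] unfolding ext_def by blast+
  have ev: "\<gamma> p (Y p) = F Y p" if Y: "VF Y" for Y p
  proof -
    note e = ext[OF VF_tangent[OF Y, of p]]
    have "F (ext p (Y p)) p = F Y p"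
      by (rule field_tensorial_cong[where F = "\<lambda>Y. F Y p", OF add scale e(1) Y e(2)])
    then show ?thesis using VF_tangent[OF Y] by (simp add: \<gamma>_def)
  qed
  have "linear_form (TS p) (\<gamma> p)" for p
    unfolding linear_form_def
  proof (intro conjI ballI allI)
    fix v w assume v: "v \<in> TS p" and w: "w \<in> TS p"
    show "\<gamma> p (v + w) = \<gamma> p v + \<gamma> p w"
      using ev[OF VF_add[OF ext(1)[OF v] ext(1)[OF w]], of p] add[OF ext(1)[OF v] ext(1)[OF w], of p]
        ext(2)[OF v] ext(2)[OF w] v w by (simp add: \<gamma>_def)
  next
    fix c v assume v: "v \<in> TS p"
    show "\<gamma> p (\<lambda>x. c * v x) = c * \<gamma> p v"
      using ev[OF VF_scale[OF smooth_const ext(1)[OF v]], of p c] scale[OF smooth_const ext(1)[OF v], of c p]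
        ext(2)[OF v] v by (simp add: \<gamma>_def vscale_def)
  qed
  then have "\<gamma> p \<in> CS p" for p by (simp add: cotangent_space_def \<gamma>_def)
  moreover have "(\<lambda>p. \<gamma> p (Y p)) \<in> SF" if "VF Y" for Y using ev[OF that] smooth[OF that] by simp
  ultimately have "FORM \<gamma>" by (simp add: one_form_def)
  then show "FORM \<gamma> \<and> (\<forall>Y. VF Y \<longrightarrow> (\<forall>p. \<gamma> p (Y p) = F Y p))" using ev by blast
next
  fix \<gamma> \<gamma>' assume "FORM \<gamma> \<and> (\<forall>Y. VF Y \<longrightarrow> (\<forall>p. \<gamma> p (Y p) = F Y p))"
    "FORM \<gamma>' \<and> (\<forall>Y. VF Y \<longrightarrow> (\<forall>p. \<gamma>' p (Y p) = F Y p))"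
  then show "\<gamma> = \<gamma>'" by (intro FORM_eqI) auto
qed

section \<open>Lie brackets and Lie derivatives\<close>

lemma lie_bracket_eval:
  "\<phi> \<in> SF \<Longrightarrow> lie_bracket A X Y p \<phi> = X p (\<lambda>q. Y q \<phi>) - Y p (\<lambda>q. X q \<phi>)"
  by (simp add: lie_bracket_def)

lemma field_mult:
  assumes "VF X" "\<phi> \<in> SF" "\<psi> \<in> SF"
  shows "X p (\<lambda>x. \<phi> x * \<psi> x) = \<phi> p * X p \<psi> + \<psi> p * X p \<phi>"
  using tangentD(3)[OF VF_tangent[OF assms(1)]] assms by simp

lemma field_add: "VF X \<Longrightarrow> \<phi> \<in> SF \<Longrightarrow> \<psi> \<in> SF \<Longrightarrow> X p (\<lambda>x. \<phi> x + \<psi> x) = X p \<phi> + X p \<psi>"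
  and field_diff: "VF X \<Longrightarrow> \<phi> \<in> SF \<Longrightarrow> \<psi> \<in> SF \<Longrightarrow> X p (\<lambda>x. \<phi> x - \<psi> x) = X p \<phi> - X p \<psi>"
  using tangentD(4,5)[OF VF_tangent] by blast+

lemma field_uminus: "VF X \<Longrightarrow> \<phi> \<in> SF \<Longrightarrow> X p (\<lambda>x. - \<phi> x) = - X p \<phi>"
  using linear_form_scale[OF tangentD(1)[OF VF_tangent], of X \<phi> p "-1"] by simp

lemma field_const: "VF X \<Longrightarrow> X p (\<lambda>_. c) = 0"
  using tangent_const[OF VF_tangent] by blast

lemma lie_bracket_VF:
  assumes X: "VF X" and Y: "VF Y" shows "VF (lie_bracket A X Y)"
proof -
  note s = VF_smooth[OF X] VF_smooth[OF Y]
  have "lie_bracket A X Y p \<in> TS p" for p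
    unfolding tangent_space_def linear_form_def mem_Collect_eq
  proof (intro conjI ballI allI impI)
    fix \<phi> \<psi> assume a: "\<phi> \<in> SF" "\<psi> \<in> SF"
    have plus: "\<phi> + \<psi> = (\<lambda>x. \<phi> x + \<psi> x)" by auto
    show "lie_bracket A X Y p (\<phi> + \<psi>) = lie_bracket A X Y p \<phi> + lie_bracket A X Y p \<psi>"
      unfolding plus using a s
      by (simp add: lie_bracket_eval smooth_add field_add[OF X] field_add[OF Y])
    show "lie_bracket A X Y p (\<lambda>x. \<phi> x * \<psi> x) = \<phi> p * lie_bracket A X Y p \<psi> + \<psi> p * lie_bracket A X Y p \<phi>"
      using a s
      by (simp add: lie_bracket_eval smooth_mult smooth_add field_add[OF X] field_add[OF Y] field_mult[OF X]
          field_mult[OF Y] algebra_simps)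
  next
    fix c \<phi> assume a: "\<phi> \<in> SF"
    then show "lie_bracket A X Y p (\<lambda>x. c * \<phi> x) = c * lie_bracket A X Y p \<phi>"
      using s by (simp add: lie_bracket_eval smooth_mult field_mult[OF X] field_mult[OF Y] field_const[OF X]
          field_const[OF Y] algebra_simps)
  qed (simp add: lie_bracket_def)
  moreover have "(\<lambda>p. lie_bracket A X Y p \<phi>) \<in> SF" if "\<phi> \<in> SF" for \<phi>
    using that s by (simp add: lie_bracket_eval smooth_diff)
  ultimately show ?thesis by (simp add: vector_field_def)
qed

lemma lie_bracket_scale_right:
  assumes X: "VF X" and Y: "VF Y" and \<phi>: "\<phi> \<in> SF"
  shows "lie_bracket A X (vscale \<phi> Y) p = (\<lambda>\<psi>. \<phi> p * lie_bracket A X Y p \<psi>) + (\<lambda>\<psi>. X p \<phi> * Y p \<psi>)"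
proof
  fix \<psi>
  show "lie_bracket A X (vscale \<phi> Y) p \<psi> = ((\<lambda>\<psi>. \<phi> p * lie_bracket A X Y p \<psi>) + (\<lambda>\<psi>. X p \<phi> * Y p \<psi>)) \<psi>"
    using tangentD(2)[OF VF_tangent[OF Y], of \<psi>]
    by (cases "\<psi> \<in> SF")
      (simp_all add: lie_bracket_def vscale_def field_mult[OF X \<phi> VF_smooth[OF Y]] algebra_simps)
qed

lemma lie_bracket_antisym: "lie_bracket A X Y p = - lie_bracket A Y X p"
  by (auto simp: lie_bracket_def fun_eq_iff)

lemma lie_bracket_scale_left:
  assumes X: "VF X" and Y: "VF Y" and \<phi>: "\<phi> \<in> SF"
  shows "lie_bracket A (vscale \<phi> X) Y p = (\<lambda>\<psi>. \<phi> p * lie_bracket A X Y p \<psi>) - (\<lambda>\<psi>. Y p \<phi> * X p \<psi>)"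
  unfolding lie_bracket_antisym[of "vscale \<phi> X" Y] lie_bracket_scale_right[OF Y X \<phi>]
  by (auto simp: lie_bracket_def fun_eq_iff algebra_simps)

lemma lie_bracket_add_right:
  assumes X: "VF X" and Y: "VF Y" and Z: "VF Z"
  shows "lie_bracket A X (Y + Z) p = lie_bracket A X Y p + lie_bracket A X Z p"
  by (auto simp: lie_bracket_def fun_eq_iff field_add[OF X VF_smooth[OF Y] VF_smooth[OF Z]])

lemma lie_bracket_add_left:
  assumes X: "VF X" and Y: "VF Y" and Z: "VF Z"
  shows "lie_bracket A (X + Y) Z p = lie_bracket A X Z p + lie_bracket A Y Z p"
  by (auto simp: lie_bracket_def fun_eq_iff field_add[OF Z VF_smooth[OF X] VF_smooth[OF Y]])

text \<open>Replacing Y by \<phi> Y produces the same term X(\<phi>) \<beta>(Y) in X(\<beta>(Y)) and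
  in \<beta>([X, Y]), so their difference is linear over functions in Y.\<close>

lemma lie_derivative_spec:
  assumes X: "VF X" and \<beta>: "FORM \<beta>"
  shows "FORM (lie_derivative A X \<beta>)"
    "VF Y \<Longrightarrow> lie_derivative A X \<beta> p (Y p) = X p (\<lambda>q. \<beta> q (Y q)) - \<beta> p (lie_bracket A X Y p)"
proof -
  define F where "F Y p = X p (\<lambda>q. \<beta> q (Y q)) - \<beta> p (lie_bracket A X Y p)" for Y p
  have "\<exists>!\<gamma>. FORM \<gamma> \<and> (\<forall>Y. VF Y \<longrightarrow> (\<forall>p. \<gamma> p (Y p) = F Y p))"
  proof (rule form_of_functional)
    fix Y Z p assume YZ: "VF Y" "VF Z"
    have "(\<lambda>q. \<beta> q ((Y + Z) q)) = (\<lambda>q. \<beta> q (Y q) + \<beta> q (Z q))"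
      using FORM_tangent_add[OF \<beta> VF_tangent[OF YZ(1)] VF_tangent[OF YZ(2)]] by simp
    then show "F (Y + Z) p = F Y p + F Z p"
      using lie_bracket_add_right[OF X YZ] FORM_smooth[OF \<beta>] YZ
      by (simp add: F_def field_add[OF X] FORM_tangent_add[OF \<beta>] VF_tangent lie_bracket_VF X)
  next
    fix \<phi> Y p assume \<phi>: "\<phi> \<in> SF" and Y: "VF Y"
    note b = VF_tangent[OF lie_bracket_VF[OF X Y]] VF_tangent[OF Y]
    have "(\<lambda>q. \<beta> q (vscale \<phi> Y q)) = (\<lambda>q. \<phi> q * \<beta> q (Y q))"
      using FORM_tangent_scale[OF \<beta> VF_tangent[OF Y]] by (simp add: vscale_def)
    moreover have "\<beta> p (lie_bracket A X (vscale \<phi> Y) p) = \<phi> p * \<beta> p (lie_bracket A X Y p) + X p \<phi> * \<beta> p (Y p)"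
      unfolding lie_bracket_scale_right[OF X Y \<phi>]
      using FORM_tangent_add[OF \<beta> fsubspace_scale[OF fsubspace_tangent b(1)] fsubspace_scale[OF fsubspace_tangent b(2)]]
        FORM_tangent_scale[OF \<beta> b(1)] FORM_tangent_scale[OF \<beta> b(2)] by simp
    ultimately show "F (vscale \<phi> Y) p = \<phi> p * F Y p"
      using field_mult[OF X \<phi> FORM_smooth[OF \<beta> Y]] by (simp add: F_def algebra_simps)
  next
    fix Y assume Y: "VF Y"
    show "F Y \<in> SF"
      unfolding F_def
      by (rule smooth_diff[OF VF_smooth[OF X FORM_smooth[OF \<beta> Y]] FORM_smooth[OF \<beta> lie_bracket_VF[OF X Y]]])
  qed
  from theI'[OF this]
  have "FORM (lie_derivative A X \<beta>) \<and> (\<forall>Y. VF Y \<longrightarrow> (\<forall>p. lie_derivative A X \<beta> p (Y p) = F Y p))"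
    unfolding lie_derivative_def F_def .
  then show "FORM (lie_derivative A X \<beta>)"
    "VF Y \<Longrightarrow> lie_derivative A X \<beta> p (Y p) = X p (\<lambda>q. \<beta> q (Y q)) - \<beta> p (lie_bracket A X Y p)"
    by (auto simp: F_def)
qed

text \<open>Reflexivity of the finite-dimensional tangent space: the vector is built from the values
  of \<open>L\<close> on the coordinate differentials. It makes the definite description in
  \<open>anchor\<close> well defined.\<close>

lemma bidual:
  assumes L: "linear_form (CS p) L"
  shows "\<exists>!v. v \<in> TS p \<and> (\<forall>b\<in>CS p. b v = L b)"
proof -
  obtain \<zeta> W x X where fr: "frame_at p \<zeta> W x X" using frame_exists by metis
  note f = frame_atD[OF fr]
  let ?v = "\<lambda>\<phi>. \<Sum>b\<in>Basis. L (d (x b) p) * X b p \<phi>"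
  have v: "?v \<in> TS p" by (rule fsubspace_sum[OF fsubspace_tangent]) (rule VF_tangent[OF f(6)])
  have ev: "b ?v = L b" if b: "b \<in> CS p" for b
  proof -
    have "b ?v = (\<Sum>c\<in>Basis. L (d (x c) p) * b (X c p))"
      by (rule linear_form_sum[OF fsubspace_tangent cotangentD(1)[OF b]]) (rule VF_tangent[OF f(6)])
    also have "\<dots> = L (\<lambda>v. \<Sum>c\<in>Basis. b (X c p) * d (x c) p v)"
      by (subst linear_form_sum[OF fsubspace_cotangent L]) (simp_all add: differential_cotangent mult.commute)
    also have "\<dots> = L b" by (rule arg_cong[OF covector_frame[OF fr f(3) b, symmetric]])
    finally show ?thesis .
  qed
  show ?thesis
  proof
    show "?v \<in> TS p \<and> (\<forall>b\<in>CS p. b ?v = L b)" using v ev by blast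
    fix w assume w: "w \<in> TS p \<and> (\<forall>b\<in>CS p. b w = L b)"
    have "w \<phi> = ?v \<phi>" if "\<phi> \<in> SF" for \<phi>
      using ev[OF differential_cotangent[of \<phi>]] w differential_cotangent[of \<phi> p] differential_eval[of w p \<phi>]
        differential_eval[OF v] by simp
    then show "w = ?v" using tangentD(2) w v by (metis (no_types, lifting) ext)
  qed
qed

end

section \<open>Bivector fields and the Koszul bracket\<close>

locale bivector_manifold = manifold A
  for A :: "('m::{t2_space, second_countable_topology}, 'e::euclidean_space) atlas" +
  fixes P :: "'m \<Rightarrow> 'm covec \<Rightarrow> 'm covec \<Rightarrow> real"
  assumes bivector: "bivector_field A P"
begin

abbreviation "sh \<equiv> anchor A P"
abbreviation "kb \<equiv> koszul_bracket A P"

lemma P_bilinear: "bilinear_form (CS p) (P p)"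
  and P_self: "a \<in> CS p \<Longrightarrow> P p a a = 0"
  and P_smooth: "FORM \<alpha> \<Longrightarrow> FORM \<beta> \<Longrightarrow> (\<lambda>p. P p (\<alpha> p) (\<beta> p)) \<in> SF"
  using bivector by (auto simp: bivector_field_def)

lemma P_add_left: "a \<in> CS p \<Longrightarrow> b \<in> CS p \<Longrightarrow> c \<in> CS p \<Longrightarrow> P p (a + b) c = P p a c + P p b c"
  by (rule linear_form_add[OF bilinear_form_left[OF P_bilinear]])

lemma P_add_right: "a \<in> CS p \<Longrightarrow> b \<in> CS p \<Longrightarrow> c \<in> CS p \<Longrightarrow> P p c (a + b) = P p c a + P p c b"
  by (rule linear_form_add[OF bilinear_form_right[OF P_bilinear]])

lemma P_scale_left: "a \<in> CS p \<Longrightarrow> c \<in> CS p \<Longrightarrow> P p (\<lambda>v. r * a v) c = r * P p a c"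
  by (rule linear_form_scale[OF bilinear_form_left[OF P_bilinear]])

lemma P_scale_right: "a \<in> CS p \<Longrightarrow> c \<in> CS p \<Longrightarrow> P p c (\<lambda>v. r * a v) = r * P p c a"
  by (rule linear_form_scale[OF bilinear_form_right[OF P_bilinear]])

lemma P_antisym: 
  assumes "a \<in> CS p" "b \<in> CS p" shows "P p a b = - P p b a"
proof -
  note ab = fsubspace_add[OF fsubspace_cotangent assms]
  show ?thesis
    using P_self[OF ab] P_add_left[OF assms ab] P_add_right[OF assms assms(1)] P_add_right[OF assms assms(2)]
      P_self[OF assms(1)] P_self[OF assms(2)] by linarith
qed

lemma anchor_spec:
  assumes "FORM \<alpha>"
  shows "sh \<alpha> p \<in> TS p" "b \<in> CS p \<Longrightarrow> b (sh \<alpha> p) = P p (\<alpha> p) b"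
proof -
  have "sh \<alpha> p \<in> TS p \<and> (\<forall>b\<in>CS p. b (sh \<alpha> p) = P p (\<alpha> p) b)"
    unfolding anchor_def by (rule theI'[OF bidual[OF bilinear_form_right[OF P_bilinear FORM_cotangent[OF assms]]]])
  then show "sh \<alpha> p \<in> TS p" "b \<in> CS p \<Longrightarrow> b (sh \<alpha> p) = P p (\<alpha> p) b" by blast+
qed

lemma anchor_eval: "FORM \<alpha> \<Longrightarrow> \<phi> \<in> SF \<Longrightarrow> sh \<alpha> p \<phi> = P p (\<alpha> p) (d \<phi> p)"
  using anchor_spec(2)[OF _ differential_cotangent[of \<phi> p], of \<alpha>] anchor_spec(1)[of \<alpha> p]
  by (simp add: differential_eval)

lemma anchor_nonsmooth: "FORM \<alpha> \<Longrightarrow> \<phi> \<notin> SF \<Longrightarrow> sh \<alpha> p \<phi> = 0"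
  using tangentD(2)[OF anchor_spec(1)] by blast

lemma FORM_anchor: "FORM \<alpha> \<Longrightarrow> FORM \<beta> \<Longrightarrow> \<beta> p (sh \<alpha> p) = P p (\<alpha> p) (\<beta> p)"
  using anchor_spec(2)[OF _ FORM_cotangent] by blast

lemma anchor_VF: "FORM \<alpha> \<Longrightarrow> VF (sh \<alpha>)"
  by (simp add: vector_field_def anchor_spec(1) anchor_eval P_smooth FORM_differential)

lemma anchor_scale: 
  assumes "\<phi> \<in> SF" "FORM \<alpha>" shows "sh (fscale \<phi> \<alpha>) = vscale \<phi> (sh \<alpha>)"
proof (intro ext)
  fix p \<psi> show "sh (fscale \<phi> \<alpha>) p \<psi> = vscale \<phi> (sh \<alpha>) p \<psi>"
    using assms FORM_scale[OF assms] P_scale_left[OF FORM_cotangent[OF assms(2)] differential_cotangent]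
    by (cases "\<psi> \<in> SF") (simp_all add: vscale_def anchor_eval anchor_nonsmooth fscale_def)
qed

lemma anchor_add: 
  assumes "FORM \<alpha>" "FORM \<beta>" shows "sh (\<alpha> + \<beta>) = sh \<alpha> + sh \<beta>"
proof (intro ext)
  fix p \<psi> show "sh (\<alpha> + \<beta>) p \<psi> = (sh \<alpha> + sh \<beta>) p \<psi>"
    using assms FORM_add[OF assms] P_add_left[OF FORM_cotangent[OF assms(1)] FORM_cotangent[OF assms(2)]
        differential_cotangent]
    by (cases "\<psi> \<in> SF") (simp_all add: anchor_eval anchor_nonsmooth)
qed

lemma koszul_FORM: "FORM \<alpha> \<Longrightarrow> FORM \<beta> \<Longrightarrow> FORM (kb \<alpha> \<beta>)"
  unfolding koszul_bracket_def
  by (rule FORM_diff[OF FORM_diff[OF lie_derivative_spec(1) lie_derivative_spec(1)] FORM_differential[OF P_smooth]])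
    (simp_all add: anchor_VF)

lemma koszul_eval:
  assumes "FORM \<alpha>" "FORM \<beta>" "VF Y"
  shows "kb \<alpha> \<beta> p (Y p) = sh \<alpha> p (\<lambda>q. \<beta> q (Y q)) - \<beta> p (lie_bracket A (sh \<alpha>) Y p)
    - (sh \<beta> p (\<lambda>q. \<alpha> q (Y q)) - \<alpha> p (lie_bracket A (sh \<beta>) Y p)) - Y p (\<lambda>q. P q (\<alpha> q) (\<beta> q))"
  using assms by (simp add: koszul_bracket_def lie_derivative_spec anchor_VF differential_VF)

lemma koszul_antisym:
  assumes a: "FORM \<alpha>" and b: "FORM \<beta>" shows "kb \<alpha> \<beta> = - kb \<beta> \<alpha>"
proof (rule FORM_eqI[OF koszul_FORM[OF a b]])
  show "FORM (- kb \<beta> \<alpha>)" using FORM_diff[OF FORM_0 koszul_FORM[OF b a]] by simp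
  fix Y p assume Y: "VF Y"
  have "(\<lambda>q. P q (\<beta> q) (\<alpha> q)) = (\<lambda>q. - P q (\<alpha> q) (\<beta> q))"
    using P_antisym FORM_cotangent a b by blast
  then show "kb \<alpha> \<beta> p (Y p) = (- kb \<beta> \<alpha>) p (Y p)"
    using field_uminus[OF Y P_smooth[OF a b]] by (simp add: koszul_eval a b Y)
qed

lemma koszul_add_right:
  assumes a: "FORM \<alpha>" and b: "FORM \<beta>" and c: "FORM \<gamma>" shows "kb \<alpha> (\<beta> + \<gamma>) = kb \<alpha> \<beta> + kb \<alpha> \<gamma>"
proof (rule FORM_eqI)
  fix Y p assume Y: "VF Y"
  have 1: "(\<lambda>q. P q (\<alpha> q) ((\<beta> + \<gamma>) q)) = (\<lambda>q. P q (\<alpha> q) (\<beta> q) + P q (\<alpha> q) (\<gamma> q))"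
    using P_add_right FORM_cotangent a b c by simp
  have 2: "(\<lambda>q. (\<beta> + \<gamma>) q (Y q)) = (\<lambda>q. \<beta> q (Y q) + \<gamma> q (Y q))" by simp
  have 3: "sh \<alpha> p (\<lambda>q. (\<beta> + \<gamma>) q (Y q)) = sh \<alpha> p (\<lambda>q. \<beta> q (Y q)) + sh \<alpha> p (\<lambda>q. \<gamma> q (Y q))"
    unfolding 2 by (rule field_add[OF anchor_VF[OF a] FORM_smooth[OF b Y] FORM_smooth[OF c Y]])
  have 4: "\<alpha> p (lie_bracket A (sh (\<beta> + \<gamma>)) Y p) = \<alpha> p (lie_bracket A (sh \<beta>) Y p) + \<alpha> p (lie_bracket A (sh \<gamma>) Y p)"
    unfolding anchor_add[OF b c] lie_bracket_add_left[OF anchor_VF[OF b] anchor_VF[OF c] Y]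
    by (intro FORM_tangent_add a VF_tangent lie_bracket_VF anchor_VF b c Y)
  show "kb \<alpha> (\<beta> + \<gamma>) p (Y p) = (kb \<alpha> \<beta> + kb \<alpha> \<gamma>) p (Y p)"
    using koszul_eval[OF a FORM_add[OF b c] Y, of p] 3 4 field_add[OF Y P_smooth[OF a b] P_smooth[OF a c], of p]
    unfolding 1 by (simp add: koszul_eval a b c Y anchor_add)
qed (rule koszul_FORM[OF a FORM_add[OF b c]] FORM_add[OF koszul_FORM[OF a b] koszul_FORM[OF a c]])+

lemma koszul_add_left:
  assumes a: "FORM \<alpha>" and b: "FORM \<beta>" and c: "FORM \<gamma>" shows "kb (\<alpha> + \<beta>) \<gamma> = kb \<alpha> \<gamma> + kb \<beta> \<gamma>"
  using koszul_add_right[OF c a b] koszul_antisym[OF FORM_add[OF a b] c] koszul_antisym[OF a c]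
    koszul_antisym[OF b c] by simp

text \<open>The term with Y(\<phi>) that comes from the Lie derivative along the anchor of \<phi>
  \<beta> cancels the one from the differential, because \<open>P\<close> is antisymmetric. Only the
  derivative of \<open>\<phi>\<close> along \<open>sh \<alpha>\<close> survives.\<close>

lemma koszul_scale_right:
  assumes a: "FORM \<alpha>" and b: "FORM \<beta>" and f: "\<phi> \<in> SF"
  shows "kb \<alpha> (fscale \<phi> \<beta>) = fscale \<phi> (kb \<alpha> \<beta>) + fscale (\<lambda>p. sh \<alpha> p \<phi>) \<beta>"
proof (rule FORM_eqI)
  fix Y p assume Y: "VF Y"
  have 1: "(\<lambda>q. P q (\<alpha> q) (fscale \<phi> \<beta> q)) = (\<lambda>q. \<phi> q * P q (\<alpha> q) (\<beta> q))"
    using P_scale_right FORM_cotangent a b by (simp add: fscale_def)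
  have 2: "(\<lambda>q. fscale \<phi> \<beta> q (Y q)) = (\<lambda>q. \<phi> q * \<beta> q (Y q))" by (simp add: fscale_def)
  have 3: "sh \<alpha> p (\<lambda>q. fscale \<phi> \<beta> q (Y q)) = \<phi> p * sh \<alpha> p (\<lambda>q. \<beta> q (Y q)) + \<beta> p (Y p) * sh \<alpha> p \<phi>"
    unfolding 2 by (rule field_mult[OF anchor_VF[OF a] f FORM_smooth[OF b Y]])
  note t = VF_tangent[OF lie_bracket_VF[OF anchor_VF[OF b] Y]] VF_tangent[OF anchor_VF[OF b]]
  have "\<alpha> p (lie_bracket A (sh (fscale \<phi> \<beta>)) Y p) = \<alpha> p (\<lambda>\<psi>. \<phi> p * lie_bracket A (sh \<beta>) Y p \<psi>) - \<alpha> p (\<lambda>\<psi>. Y p \<phi> * sh \<beta> p \<psi>)"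
    unfolding anchor_scale[OF f b] lie_bracket_scale_left[OF anchor_VF[OF b] Y f]
    by (intro FORM_tangent_diff a fsubspace_scale[OF fsubspace_tangent] t)
  then have 4: "\<alpha> p (lie_bracket A (sh (fscale \<phi> \<beta>)) Y p) = \<phi> p * \<alpha> p (lie_bracket A (sh \<beta>) Y p) - Y p \<phi> * P p (\<beta> p) (\<alpha> p)"
    by (simp add: FORM_tangent_scale[OF a] t FORM_anchor a b)
  have 5: "P p (\<beta> p) (\<alpha> p) = - P p (\<alpha> p) (\<beta> p)" by (intro P_antisym FORM_cotangent a b)
  have 6: "sh (fscale \<phi> \<beta>) p \<psi> = \<phi> p * sh \<beta> p \<psi>" for \<psi>
    unfolding anchor_scale[OF f b] by (simp add: vscale_def)
  have 7: "fscale \<phi> \<beta> p v = \<phi> p * \<beta> p v" for v by (simp add: fscale_def)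
  show "kb \<alpha> (fscale \<phi> \<beta>) p (Y p) = (fscale \<phi> (kb \<alpha> \<beta>) + fscale (\<lambda>p. sh \<alpha> p \<phi>) \<beta>) p (Y p)"
    unfolding koszul_eval[OF a FORM_scale[OF f b] Y] 1 3 4 field_mult[OF Y f P_smooth[OF a b]] 5 6 7
    by (simp add: fscale_def koszul_eval a b Y algebra_simps)
qed (rule koszul_FORM[OF a FORM_scale[OF f b]]
  FORM_add[OF FORM_scale[OF f koszul_FORM[OF a b]] FORM_scale[OF VF_smooth[OF anchor_VF[OF a] f] b]])+

lemma koszul_scale_left:
  assumes a: "FORM \<alpha>" and b: "FORM \<beta>" and f: "\<phi> \<in> SF"
  shows "kb (fscale \<phi> \<alpha>) \<beta> = fscale \<phi> (kb \<alpha> \<beta>) - fscale (\<lambda>p. sh \<beta> p \<phi>) \<alpha>"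
  unfolding koszul_antisym[OF FORM_scale[OF f a] b] koszul_scale_right[OF b a f] koszul_antisym[OF a b]
  by (auto simp: fscale_def fun_eq_iff)

text \<open>Each of the two Lie derivative terms contributes one copy of the right-hand side, and
  the last term of the bracket removes one.\<close>

lemma koszul_exact:
  assumes f: "\<phi> \<in> SF" and g: "\<psi> \<in> SF"
  shows "kb (d \<phi>) (d \<psi>) = d (\<lambda>p. P p (d \<phi> p) (d \<psi> p))"
proof (rule FORM_eqI)
  note fd = FORM_differential[OF f] FORM_differential[OF g]
  fix Y p assume Y: "VF Y"
  have br: "d \<psi> p (lie_bracket A (sh (d \<phi>)) Y p) = sh (d \<phi>) p (\<lambda>q. Y q \<psi>) - Y p (\<lambda>q. P q (d \<phi> q) (d \<psi> q))"
    if "\<phi> \<in> SF" "\<psi> \<in> SF" for \<phi> \<psi>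
    using that Y by (simp add: differential_VF lie_bracket_VF anchor_VF FORM_differential lie_bracket_eval anchor_eval)
  have "(\<lambda>q. P q (d \<psi> q) (d \<phi> q)) = (\<lambda>q. - P q (d \<phi> q) (d \<psi> q))"
    using P_antisym differential_cotangent by blast
  then have "Y p (\<lambda>q. P q (d \<psi> q) (d \<phi> q)) = - Y p (\<lambda>q. P q (d \<phi> q) (d \<psi> q))"
    using field_uminus[OF Y P_smooth[OF fd]] by simp
  then show "kb (d \<phi>) (d \<psi>) p (Y p) = d (\<lambda>p. P p (d \<phi> p) (d \<psi> p)) p (Y p)"
    unfolding koszul_eval[OF fd Y] br[OF f g] br[OF g f] by (simp add: differential_VF Y)
qed (rule koszul_FORM[OF FORM_differential[OF f] FORM_differential[OF g]]
  FORM_differential[OF P_smooth[OF FORM_differential[OF f] FORM_differential[OF g]]])+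

end

section \<open>Orthonormal bases\<close>

text \<open>The coordinates \<open>co\<close> bound the dimension of \<open>V\<close> from above. An
  orthonormal family of DIM('e) vectors is independent, so the linear map \<open>L\<close> of the
  Euclidean space into itself that it induces is injective, hence surjective. The abstract form
  serves tangent and cotangent spaces alike.\<close>

lemma orthonormal_expansion:
  fixes u :: "'e::euclidean_space \<Rightarrow> 'x \<Rightarrow> real" and e :: "nat \<Rightarrow> 'x \<Rightarrow> real"
  assumes V: "fsubspace V" and B: "bilinear_form V B"
    and co: "\<And>b. b \<in> Basis \<Longrightarrow> linear_form V (co b)"
    and expand: "\<And>v. v \<in> V \<Longrightarrow> v = (\<lambda>t. \<Sum>b\<in>Basis. co b v * u b t)"
    and e: "\<And>i. i \<in> {1..DIM('e)} \<Longrightarrow> e i \<in> V"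
    and orth: "\<And>i j. i \<in> {1..DIM('e)} \<Longrightarrow> j \<in> {1..DIM('e)} \<Longrightarrow>
      B (e i) (e j) = (if i = j then \<epsilon> i else 0)"
    and eps: "\<And>i. i \<in> {1..DIM('e)} \<Longrightarrow> \<bar>\<epsilon> i\<bar> = (1::real)"
    and v: "v \<in> V"
  shows "v = (\<lambda>t. \<Sum>i\<in>{1..DIM('e)}. \<epsilon> i * B v (e i) * e i t)"
proof -
  obtain h where h: "bij_betw h {1..DIM('e)} (Basis::'e set)"
    using ex_bij_betw_nat_finite_1[OF finite_Basis] by blast
  define \<Psi> where "\<Psi> v = (\<Sum>b\<in>Basis. co b v *\<^sub>R (b::'e))" for v
  have inj\<Psi>: "v = w" if "v \<in> V" "w \<in> V" "\<Psi> v = \<Psi> w" for v w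
  proof -
    have eq: "co b v = co b w" if b: "b \<in> Basis" for b
      using arg_cong[OF \<open>\<Psi> v = \<Psi> w\<close>, of "\<lambda>x. x \<bullet> b"] b by (simp add: \<Psi>_def inner_sum_left_Basis)
    have "v = (\<lambda>t. \<Sum>b\<in>Basis. co b v * u b t)" by (rule expand[OF that(1)])
    also have "\<dots> = (\<lambda>t. \<Sum>b\<in>Basis. co b w * u b t)" using eq by (intro ext sum.cong) auto
    also have "\<dots> = w" by (rule expand[OF that(2), symmetric])
    finally show ?thesis .
  qed
  define w where "w x = (\<lambda>t. \<Sum>i\<in>{1..DIM('e)}. (x \<bullet> h i) * e i t)" for x
  have wV: "w x \<in> V" for x unfolding w_def by (rule fsubspace_sum[OF V e])
  have wB: "B (w x) (e j) = (x \<bullet> h j) * \<epsilon> j" if j: "j \<in> {1..DIM('e)}" for x j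
  proof -
    have "B (w x) (e j) = (\<Sum>i\<in>{1..DIM('e)}. (x \<bullet> h i) * B (e i) (e j))"
      unfolding w_def by (rule linear_form_sum[OF V bilinear_form_left[OF B e[OF j]] e])
    also have "\<dots> = (\<Sum>i\<in>{1..DIM('e)}. if i = j then (x \<bullet> h j) * \<epsilon> j else 0)"
      using orth j by (intro sum.cong) auto
    finally show ?thesis using j by simp
  qed
  define L where "L x = (\<Sum>i\<in>{1..DIM('e)}. (x \<bullet> h i) *\<^sub>R \<Psi> (e i))" for x
  have L: "\<Psi> (w x) = L x" for x
  proof -
    have "co b (w x) = (\<Sum>i\<in>{1..DIM('e)}. (x \<bullet> h i) * co b (e i))" if "b \<in> Basis" for b
      unfolding w_def by (rule linear_form_sum[OF V co[OF that] e])
    then have "\<Psi> (w x) = (\<Sum>b\<in>Basis. (\<Sum>i\<in>{1..DIM('e)}. (x \<bullet> h i) * co b (e i)) *\<^sub>R b)"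
      unfolding \<Psi>_def by simp
    also have "\<dots> = (\<Sum>b\<in>Basis. \<Sum>i\<in>{1..DIM('e)}. ((x \<bullet> h i) * co b (e i)) *\<^sub>R b)"
      by (simp add: scaleR_sum_left)
    also have "\<dots> = L x"
      unfolding L_def \<Psi>_def by (subst sum.swap) (simp add: scaleR_sum_right)
    finally show ?thesis .
  qed
  have "linear L"
    unfolding L_def by (rule linearI) (simp_all add: inner_add_left scaleR_add_left sum.distrib scaleR_sum_right)
  moreover have "inj L"
  proof (rule injI)
    fix x y assume "L x = L y"
    then have eq: "w x = w y" using L wV inj\<Psi> by metis
    show "x = y"
    proof (rule euclidean_eqI)
      fix b :: 'e assume "b \<in> Basis"
      then have "b \<in> h ` {1..DIM('e)}" using h by (simp only: bij_betw_def)
      then obtain j where j: "j \<in> {1..DIM('e)}" "b = h j" by blast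
      then show "x \<bullet> b = y \<bullet> b" using wB[OF j(1), of x] wB[OF j(1), of y] eps[OF j(1)] eq by auto
    qed
  qed
  ultimately have "surj L" by (rule linear_inj_imp_surj)
  then obtain x where "\<Psi> v = L x" by (metis surjD)
  then have vx: "v = w x" using inj\<Psi>[OF v wV] L by metis
  have "\<epsilon> i * B v (e i) = x \<bullet> h i" if "i \<in> {1..DIM('e)}" for i
  proof -
    have "\<epsilon> i * \<epsilon> i = 1" using eps[OF that] by (metis abs_mult_self_eq mult_1)
    then show ?thesis using wB[OF that, of x] vx by (simp add: mult.left_commute)
  qed
  then have "w x = (\<lambda>t. \<Sum>i\<in>{1..DIM('e)}. \<epsilon> i * B v (e i) * e i t)"
    unfolding w_def by (intro ext sum.cong) auto
  from vx this show ?thesis by (rule trans)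
qed

section \<open>The Levi-Civita contravariant connection\<close>

text \<open>Existence of frames is an assumption because it has two sources: the cometric of a
  pseudo-Riemannian metric on the factors, and product frames for the warped metric.\<close>

locale metric_manifold = bivector_manifold A P
  for A :: "('m::{t2_space, second_countable_topology}, 'e::euclidean_space) atlas"
    and P :: "'m \<Rightarrow> 'm covec \<Rightarrow> 'm covec \<Rightarrow> real" +
  fixes g :: "'m \<Rightarrow> 'm covec \<Rightarrow> 'm covec \<Rightarrow> real"
  assumes metric: "contravariant_metric A g"
    and orthonormal_frame: "\<exists>e. orthonormal_frame_at A g p e"
begin

definition G :: "'m form \<Rightarrow> 'm form \<Rightarrow> 'm \<Rightarrow> real" where
  "G \<alpha> \<beta> p = g p (\<alpha> p) (\<beta> p)"

lemma g_bilinear: "bilinear_form (CS p) (g p)"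
  and g_sym: "a \<in> CS p \<Longrightarrow> b \<in> CS p \<Longrightarrow> g p a b = g p b a"
  and g_nondegenerate: "a \<in> CS p \<Longrightarrow> (\<And>b. b \<in> CS p \<Longrightarrow> g p a b = 0) \<Longrightarrow> a = 0"
  and G_smooth: "FORM \<alpha> \<Longrightarrow> FORM \<beta> \<Longrightarrow> G \<alpha> \<beta> \<in> SF"
  using metric by (auto simp: contravariant_metric_def G_def[abs_def])

lemma g_add_left: "a \<in> CS p \<Longrightarrow> b \<in> CS p \<Longrightarrow> c \<in> CS p \<Longrightarrow> g p (a + b) c = g p a c + g p b c"
  by (rule linear_form_add[OF bilinear_form_left[OF g_bilinear]])

lemma g_diff_left: "a \<in> CS p \<Longrightarrow> b \<in> CS p \<Longrightarrow> c \<in> CS p \<Longrightarrow> g p (a - b) c = g p a c - g p b c"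
  by (rule linear_form_diff[OF fsubspace_cotangent bilinear_form_left[OF g_bilinear]])

lemma g_scale_left: "a \<in> CS p \<Longrightarrow> c \<in> CS p \<Longrightarrow> g p (\<lambda>v. r * a v) c = r * g p a c"
  by (rule linear_form_scale[OF bilinear_form_left[OF g_bilinear]])

lemma G_sym: "FORM \<alpha> \<Longrightarrow> FORM \<beta> \<Longrightarrow> G \<alpha> \<beta> = G \<beta> \<alpha>"
  by (auto simp: fun_eq_iff G_def g_sym FORM_cotangent)

lemma G_add_left: "FORM \<alpha> \<Longrightarrow> FORM \<beta> \<Longrightarrow> FORM \<gamma> \<Longrightarrow> G (\<alpha> + \<beta>) \<gamma> = (\<lambda>p. G \<alpha> \<gamma> p + G \<beta> \<gamma> p)"
  by (simp add: fun_eq_iff G_def g_add_left FORM_cotangent)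

lemma G_diff_left: "FORM \<alpha> \<Longrightarrow> FORM \<beta> \<Longrightarrow> FORM \<gamma> \<Longrightarrow> G (\<alpha> - \<beta>) \<gamma> = (\<lambda>p. G \<alpha> \<gamma> p - G \<beta> \<gamma> p)"
  by (simp add: fun_eq_iff G_def g_diff_left FORM_cotangent)

lemma G_scale_left: "FORM \<alpha> \<Longrightarrow> FORM \<gamma> \<Longrightarrow> G (fscale \<phi> \<alpha>) \<gamma> = (\<lambda>p. \<phi> p * G \<alpha> \<gamma> p)"
  by (simp add: fun_eq_iff G_def fscale_def g_scale_left FORM_cotangent)

lemma G_add_right: "FORM \<alpha> \<Longrightarrow> FORM \<beta> \<Longrightarrow> FORM \<gamma> \<Longrightarrow> G \<gamma> (\<alpha> + \<beta>) = (\<lambda>p. G \<gamma> \<alpha> p + G \<gamma> \<beta> p)"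
  using G_add_left[of \<alpha> \<beta> \<gamma>] by (simp add: G_sym[of \<gamma>] FORM_add)

lemma G_scale_right: 
  "\<phi> \<in> SF \<Longrightarrow> FORM \<alpha> \<Longrightarrow> FORM \<gamma> \<Longrightarrow> G \<gamma> (fscale \<phi> \<alpha>) = (\<lambda>p. \<phi> p * G \<gamma> \<alpha> p)"
  using G_scale_left[of \<alpha> \<gamma> \<phi>] by (simp add: G_sym[of \<gamma>] FORM_scale)

lemma form_eqI_G:
  assumes "FORM \<alpha>" "FORM \<beta>" "\<And>\<gamma>. FORM \<gamma> \<Longrightarrow> G \<alpha> \<gamma> p = G \<beta> \<gamma> p"
  shows "\<alpha> p = \<beta> p"
proof -
  note c = FORM_cotangent[OF assms(1), of p] FORM_cotangent[OF assms(2), of p]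
  have "\<alpha> p - \<beta> p = 0"
  proof (rule g_nondegenerate[OF fsubspace_diff[OF fsubspace_cotangent c]])
    fix b assume b: "b \<in> CS p"
    obtain \<gamma> where "FORM \<gamma>" "\<gamma> p = b" by (rule FORM_extension[OF b])
    then show "g p (\<alpha> p - \<beta> p) b = 0" using assms(3)[of \<gamma>] g_diff_left[OF c b] by (simp add: G_def)
  qed
  then show ?thesis by simp
qed

text \<open>On \<open>U\<close> the signs of the frame are constant, so they are read off at
  \<open>p\<close>; the last clause adds that the frame spans.\<close>

definition orthonormal_near where
  "orthonormal_near p e U \<longleftrightarrow> open U \<and> p \<in> U \<and> (\<forall>i\<in>{1..DIM('e)}. FORM (e i)) \<and>
    (\<forall>i\<in>{1..DIM('e)}. \<bar>G (e i) (e i) p\<bar> = 1) \<and>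
    (\<forall>q\<in>U. \<forall>i\<in>{1..DIM('e)}. \<forall>j\<in>{1..DIM('e)}. G (e i) (e j) q = (if i = j then G (e i) (e i) p else 0)) \<and>
    (\<forall>q\<in>U. \<forall>a\<in>CS q. a = (\<lambda>v. \<Sum>i\<in>{1..DIM('e)}. G (e i) (e i) p * g q a (e i q) * e i q v))"

lemma orthonormal_nearD:
  assumes "orthonormal_near p e U"
  shows "open U" "p \<in> U" "\<And>i. i \<in> {1..DIM('e)} \<Longrightarrow> FORM (e i)"
    "\<And>i. i \<in> {1..DIM('e)} \<Longrightarrow> \<bar>G (e i) (e i) p\<bar> = 1"
    "\<And>q i j. q \<in> U \<Longrightarrow> i \<in> {1..DIM('e)} \<Longrightarrow> j \<in> {1..DIM('e)} \<Longrightarrow>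
      G (e i) (e j) q = (if i = j then G (e i) (e i) p else 0)"
    "\<And>q a. q \<in> U \<Longrightarrow> a \<in> CS q \<Longrightarrow>
      a = (\<lambda>v. \<Sum>i\<in>{1..DIM('e)}. G (e i) (e i) p * g q a (e i q) * e i q v)"
proof -
  show "open U" using assms unfolding orthonormal_near_def by (elim conjE)
  show "p \<in> U" using assms unfolding orthonormal_near_def by (elim conjE)
  have 1: "\<forall>i\<in>{1..DIM('e)}. FORM (e i)" using assms unfolding orthonormal_near_def by (elim conjE)
  have 2: "\<forall>i\<in>{1..DIM('e)}. \<bar>G (e i) (e i) p\<bar> = 1"
    using assms unfolding orthonormal_near_def by (elim conjE)
  have 3: "\<forall>q\<in>U. \<forall>i\<in>{1..DIM('e)}. \<forall>j\<in>{1..DIM('e)}. G (e i) (e j) q = (if i = j then G (e i) (e i) p else 0)"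
    using assms unfolding orthonormal_near_def by (elim conjE)
  have 4: "\<forall>q\<in>U. \<forall>a\<in>CS q. a = (\<lambda>v. \<Sum>i\<in>{1..DIM('e)}. G (e i) (e i) p * g q a (e i q) * e i q v)"
    using assms unfolding orthonormal_near_def by (elim conjE)
  show "\<And>i. i \<in> {1..DIM('e)} \<Longrightarrow> FORM (e i)" by (rule 1[THEN bspec])
  show "\<And>i. i \<in> {1..DIM('e)} \<Longrightarrow> \<bar>G (e i) (e i) p\<bar> = 1" by (rule 2[THEN bspec])
  show "\<And>q i j. q \<in> U \<Longrightarrow> i \<in> {1..DIM('e)} \<Longrightarrow> j \<in> {1..DIM('e)} \<Longrightarrow>
      G (e i) (e j) q = (if i = j then G (e i) (e i) p else 0)"
    by (rule 3[THEN bspec, THEN bspec, THEN bspec])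
  show "\<And>q a. q \<in> U \<Longrightarrow> a \<in> CS q \<Longrightarrow>
      a = (\<lambda>v. \<Sum>i\<in>{1..DIM('e)}. G (e i) (e i) p * g q a (e i q) * e i q v)"
    by (rule 4[THEN bspec, THEN bspec])
qed

lemma orthonormal_near_exists:
  assumes "orthonormal_frame_at A g p e"
  shows "\<exists>U. orthonormal_near p e U"
proof -
  let ?I = "{1..DIM('e)}"
  obtain U where U: "open U" "p \<in> U" "\<And>i. i \<in> ?I \<Longrightarrow> FORM (e i)"
    "\<And>q i j. q \<in> U \<Longrightarrow> i \<in> ?I \<Longrightarrow> j \<in> ?I \<Longrightarrow>
      if i = j then \<bar>g q (e i q) (e j q)\<bar> = 1 else g q (e i q) (e j q) = 0"
    using assms unfolding orthonormal_frame_at_def by blast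
  have ep: "\<bar>G (e i) (e i) q\<bar> = 1" if "q \<in> U" "i \<in> ?I" for q i
    using U(4)[OF that that(2)] by (simp add: G_def)
  define U' where "U' = U \<inter> (\<Inter>i\<in>?I. {q. G (e i) (e i) q * G (e i) (e i) p > 0})"
  have "open U'"
    unfolding U'_def
    by (intro open_Int open_INT ballI U(1) finite_atLeastAtMost smooth_open_positive
        smooth_mult[OF G_smooth smooth_const] U(3))
  moreover have "p \<in> U'"
  proof -
    have "G (e i) (e i) p * G (e i) (e i) p > 0" if "i \<in> ?I" for i
      using ep[OF U(2) that] by (metis abs_mult_self_eq mult_1 zero_less_one)
    then show ?thesis using U(2) by (simp add: U'_def)
  qed
  moreover have orth: "G (e i) (e j) q = (if i = j then G (e i) (e i) p else 0)"
    if q: "q \<in> U'" and i: "i \<in> ?I" and j: "j \<in> ?I" for q i j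
  proof (cases "i = j")
    case True
    have "q \<in> U" "G (e i) (e i) q * G (e i) (e i) p > 0" using q i by (auto simp: U'_def)
    then show ?thesis using ep[OF _ i, of q] ep[OF U(2) i] True
      by (auto simp: abs_if zero_less_mult_iff split: if_splits)
  qed (use U(4)[of q i j] q i j in \<open>simp add: U'_def G_def\<close>)
  moreover have "a = (\<lambda>v. \<Sum>i\<in>?I. G (e i) (e i) p * g q a (e i q) * e i q v)"
    if q: "q \<in> U'" and a: "a \<in> CS q" for q a
  proof -
    obtain \<zeta> W x X where fr: "frame_at q \<zeta> W x X" using frame_exists by metis
    note f = frame_atD[OF fr]
    show ?thesis
    proof (rule orthonormal_expansion[where u = "\<lambda>b. d (x b) q" and co = "\<lambda>b a. a (X b q)"])
      show "linear_form (CS q) (\<lambda>a. a (X b q))" for b by (simp add: linear_form_def)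
      show "v = (\<lambda>t. \<Sum>b\<in>Basis. v (X b q) * d (x b) q t)" if "v \<in> CS q" for v
        by (rule covector_frame[OF fr f(3) that])
      show "g q (e i q) (e j q) = (if i = j then G (e i) (e i) p else 0)" if "i \<in> ?I" "j \<in> ?I" for i j
        using orth[OF q that] by (simp add: G_def)
    qed (use g_bilinear fsubspace_cotangent a FORM_cotangent U(3) ep[OF U(2)] in auto)
  qed
  moreover have "\<forall>i\<in>?I. FORM (e i)" "\<forall>i\<in>?I. \<bar>G (e i) (e i) p\<bar> = 1" using U(3) ep[OF U(2)] by blast+
  ultimately have "orthonormal_near p e U'"
    unfolding orthonormal_near_def by (intro conjI ballI; assumption?) blast+
  then show ?thesis by (rule exI)
qed

lemma additive_form_sum:
  fixes F :: "'m form \<Rightarrow> real"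
  assumes add: "\<And>\<alpha> \<beta>. FORM \<alpha> \<Longrightarrow> FORM \<beta> \<Longrightarrow> F (\<alpha> + \<beta>) = F \<alpha> + F \<beta>"
    and \<beta>: "\<And>i. i \<in> J \<Longrightarrow> FORM (\<beta> i)"
  shows "F (\<Sum>i\<in>J. \<beta> i) = (\<Sum>i\<in>J. F (\<beta> i))"
proof -
  have F0: "F 0 = 0" using add[OF FORM_0 FORM_0] by simp
  from \<beta> show ?thesis
    by (induction J rule: infinite_finite_induct) (simp_all add: F0 add FORM_sum)
qed

text \<open>As \<open>F\<close> sees only the value at \<open>p\<close>, the form may be replaced by
  a combination of the frame with constant coefficients.\<close>

lemma form_tensorial_orthonormal:
  fixes F :: "'m form \<Rightarrow> real"
  assumes e: "orthonormal_frame_at A g p e"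
    and add: "\<And>\<alpha> \<beta>. FORM \<alpha> \<Longrightarrow> FORM \<beta> \<Longrightarrow> F (\<alpha> + \<beta>) = F \<alpha> + F \<beta>"
    and scale: "\<And>\<phi> \<alpha>. \<phi> \<in> SF \<Longrightarrow> FORM \<alpha> \<Longrightarrow> F (fscale \<phi> \<alpha>) = \<phi> p * F \<alpha>"
    and \<alpha>: "FORM \<alpha>"
  shows "F \<alpha> = (\<Sum>i\<in>{1..DIM('e)}. G (e i) (e i) p * G \<alpha> (e i) p * F (e i))"
proof -
  let ?I = "{1..DIM('e)}"
  obtain U where nU: "orthonormal_near p e U" using orthonormal_near_exists[OF e] by metis
  note U = orthonormal_nearD(1-3,6)[OF nU]
  let ?c = "\<lambda>i. G (e i) (e i) p * G \<alpha> (e i) p"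
  have fs: "FORM (fscale (\<lambda>_. ?c i) (e i))" if "i \<in> ?I" for i
    by (rule FORM_scale[OF smooth_const U(3)[OF that]])
  have "F \<alpha> = F (\<Sum>i\<in>?I. fscale (\<lambda>_. ?c i) (e i))"
  proof (rule form_tensorial_cong[of F p, OF add scale \<alpha>])
    show "\<alpha> p = (\<Sum>i\<in>?I. fscale (\<lambda>_. ?c i) (e i)) p"
    proof
      fix v show "\<alpha> p v = (\<Sum>i\<in>?I. fscale (\<lambda>_. ?c i) (e i)) p v"
        using fun_cong[OF U(4)[OF U(2) FORM_cotangent[OF \<alpha>]], of v]
        by (simp add: sum_form_apply fscale_def G_def)
    qed
  qed (assumption | rule FORM_sum[OF fs])+
  also have "\<dots> = (\<Sum>i\<in>?I. F (fscale (\<lambda>_. ?c i) (e i)))"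
    by (rule additive_form_sum[OF add fs])
  also have "\<dots> = (\<Sum>i\<in>?I. ?c i * F (e i))"
    using scale[OF smooth_const U(3)] by simp
  finally show ?thesis .
qed

text \<open>Representation of a functional by the metric. Near a point the representing form is the
  sum of \<epsilon>_i L(e_i) e_i, and nondegeneracy makes the local solutions agree pointwise, which
  yields a global smooth form.\<close>

lemma form_of_metric_functional:
  fixes L :: "'m form \<Rightarrow> 'm \<Rightarrow> real"
  assumes add: "\<And>\<alpha> \<beta> p. FORM \<alpha> \<Longrightarrow> FORM \<beta> \<Longrightarrow> L (\<alpha> + \<beta>) p = L \<alpha> p + L \<beta> p"
    and scale: "\<And>\<phi> \<alpha> p. \<phi> \<in> SF \<Longrightarrow> FORM \<alpha> \<Longrightarrow> L (fscale \<phi> \<alpha>) p = \<phi> p * L \<alpha> p"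
    and smooth: "\<And>\<alpha>. FORM \<alpha> \<Longrightarrow> L \<alpha> \<in> SF"
  shows "\<exists>\<delta>. FORM \<delta> \<and> (\<forall>\<gamma>. FORM \<gamma> \<longrightarrow> G \<delta> \<gamma> = L \<gamma>)"
proof -
  let ?I = "{1..DIM('e)}"
  let ?S = "\<lambda>p a. a \<in> CS p \<and> (\<forall>\<gamma>. FORM \<gamma> \<longrightarrow> g p a (\<gamma> p) = L \<gamma> p)"
  have uniq: "a = b" if a: "?S p a" and b: "?S p b" for p a b
  proof -
    have "a - b = 0"
    proof (rule g_nondegenerate)
      show "a - b \<in> CS p" using a b fsubspace_diff[OF fsubspace_cotangent] by blast
      fix c assume c: "c \<in> CS p"
      obtain \<gamma> where "FORM \<gamma>" "\<gamma> p = c" by (rule FORM_extension[OF c])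
      then show "g p (a - b) c = 0" using a b g_diff_left[of a p b c] c by auto
    qed
    then show ?thesis by simp
  qed
  have local: "\<exists>U \<delta>'. open U \<and> p \<in> U \<and> FORM \<delta>' \<and> (\<forall>q\<in>U. ?S q (\<delta>' q))" for p
  proof -
    obtain e where e: "orthonormal_frame_at A g p e" using orthonormal_frame by blast
    obtain U where nU: "orthonormal_near p e U" using orthonormal_near_exists[OF e] by metis
    note U = orthonormal_nearD[OF nU]
    let ?\<delta> = "\<Sum>i\<in>?I. fscale (\<lambda>q. G (e i) (e i) p * L (e i) q) (e i)"
    have F: "FORM ?\<delta>"
      by (intro FORM_sum FORM_scale smooth_mult[OF smooth_const smooth] U(3))
    have "g q (?\<delta> q) (\<gamma> q) = L \<gamma> q" if q: "q \<in> U" and \<gamma>: "FORM \<gamma>" for q \<gamma>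
    proof -
      have eq: "orthonormal_frame_at A g q e"
        unfolding orthonormal_frame_at_def
      proof (intro conjI exI[of _ U] ballI)
        fix q i j assume a: "q \<in> U" "i \<in> ?I" "j \<in> ?I"
        show "if i = j then \<bar>g q (e i q) (e j q)\<bar> = 1 else g q (e i q) (e j q) = 0"
          using U(4)[OF a(2)] U(5)[OF a] by (cases "i = j") (simp_all add: G_def)
      qed (use U(1,3) q in auto)
      have "L \<gamma> q = (\<Sum>i\<in>?I. G (e i) (e i) q * G \<gamma> (e i) q * L (e i) q)"
        by (rule form_tensorial_orthonormal[OF eq add scale \<gamma>])
      also have "\<dots> = (\<Sum>i\<in>?I. (G (e i) (e i) p * L (e i) q) * g q (e i q) (\<gamma> q))"
      proof (rule sum.cong)
        fix i assume i: "i \<in> ?I"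
        show "G (e i) (e i) q * G \<gamma> (e i) q * L (e i) q = (G (e i) (e i) p * L (e i) q) * g q (e i q) (\<gamma> q)"
          using U(5)[OF q i i] fun_cong[OF G_sym[OF \<gamma> U(3)[OF i]], of q] by (simp add: G_def)
      qed simp
      also have "\<dots> = g q (\<lambda>v. \<Sum>i\<in>?I. (G (e i) (e i) p * L (e i) q) * e i q v) (\<gamma> q)"
        by (rule linear_form_sum[OF fsubspace_cotangent bilinear_form_left[OF g_bilinear FORM_cotangent[OF \<gamma>]]
              FORM_cotangent[OF U(3)], symmetric])
      also have "(\<lambda>v. \<Sum>i\<in>?I. (G (e i) (e i) p * L (e i) q) * e i q v) = ?\<delta> q"
        by (simp add: fun_eq_iff sum_form_apply fscale_def)
      finally show ?thesis by simp
    qed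
    then show ?thesis using U(1,2) F FORM_cotangent by blast
  qed
  define \<delta> where "\<delta> p = (SOME a. ?S p a)" for p
  have \<delta>: "?S p (\<delta> p)" for p
  proof -
    obtain U \<delta>' where "p \<in> U" "\<forall>q\<in>U. ?S q (\<delta>' q)" using local by blast
    then have "\<exists>a. ?S p a" by blast
    then show ?thesis unfolding \<delta>_def by (rule someI_ex)
  qed
  have "(\<lambda>p. \<delta> p (X p)) \<in> SF" if X: "VF X" for X
  proof (rule smooth_functions_local)
    fix p
    obtain U \<delta>' where U: "open U" "p \<in> U" "FORM \<delta>'" "\<forall>q\<in>U. ?S q (\<delta>' q)" using local[of p] by metis
    have "\<delta> q = \<delta>' q" if "q \<in> U" for q using uniq[OF \<delta>] U(4) that by blast
    then show "\<exists>W \<psi>. open W \<and> p \<in> W \<and> \<psi> \<in> SF \<and> (\<forall>q\<in>W. \<delta> q (X q) = \<psi> q)"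
      using U FORM_smooth[OF U(3) X] by (intro exI[of _ U] exI[of _ "\<lambda>q. \<delta>' q (X q)"]) auto
  qed
  then have "FORM \<delta>" using \<delta> by (simp add: one_form_def)
  then show ?thesis using \<delta> by (auto simp: G_def fun_eq_iff)
qed

text \<open>The right-hand side of the Koszul formula: twice g(D_\<alpha> \<beta>, \<gamma>) for the
  Levi-Civita connection D.\<close>

definition K :: "'m form \<Rightarrow> 'm form \<Rightarrow> 'm form \<Rightarrow> 'm \<Rightarrow> real" where
  "K \<alpha> \<beta> \<gamma> p = sh \<alpha> p (G \<beta> \<gamma>) + sh \<beta> p (G \<alpha> \<gamma>) - sh \<gamma> p (G \<alpha> \<beta>)
    + G (kb \<alpha> \<beta>) \<gamma> p + G (kb \<gamma> \<alpha>) \<beta> p + G (kb \<gamma> \<beta>) \<alpha> p"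

lemma sh_smooth: "FORM \<alpha> \<Longrightarrow> \<phi> \<in> SF \<Longrightarrow> (\<lambda>p. sh \<alpha> p \<phi>) \<in> SF"
  by (rule VF_smooth[OF anchor_VF])

lemma sh_add: "FORM \<alpha> \<Longrightarrow> \<phi> \<in> SF \<Longrightarrow> \<psi> \<in> SF \<Longrightarrow> sh \<alpha> p (\<lambda>q. \<phi> q + \<psi> q) = sh \<alpha> p \<phi> + sh \<alpha> p \<psi>"
  and sh_diff: "FORM \<alpha> \<Longrightarrow> \<phi> \<in> SF \<Longrightarrow> \<psi> \<in> SF \<Longrightarrow> sh \<alpha> p (\<lambda>q. \<phi> q - \<psi> q) = sh \<alpha> p \<phi> - sh \<alpha> p \<psi>"
  and sh_mult: "FORM \<alpha> \<Longrightarrow> \<phi> \<in> SF \<Longrightarrow> \<psi> \<in> SF \<Longrightarrow> sh \<alpha> p (\<lambda>q. \<phi> q * \<psi> q) = \<phi> p * sh \<alpha> p \<psi> + \<psi> p * sh \<alpha> p \<phi>"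
  and sh_const: "FORM \<alpha> \<Longrightarrow> sh \<alpha> p (\<lambda>q. c) = 0"
  by (rule field_add[OF anchor_VF] field_diff[OF anchor_VF] field_mult[OF anchor_VF] field_const[OF anchor_VF];
      assumption)+

lemma sh_form_add: "FORM \<alpha> \<Longrightarrow> FORM \<beta> \<Longrightarrow> sh (\<alpha> + \<beta>) p \<phi> = sh \<alpha> p \<phi> + sh \<beta> p \<phi>"
  by (simp add: anchor_add)

lemma sh_form_scale: "\<psi> \<in> SF \<Longrightarrow> FORM \<alpha> \<Longrightarrow> sh (fscale \<psi> \<alpha>) p \<phi> = \<psi> p * sh \<alpha> p \<phi>"
  by (simp add: anchor_scale vscale_def)

lemmas form_simps = FORM_add FORM_diff FORM_scale koszul_FORM G_smooth sh_smooth smooth_mult smooth_add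
  smooth_diff sh_add sh_diff sh_mult sh_form_add sh_form_scale G_add_left G_add_right G_diff_left
  G_scale_left G_scale_right koszul_add_left koszul_add_right koszul_scale_left koszul_scale_right

section \<open>Linearity and symmetries of the Koszul expression\<close>

lemma K_add3: "FORM \<alpha> \<Longrightarrow> FORM \<beta> \<Longrightarrow> FORM \<gamma> \<Longrightarrow> FORM \<delta> \<Longrightarrow> K \<alpha> \<beta> (\<gamma> + \<delta>) p = K \<alpha> \<beta> \<gamma> p + K \<alpha> \<beta> \<delta> p"
  by (simp add: K_def form_simps)

lemma K_add2: "FORM \<alpha> \<Longrightarrow> FORM \<beta> \<Longrightarrow> FORM \<gamma> \<Longrightarrow> FORM \<delta> \<Longrightarrow> K \<alpha> (\<beta> + \<delta>) \<gamma> p = K \<alpha> \<beta> \<gamma> p + K \<alpha> \<delta> \<gamma> p"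
  by (simp add: K_def form_simps)

lemma K_add1: "FORM \<alpha> \<Longrightarrow> FORM \<beta> \<Longrightarrow> FORM \<gamma> \<Longrightarrow> FORM \<delta> \<Longrightarrow> K (\<alpha> + \<delta>) \<beta> \<gamma> p = K \<alpha> \<beta> \<gamma> p + K \<delta> \<beta> \<gamma> p"
  by (simp add: K_def form_simps)

lemma K_scale3:
  assumes "FORM \<alpha>" "FORM \<beta>" "FORM \<gamma>" "\<phi> \<in> SF"
  shows "K \<alpha> \<beta> (fscale \<phi> \<gamma>) p = \<phi> p * K \<alpha> \<beta> \<gamma> p"
  using fun_cong[OF G_sym[OF assms(1,3)], of p] fun_cong[OF G_sym[OF assms(2,3)], of p]
  by (simp add: K_def form_simps assms algebra_simps)

lemma K_scale1:
  assumes "FORM \<alpha>" "FORM \<beta>" "FORM \<gamma>" "\<phi> \<in> SF"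
  shows "K (fscale \<phi> \<alpha>) \<beta> \<gamma> p = \<phi> p * K \<alpha> \<beta> \<gamma> p"
  using fun_cong[OF G_sym[OF assms(1,2)], of p] fun_cong[OF G_sym[OF assms(2,3)], of p]
    fun_cong[OF G_sym[OF assms(1,3)], of p]
  by (simp add: K_def form_simps assms algebra_simps)

text \<open>The surplus term, once halved, is the Leibniz rule of a contravariant
  connection.\<close>

lemma K_scale2:
  assumes "FORM \<alpha>" "FORM \<beta>" "FORM \<gamma>" "\<phi> \<in> SF"
  shows "K \<alpha> (fscale \<phi> \<beta>) \<gamma> p = \<phi> p * K \<alpha> \<beta> \<gamma> p + 2 * sh \<alpha> p \<phi> * G \<beta> \<gamma> p"
  using fun_cong[OF G_sym[OF assms(1,2)], of p] fun_cong[OF G_sym[OF assms(2,3)], of p]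
    fun_cong[OF G_sym[OF assms(1,3)], of p]
  by (simp add: K_def form_simps assms algebra_simps)

lemma G_koszul_antisym: "FORM \<alpha> \<Longrightarrow> FORM \<beta> \<Longrightarrow> FORM \<gamma> \<Longrightarrow> G (kb \<alpha> \<beta>) \<gamma> p = - G (kb \<beta> \<alpha>) \<gamma> p"
  using fun_cong[OF G_diff_left[OF FORM_0 koszul_FORM, of \<beta> \<alpha> \<gamma>], of p] koszul_antisym[of \<alpha> \<beta>]
    fun_cong[OF G_diff_left[OF FORM_0 FORM_0, of \<gamma>], of p] by simp

lemma K_metric:
  assumes "FORM \<alpha>" "FORM \<beta>" "FORM \<gamma>"
  shows "K \<alpha> \<beta> \<gamma> p + K \<alpha> \<gamma> \<beta> p = 2 * sh \<alpha> p (G \<beta> \<gamma>)"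
  using G_koszul_antisym[OF assms(1,2,3), of p] G_koszul_antisym[OF assms(1,3,2), of p]
    G_koszul_antisym[OF assms(2,3,1), of p] G_sym[OF assms(1,2)] G_sym[OF assms(1,3)] G_sym[OF assms(2,3)]
  by (simp add: K_def)

lemma K_torsion:
  assumes "FORM \<alpha>" "FORM \<beta>" "FORM \<gamma>"
  shows "K \<alpha> \<beta> \<gamma> p - K \<beta> \<alpha> \<gamma> p = 2 * G (kb \<alpha> \<beta>) \<gamma> p"
  using G_koszul_antisym[OF assms(1,2,3), of p] G_sym[OF assms(1,2)]
  by (simp add: K_def)

lemma K_smooth:
  assumes "FORM \<alpha>" "FORM \<beta>" "FORM \<gamma>" shows "K \<alpha> \<beta> \<gamma> \<in> SF"
  unfolding K_def[abs_def] using assms by (simp add: form_simps)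

text \<open>The property inside the definite description of \<open>levi_civita\<close>, isolated to
  state its unique existence.\<close>

definition LC :: "('m form \<Rightarrow> 'm form \<Rightarrow> 'm form) \<Rightarrow> bool" where
  "LC D \<longleftrightarrow> contravariant_connection A P D \<and>
    (\<forall>\<alpha> \<beta> \<gamma>. FORM \<alpha> \<longrightarrow> FORM \<beta> \<longrightarrow> FORM \<gamma> \<longrightarrow>
      (\<forall>p. sh \<alpha> p (\<lambda>q. g q (\<beta> q) (\<gamma> q)) = g p (D \<alpha> \<beta> p) (\<gamma> p) + g p (\<beta> p) (D \<alpha> \<gamma> p))) \<and>
    (\<forall>\<alpha> \<beta>. FORM \<alpha> \<longrightarrow> FORM \<beta> \<longrightarrow> D \<alpha> \<beta> - D \<beta> \<alpha> = kb \<alpha> \<beta>)"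

lemma connection_FORM: 
  assumes "contravariant_connection A P D" "FORM \<alpha>" "FORM \<beta>" shows "FORM (D \<alpha> \<beta>)"
  using assms(1)[unfolded contravariant_connection_def, THEN conjunct1] assms(2,3) by blast

lemma connection_zero:
  assumes "contravariant_connection A P D" "\<not> (FORM \<alpha> \<and> FORM \<beta>)" shows "D \<alpha> \<beta> = 0"
  using assms(1)[unfolded contravariant_connection_def, THEN conjunct2, THEN conjunct1] assms(2) by blast

text \<open>Metric compatibility expands the three derivatives in \<open>K\<close>, vanishing
  torsion the three brackets; everything cancels except two copies of one term.\<close>

lemma LC_koszul:
  assumes LC: "LC D" and F: "FORM \<alpha>" "FORM \<beta>" "FORM \<gamma>"
  shows "2 * G (D \<alpha> \<beta>) \<gamma> p = K \<alpha> \<beta> \<gamma> p"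
proof -
  have FD: "FORM (D \<alpha> \<beta>)" if "FORM \<alpha>" "FORM \<beta>" for \<alpha> \<beta>
    by (rule connection_FORM[OF LC[unfolded LC_def, THEN conjunct1] that])
  have m: "sh \<alpha> p (G \<beta> \<gamma>) = G (D \<alpha> \<beta>) \<gamma> p + G (D \<alpha> \<gamma>) \<beta> p"
    if "FORM \<alpha>" "FORM \<beta>" "FORM \<gamma>" for \<alpha> \<beta> \<gamma>
  proof -
    have "sh \<alpha> p (G \<beta> \<gamma>) = G (D \<alpha> \<beta>) \<gamma> p + G \<beta> (D \<alpha> \<gamma>) p"
      unfolding G_def[abs_def]
      by (rule LC[unfolded LC_def, THEN conjunct2, THEN conjunct1, rule_format, OF that])
    then show ?thesis using G_sym[OF that(2) FD[OF that(1,3)]] by simp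
  qed
  have t: "G (kb \<alpha> \<beta>) \<gamma> p = G (D \<alpha> \<beta>) \<gamma> p - G (D \<beta> \<alpha>) \<gamma> p"
    if "FORM \<alpha>" "FORM \<beta>" "FORM \<gamma>" for \<alpha> \<beta> \<gamma>
  proof -
    have "kb \<alpha> \<beta> = D \<alpha> \<beta> - D \<beta> \<alpha>"
      by (rule LC[unfolded LC_def, THEN conjunct2, THEN conjunct2, rule_format, OF that(1,2), symmetric])
    then show ?thesis using fun_cong[OF G_diff_left[OF FD FD, of \<alpha> \<beta> \<beta> \<alpha> \<gamma>], of p] that by simp
  qed
  show ?thesis
    unfolding K_def m[OF F] m[OF F(2,1,3)] m[OF F(3,1,2)] t[OF F] t[OF F(3,1,2)] t[OF F(3,2,1)]
    by simp
qed

lemma LC_unique: 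
  assumes "LC D" "LC D'" shows "D = D'"
proof (intro ext)
  fix \<alpha> \<beta>
  have FD: "FORM (D \<alpha> \<beta>)" if "FORM \<alpha>" "FORM \<beta>" "LC D" for D
    by (rule connection_FORM[OF that(3)[unfolded LC_def, THEN conjunct1] that(1,2)])
  have Z: "D \<alpha> \<beta> = 0" if "\<not> (FORM \<alpha> \<and> FORM \<beta>)" "LC D" for D
    by (rule connection_zero[OF that(2)[unfolded LC_def, THEN conjunct1] that(1)])
  have "D \<alpha> \<beta> = D' \<alpha> \<beta>"
  proof (cases "FORM \<alpha> \<and> FORM \<beta>")
    case True
    show ?thesis
    proof
      fix p show "D \<alpha> \<beta> p = D' \<alpha> \<beta> p"
      proof (rule form_eqI_G)
        fix \<gamma> assume "FORM \<gamma>"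
        then show "G (D \<alpha> \<beta>) \<gamma> p = G (D' \<alpha> \<beta>) \<gamma> p"
          using LC_koszul[OF assms(1), of \<alpha> \<beta> \<gamma> p] LC_koszul[OF assms(2), of \<alpha> \<beta> \<gamma> p] True by simp
      qed (use FD assms True in blast)+
    qed
  next
    case False
    then show ?thesis using Z[OF False assms(1)] Z[OF False assms(2)] by simp
  qed
  then show "D \<alpha> \<beta> p v = D' \<alpha> \<beta> p v" for p v by simp
qed

text \<open>Half of \<open>K\<close> is linear over functions in its last argument, hence
  represented by a form. The behaviour of \<open>K\<close> in the other arguments then translates
  into the axioms of the connection.\<close>

lemma LC_exists: "\<exists>D. LC D"
proof -
  have ex: "\<exists>\<delta>. FORM \<delta> \<and> (\<forall>\<gamma>. FORM \<gamma> \<longrightarrow> G \<delta> \<gamma> = (\<lambda>p. 1 / 2 * K \<alpha> \<beta> \<gamma> p))"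
    if "FORM \<alpha>" "FORM \<beta>" for \<alpha> \<beta>
  proof (rule form_of_metric_functional)
    show "(\<lambda>p. 1 / 2 * K \<alpha> \<beta> \<gamma> p) \<in> SF" if "FORM \<gamma>" for \<gamma>
      by (rule smooth_mult[OF smooth_const K_smooth[OF \<open>FORM \<alpha>\<close> \<open>FORM \<beta>\<close> that]])
  qed (simp_all add: K_add3 K_scale3 that add_divide_distrib)
  \<comment> \<open>The value 0 off pairs of 1-forms is the convention of
    \<open>contravariant_connection\<close>, without which uniqueness would fail.\<close>
  define D where "D \<alpha> \<beta> = (if FORM \<alpha> \<and> FORM \<beta>
    then SOME \<delta>. FORM \<delta> \<and> (\<forall>\<gamma>. FORM \<gamma> \<longrightarrow> G \<delta> \<gamma> = (\<lambda>p. 1 / 2 * K \<alpha> \<beta> \<gamma> p)) else 0)" for \<alpha> \<beta>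
  have D: "FORM (D \<alpha> \<beta>) \<and> (\<forall>\<gamma>. FORM \<gamma> \<longrightarrow> G (D \<alpha> \<beta>) \<gamma> = (\<lambda>p. 1 / 2 * K \<alpha> \<beta> \<gamma> p))"
    if "FORM \<alpha>" "FORM \<beta>" for \<alpha> \<beta>
    using someI_ex[OF ex[OF that]] that by (simp add: D_def)
  note FD = D[THEN conjunct1] 
  have GD: "G (D \<alpha> \<beta>) \<gamma> = (\<lambda>p. 1 / 2 * K \<alpha> \<beta> \<gamma> p)" if "FORM \<alpha>" "FORM \<beta>" "FORM \<gamma>" for \<alpha> \<beta> \<gamma>
    using D that by blast
  have eqI: "\<alpha> = \<beta>" if "FORM \<alpha>" "FORM \<beta>" "\<And>\<gamma> p. FORM \<gamma> \<Longrightarrow> G \<alpha> \<gamma> p = G \<beta> \<gamma> p" for \<alpha> \<beta>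
    using form_eqI_G[OF that(1,2)] that(3) by blast
  have "contravariant_connection A P D"
    unfolding contravariant_connection_def
  proof (intro conjI allI ballI impI)
    fix \<alpha> \<beta> \<delta> assume F: "FORM \<alpha>" "FORM \<beta>" "FORM \<delta>"
    show "D (\<alpha> + \<beta>) \<delta> = D \<alpha> \<delta> + D \<beta> \<delta>"
      by (rule eqI) (simp_all add: FD FORM_add F G_add_left GD K_add1 algebra_simps)
    show "D \<delta> (\<alpha> + \<beta>) = D \<delta> \<alpha> + D \<delta> \<beta>"
      by (rule eqI) (simp_all add: FD FORM_add F G_add_left GD K_add2 algebra_simps)
  next
    have S1: "D (fscale \<phi> \<alpha>) \<beta> = fscale \<phi> (D \<alpha> \<beta>)" if \<phi>: "\<phi> \<in> SF" and F: "FORM \<alpha>" "FORM \<beta>" for \<phi> \<alpha> \<beta>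
      by (rule eqI) (simp_all add: FD FORM_scale F \<phi> G_scale_left GD K_scale1)
    have S2: "D \<alpha> (fscale \<phi> \<beta>) = fscale \<phi> (D \<alpha> \<beta>) + fscale (\<lambda>p. sh \<alpha> p \<phi>) \<beta>"
      if \<phi>: "\<phi> \<in> SF" and F: "FORM \<alpha>" "FORM \<beta>" for \<phi> \<alpha> \<beta>
      by (rule eqI) (simp_all add: FD FORM_add FORM_scale sh_smooth F \<phi> G_scale_left G_add_left GD K_scale2 algebra_simps)
    {
      fix \<alpha> \<beta> c assume F: "FORM \<alpha>" "FORM \<beta>"
      show "D (fscale (\<lambda>_. c) \<alpha>) \<beta> = fscale (\<lambda>_. c) (D \<alpha> \<beta>)" by (rule S1[OF smooth_const F])
      show "D \<alpha> (fscale (\<lambda>_. c) \<beta>) = fscale (\<lambda>_. c) (D \<alpha> \<beta>)"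
        unfolding S2[OF smooth_const F] using sh_const[OF F(1)] by (simp add: fscale_def fun_eq_iff)
    next
      fix \<alpha> \<beta> \<phi> assume F: "FORM \<alpha>" "FORM \<beta>" and \<phi>: "\<phi> \<in> SF"
      show "D (fscale \<phi> \<alpha>) \<beta> = fscale \<phi> (D \<alpha> \<beta>)" by (rule S1[OF \<phi> F])
      show "D \<alpha> (fscale \<phi> \<beta>) = fscale \<phi> (D \<alpha> \<beta>) + fscale (\<lambda>p. sh \<alpha> p \<phi>) \<beta>" by (rule S2[OF \<phi> F])
    }
  next
    fix \<alpha> \<beta> assume "FORM \<alpha>" "FORM \<beta>"
    then show "FORM (D \<alpha> \<beta>)" by (rule FD)
  next
    fix \<alpha> \<beta> assume "\<not> (FORM \<alpha> \<and> FORM \<beta>)"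
    then show "D \<alpha> \<beta> = 0" by (simp only: D_def if_False)
  qed
  moreover have "sh \<alpha> p (\<lambda>q. g q (\<beta> q) (\<gamma> q)) = g p (D \<alpha> \<beta> p) (\<gamma> p) + g p (\<beta> p) (D \<alpha> \<gamma> p)"
    if F: "FORM \<alpha>" "FORM \<beta>" "FORM \<gamma>" for \<alpha> \<beta> \<gamma> p
  proof -
    have "sh \<alpha> p (G \<beta> \<gamma>) = G (D \<alpha> \<beta>) \<gamma> p + G (D \<alpha> \<gamma>) \<beta> p"
      using K_metric[OF F, of p] by (simp add: GD F)
    also have "G (D \<alpha> \<gamma>) \<beta> = G \<beta> (D \<alpha> \<gamma>)" by (rule G_sym[OF FD[OF F(1,3)] F(2)])
    finally show ?thesis by (simp add: G_def[abs_def])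
  qed
  moreover have "D \<alpha> \<beta> - D \<beta> \<alpha> = kb \<alpha> \<beta>" if F: "FORM \<alpha>" "FORM \<beta>" for \<alpha> \<beta>
  proof (rule eqI)
    fix \<gamma> p assume c: "FORM \<gamma>"
    show "G (D \<alpha> \<beta> - D \<beta> \<alpha>) \<gamma> p = G (kb \<alpha> \<beta>) \<gamma> p"
      using K_torsion[OF F c, of p] by (simp add: G_diff_left FD F c GD field_simps)
  qed (simp_all add: FORM_diff FD F koszul_FORM)
  ultimately have "LC D" unfolding LC_def by blast
  then show ?thesis by blast
qed

abbreviation "D \<equiv> levi_civita A g P"

lemma LC_levi_civita: "LC D"
proof -
  have "\<exists>!D. LC D" using LC_exists LC_unique by blast
  from theI'[OF this] show ?thesis unfolding LC_def levi_civita_def .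
qed

lemma D_koszul: "FORM \<alpha> \<Longrightarrow> FORM \<beta> \<Longrightarrow> FORM \<gamma> \<Longrightarrow> 2 * G (D \<alpha> \<beta>) \<gamma> p = K \<alpha> \<beta> \<gamma> p"
  by (rule LC_koszul[OF LC_levi_civita])

lemma D_connection: "contravariant_connection A P D"
  using LC_levi_civita by (simp add: LC_def)

lemma D_FORM: "FORM \<alpha> \<Longrightarrow> FORM \<beta> \<Longrightarrow> FORM (D \<alpha> \<beta>)"
  by (rule connection_FORM[OF D_connection])

lemma D_add_left: "FORM \<alpha> \<Longrightarrow> FORM \<alpha>' \<Longrightarrow> FORM \<beta> \<Longrightarrow> D (\<alpha> + \<alpha>') \<beta> = D \<alpha> \<beta> + D \<alpha>' \<beta>"
  by (rule D_connection[unfolded contravariant_connection_def, THEN conjunct2, THEN conjunct2, THEN conjunct1,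
      rule_format, THEN conjunct1])

lemma D_add_right: "FORM \<alpha> \<Longrightarrow> FORM \<alpha>' \<Longrightarrow> FORM \<beta> \<Longrightarrow> D \<beta> (\<alpha> + \<alpha>') = D \<beta> \<alpha> + D \<beta> \<alpha>'"
  by (rule D_connection[unfolded contravariant_connection_def, THEN conjunct2, THEN conjunct2, THEN conjunct1,
      rule_format, THEN conjunct2])

lemma D_scale_left: "\<phi> \<in> SF \<Longrightarrow> FORM \<alpha> \<Longrightarrow> FORM \<beta> \<Longrightarrow> D (fscale \<phi> \<alpha>) \<beta> = fscale \<phi> (D \<alpha> \<beta>)"
  by (rule D_connection[unfolded contravariant_connection_def, THEN conjunct2, THEN conjunct2, THEN conjunct2,
      THEN conjunct2, rule_format, THEN conjunct1])

lemma D_scale_right: "\<phi> \<in> SF \<Longrightarrow> FORM \<alpha> \<Longrightarrow> FORM \<beta> \<Longrightarrow>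
    D \<alpha> (fscale \<phi> \<beta>) = fscale \<phi> (D \<alpha> \<beta>) + fscale (\<lambda>p. sh \<alpha> p \<phi>) \<beta>"
  by (rule D_connection[unfolded contravariant_connection_def, THEN conjunct2, THEN conjunct2, THEN conjunct2,
      THEN conjunct2, rule_format, THEN conjunct2])

end

section \<open>Curvature\<close>

lemma fscale_zero: "fscale \<phi> 0 = 0"
  by (simp add: fscale_def fun_eq_iff)

context metric_manifold
begin

lemma D_zero: "FORM \<alpha> \<Longrightarrow> D \<alpha> 0 = 0" "FORM \<alpha> \<Longrightarrow> D 0 \<alpha> = 0"
  using D_add_right[OF FORM_0 FORM_0, of \<alpha>] D_add_left[OF FORM_0 FORM_0, of \<alpha>] by simp_all

lemma FORM_uminus: "FORM \<alpha> \<Longrightarrow> FORM (- \<alpha>)"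
  using FORM_diff[OF FORM_0, of \<alpha>] by simp

lemma D_uminus_left: "FORM \<alpha> \<Longrightarrow> FORM \<beta> \<Longrightarrow> D (- \<alpha>) \<beta> = - D \<alpha> \<beta>"
  using D_add_left[OF FORM_uminus, of \<alpha> \<alpha> \<beta>] D_zero(2)[of \<beta>] by (simp add: eq_neg_iff_add_eq_0)

lemma D_diff_left: "FORM \<alpha> \<Longrightarrow> FORM \<beta> \<Longrightarrow> FORM \<gamma> \<Longrightarrow> D (\<alpha> - \<beta>) \<gamma> = D \<alpha> \<gamma> - D \<beta> \<gamma>"
  using D_add_left[of \<alpha> "- \<beta>" \<gamma>] FORM_uminus[of \<beta>] D_uminus_left[of \<beta> \<gamma>] by simp

abbreviation "R \<equiv> curvature A g P"

lemma R_eq: "R \<alpha> \<beta> \<gamma> = D \<alpha> (D \<beta> \<gamma>) - D \<beta> (D \<alpha> \<gamma>) - D (kb \<alpha> \<beta>) \<gamma>"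
  by (simp add: curvature_def Let_def)

lemma R_FORM: "FORM \<alpha> \<Longrightarrow> FORM \<beta> \<Longrightarrow> FORM \<gamma> \<Longrightarrow> FORM (R \<alpha> \<beta> \<gamma>)"
  by (simp add: R_eq FORM_diff D_FORM koszul_FORM)

lemma R_antisym: "FORM \<alpha> \<Longrightarrow> FORM \<beta> \<Longrightarrow> FORM \<gamma> \<Longrightarrow> R \<alpha> \<beta> \<gamma> = - R \<beta> \<alpha> \<gamma>"
  using koszul_antisym[of \<alpha> \<beta>] by (simp add: R_eq D_uminus_left koszul_FORM)

lemma R_add1: "FORM \<alpha> \<Longrightarrow> FORM \<alpha>' \<Longrightarrow> FORM \<beta> \<Longrightarrow> FORM \<gamma> \<Longrightarrow> R (\<alpha> + \<alpha>') \<beta> \<gamma> = R \<alpha> \<beta> \<gamma> + R \<alpha>' \<beta> \<gamma>"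
  by (simp add: R_eq D_add_left D_add_right D_FORM koszul_FORM koszul_add_left)

lemma R_add2: "FORM \<alpha> \<Longrightarrow> FORM \<beta>' \<Longrightarrow> FORM \<beta> \<Longrightarrow> FORM \<gamma> \<Longrightarrow> R \<alpha> (\<beta> + \<beta>') \<gamma> = R \<alpha> \<beta> \<gamma> + R \<alpha> \<beta>' \<gamma>"
  by (simp add: R_eq D_add_left D_add_right D_FORM koszul_FORM koszul_add_right)

lemma R_add3: "FORM \<alpha> \<Longrightarrow> FORM \<gamma>' \<Longrightarrow> FORM \<beta> \<Longrightarrow> FORM \<gamma> \<Longrightarrow> R \<alpha> \<beta> (\<gamma> + \<gamma>') = R \<alpha> \<beta> \<gamma> + R \<alpha> \<beta> \<gamma>'"
  by (simp add: R_eq D_add_right D_FORM koszul_FORM)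

lemma R_scale1:
  assumes F: "FORM \<alpha>" "FORM \<beta>" "FORM \<gamma>" and \<phi>: "\<phi> \<in> SF"
  shows "R (fscale \<phi> \<alpha>) \<beta> \<gamma> = fscale \<phi> (R \<alpha> \<beta> \<gamma>)"
proof (intro ext)
  fix p v
  have "D (fscale \<phi> (kb \<alpha> \<beta>) - fscale (\<lambda>p. sh \<beta> p \<phi>) \<alpha>) \<gamma> = fscale \<phi> (D (kb \<alpha> \<beta>) \<gamma>) - fscale (\<lambda>p. sh \<beta> p \<phi>) (D \<alpha> \<gamma>)"
    by (simp add: D_diff_left D_scale_left FORM_scale koszul_FORM sh_smooth F \<phi>)
  then show "R (fscale \<phi> \<alpha>) \<beta> \<gamma> p v = fscale \<phi> (R \<alpha> \<beta> \<gamma>) p v"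
    by (simp add: R_eq D_scale_left D_scale_right D_FORM koszul_scale_left F \<phi>)
      (simp add: fscale_def algebra_simps)
qed

lemma R_scale2:
  assumes F: "FORM \<alpha>" "FORM \<beta>" "FORM \<gamma>" and \<phi>: "\<phi> \<in> SF"
  shows "R \<alpha> (fscale \<phi> \<beta>) \<gamma> = fscale \<phi> (R \<alpha> \<beta> \<gamma>)"
  using R_scale1[OF F(2,1,3) \<phi>] R_antisym[OF F(1) FORM_scale[OF \<phi> F(2)] F(3)] R_antisym[OF F]
  by (simp add: fscale_def fun_eq_iff)

text \<open>The defect of the anchor map from preserving brackets. It vanishes iff \<open>P\<close> is Poisson.\<close>

definition tor :: "'m form \<Rightarrow> 'm form \<Rightarrow> 'm \<Rightarrow> 'm tvec" where
  "tor \<alpha> \<beta> p = lie_bracket A (sh \<alpha>) (sh \<beta>) p - sh (kb \<alpha> \<beta>) p"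

lemma tor_tangent: "FORM \<alpha> \<Longrightarrow> FORM \<beta> \<Longrightarrow> tor \<alpha> \<beta> p \<in> TS p"
  unfolding tor_def
  by (rule fsubspace_diff[OF fsubspace_tangent VF_tangent[OF lie_bracket_VF[OF anchor_VF anchor_VF]]
        VF_tangent[OF anchor_VF[OF koszul_FORM]]])

lemma tor_eval: "\<phi> \<in> SF \<Longrightarrow> tor \<alpha> \<beta> p \<phi> = sh \<alpha> p (\<lambda>q. sh \<beta> q \<phi>) - sh \<beta> p (\<lambda>q. sh \<alpha> q \<phi>) - sh (kb \<alpha> \<beta>) p \<phi>"
  by (simp add: tor_def lie_bracket_eval)

lemma tor_smooth: "FORM \<alpha> \<Longrightarrow> FORM \<beta> \<Longrightarrow> \<phi> \<in> SF \<Longrightarrow> (\<lambda>p. tor \<alpha> \<beta> p \<phi>) \<in> SF"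
  by (simp add: tor_eval smooth_diff sh_smooth koszul_FORM)

text \<open>The mixed terms, with one derivative on \<open>\<phi>\<close> and one on
  \<open>\<gamma>\<close>, cancel. What is left acts on \<open>\<phi>\<close> alone: the commutator
  of the two anchors minus the anchor of the bracket.\<close>

lemma R_scale3:
  assumes F: "FORM \<alpha>" "FORM \<beta>" "FORM \<gamma>" and \<phi>: "\<phi> \<in> SF"
  shows "R \<alpha> \<beta> (fscale \<phi> \<gamma>) = fscale \<phi> (R \<alpha> \<beta> \<gamma>) + fscale (\<lambda>p. tor \<alpha> \<beta> p \<phi>) \<gamma>"
proof (intro ext)
  fix p v
  note s = sh_smooth[OF F(1) \<phi>] sh_smooth[OF F(2) \<phi>]
  show "R \<alpha> \<beta> (fscale \<phi> \<gamma>) p v = (fscale \<phi> (R \<alpha> \<beta> \<gamma>) + fscale (\<lambda>p. tor \<alpha> \<beta> p \<phi>) \<gamma>) p v"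
    by (simp add: R_eq D_scale_right D_add_right D_FORM FORM_scale koszul_FORM F \<phi> s)
      (simp add: fscale_def algebra_simps tor_eval \<phi>)
qed

lemma tor_add: "FORM \<alpha> \<Longrightarrow> FORM \<beta> \<Longrightarrow> FORM \<gamma> \<Longrightarrow> \<phi> \<in> SF \<Longrightarrow> tor (\<alpha> + \<beta>) \<gamma> p \<phi> = tor \<alpha> \<gamma> p \<phi> + tor \<beta> \<gamma> p \<phi>"
  by (simp add: tor_eval sh_form_add koszul_add_left koszul_FORM sh_add sh_smooth)

lemma tor_scale: 
  "FORM \<alpha> \<Longrightarrow> FORM \<gamma> \<Longrightarrow> \<psi> \<in> SF \<Longrightarrow> \<phi> \<in> SF \<Longrightarrow> tor (fscale \<psi> \<alpha>) \<gamma> p \<phi> = \<psi> p * tor \<alpha> \<gamma> p \<phi>"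
proof -
  assume F: "FORM \<alpha>" "FORM \<gamma>" "\<psi> \<in> SF" "\<phi> \<in> SF"
  have "sh (fscale \<psi> (kb \<alpha> \<gamma>) - fscale (\<lambda>p. sh \<gamma> p \<psi>) \<alpha>) p \<phi>
      = \<psi> p * sh (kb \<alpha> \<gamma>) p \<phi> - sh \<gamma> p \<psi> * sh \<alpha> p \<phi>"
  proof -
    have "sh (fscale \<psi> (kb \<alpha> \<gamma>)) p \<phi> = sh (fscale \<psi> (kb \<alpha> \<gamma>) - fscale (\<lambda>p. sh \<gamma> p \<psi>) \<alpha>) p \<phi>
        + sh (fscale (\<lambda>p. sh \<gamma> p \<psi>) \<alpha>) p \<phi>"
      by (subst sh_form_add[symmetric]) (simp_all add: FORM_diff FORM_scale koszul_FORM sh_smooth F)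
    then show ?thesis by (simp add: sh_form_scale koszul_FORM sh_smooth F)
  qed
  then show ?thesis
    by (simp add: tor_eval sh_form_scale koszul_scale_left sh_mult sh_smooth F algebra_simps)
qed

lemma tor_antisym: "FORM \<alpha> \<Longrightarrow> FORM \<beta> \<Longrightarrow> \<phi> \<in> SF \<Longrightarrow> tor \<alpha> \<beta> p \<phi> = - tor \<beta> \<alpha> p \<phi>"
proof -
  assume F: "FORM \<alpha>" "FORM \<beta>" "\<phi> \<in> SF"
  have "sh (kb \<alpha> \<beta> + kb \<beta> \<alpha>) p \<phi> = sh 0 p \<phi>" using koszul_antisym[OF F(1,2)] by simp
  moreover have "sh 0 p \<phi> = 0" using sh_form_add[OF FORM_0 FORM_0, of p \<phi>] by simp
  ultimately have "sh (kb \<alpha> \<beta>) p \<phi> + sh (kb \<beta> \<alpha>) p \<phi> = 0" by (simp add: sh_form_add koszul_FORM F)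
  then show ?thesis by (simp add: tor_eval F)
qed

lemma G_add_left_at: "FORM \<alpha> \<Longrightarrow> FORM \<beta> \<Longrightarrow> FORM \<gamma> \<Longrightarrow> G (\<alpha> + \<beta>) \<gamma> p = G \<alpha> \<gamma> p + G \<beta> \<gamma> p"
  and G_scale_left_at: "FORM \<alpha> \<Longrightarrow> FORM \<gamma> \<Longrightarrow> G (fscale \<phi> \<alpha>) \<gamma> p = \<phi> p * G \<alpha> \<gamma> p"
  by (simp_all add: G_add_left G_scale_left)

lemma R_cong2:
  assumes F: "FORM \<alpha>" "FORM \<beta>" "FORM \<beta>'" "FORM \<gamma>" "FORM \<eta>" and eq: "\<beta> p = \<beta>' p"
  shows "G (R \<alpha> \<beta> \<gamma>) \<eta> p = G (R \<alpha> \<beta>' \<gamma>) \<eta> p"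
  by (rule form_tensorial_cong[where F = "\<lambda>\<beta>. G (R \<alpha> \<beta> \<gamma>) \<eta> p" and p = p, OF _ _ F(2,3) eq])
    (simp_all add: R_add2 R_scale2 R_FORM F G_add_left_at G_scale_left_at)

lemma ricci_eq:
  "ricci A g P e p \<theta> \<eta> = (\<Sum>i\<in>{1..DIM('e)}. G (e i) (e i) p * G (R \<theta> (e i) (e i)) \<eta> p)"
  by (simp add: ricci_def G_def)

text \<open>Rotating two vectors of a frame changes the Ricci curvature by a multiple of the defect.\<close>

lemma ricci_flat_tor:
  assumes flat: "ricci_flat A g P" and F: "FORM \<theta>" "FORM \<eta>" "\<phi> \<in> SF"
  shows "tor \<theta> \<eta> p \<phi> = 0"
proof -
  let ?I = "{1..DIM('e)}"
  obtain e where e: "orthonormal_frame_at A g p e" using orthonormal_frame by blast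
  obtain U where nU: "orthonormal_near p e U" using orthonormal_near_exists[OF e] by metis
  note U = orthonormal_nearD[OF nU]
  have add2: "tor \<alpha> (\<beta> + \<gamma>) p \<phi> = tor \<alpha> \<beta> p \<phi> + tor \<alpha> \<gamma> p \<phi>"
    if "FORM \<alpha>" "FORM \<beta>" "FORM \<gamma>" for \<alpha> \<beta> \<gamma>
    using tor_add[OF that(2,3,1) F(3), of p] tor_antisym[OF that(1) FORM_add[OF that(2,3)] F(3), of p]
      tor_antisym[OF that(1,2) F(3), of p] tor_antisym[OF that(1,3) F(3), of p] by linarith
  have scale2: "tor \<alpha> (fscale \<psi> \<beta>) p \<phi> = \<psi> p * tor \<alpha> \<beta> p \<phi>"
    if "FORM \<alpha>" "FORM \<beta>" "\<psi> \<in> SF" for \<alpha> \<beta> \<psi>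
    using tor_scale[OF that(2,1,3) F(3), of p] tor_antisym[OF that(1) FORM_scale[OF that(3,2)] F(3), of p]
      tor_antisym[OF that(1,2) F(3), of p] by simp
  have exp2: "tor \<alpha> \<beta> p \<phi> = (\<Sum>i\<in>?I. G (e i) (e i) p * G \<beta> (e i) p * tor \<alpha> (e i) p \<phi>)"
    if "FORM \<alpha>" "FORM \<beta>" for \<alpha> \<beta>
    by (rule form_tensorial_orthonormal[where F = "\<lambda>\<beta>. tor \<alpha> \<beta> p \<phi>", OF e])
      (simp_all add: that add2 scale2)
  have exp1: "tor \<alpha> \<beta> p \<phi> = (\<Sum>i\<in>?I. G (e i) (e i) p * G \<alpha> (e i) p * tor (e i) \<beta> p \<phi>)"
    if "FORM \<alpha>" "FORM \<beta>" for \<alpha> \<beta>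
    by (rule form_tensorial_orthonormal[where F = "\<lambda>\<alpha>. tor \<alpha> \<beta> p \<phi>", OF e])
      (simp_all add: that F(3) tor_add tor_scale)
  \<comment> \<open>By \<open>exp2\<close> it suffices to put members of the frame into the second
    slot.\<close>
  have key: "tor \<theta> (e j) p \<phi> = 0" if j: "j \<in> ?I" for j
  proof (cases "?I = {j}")
    \<comment> \<open>In dimension one there is no second vector to rotate with, but antisymmetry
      alone makes the defect vanish.\<close>
    case True
    have "tor (e j) (e j) p \<phi> = 0" using tor_antisym[OF U(3)[OF j] U(3)[OF j] F(3), of p] by simp
    then show ?thesis using exp1[OF F(1) U(3)[OF j]] True by simp
  next
    case False
    then obtain k where k: "k \<in> ?I" "k \<noteq> j" using j by blast
    let ?Gj = "G (e j) (e j) p" and ?Gk = "G (e k) (e k) p"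
    define \<epsilon> where "\<epsilon> = ?Gj * ?Gk"
    have ejk: "?Gj * ?Gj = 1" "?Gk * ?Gk = 1"
      using U(4)[OF j] U(4)[OF k(1)] by (metis abs_mult_self_eq mult_1)+
    then have ee: "\<epsilon> * \<epsilon> = 1" "\<epsilon> * ?Gj = ?Gk" "\<epsilon> * ?Gk = ?Gj"
      by (simp_all add: \<epsilon>_def algebra_simps)
    \<comment> \<open>\<open>t\<close> vanishes at \<open>p\<close> and has the differential of
      \<open>\<phi>\<close>. The functions (1 - \<epsilon> t^2) / (1 + \<epsilon> t^2) and 2 t / (1
      + \<epsilon> t^2) parametrise the curve C^2 + \<epsilon> S^2 = 1: a circle if
      \<open>e j\<close> and \<open>e k\<close> have equal signs, a hyperbola otherwise.\<close>
    define t where "t q = \<phi> q - \<phi> p" for q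
    have t: "t \<in> SF" unfolding t_def by (intro smooth_diff F(3) smooth_const)
    have tp: "t p = 0" by (simp add: t_def)
    define w where "w q = 1 + \<epsilon> * (t q * t q)" for q
    have w: "w \<in> SF" unfolding w_def by (intro smooth_add smooth_mult smooth_const t)
    \<comment> \<open>For \<epsilon> = -1 the denominator \<open>w\<close> may vanish away from
      \<open>p\<close>; \<open>u\<close> squared is its inverse near \<open>p\<close> and smooth
      everywhere.\<close>
    obtain u W where u: "u \<in> SF" "open W" "p \<in> W" "\<And>q. q \<in> W \<Longrightarrow> (u q)\<^sup>2 * w q = 1"
      using local_inverse_sqrt[OF w, of p] by (auto simp: w_def tp)
    define C where "C q = (1 - \<epsilon> * (t q * t q)) * (u q * u q)" for q
    define S where "S q = 2 * t q * (u q * u q)" for q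
    have C: "C \<in> SF" unfolding C_def by (intro smooth_diff smooth_mult smooth_const t u(1))
    have S: "S \<in> SF" unfolding S_def by (intro smooth_mult smooth_const t u(1))
    have upp: "u p * u p = 1" using u(4)[OF u(3)] by (simp add: w_def tp power2_eq_square)
    have Cp: "C p = 1" "S p = 0" by (simp_all add: C_def S_def tp upp)
    have CS: "C q * C q + \<epsilon> * (S q * S q) = 1" if "q \<in> W" for q
    proof -
      have "C q * C q + \<epsilon> * (S q * S q) = (u q * u q)\<^sup>2 * ((1 - \<epsilon> * (t q * t q))\<^sup>2 + 4 * \<epsilon> * (t q * t q))"
        by (simp add: C_def S_def power2_eq_square algebra_simps)
      also have "(1 - \<epsilon> * (t q * t q))\<^sup>2 + 4 * \<epsilon> * (t q * t q) = (w q)\<^sup>2"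
        by (simp add: w_def power2_eq_square algebra_simps)
      also have "(u q * u q)\<^sup>2 * (w q)\<^sup>2 = ((u q)\<^sup>2 * w q)\<^sup>2"
        by (simp add: power2_eq_square algebra_simps)
      finally show ?thesis using u(4)[OF that] by simp
    qed
    \<comment> \<open>The coefficient that makes the rotated \<open>e k\<close> orthogonal to the
      rotated \<open>e j\<close>.\<close>
    define \<epsilon>S where "\<epsilon>S q = - \<epsilon> * S q" for q
    have \<epsilon>S: "\<epsilon>S \<in> SF" unfolding \<epsilon>S_def by (intro smooth_mult smooth_const S)
    define e' where "e' i = (if i = j then fscale C (e j) + fscale S (e k)
      else if i = k then fscale C (e k) + fscale \<epsilon>S (e j) else e i)" for i
    have e'j: "e' j = fscale C (e j) + fscale S (e k)" and e'k: "e' k = fscale C (e k) + fscale \<epsilon>S (e j)"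
      and e'i: "\<And>i. i \<noteq> j \<Longrightarrow> i \<noteq> k \<Longrightarrow> e' i = e i"
      using k(2) by (auto simp: e'_def)
    have F': "FORM (e' i)" if "i \<in> ?I" for i
      unfolding e'_def
      using FORM_add[OF FORM_scale[OF C U(3)[OF j]] FORM_scale[OF S U(3)[OF k(1)]]]
        FORM_add[OF FORM_scale[OF C U(3)[OF k(1)]] FORM_scale[OF \<epsilon>S U(3)[OF j]]] U(3)[OF that] by simp
    note Fj = U(3)[OF j] and Fk = U(3)[OF k(1)]
    have orth: "G (e' i) (e' l) q = (if i = l then G (e i) (e i) p else 0)"
      if q: "q \<in> U \<inter> W" and i: "i \<in> ?I" and l: "l \<in> ?I" for q i l
    proof -
      have qU: "q \<in> U" using q by simp
      have jj: "G (e' j) (e' j) q = ?Gj"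
      proof -
        have "G (e' j) (e' j) q = C q * C q * ?Gj + S q * S q * ?Gk"
          unfolding e'j using U(5)[OF qU j j] U(5)[OF qU k(1) k(1)] U(5)[OF qU j k(1)] U(5)[OF qU k(1) j] k(2)
          by (simp add: G_add_left G_add_right G_scale_left G_scale_right FORM_add FORM_scale C S Fj Fk algebra_simps)
        also have "\<dots> = (C q * C q + \<epsilon> * (S q * S q)) * ?Gj" using ee(2) by (simp add: algebra_simps)
        finally show ?thesis using CS q by simp
      qed
      have kk: "G (e' k) (e' k) q = ?Gk"
      proof -
        have "G (e' k) (e' k) q = C q * C q * ?Gk + \<epsilon>S q * \<epsilon>S q * ?Gj"
          unfolding e'k using U(5)[OF qU j j] U(5)[OF qU k(1) k(1)] U(5)[OF qU j k(1)] U(5)[OF qU k(1) j] k(2)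
          by (simp add: G_add_left G_add_right G_scale_left G_scale_right FORM_add FORM_scale C \<epsilon>S Fj Fk algebra_simps)
        also have "\<epsilon>S q * \<epsilon>S q * ?Gj = (\<epsilon> * \<epsilon>) * (S q * S q) * (\<epsilon> * ?Gk)"
          using ee(3) by (simp add: \<epsilon>S_def algebra_simps)
        also have "C q * C q * ?Gk + \<dots> = (C q * C q + \<epsilon> * (S q * S q)) * ?Gk" using ee(1) by (simp add: algebra_simps)
        finally show ?thesis using CS q by simp
      qed
      have jk: "G (e' j) (e' k) q = 0"
      proof -
        have "G (e' j) (e' k) q = C q * \<epsilon>S q * ?Gj + S q * C q * ?Gk"
          unfolding e'j e'k using U(5)[OF qU j j] U(5)[OF qU k(1) k(1)] U(5)[OF qU j k(1)] U(5)[OF qU k(1) j] k(2)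
          by (simp add: G_add_left G_add_right G_scale_left G_scale_right FORM_add FORM_scale C S \<epsilon>S Fj Fk algebra_simps)
        also have "\<dots> = S q * C q * (?Gk - \<epsilon> * ?Gj)" by (simp add: \<epsilon>S_def algebra_simps)
        finally show ?thesis using ee(2) by simp
      qed
      have ij: "G (e i) (e' j) q = 0" and ik: "G (e i) (e' k) q = 0" if "i \<noteq> j" "i \<noteq> k" "i \<in> ?I" for i
        unfolding e'j e'k using U(5)[OF qU that(3) j] U(5)[OF qU that(3) k(1)] that
        by (simp_all add: G_add_right G_scale_right FORM_scale C S \<epsilon>S Fj Fk U(3))
      have sym: "G (e' i) (e' l) q = G (e' l) (e' i) q" if "i \<in> ?I" "l \<in> ?I" for i l
        using fun_cong[OF G_sym[OF F'[OF that(1)] F'[OF that(2)]]] .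
      consider "i = j" "l = j" | "i = j" "l = k" | "i = k" "l = j" | "i = k" "l = k"
        | "i = j" "l \<noteq> j" "l \<noteq> k" | "i = k" "l \<noteq> j" "l \<noteq> k" | "i \<noteq> j" "i \<noteq> k" "l = j" | "i \<noteq> j" "i \<noteq> k" "l = k"
        | "i \<noteq> j" "i \<noteq> k" "l \<noteq> j" "l \<noteq> k" by blast
      then show ?thesis
      proof cases
        case 1 then show ?thesis using jj by simp
      next
        case 2 then show ?thesis using jk k(2) by simp
      next
        case 3 then show ?thesis using jk sym[OF k(1) j] k(2) by simp
      next
        case 4 then show ?thesis using kk by simp
      next
        case 5 then show ?thesis using ij[of l] sym[OF i l] l by (simp add: e'i)
      next
        case 6 then show ?thesis using ik[of l] sym[OF i l] l by (simp add: e'i)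
      next
        case 7 then show ?thesis using ij[of i] i by (simp add: e'i)
      next
        case 8 then show ?thesis using ik[of i] i by (simp add: e'i)
      next
        case 9 then show ?thesis using U(5)[OF qU i l] by (simp add: e'i)
      qed
    qed
    have e': "orthonormal_frame_at A g p e'"
      unfolding orthonormal_frame_at_def
    proof (intro conjI exI[of _ "U \<inter> W"] ballI)
      fix q i l assume a: "q \<in> U \<inter> W" "i \<in> ?I" "l \<in> ?I"
      show "if i = l then \<bar>g q (e' i q) (e' l q)\<bar> = 1 else g q (e' i q) (e' l q) = 0"
        using orth[OF a] U(4)[OF a(2)] by (cases "i = l") (simp_all add: G_def)
    qed (use F' U(1,2) u(2,3) in auto)
    have pUW: "p \<in> U \<inter> W" using U(2) u(3) by simp
    \<comment> \<open>The rotation is the identity at \<open>p\<close>, so only derivatives of its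
      coefficients can matter, and these are felt only in the last argument of the
      curvature.\<close>
    have at: "e' i p = e i p" for i
      by (auto simp: e'_def fscale_def Cp \<epsilon>S_def fun_eq_iff)
    \<comment> \<open>Pairing with \<open>e k\<close> isolates the derivative of \<open>S\<close>,
      the coefficient of \<open>e k\<close> in \<open>e' j\<close>.\<close>
    let ?r = "\<lambda>f i. G (f i) (f i) p * G (R \<theta> (f i) (f i)) (e k) p"
    have "(\<Sum>i\<in>?I. G (e i) (e i) p * G (R \<theta> (e i) (e i)) (e k) p) = 0"
      using flat e F(1) Fk unfolding ricci_flat_def ricci_eq by blast
    moreover have "(\<Sum>i\<in>?I. G (e' i) (e' i) p * G (R \<theta> (e' i) (e' i)) (e k) p) = 0"
      using flat e' F(1) Fk unfolding ricci_flat_def ricci_eq by blast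
    ultimately have "(\<Sum>i\<in>?I. ?r e' i - ?r e i) = 0" by (simp add: sum_subtractf)
    also have "(\<Sum>i\<in>?I. ?r e' i - ?r e i) = (\<Sum>i\<in>{j, k}. ?r e' i - ?r e i)"
      by (rule sum.mono_neutral_right) (use j k e'i in auto)
    finally have sum0: "(?r e' j - ?r e j) + (?r e' k - ?r e k) = 0" using k(2) by simp
    have R3: "G (R \<theta> (e' i) (fscale a \<alpha> + fscale b \<beta>)) (e k) p
        = a p * G (R \<theta> (e i) \<alpha>) (e k) p + tor \<theta> (e i) p a * G \<alpha> (e k) p
          + b p * G (R \<theta> (e i) \<beta>) (e k) p + tor \<theta> (e i) p b * G \<beta> (e k) p"
      if "a \<in> SF" "b \<in> SF" "FORM \<alpha>" "FORM \<beta>" "i \<in> ?I" for a b \<alpha> \<beta> i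
    proof -
      have "G (R \<theta> (e' i) (fscale a \<alpha> + fscale b \<beta>)) (e k) p = G (R \<theta> (e i) (fscale a \<alpha> + fscale b \<beta>)) (e k) p"
        by (rule R_cong2[OF F(1) F'[OF that(5)] U(3)[OF that(5)] _ Fk at]) (simp add: FORM_add FORM_scale that)
      then show ?thesis
        by (simp add: R_add3 R_scale3 G_add_left G_scale_left FORM_add FORM_scale R_FORM tor_smooth
            that(1-4) F(1) Fk U(3)[OF that(5)])
    qed
    have Gkk: "G (e' k) (e' k) p = ?Gk" "G (e' j) (e' j) p = ?Gj"
      using orth[OF pUW k(1) k(1)] orth[OF pUW j j] by simp_all
    have Gjk: "G (e j) (e k) p = 0" using U(5)[OF U(2) j k(1)] k(2) by simp
    note tv = tor_tangent[OF F(1) Fj, of p] tor_tangent[OF F(1) Fk, of p]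
    \<comment> \<open>Differentiate C^2 + \<epsilon> S^2 = 1 at \<open>p\<close>, where C = 1 and S
      = 0.\<close>
    have torC: "tor \<theta> (e k) p C = 0"
    proof -
      have "tor \<theta> (e k) p (\<lambda>q. C q * C q + \<epsilon> * (S q * S q)) = tor \<theta> (e k) p (\<lambda>_. 1)"
        by (rule tangent_local[OF tv(2) _ smooth_const u(2,3) CS])
          (intro smooth_add smooth_mult smooth_const C S)
      also have "\<dots> = 0" by (rule tangent_const[OF tv(2)])
      also have "tor \<theta> (e k) p (\<lambda>q. C q * C q + \<epsilon> * (S q * S q)) = 2 * tor \<theta> (e k) p C"
        by (simp add: tangentD(4)[OF tv(2)] tangentD(3)[OF tv(2)] tangent_const[OF tv(2)] smooth_mult C S Cp)
      finally show ?thesis by simp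
    qed
    have torS: "tor \<theta> (e j) p S = 2 * tor \<theta> (e j) p \<phi>"
    proof -
      have "tor \<theta> (e j) p S = 2 * tor \<theta> (e j) p t"
        unfolding S_def[abs_def] using upp tp
        by (simp add: tangentD(3)[OF tv(1)] tangent_const[OF tv(1)] smooth_mult t u(1))
      also have "tor \<theta> (e j) p t = tor \<theta> (e j) p \<phi>"
        unfolding t_def[abs_def] by (simp add: tangentD(5)[OF tv(1)] tangent_const[OF tv(1)] F(3))
      finally show ?thesis .
    qed
    have "?r e' j - ?r e j = ?Gj * (tor \<theta> (e j) p S * ?Gk)"
      using R3[OF C S Fj Fk j] Gkk Gjk by (simp add: e'j[symmetric] Cp algebra_simps)
    moreover have "?r e' k - ?r e k = 0"
      using R3[OF C \<epsilon>S Fk Fj k(1)] Gkk Gjk torC by (simp add: e'k[symmetric] Cp \<epsilon>S_def algebra_simps)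
    ultimately have "\<epsilon> * tor \<theta> (e j) p \<phi> = 0" using sum0 torS by (simp add: \<epsilon>_def algebra_simps)
    then show ?thesis using ee(1) by auto
  qed
  show ?thesis using exp2[OF F(1,2)] key by simp
qed

text \<open>Without defect at \<open>p\<close>, the curvature there is linear over functions in its
  last argument too, so the Ricci curvature is the metric trace of a bilinear form on the cotangent
  space.\<close>

lemma ricci_frame_independent:
  assumes tor: "\<And>\<alpha> \<beta> \<phi>. FORM \<alpha> \<Longrightarrow> FORM \<beta> \<Longrightarrow> \<phi> \<in> SF \<Longrightarrow> tor \<alpha> \<beta> p \<phi> = 0"
    and e: "orthonormal_frame_at A g p e" and e': "orthonormal_frame_at A g p e'"
    and F: "FORM \<theta>" "FORM \<eta>"
  shows "ricci A g P e p \<theta> \<eta> = ricci A g P e' p \<theta> \<eta>"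
proof -
  let ?I = "{1..DIM('e)}"
  define B where "B \<alpha> \<beta> = G (R \<theta> \<alpha> \<beta>) \<eta> p" for \<alpha> \<beta>
  obtain U where nU: "orthonormal_near p e U" using orthonormal_near_exists[OF e] by metis
  note U = orthonormal_nearD[OF nU]
  obtain U' where nU': "orthonormal_near p e' U'" using orthonormal_near_exists[OF e'] by metis
  note U' = orthonormal_nearD[OF nU']
  let ?a = "\<lambda>i j. G (e' i) (e j) p" and ?\<epsilon> = "\<lambda>j. G (e j) (e j) p" and ?\<epsilon>' = "\<lambda>j. G (e' j) (e' j) p"
  have B1: "B \<alpha> \<beta> = (\<Sum>j\<in>?I. ?\<epsilon> j * G \<alpha> (e j) p * B (e j) \<beta>)" if "FORM \<alpha>" "FORM \<beta>" for \<alpha> \<beta>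
    by (rule form_tensorial_orthonormal[where F = "\<lambda>\<alpha>. B \<alpha> \<beta>", OF e])
      (simp_all add: that F B_def R_add2 R_scale2 R_FORM G_add_left G_scale_left)
  have B2: "B \<alpha> \<beta> = (\<Sum>j\<in>?I. ?\<epsilon> j * G \<beta> (e j) p * B \<alpha> (e j))" if "FORM \<alpha>" "FORM \<beta>" for \<alpha> \<beta>
  proof (rule form_tensorial_orthonormal[where F = "B \<alpha>", OF e _ _ that(2)])
    show "B \<alpha> (\<beta> + \<gamma>) = B \<alpha> \<beta> + B \<alpha> \<gamma>" if "FORM \<beta>" "FORM \<gamma>" for \<beta> \<gamma>
      using that \<open>FORM \<alpha>\<close> F by (simp add: B_def R_add3 R_FORM G_add_left)
    show "B \<alpha> (fscale \<phi> \<gamma>) = \<phi> p * B \<alpha> \<gamma>" if "\<phi> \<in> SF" "FORM \<gamma>" for \<phi> \<gamma>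
      using that \<open>FORM \<alpha>\<close> F
      by (simp add: B_def R_scale3 R_FORM G_add_left G_scale_left FORM_scale tor_smooth tor)
  qed
  \<comment> \<open>Expanding \<open>e j\<close> in the frame \<open>e'\<close> and pairing with
    \<open>e k\<close> shows that the change of basis is pseudo-orthogonal.\<close>
  have trace: "(\<Sum>i\<in>?I. ?\<epsilon>' i * ?a i j * ?a i k) = (if j = k then ?\<epsilon> j else 0)" if jk: "j \<in> ?I" "k \<in> ?I" for j k
  proof -
    have "G (e j) (e k) p = (\<Sum>i\<in>?I. ?\<epsilon>' i * G (e j) (e' i) p * ?a i k)"
      by (rule form_tensorial_orthonormal[where F = "\<lambda>\<alpha>. G \<alpha> (e k) p", OF e'])
        (simp_all add: U(3)[OF jk(1)] U(3)[OF jk(2)] G_add_left G_scale_left)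
    also have "\<dots> = (\<Sum>i\<in>?I. ?\<epsilon>' i * ?a i j * ?a i k)"
      using G_sym[OF U(3)[OF jk(1)] U'(3)] by (intro sum.cong) auto
    finally show ?thesis using U(5)[OF U(2) jk] by simp
  qed
  have "ricci A g P e' p \<theta> \<eta> = (\<Sum>i\<in>?I. ?\<epsilon>' i * B (e' i) (e' i))"
    by (simp add: ricci_eq B_def)
  also have "\<dots> = (\<Sum>i\<in>?I. \<Sum>j\<in>?I. \<Sum>k\<in>?I. (?\<epsilon> j * ?\<epsilon> k * B (e j) (e k)) * (?\<epsilon>' i * ?a i j * ?a i k))"
  proof (rule sum.cong)
    fix i assume i: "i \<in> ?I"
    have "B (e' i) (e' i) = (\<Sum>j\<in>?I. ?\<epsilon> j * ?a i j * (\<Sum>k\<in>?I. ?\<epsilon> k * ?a i k * B (e j) (e k)))"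
      using B1[OF U'(3)[OF i] U'(3)[OF i]] B2[OF U(3) U'(3)[OF i]] by simp
    then show "?\<epsilon>' i * B (e' i) (e' i) = (\<Sum>j\<in>?I. \<Sum>k\<in>?I. (?\<epsilon> j * ?\<epsilon> k * B (e j) (e k)) * (?\<epsilon>' i * ?a i j * ?a i k))"
      by (simp add: sum_distrib_left algebra_simps)
  qed simp
  also have "\<dots> = (\<Sum>j\<in>?I. \<Sum>k\<in>?I. \<Sum>i\<in>?I. (?\<epsilon> j * ?\<epsilon> k * B (e j) (e k)) * (?\<epsilon>' i * ?a i j * ?a i k))"
    by (subst sum.swap) (intro sum.cong refl sum.swap)
  also have "\<dots> = (\<Sum>j\<in>?I. \<Sum>k\<in>?I. (?\<epsilon> j * ?\<epsilon> k * B (e j) (e k)) * (if j = k then ?\<epsilon> j else 0))"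
    using trace by (simp add: sum_distrib_left[symmetric])
  also have "\<dots> = (\<Sum>j\<in>?I. ?\<epsilon> j * B (e j) (e j))"
  proof (rule sum.cong)
    fix j assume j: "j \<in> ?I"
    have "?\<epsilon> j * ?\<epsilon> j = 1" using U(4)[OF j] by (metis abs_mult_self_eq mult_1)
    then have "?\<epsilon> j * ?\<epsilon> j * B (e j) (e j) * ?\<epsilon> j = ?\<epsilon> j * B (e j) (e j)" by simp
    moreover have "(\<Sum>k\<in>?I. (?\<epsilon> j * ?\<epsilon> k * B (e j) (e k)) * (if j = k then ?\<epsilon> j else 0))
        = (\<Sum>k\<in>?I. if k = j then ?\<epsilon> j * ?\<epsilon> j * B (e j) (e j) * ?\<epsilon> j else 0)"
      by (intro sum.cong) auto
    ultimately show "(\<Sum>k\<in>?I. (?\<epsilon> j * ?\<epsilon> k * B (e j) (e k)) * (if j = k then ?\<epsilon> j else 0)) = ?\<epsilon> j * B (e j) (e j)"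
      using j by simp
  qed simp
  also have "\<dots> = ricci A g P e p \<theta> \<eta>" by (simp add: ricci_eq B_def)
  finally show ?thesis by simp
qed

lemma ricci_add:
  assumes "\<And>i. i \<in> {1..DIM('e)} \<Longrightarrow> FORM (e i)" "FORM \<theta>" "FORM \<theta>'" "FORM \<eta>" "FORM \<eta>'"
  shows "ricci A g P e p (\<theta> + \<theta>') \<eta> = ricci A g P e p \<theta> \<eta> + ricci A g P e p \<theta>' \<eta>"
    "ricci A g P e p \<theta> (\<eta> + \<eta>') = ricci A g P e p \<theta> \<eta> + ricci A g P e p \<theta> \<eta>'"
  unfolding ricci_eq sum.distrib[symmetric]
  by (rule sum.cong; simp add: assms R_add1 R_FORM G_add_left G_add_right distrib_left)+

lemma ricci_cong:
  assumes e: "\<And>i. i \<in> {1..DIM('e)} \<Longrightarrow> FORM (e i)" and F: "FORM \<theta>" "FORM \<theta>'" "FORM \<eta>" "FORM \<eta>'"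
    and eq: "\<theta> p = \<theta>' p" "\<eta> p = \<eta>' p"
  shows "ricci A g P e p \<theta> \<eta> = ricci A g P e p \<theta>' \<eta>'"
  unfolding ricci_eq
proof (rule sum.cong)
  fix i assume i: "i \<in> {1..DIM('e)}"
  have "G (R \<theta> (e i) (e i)) \<eta> p = G (R \<theta>' (e i) (e i)) \<eta> p"
    by (rule form_tensorial_cong[where F = "\<lambda>\<theta>. G (R \<theta> (e i) (e i)) \<eta> p" and p = p, OF _ _ F(1,2) eq(1)])
      (simp_all add: R_add1 R_scale1 R_FORM F e[OF i] G_add_left_at G_scale_left_at)
  also have "\<dots> = G (R \<theta>' (e i) (e i)) \<eta>' p" using eq(2) by (simp add: G_def)
  finally show "G (e i) (e i) p * G (R \<theta> (e i) (e i)) \<eta> p = G (e i) (e i) p * G (R \<theta>' (e i) (e i)) \<eta>' p" by simp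
qed simp

end

section \<open>The cometric of a pseudo-Riemannian metric\<close>

locale pseudo_riemannian_manifold = manifold A
  for A :: "('m::{t2_space, second_countable_topology}, 'e::euclidean_space) atlas" +
  fixes h :: "'m \<Rightarrow> 'm tvec \<Rightarrow> 'm tvec \<Rightarrow> real"
  assumes pseudo_riemannian: "pseudo_riemannian_metric A h"
begin

lemma h_bilinear: "bilinear_form (TS p) (h p)"
  and h_sym: "v \<in> TS p \<Longrightarrow> w \<in> TS p \<Longrightarrow> h p v w = h p w v"
  and h_nondegenerate: "v \<in> TS p \<Longrightarrow> (\<And>w. w \<in> TS p \<Longrightarrow> h p v w = 0) \<Longrightarrow> v = 0"
  and h_smooth: "VF X \<Longrightarrow> VF Y \<Longrightarrow> (\<lambda>p. h p (X p) (Y p)) \<in> SF"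
  using pseudo_riemannian by (auto simp: pseudo_riemannian_metric_def)

lemmas h_left = bilinear_form_left[OF h_bilinear]
lemmas h_right = bilinear_form_right[OF h_bilinear]

text \<open>Fewer fields than the dimension are allowed, for the Gram-Schmidt induction on
  \<open>k\<close>.\<close>

definition field_frame :: "nat \<Rightarrow> 'm \<Rightarrow> (nat \<Rightarrow> 'm \<Rightarrow> 'm tvec) \<Rightarrow> 'm set \<Rightarrow> (nat \<Rightarrow> real) \<Rightarrow> bool" where
  "field_frame k p E U \<epsilon> \<longleftrightarrow> open U \<and> p \<in> U \<and> (\<forall>i\<in>{1..k}. VF (E i)) \<and> (\<forall>i\<in>{1..k}. \<bar>\<epsilon> i\<bar> = 1) \<and>
    (\<forall>q\<in>U. \<forall>i\<in>{1..k}. \<forall>j\<in>{1..k}. h q (E i q) (E j q) = (if i = j then \<epsilon> i else 0))"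

lemma field_frameD:
  assumes "field_frame k p E U \<epsilon>"
  shows "open U" "p \<in> U" "\<And>i. i \<in> {1..k} \<Longrightarrow> VF (E i)" "\<And>i. i \<in> {1..k} \<Longrightarrow> \<bar>\<epsilon> i\<bar> = 1"
    "\<And>q i j. q \<in> U \<Longrightarrow> i \<in> {1..k} \<Longrightarrow> j \<in> {1..k} \<Longrightarrow> h q (E i q) (E j q) = (if i = j then \<epsilon> i else 0)"
    "\<And>i. i \<in> {1..k} \<Longrightarrow> \<epsilon> i * \<epsilon> i = 1"
proof -
  show "open U" "p \<in> U" "\<And>i. i \<in> {1..k} \<Longrightarrow> VF (E i)" and ab: "\<And>i. i \<in> {1..k} \<Longrightarrow> \<bar>\<epsilon> i\<bar> = 1"
    using assms unfolding field_frame_def by blast+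
  have "\<forall>q\<in>U. \<forall>i\<in>{1..k}. \<forall>j\<in>{1..k}. h q (E i q) (E j q) = (if i = j then \<epsilon> i else 0)"
    using assms unfolding field_frame_def by (elim conjE)
  then show "\<And>q i j. q \<in> U \<Longrightarrow> i \<in> {1..k} \<Longrightarrow> j \<in> {1..k} \<Longrightarrow> h q (E i q) (E j q) = (if i = j then \<epsilon> i else 0)"
    by blast
  show "\<epsilon> i * \<epsilon> i = 1" if "i \<in> {1..k}" for i using ab[OF that] by (metis abs_mult_self_eq mult_1)
qed

lemma VF_lincomb:
  assumes "\<And>i. i \<in> I \<Longrightarrow> c i \<in> SF" "\<And>i. i \<in> I \<Longrightarrow> VF (X i)"
  shows "VF (\<lambda>q \<phi>. \<Sum>i\<in>I. c i q * X i q \<phi>)"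
  unfolding vector_field_def
proof (intro conjI allI ballI)
  show "(\<lambda>\<phi>. \<Sum>i\<in>I. c i q * X i q \<phi>) \<in> TS q" for q
    by (rule fsubspace_sum[OF fsubspace_tangent VF_tangent[OF assms(2)]])
  show "(\<lambda>q. \<Sum>i\<in>I. c i q * X i q \<phi>) \<in> SF" if "\<phi> \<in> SF" for \<phi>
    by (rule smooth_sum[OF smooth_mult[OF assms(1) VF_smooth[OF assms(2) that]]])
qed

text \<open>Otherwise the orthogonal complement would be totally isotropic, hence \<open>0\<close>, and the vectors would span.\<close>

lemma field_frame_complement:
  assumes fr: "field_frame k p E U \<epsilon>" and k: "k < DIM('e)"
  shows "\<exists>w\<in>TS p. (\<forall>i\<in>{1..k}. h p w (E i p) = 0) \<and> h p w w \<noteq> 0"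
proof (rule ccontr)
  note f = field_frameD[OF fr]
  assume no: "\<not> ?thesis"
  let ?pr = "\<lambda>v. (\<lambda>\<phi>. \<Sum>i\<in>{1..k}. (\<epsilon> i * h p v (E i p)) * E i p \<phi>)"
  have Et: "E i p \<in> TS p" if "i \<in> {1..k}" for i using VF_tangent[OF f(3)[OF that]] .
  have prT: "?pr v \<in> TS p" for v by (rule fsubspace_sum[OF fsubspace_tangent Et])
  have h_pr: "h p (?pr v) w = (\<Sum>i\<in>{1..k}. (\<epsilon> i * h p v (E i p)) * h p (E i p) w)"
    if w: "w \<in> TS p" for v w
    by (rule linear_form_sum[OF fsubspace_tangent h_left[OF w] Et])
  have perp: "h p (v - ?pr v) (E j p) = 0" if v: "v \<in> TS p" and j: "j \<in> {1..k}" for v j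
  proof -
    have "h p (?pr v) (E j p) = (\<Sum>i\<in>{1..k}. if i = j then \<epsilon> j * \<epsilon> j * h p v (E j p) else 0)"
      unfolding h_pr[OF Et[OF j]] using f(5)[OF f(2) _ j] by (intro sum.cong) auto
    also have "\<dots> = h p v (E j p)" using j f(6)[OF j] by simp
    finally show ?thesis
      using linear_form_diff[OF fsubspace_tangent h_left[OF Et[OF j]] v prT] by simp
  qed
  have iso: "h p w w = 0" if "w \<in> TS p" "\<And>i. i \<in> {1..k} \<Longrightarrow> h p w (E i p) = 0" for w
    using no that by blast
  have span: "v = ?pr v" if v: "v \<in> TS p" for v
  proof -
    let ?w = "v - ?pr v"
    have w: "?w \<in> TS p" by (rule fsubspace_diff[OF fsubspace_tangent v prT])
    have "?w = 0"
    proof (rule h_nondegenerate[OF w])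
      fix w' assume w': "w' \<in> TS p"
      let ?w' = "w' - ?pr w'"
      have w'': "?w' \<in> TS p" by (rule fsubspace_diff[OF fsubspace_tangent w' prT])
      have ww: "?w + ?w' \<in> TS p" by (rule fsubspace_add[OF fsubspace_tangent w w''])
      have "h p (?w + ?w') (?w + ?w') = 0"
      proof (rule iso[OF ww])
        fix i assume i: "i \<in> {1..k}"
        show "h p (?w + ?w') (E i p) = 0"
          using linear_form_add[OF h_left[OF Et[OF i]] w w''] perp[OF v i] perp[OF w' i] by simp
      qed
      moreover have "h p ?w ?w = 0" by (rule iso[OF w perp[OF v]])
      moreover have "h p ?w' ?w' = 0" by (rule iso[OF w'' perp[OF w']])
      \<comment> \<open>Polarisation: the two vectors of the complement and their sum are all
        null.\<close>
      ultimately have 1: "h p ?w ?w' = 0"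
        using linear_form_add[OF h_left[OF ww] w w''] linear_form_add[OF h_right[OF w] w w'']
          linear_form_add[OF h_right[OF w''] w w''] h_sym[OF w w''] by linarith
      have "h p (?pr w') ?w = (\<Sum>i\<in>{1..k}. (\<epsilon> i * h p w' (E i p)) * h p (E i p) ?w)" by (rule h_pr[OF w])
      also have "\<dots> = 0"
      proof (intro sum.neutral ballI)
        fix i assume i: "i \<in> {1..k}"
        show "(\<epsilon> i * h p w' (E i p)) * h p (E i p) ?w = 0"
          using perp[OF v i] h_sym[OF Et[OF i] w] by simp
      qed
      finally have 2: "h p ?w (?pr w') = 0" using h_sym[OF prT w] by simp
      show "h p ?w w' = 0"
        using linear_form_diff[OF fsubspace_tangent h_right[OF w] w' prT] 1 2 by simp
    qed
    then show ?thesis by simp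
  qed
  obtain \<zeta> W x X where fr': "frame_at p \<zeta> W x X" using frame_exists by metis
  note f' = frame_atD[OF fr']
  \<comment> \<open>In coordinates, the spanning property makes k vectors span a Euclidean space of
    larger dimension.\<close>
  define \<Psi> where "\<Psi> v = (\<Sum>b\<in>Basis. v (x b) *\<^sub>R (b::'e))" for v :: "'m tvec"
  have "y \<in> span ((\<lambda>i. \<Psi> (E i p)) ` {1..k})" for y
  proof -
    define v where "v = (\<lambda>\<phi>. \<Sum>b\<in>Basis. (y \<bullet> b) * X b p \<phi>)"
    have v: "v \<in> TS p" unfolding v_def by (rule fsubspace_sum[OF fsubspace_tangent VF_tangent[OF f'(6)]])
    have "v (x c) = y \<bullet> c" if c: "c \<in> Basis" for c
    proof -
      have "v (x c) = (\<Sum>b\<in>Basis. if b = c then y \<bullet> c else 0)"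
        unfolding v_def using f'(8)[OF f'(3) _ c] by (intro sum.cong) auto
      then show ?thesis using c by simp
    qed
    then have "\<Psi> v = y" unfolding \<Psi>_def by (simp add: euclidean_representation)
    moreover have "\<Psi> v = (\<Sum>i\<in>{1..k}. (\<epsilon> i * h p v (E i p)) *\<^sub>R \<Psi> (E i p))"
    proof -
      have "\<Psi> v = \<Psi> (?pr v)" by (rule arg_cong[OF span[OF v]])
      also have "\<dots> = (\<Sum>b\<in>Basis. \<Sum>i\<in>{1..k}. ((\<epsilon> i * h p v (E i p)) * E i p (x b)) *\<^sub>R b)"
        unfolding \<Psi>_def by (simp add: scaleR_sum_left)
      also have "\<dots> = (\<Sum>i\<in>{1..k}. (\<epsilon> i * h p v (E i p)) *\<^sub>R \<Psi> (E i p))"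
        unfolding \<Psi>_def by (subst sum.swap) (simp add: scaleR_sum_right)
      finally show ?thesis .
    qed
    moreover have "(\<Sum>i\<in>{1..k}. (\<epsilon> i * h p v (E i p)) *\<^sub>R \<Psi> (E i p)) \<in> span ((\<lambda>i. \<Psi> (E i p)) ` {1..k})"
      by (intro span_sum span_scale span_base imageI)
    ultimately show ?thesis by simp
  qed
  then have "dim (UNIV :: 'e set) \<le> card ((\<lambda>i. \<Psi> (E i p)) ` {1..k})"
    by (intro dim_le_card) auto
  also have "\<dots> \<le> card {1..k}" by (rule card_image_le) simp
  finally show False using k by simp
qed

text \<open>Gram-Schmidt, one field at a time. In indefinite signature an arbitrary new vector may
  become null after projection, so a non-null vector orthogonal to the earlier fields at
  \<open>p\<close> is chosen first and then extended.\<close>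

lemma field_frame_exists:
  "k \<le> DIM('e) \<Longrightarrow> \<exists>E U \<epsilon>. field_frame k p E U \<epsilon>"
proof (induction k)
  case 0
  have "field_frame 0 p (\<lambda>_ _. 0) UNIV (\<lambda>_. 1)" by (simp add: field_frame_def)
  then show ?case by (intro exI)
next
  case (Suc k)
  then obtain E U \<epsilon> where fr: "field_frame k p E U \<epsilon>" by (metis Suc_leD)
  note f = field_frameD[OF fr]
  obtain w where w: "w \<in> TS p" "\<And>i. i \<in> {1..k} \<Longrightarrow> h p w (E i p) = 0" "h p w w \<noteq> 0"
    using field_frame_complement[OF fr] Suc.prems by (metis Suc_le_lessD)
  obtain X where X: "VF X" "X p = w" by (rule VF_extension[OF w(1)])
  \<comment> \<open>Makes the extension orthogonal to the earlier fields near \<open>p\<close>. At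
    \<open>p\<close> nothing is subtracted, since \<open>w\<close> is orthogonal already, so
    \<open>Y\<close> is non-null there.\<close>
  define Y where "Y = X + vscale (\<lambda>_. -1) (\<lambda>q \<phi>. \<Sum>i\<in>{1..k}. (\<epsilon> i * h q (X q) (E i q)) * E i q \<phi>)"
  have S: "VF (\<lambda>q \<phi>. \<Sum>i\<in>{1..k}. (\<epsilon> i * h q (X q) (E i q)) * E i q \<phi>)"
    by (rule VF_lincomb[OF smooth_mult[OF smooth_const h_smooth[OF X(1) f(3)]] f(3)])
  have Y: "VF Y" unfolding Y_def by (rule VF_add[OF X(1) VF_scale[OF smooth_const S]])
  have Yq: "Y q = X q - (\<lambda>\<phi>. \<Sum>i\<in>{1..k}. (\<epsilon> i * h q (X q) (E i q)) * E i q \<phi>)" for q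
    by (simp add: Y_def vscale_def fun_eq_iff)
  have "(\<lambda>\<phi>. \<Sum>i\<in>{1..k}. (\<epsilon> i * h p (X p) (E i p)) * E i p \<phi>) = 0"
    unfolding X(2) zero_fun_def by (intro ext sum.neutral ballI) (simp only: w(2) mult_zero_left mult_zero_right)
  then have Yp: "Y p = w" unfolding Yq X(2) by simp
  have perp: "h q (Y q) (E j q) = 0" if q: "q \<in> U" and j: "j \<in> {1..k}" for q j
  proof -
    note Ej = VF_tangent[OF f(3)[OF j], of q]
    have "h q (\<lambda>\<phi>. \<Sum>i\<in>{1..k}. (\<epsilon> i * h q (X q) (E i q)) * E i q \<phi>) (E j q)
        = (\<Sum>i\<in>{1..k}. (\<epsilon> i * h q (X q) (E i q)) * h q (E i q) (E j q))"
      by (rule linear_form_sum[OF fsubspace_tangent h_left[OF Ej] VF_tangent[OF f(3)]])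
    also have "\<dots> = (\<Sum>i\<in>{1..k}. if i = j then \<epsilon> j * \<epsilon> j * h q (X q) (E j q) else 0)"
      using f(5)[OF q _ j] by (intro sum.cong) auto
    also have "\<dots> = h q (X q) (E j q)" using j f(6)[OF j] by simp
    finally show ?thesis
      unfolding Yq using linear_form_diff[OF fsubspace_tangent h_left[OF Ej] VF_tangent[OF X(1)] VF_tangent[OF S]]
      by simp
  qed
  \<comment> \<open>The sign turns the square norm of \<open>Y\<close> positive at \<open>p\<close>,
    which gives it a smooth inverse square root nearby.\<close>
  define s where "s = sgn (h p w w)"
  have s: "s * s = 1" "\<bar>s\<bar> = 1" "s * h p w w > 0" using w(3) by (auto simp: s_def sgn_if)
  have "s * h p (Y p) (Y p) > 0" using s(3) Yp by simp
  then obtain u V where u: "u \<in> SF" "open V" "p \<in> V" "\<And>q. q \<in> V \<Longrightarrow> (u q)\<^sup>2 * (s * h q (Y q) (Y q)) = 1"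
    using local_inverse_sqrt[OF smooth_mult[OF smooth_const h_smooth[OF Y Y]], of s p] by metis
  let ?E = "E(Suc k := vscale u Y)" and ?\<epsilon> = "\<epsilon>(Suc k := s)"
  have vs: "vscale u Y q = (\<lambda>\<phi>. u q * Y q \<phi>)" for q by (simp add: vscale_def)
  have N: "VF (vscale u Y)" by (rule VF_scale[OF u(1) Y])
  have new: "h q (vscale u Y q) (vscale u Y q) = s" if "q \<in> V" for q
  proof -
    note T = VF_tangent[OF Y, of q] VF_tangent[OF N, of q]
    have "h q (vscale u Y q) (vscale u Y q) = u q * (u q * h q (Y q) (Y q))"
      using linear_form_scale[OF h_left[OF T(2)] T(1), of "u q"] linear_form_scale[OF h_right[OF T(1)] T(1), of "u q"]
      by (simp add: vs)
    also have "\<dots> = s * ((u q)\<^sup>2 * (s * h q (Y q) (Y q)))" using s(1) by (simp add: power2_eq_square algebra_simps)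
    finally show ?thesis using u(4)[OF that] by simp
  qed
  have mixed: "h q (vscale u Y q) (E j q) = 0" "h q (E j q) (vscale u Y q) = 0" if q: "q \<in> U" and j: "j \<in> {1..k}" for q j
  proof -
    note T = VF_tangent[OF Y, of q] VF_tangent[OF f(3)[OF j], of q]
    show "h q (vscale u Y q) (E j q) = 0"
      using linear_form_scale[OF h_left[OF T(2)] T(1), of "u q"] perp[OF q j] by (simp add: vs)
    then show "h q (E j q) (vscale u Y q) = 0" using h_sym[OF T(2) VF_tangent[OF N]] by simp
  qed
  have "field_frame (Suc k) p ?E (U \<inter> V) ?\<epsilon>"
    unfolding field_frame_def
  proof (intro conjI ballI)
    fix q i j assume q: "q \<in> U \<inter> V" and i: "i \<in> {1..Suc k}" and j: "j \<in> {1..Suc k}"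
    have "i = Suc k \<or> i \<in> {1..k}" "j = Suc k \<or> j \<in> {1..k}" using i j by auto
    then show "h q (?E i q) (?E j q) = (if i = j then ?\<epsilon> i else 0)"
      using new[of q] mixed[of q] f(5)[of q i j] q by auto
  next
    fix i assume "i \<in> {1..Suc k}"
    then have "i = Suc k \<or> i \<in> {1..k}" by auto
    then show "VF (?E i)" "\<bar>?\<epsilon> i\<bar> = 1" using f(3,4)[of i] N s(2) by auto
  qed (use f(1,2) u(2,3) in auto)
  then show ?case by (intro exI)
qed

lemma field_frame_expansion:
  assumes fr: "field_frame DIM('e) p E U \<epsilon>" and q: "q \<in> U" and v: "v \<in> TS q"
  shows "v = (\<lambda>\<phi>. \<Sum>i\<in>{1..DIM('e)}. \<epsilon> i * h q v (E i q) * E i q \<phi>)"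
proof -
  note f = field_frameD[OF fr]
  obtain \<zeta> W x X where fr': "frame_at q \<zeta> W x X" using frame_exists by metis
  note f' = frame_atD[OF fr']
  show ?thesis
  proof (rule orthonormal_expansion[where u = "\<lambda>b. X b q" and co = "\<lambda>b v. v (x b)"])
    show "linear_form (TS q) (\<lambda>v. v (x b))" for b by (simp add: linear_form_def)
    show "v = (\<lambda>t. \<Sum>b\<in>Basis. v (x b) * X b q t)" if "v \<in> TS q" for v
      by (rule frame_tangent[OF fr' f'(3) that])
    show "h q (E i q) (E j q) = (if i = j then \<epsilon> i else 0)" if "i \<in> {1..DIM('e)}" "j \<in> {1..DIM('e)}" for i j
      by (rule f(5)[OF q that])
    show "E i q \<in> TS q" if "i \<in> {1..DIM('e)}" for i by (rule VF_tangent[OF f(3)[OF that]])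
    show "\<bar>\<epsilon> i\<bar> = 1" if "i \<in> {1..DIM('e)}" for i by (rule f(4)[OF that])
  qed (rule fsubspace_tangent h_bilinear v)+
qed

text \<open>In an orthonormal frame, the vector that represents \<open>a\<close> is the sum of
  \<epsilon>_i a(E_i) E_i.\<close>

lemma cometric_eq:
  assumes fr: "field_frame DIM('e) p E U \<epsilon>" and q: "q \<in> U" and a: "a \<in> CS q" and b: "b \<in> CS q"
  shows "cometric A h q a b = (\<Sum>i\<in>{1..DIM('e)}. \<epsilon> i * a (E i q) * b (E i q))"
proof -
  let ?I = "{1..DIM('e)}"
  note f = field_frameD[OF fr]
  let ?s = "\<lambda>a. (\<lambda>\<phi>. \<Sum>i\<in>?I. (\<epsilon> i * a (E i q)) * E i q \<phi>)"
  have Et: "E i q \<in> TS q" if "i \<in> ?I" for i by (rule VF_tangent[OF f(3)[OF that]])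
  have sT: "?s a \<in> TS q" for a by (rule fsubspace_sum[OF fsubspace_tangent Et])
  have sh: "h q (?s a) w = a w" if a: "a \<in> CS q" and w: "w \<in> TS q" for a w
  proof -
    have "h q (?s a) w = (\<Sum>i\<in>?I. (\<epsilon> i * a (E i q)) * h q (E i q) w)"
      by (rule linear_form_sum[OF fsubspace_tangent h_left[OF w] Et])
    also have "\<dots> = (\<Sum>i\<in>?I. (\<epsilon> i * h q w (E i q)) * a (E i q))"
      using h_sym[OF Et w] by (intro sum.cong) auto
    also have "\<dots> = a (\<lambda>\<phi>. \<Sum>i\<in>?I. (\<epsilon> i * h q w (E i q)) * E i q \<phi>)"
      by (rule linear_form_sum[OF fsubspace_tangent cotangentD(1)[OF a] Et, symmetric])
    also have "\<dots> = a w" by (rule arg_cong[OF field_frame_expansion[OF fr q w, symmetric]])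
    finally show ?thesis .
  qed
  have ms: "metric_sharp A h q a = ?s a" if a: "a \<in> CS q" for a
    unfolding metric_sharp_def
  proof (rule the_equality)
    show "?s a \<in> TS q \<and> (\<forall>w\<in>TS q. h q (?s a) w = a w)" using sT sh[OF a] by blast
    fix v assume v: "v \<in> TS q \<and> (\<forall>w\<in>TS q. h q v w = a w)"
    then have vT: "v \<in> TS q" by blast
    have "v - ?s a = 0"
    proof (rule h_nondegenerate[OF fsubspace_diff[OF fsubspace_tangent vT sT]])
      fix w assume w: "w \<in> TS q"
      show "h q (v - ?s a) w = 0"
        using linear_form_diff[OF fsubspace_tangent h_left[OF w] vT sT] sh[OF a w] v w by simp
    qed
    then show "v = ?s a" by simp
  qed
  have "cometric A h q a b = a (?s b)" unfolding cometric_def ms[OF a] ms[OF b] by (rule sh[OF a sT])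
  also have "\<dots> = (\<Sum>i\<in>?I. (\<epsilon> i * b (E i q)) * a (E i q))"
    by (rule linear_form_sum[OF fsubspace_tangent cotangentD(1)[OF a] Et])
  finally show ?thesis by (simp add: algebra_simps)
qed

text \<open>The pointwise inverse of \<open>metric_sharp\<close>. It turns an orthonormal frame of
  fields into an orthonormal frame of 1-forms with the same signs.\<close>

definition lower :: "('m \<Rightarrow> 'm tvec) \<Rightarrow> 'm form" where
  "lower X = (\<lambda>q v. if v \<in> TS q then h q (X q) v else 0)"

lemma lower_FORM: assumes X: "VF X" shows "FORM (lower X)"
proof -
  have "lower X q \<in> CS q" for q
    using h_right[OF VF_tangent[OF X, of q]] fsubspace_add[OF fsubspace_tangent] fsubspace_scale[OF fsubspace_tangent]
    by (simp add: cotangent_space_def lower_def linear_form_def)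
  moreover have "(\<lambda>q. lower X q (Y q)) \<in> SF" if "VF Y" for Y
    using h_smooth[OF X that] VF_tangent[OF that] by (simp add: lower_def)
  ultimately show ?thesis by (simp add: one_form_def)
qed

text \<open>All the properties can be checked near a point, where \<open>cometric_eq\<close> makes
  the cometric a diagonal sum.\<close>

lemma cometric_contravariant: "contravariant_metric A (cometric A h)"
proof -
  let ?I = "{1..DIM('e)}"
  have "bilinear_form (CS p) (cometric A h p) \<and>
      (\<forall>a\<in>CS p. \<forall>b\<in>CS p. cometric A h p a b = cometric A h p b a) \<and>
      (\<forall>a\<in>CS p. (\<forall>b\<in>CS p. cometric A h p a b = 0) \<longrightarrow> a = 0)" for p
  proof -
    obtain E U \<epsilon> where fr: "field_frame DIM('e) p E U \<epsilon>" using field_frame_exists[OF order_refl] by metis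
    note f = field_frameD[OF fr]
    note c = cometric_eq[OF fr f(2)]
    note cs = fsubspace_add[OF fsubspace_cotangent, of _ p] fsubspace_scale[OF fsubspace_cotangent, of _ p]
    have "bilinear_form (CS p) (cometric A h p)"
      by (simp add: bilinear_form_def linear_form_def c cs sum.distrib sum_distrib_left algebra_simps)
    moreover have "cometric A h p a b = cometric A h p b a" if "a \<in> CS p" "b \<in> CS p" for a b
      using that by (simp add: c algebra_simps)
    moreover have "a = 0" if a: "a \<in> CS p" and z: "\<forall>b\<in>CS p. cometric A h p a b = 0" for a
    proof -
      \<comment> \<open>Testing against \<open>lower (E j)\<close> picks out the component of
        \<open>a\<close> on \<open>E j\<close>.\<close>
      have aE: "a (E j p) = 0" if j: "j \<in> ?I" for j
      proof -
        have b: "lower (E j) p \<in> CS p" by (rule FORM_cotangent[OF lower_FORM[OF f(3)[OF j]]])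
        have "0 = (\<Sum>i\<in>?I. \<epsilon> i * a (E i p) * lower (E j) p (E i p))"
          using z b c[OF a b] by simp
        also have "\<dots> = (\<Sum>i\<in>?I. if i = j then \<epsilon> j * \<epsilon> j * a (E j p) else 0)"
          using f(5)[OF f(2) j] VF_tangent[OF f(3)] by (intro sum.cong) (auto simp: lower_def)
        finally show ?thesis using j f(6)[OF j] by simp
      qed
      show ?thesis
      proof
        fix v show "a v = 0 v"
        proof (cases "v \<in> TS p")
          case True
          have "a v = a (\<lambda>\<phi>. \<Sum>i\<in>?I. (\<epsilon> i * h p v (E i p)) * E i p \<phi>)"
            by (rule arg_cong[OF field_frame_expansion[OF fr f(2) True]])
          also have "\<dots> = (\<Sum>i\<in>?I. (\<epsilon> i * h p v (E i p)) * a (E i p))"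
            by (rule linear_form_sum[OF fsubspace_tangent cotangentD(1)[OF a] VF_tangent[OF f(3)]])
          finally show ?thesis using aE by simp
        qed (simp add: cotangentD(2)[OF a])
      qed
    qed
    ultimately show ?thesis by blast
  qed
  moreover have "(\<lambda>p. cometric A h p (\<alpha> p) (\<beta> p)) \<in> SF" if F: "FORM \<alpha>" "FORM \<beta>" for \<alpha> \<beta>
  proof (rule smooth_functions_local)
    fix p
    obtain E U \<epsilon> where fr: "field_frame DIM('e) p E U \<epsilon>" using field_frame_exists[OF order_refl] by metis
    note f = field_frameD[OF fr]
    have "(\<lambda>q. \<Sum>i\<in>?I. \<epsilon> i * \<alpha> q (E i q) * \<beta> q (E i q)) \<in> SF"
      by (intro smooth_sum smooth_mult[OF smooth_mult[OF smooth_const FORM_smooth[OF F(1) f(3)]] FORM_smooth[OF F(2) f(3)]])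
    then show "\<exists>W \<psi>. open W \<and> p \<in> W \<and> \<psi> \<in> SF \<and> (\<forall>q\<in>W. cometric A h q (\<alpha> q) (\<beta> q) = \<psi> q)"
      using f(1,2) cometric_eq[OF fr _ FORM_cotangent[OF F(1)] FORM_cotangent[OF F(2)]]
      by (intro exI[of _ U] exI[of _ "\<lambda>q. \<Sum>i\<in>?I. \<epsilon> i * \<alpha> q (E i q) * \<beta> q (E i q)"]) auto
  qed
  ultimately show ?thesis unfolding contravariant_metric_def by blast
qed

lemma cometric_frame: "\<exists>e. orthonormal_frame_at A (cometric A h) p e"
proof -
  let ?I = "{1..DIM('e)}"
  obtain E U \<epsilon> where fr: "field_frame DIM('e) p E U \<epsilon>" using field_frame_exists[OF order_refl] by metis
  note f = field_frameD[OF fr]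
  have F: "FORM (lower (E i))" if "i \<in> ?I" for i by (rule lower_FORM[OF f(3)[OF that]])
  have orth: "cometric A h q (lower (E i) q) (lower (E j) q) = (if i = j then \<epsilon> i else 0)"
    if q: "q \<in> U" and i: "i \<in> ?I" and j: "j \<in> ?I" for q i j
  proof -
    have "cometric A h q (lower (E i) q) (lower (E j) q)
        = (\<Sum>l\<in>?I. \<epsilon> l * lower (E i) q (E l q) * lower (E j) q (E l q))"
      by (rule cometric_eq[OF fr q FORM_cotangent[OF F[OF i]] FORM_cotangent[OF F[OF j]]])
    also have "\<dots> = (\<Sum>l\<in>?I. if l = i then (if i = j then \<epsilon> i * \<epsilon> i * \<epsilon> i else 0) else 0)"
      using f(5)[OF q i] f(5)[OF q j] VF_tangent[OF f(3)] by (intro sum.cong) (auto simp: lower_def)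
    also have "\<dots> = (if i = j then \<epsilon> i else 0)" using i f(6)[OF i] f(6)[OF j] by simp
    finally show ?thesis .
  qed
  have "orthonormal_frame_at A (cometric A h) p (\<lambda>i. lower (E i))"
    unfolding orthonormal_frame_at_def
  proof (intro conjI exI[of _ U] ballI)
    fix q i j assume a: "q \<in> U" "i \<in> ?I" "j \<in> ?I"
    show "if i = j then \<bar>cometric A h q (lower (E i) q) (lower (E j) q)\<bar> = 1
        else cometric A h q (lower (E i) q) (lower (E j) q) = 0"
      using orth[OF a] f(4)[OF a(2)] by (cases "i = j") simp_all
  qed (use F f(1,2) in auto)
  then show ?thesis by (rule exI[of _ "\<lambda>i. lower (E i)"])
qed

end

section \<open>Product manifolds\<close>

lemma inv_into_map_prod:
  assumes "inj_on \<kappa> U" "inj_on \<psi> V" "x \<in> \<kappa> ` U" "y \<in> \<psi> ` V"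
  shows "inv_into (U \<times> V) (map_prod \<kappa> \<psi>) (x, y) = (inv_into U \<kappa> x, inv_into V \<psi> y)"
proof (rule inv_into_f_eq)
  show "inj_on (map_prod \<kappa> \<psi>) (U \<times> V)" by (rule map_prod_inj_on[OF assms(1,2)])
qed (use assms(3,4) in \<open>auto simp: inv_into_into f_inv_into_f\<close>)

lemma smooth_on_fst: "open S \<Longrightarrow> open T \<Longrightarrow> smooth_on f S \<Longrightarrow> smooth_on (\<lambda>z. f (fst z)) (S \<times> T)"
  by (rule smooth_on_compose[OF _ _ _ smooth_on_bounded_linear[OF bounded_linear_fst]]) (auto simp: open_Times)

lemma smooth_on_snd: "open S \<Longrightarrow> open T \<Longrightarrow> smooth_on f T \<Longrightarrow> smooth_on (\<lambda>z. f (snd z)) (S \<times> T)"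
  by (rule smooth_on_compose[OF _ _ _ smooth_on_bounded_linear[OF bounded_linear_snd]]) (auto simp: open_Times)

locale manifold_product = M1: manifold A1 + M2: manifold A2
  for A1 :: "('m1::{t2_space, second_countable_topology}, 'e1::euclidean_space) atlas"
    and A2 :: "('m2::{t2_space, second_countable_topology}, 'e2::euclidean_space) atlas"
begin

lemma prod_chart_facts:
  assumes U: "(U, \<kappa>) \<in> A1" and V: "(V, \<psi>) \<in> A2"
  shows "map_prod \<kappa> \<psi> ` (U \<times> V) = \<kappa> ` U \<times> \<psi> ` V"
    "\<And>x y. x \<in> \<kappa> ` U \<Longrightarrow> y \<in> \<psi> ` V \<Longrightarrow>
      inv_into (U \<times> V) (map_prod \<kappa> \<psi>) (x, y) = (inv_into U \<kappa> x, inv_into V \<psi> y)"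
    "(U \<times> V, map_prod \<kappa> \<psi>) \<in> prod_atlas A1 A2"
proof -
  show "map_prod \<kappa> \<psi> ` (U \<times> V) = \<kappa> ` U \<times> \<psi> ` V" by force
  show "\<And>x y. x \<in> \<kappa> ` U \<Longrightarrow> y \<in> \<psi> ` V \<Longrightarrow>
      inv_into (U \<times> V) (map_prod \<kappa> \<psi>) (x, y) = (inv_into U \<kappa> x, inv_into V \<psi> y)"
    by (rule inv_into_map_prod[OF M1.chart_facts(5)[OF U] M2.chart_facts(5)[OF V]])
  show "(U \<times> V, map_prod \<kappa> \<psi>) \<in> prod_atlas A1 A2" using U V by (auto simp: prod_atlas_def)
qed

lemma prod_atlasE:
  assumes "(UV, \<kappa>\<psi>) \<in> prod_atlas A1 A2"
  obtains U \<kappa> V \<psi> where "(U, \<kappa>) \<in> A1" "(V, \<psi>) \<in> A2" "UV = U \<times> V" "\<kappa>\<psi> = map_prod \<kappa> \<psi>"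
  using assms by (auto simp: prod_atlas_def)

lemma prod_chart:
  assumes U: "(U, \<kappa>) \<in> A1" and V: "(V, \<psi>) \<in> A2"
  shows "chart (U \<times> V) (map_prod \<kappa> \<psi>)"
proof -
  note u = M1.chart_facts[OF U] and v = M2.chart_facts[OF V] and f = prod_chart_facts[OF U V]
  let ?inv = "inv_into (U \<times> V) (map_prod \<kappa> \<psi>)"
  have 1: "continuous_on (U \<times> V) (map_prod \<kappa> \<psi>)"
    unfolding map_prod_def split_def
    by (intro continuous_on_Pair continuous_on_compose2[OF u(3)] continuous_on_compose2[OF v(3)]
        continuous_on_fst continuous_on_snd continuous_on_id) auto
  have "continuous_on (\<kappa> ` U \<times> \<psi> ` V) (\<lambda>z. (inv_into U \<kappa> (fst z), inv_into V \<psi> (snd z)))"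
    by (intro continuous_on_Pair continuous_on_compose2[OF u(4)] continuous_on_compose2[OF v(4)]
        continuous_on_fst continuous_on_snd continuous_on_id) auto
  then have 2: "continuous_on (\<kappa> ` U \<times> \<psi> ` V) ?inv"
    by (rule continuous_on_eq) (use f(2) in force)
  have "?inv (map_prod \<kappa> \<psi> z) = z" if "z \<in> U \<times> V" for z
    using that f(2)[of "\<kappa> (fst z)" "\<psi> (snd z)"] u(6) v(6) by (cases z) auto
  moreover have "map_prod \<kappa> \<psi> (?inv z) = z" if "z \<in> \<kappa> ` U \<times> \<psi> ` V" for z
    using that f(2)[of "fst z" "snd z"] u(7)[of "fst z"] v(7)[of "snd z"] by (cases z) auto
  moreover have "?inv ` (\<kappa> ` U \<times> \<psi> ` V) = U \<times> V"
  proof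
    show "?inv ` (\<kappa> ` U \<times> \<psi> ` V) \<subseteq> U \<times> V" using f(2) u(7) v(7) by auto
    show "U \<times> V \<subseteq> ?inv ` (\<kappa> ` U \<times> \<psi> ` V)"
      using \<open>\<And>z. z \<in> U \<times> V \<Longrightarrow> ?inv (map_prod \<kappa> \<psi> z) = z\<close> f(1) by (metis image_eqI subsetI)
  qed
  ultimately show ?thesis
    unfolding chart_def homeomorphism_def f(1)
    using 1 2 u(1,2) v(1,2) f(1) by (simp add: open_Times)
qed

lemma prod_smooth_manifold: "smooth_manifold (prod_atlas A1 A2)"
proof -
  have cover: "p \<in> (\<Union>(U, \<phi>)\<in>prod_atlas A1 A2. U)" for p
  proof -
    obtain U \<kappa> where U: "(U, \<kappa>) \<in> A1" "fst p \<in> U" by (rule M1.chart_at)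
    obtain V \<psi> where V: "(V, \<psi>) \<in> A2" "snd p \<in> V" by (rule M2.chart_at)
    show ?thesis
      by (rule UN_I[OF prod_chart_facts(3)[OF U(1) V(1)]]) (use U(2) V(2) in \<open>simp add: mem_Times_iff\<close>)
  qed
  have key: "smooth_on (\<kappa>\<psi>' \<circ> inv_into UV \<kappa>\<psi>) (\<kappa>\<psi> ` (UV \<inter> UV'))"
    if a: "(UV, \<kappa>\<psi>) \<in> prod_atlas A1 A2" and b: "(UV', \<kappa>\<psi>') \<in> prod_atlas A1 A2" for UV \<kappa>\<psi> UV' \<kappa>\<psi>'
  proof -
    obtain U \<kappa> V \<psi> where U: "(U, \<kappa>) \<in> A1" and V: "(V, \<psi>) \<in> A2" and e: "UV = U \<times> V" "\<kappa>\<psi> = map_prod \<kappa> \<psi>"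
      by (rule prod_atlasE[OF a])
    obtain U' \<kappa>' V' \<psi>' where U': "(U', \<kappa>') \<in> A1" and V': "(V', \<psi>') \<in> A2"
      and e': "UV' = U' \<times> V'" "\<kappa>\<psi>' = map_prod \<kappa>' \<psi>'"
      by (rule prod_atlasE[OF b])
    let ?S = "\<kappa> ` (U \<inter> U')" and ?T = "\<psi> ` (V \<inter> V')"
    have o: "open ?S" "open ?T"
      using M1.chart_image_open[OF U M1.chart_facts(1)[OF U']] M2.chart_image_open[OF V M2.chart_facts(1)[OF V']] .
    have im: "\<kappa>\<psi> ` (UV \<inter> UV') = ?S \<times> ?T" unfolding e e' by force
    have sm: "smooth_on (\<lambda>z. ((\<kappa>' \<circ> inv_into U \<kappa>) (fst z), (\<psi>' \<circ> inv_into V \<psi>) (snd z))) (?S \<times> ?T)"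
      by (rule smooth_on_Pair[OF open_Times[OF o] smooth_on_fst[OF o M1.transition_smooth[OF U U']]
            smooth_on_snd[OF o M2.transition_smooth[OF V V']]])
    have "(\<kappa>\<psi>' \<circ> inv_into UV \<kappa>\<psi>) z = ((\<kappa>' \<circ> inv_into U \<kappa>) (fst z), (\<psi>' \<circ> inv_into V \<psi>) (snd z))"
      if "z \<in> ?S \<times> ?T" for z
    proof -
      have "fst z \<in> \<kappa> ` U" "snd z \<in> \<psi> ` V" using that by auto
      then show ?thesis using prod_chart_facts(2)[OF U V, of "fst z" "snd z"] by (simp add: e e')
    qed
    then show ?thesis unfolding im
      by (rule iffD2[OF smooth_on_cong[OF open_Times[OF o]] sm])
  qed
  show ?thesis
    unfolding smooth_manifold_def
  proof (intro conjI)
    show "\<forall>(U, \<phi>)\<in>prod_atlas A1 A2. chart U \<phi>" using prod_chart by (auto elim!: prod_atlasE)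
    show "(\<Union>(U, \<phi>)\<in>prod_atlas A1 A2. U) = UNIV" using cover by blast
    show "\<forall>(U, \<phi>)\<in>prod_atlas A1 A2. \<forall>(V, \<psi>)\<in>prod_atlas A1 A2.
        smooth_on (\<psi> \<circ> inv_into U \<phi>) (\<phi> ` (U \<inter> V))"
      by (intro ballI, clarify, rule key)
  qed
qed

sublocale M: manifold "prod_atlas A1 A2"
  by unfold_locales (rule prod_smooth_manifold)

lemma smooth_comp_fst: 
  assumes "\<phi> \<in> M1.SF" shows "\<phi> \<circ> fst \<in> M.SF"
proof -
  have "smooth_on ((\<phi> \<circ> fst) \<circ> inv_into UV \<kappa>\<psi>) (\<kappa>\<psi> ` UV)" if a: "(UV, \<kappa>\<psi>) \<in> prod_atlas A1 A2" for UV \<kappa>\<psi>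
  proof -
    obtain U \<kappa> V \<psi> where U: "(U, \<kappa>) \<in> A1" and V: "(V, \<psi>) \<in> A2" and e: "UV = U \<times> V" "\<kappa>\<psi> = map_prod \<kappa> \<psi>"
      by (rule prod_atlasE[OF a])
    note o = M1.chart_facts(2)[OF U] M2.chart_facts(2)[OF V]
    have "((\<phi> \<circ> fst) \<circ> inv_into UV \<kappa>\<psi>) z = (\<phi> \<circ> inv_into U \<kappa>) (fst z)" if "z \<in> \<kappa> ` U \<times> \<psi> ` V" for z
      using prod_chart_facts(2)[OF U V, of "fst z" "snd z"] that unfolding e by (simp add: mem_Times_iff)
    then show ?thesis unfolding e prod_chart_facts(1)[OF U V]
      by (rule iffD2[OF smooth_on_cong[OF open_Times[OF o]] smooth_on_fst[OF o M1.smooth_functionsD[OF assms U]]])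
  qed
  then show ?thesis unfolding smooth_functions_def by fast
qed

lemma smooth_comp_snd: 
  assumes "\<phi> \<in> M2.SF" shows "\<phi> \<circ> snd \<in> M.SF"
proof -
  have "smooth_on ((\<phi> \<circ> snd) \<circ> inv_into UV \<kappa>\<psi>) (\<kappa>\<psi> ` UV)" if a: "(UV, \<kappa>\<psi>) \<in> prod_atlas A1 A2" for UV \<kappa>\<psi>
  proof -
    obtain U \<kappa> V \<psi> where U: "(U, \<kappa>) \<in> A1" and V: "(V, \<psi>) \<in> A2" and e: "UV = U \<times> V" "\<kappa>\<psi> = map_prod \<kappa> \<psi>"
      by (rule prod_atlasE[OF a])
    note o = M1.chart_facts(2)[OF U] M2.chart_facts(2)[OF V]
    have "((\<phi> \<circ> snd) \<circ> inv_into UV \<kappa>\<psi>) z = (\<phi> \<circ> inv_into V \<psi>) (snd z)" if "z \<in> \<kappa> ` U \<times> \<psi> ` V" for z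
      using prod_chart_facts(2)[OF U V, of "fst z" "snd z"] that unfolding e by (simp add: mem_Times_iff)
    then show ?thesis unfolding e prod_chart_facts(1)[OF U V]
      by (rule iffD2[OF smooth_on_cong[OF open_Times[OF o]] smooth_on_snd[OF o M2.smooth_functionsD[OF assms V]]])
  qed
  then show ?thesis unfolding smooth_functions_def by fast
qed

lemma smooth_slice_fst:
  assumes \<phi>: "\<phi> \<in> M.SF" shows "\<phi> \<circ> (\<lambda>y. (y, snd p)) \<in> M1.SF"
proof -
  have "smooth_on ((\<phi> \<circ> (\<lambda>y. (y, snd p))) \<circ> inv_into U \<kappa>) (\<kappa> ` U)" if U: "(U, \<kappa>) \<in> A1" for U \<kappa>
  proof -
    obtain V \<psi> where V: "(V, \<psi>) \<in> A2" "snd p \<in> V" by (rule M2.chart_at)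
    note o = M1.chart_facts(2)[OF U] M2.chart_facts(2)[OF V(1)]
    note f = prod_chart_facts[OF U V(1)]
    have "smooth_on (\<lambda>x. (\<phi> \<circ> inv_into (U \<times> V) (map_prod \<kappa> \<psi>)) (x, \<psi> (snd p))) (\<kappa> ` U)"
      by (rule smooth_on_compose[OF o(1) open_Times[OF o] M.smooth_functionsD[OF \<phi> f(3), unfolded f(1)]
            smooth_on_Pair[OF o(1) smooth_on_bounded_linear[OF bounded_linear_ident o(1)] smooth_on_const[OF o(1)]]])
        (use V(2) in auto)
    moreover have "((\<phi> \<circ> (\<lambda>y. (y, snd p))) \<circ> inv_into U \<kappa>) x
        = (\<phi> \<circ> inv_into (U \<times> V) (map_prod \<kappa> \<psi>)) (x, \<psi> (snd p))" if "x \<in> \<kappa> ` U" for x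
      using f(2)[OF that imageI[OF V(2)]] M2.chart_facts(6)[OF V] by simp
    ultimately show ?thesis by (metis (no_types, lifting) smooth_on_cong[OF o(1)])
  qed
  then show ?thesis unfolding smooth_functions_def by fast
qed

lemma smooth_slice_snd:
  assumes \<phi>: "\<phi> \<in> M.SF" shows "\<phi> \<circ> (\<lambda>z. (fst p, z)) \<in> M2.SF"
proof -
  have "smooth_on ((\<phi> \<circ> (\<lambda>z. (fst p, z))) \<circ> inv_into V \<psi>) (\<psi> ` V)" if V: "(V, \<psi>) \<in> A2" for V \<psi>
  proof -
    obtain U \<kappa> where U: "(U, \<kappa>) \<in> A1" "fst p \<in> U" by (rule M1.chart_at)
    note o = M1.chart_facts(2)[OF U(1)] M2.chart_facts(2)[OF V]
    note f = prod_chart_facts[OF U(1) V]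
    have "smooth_on (\<lambda>x. (\<phi> \<circ> inv_into (U \<times> V) (map_prod \<kappa> \<psi>)) (\<kappa> (fst p), x)) (\<psi> ` V)"
      by (rule smooth_on_compose[OF o(2) open_Times[OF o] M.smooth_functionsD[OF \<phi> f(3), unfolded f(1)]
            smooth_on_Pair[OF o(2) smooth_on_const[OF o(2)] smooth_on_bounded_linear[OF bounded_linear_ident o(2)]]])
        (use U(2) in auto)
    moreover have "((\<phi> \<circ> (\<lambda>z. (fst p, z))) \<circ> inv_into V \<psi>) x
        = (\<phi> \<circ> inv_into (U \<times> V) (map_prod \<kappa> \<psi>)) (\<kappa> (fst p), x)" if "x \<in> \<psi> ` V" for x
      using f(2)[OF imageI[OF U(2)] that] M1.chart_facts(6)[OF U] by simp
    ultimately show ?thesis by (metis (no_types, lifting) smooth_on_cong[OF o(2)])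
  qed
  then show ?thesis unfolding smooth_functions_def by fast
qed

text \<open>Near a point, the coordinates of a product chart are lifted from the factors.\<close>

lemma prod_tangent_zero:
  assumes v: "v \<in> M.TS p" and v1: "\<And>\<phi>. \<phi> \<in> M1.SF \<Longrightarrow> v (\<phi> \<circ> fst) = 0"
    and v2: "\<And>\<phi>. \<phi> \<in> M2.SF \<Longrightarrow> v (\<phi> \<circ> snd) = 0"
  shows "v = 0"
proof -
  obtain U \<kappa> where U: "(U, \<kappa>) \<in> A1" "fst p \<in> U" by (rule M1.chart_at)
  obtain V \<psi> where V: "(V, \<psi>) \<in> A2" "snd p \<in> V" by (rule M2.chart_at)
  have p: "p \<in> U \<times> V" using U(2) V(2) by (simp add: mem_Times_iff)
  have 1: "\<exists>x W. open W \<and> fst p \<in> W \<and> (\<forall>b. x b \<in> M1.SF) \<and> (\<forall>b. \<forall>q\<in>W. x b q = \<kappa> q \<bullet> b)"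
    by (rule M1.local_frame_chart[OF U]) (intro exI conjI allI ballI; assumption)
  have 2: "\<exists>x W. open W \<and> snd p \<in> W \<and> (\<forall>b. x b \<in> M2.SF) \<and> (\<forall>b. \<forall>q\<in>W. x b q = \<psi> q \<bullet> b)"
    by (rule M2.local_frame_chart[OF V]) (intro exI conjI allI ballI; assumption)
  obtain x1 W1 where x1: "open W1" "fst p \<in> W1" "\<And>b. x1 b \<in> M1.SF" "\<And>b q. q \<in> W1 \<Longrightarrow> x1 b q = \<kappa> q \<bullet> b"
    using 1 by metis
  obtain x2 W2 where x2: "open W2" "snd p \<in> W2" "\<And>b. x2 b \<in> M2.SF" "\<And>b q. q \<in> W2 \<Longrightarrow> x2 b q = \<psi> q \<bullet> b"
    using 2 by metis
  show "v = 0"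
  proof (rule M.local_frame_chart[OF prod_chart_facts(3)[OF U(1) V(1)] p])
    fix \<zeta> W x X
    assume W: "open W" "p \<in> W" and z: "\<And>q. q \<in> W \<Longrightarrow> \<zeta> q = 1" and x: "\<And>b. x b \<in> M.SF"
      and xW: "\<And>b q. q \<in> W \<Longrightarrow> x b q = map_prod \<kappa> \<psi> q \<bullet> b"
      and exp: "\<And>q v \<phi>. v \<in> M.TS q \<Longrightarrow> \<zeta> q * v \<phi> = (\<Sum>b\<in>Basis. v (x b) * X b q \<phi>)"
    \<comment> \<open>On this neighbourhood each coordinate of the product chart agrees with a
      coordinate of one factor composed with its projection. \<open>v\<close> kills these, and a
      derivation is determined by its values on coordinates.\<close>
    have W': "open (W \<inter> W1 \<times> W2)" "p \<in> W \<inter> W1 \<times> W2"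
      using W x1(1,2) x2(1,2) by (auto simp: open_Times mem_Times_iff)
    have "v (x b) = 0" if b: "b \<in> Basis" for b
    proof -
      consider b1 where "b = (b1, 0)" | b2 where "b = (0, b2)" using b by (auto simp: Basis_prod_def)
      then show ?thesis
      proof cases
        case 1
        have "v (x b) = v (x1 b1 \<circ> fst)"
          by (rule M.tangent_local[OF v x smooth_comp_fst[OF x1(3)] W'])
            (auto simp: xW x1(4) 1)
        then show ?thesis using v1[OF x1(3)] by simp
      next
        case 2
        have "v (x b) = v (x2 b2 \<circ> snd)"
          by (rule M.tangent_local[OF v x smooth_comp_snd[OF x2(3)] W'])
            (auto simp: xW x2(4) 2)
        then show ?thesis using v2[OF x2(3)] by simp
      qed
    qed
    then have "v \<phi> = 0" for \<phi> using exp[OF v, of \<phi>] z[OF W(2)] by simp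
    then show "v = 0" by auto
  qed
qed

end

section \<open>Lifting along a projection\<close>

text \<open>\<open>\<iota> p\<close> is the slice of the projection \<open>\<sigma>\<close> through \<open>p\<close>.\<close>

locale projection = M: manifold A + N: manifold B
  for A :: "('m::{t2_space, second_countable_topology}, 'e::euclidean_space) atlas"
    and B :: "('n::{t2_space, second_countable_topology}, 'd::euclidean_space) atlas" +
  fixes \<sigma> :: "'m \<Rightarrow> 'n" and \<iota> :: "'m \<Rightarrow> 'n \<Rightarrow> 'm"
  assumes comp_smooth: "\<phi> \<in> N.SF \<Longrightarrow> \<phi> \<circ> \<sigma> \<in> M.SF"
    and slice_smooth: "\<psi> \<in> M.SF \<Longrightarrow> \<psi> \<circ> \<iota> p \<in> N.SF"
    and proj_slice: "\<sigma> (\<iota> p y) = y"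
    and slice_proj: "\<iota> p (\<sigma> p) = p"
begin

definition push :: "'m tvec \<Rightarrow> 'n tvec" where
  "push v = (\<lambda>\<phi>. if \<phi> \<in> N.SF then v (\<phi> \<circ> \<sigma>) else 0)"

definition embed :: "'m \<Rightarrow> 'n tvec \<Rightarrow> 'm tvec" where
  "embed p w = (\<lambda>\<psi>. if \<psi> \<in> M.SF then w (\<psi> \<circ> \<iota> p) else 0)"

abbreviation "lift \<equiv> pullback A B \<sigma>"

lemma comp_fun_simps: "(\<phi> + \<psi>) \<circ> s = (\<phi> \<circ> s) + (\<psi> \<circ> s)" "(\<lambda>x. c * \<phi> x) \<circ> s = (\<lambda>x. c * (\<phi> \<circ> s) x)"
    "(\<lambda>x. \<phi> x * \<psi> x) \<circ> s = (\<lambda>x. (\<phi> \<circ> s) x * (\<psi> \<circ> s) x)" for \<phi> \<psi> :: "'a \<Rightarrow> real"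
  by auto

lemma push_tangent: assumes v: "v \<in> M.TS p" shows "push v \<in> N.TS (\<sigma> p)"
  unfolding tangent_space_def linear_form_def mem_Collect_eq
proof (intro conjI ballI allI impI)
  fix \<phi> \<psi> assume a: "\<phi> \<in> N.SF" "\<psi> \<in> N.SF"
  show "push v (\<phi> + \<psi>) = push v \<phi> + push v \<psi>"
    using fsubspace_add[OF N.fsubspace_smooth a] a
      linear_form_add[OF M.tangentD(1)[OF v] comp_smooth[OF a(1)] comp_smooth[OF a(2)]]
    by (simp add: push_def comp_fun_simps)
  show "push v (\<lambda>x. \<phi> x * \<psi> x) = \<phi> (\<sigma> p) * push v \<psi> + \<psi> (\<sigma> p) * push v \<phi>"
    using N.smooth_mult[OF a] a M.tangentD(3)[OF v comp_smooth[OF a(1)] comp_smooth[OF a(2)]]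
    by (simp add: push_def comp_fun_simps del: comp_apply) (simp add: comp_def)
next
  fix c \<phi> assume a: "\<phi> \<in> N.SF"
  show "push v (\<lambda>x. c * \<phi> x) = c * push v \<phi>"
    using fsubspace_scale[OF N.fsubspace_smooth a, of c] a
      linear_form_scale[OF M.tangentD(1)[OF v] comp_smooth[OF a], of c]
    by (simp add: push_def comp_fun_simps del: comp_apply)
qed (simp add: push_def)

lemma embed_tangent: assumes w: "w \<in> N.TS (\<sigma> p)" shows "embed p w \<in> M.TS p"
  unfolding tangent_space_def linear_form_def mem_Collect_eq
proof (intro conjI ballI allI impI)
  fix \<phi> \<psi> assume a: "\<phi> \<in> M.SF" "\<psi> \<in> M.SF"
  show "embed p w (\<phi> + \<psi>) = embed p w \<phi> + embed p w \<psi>"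
    using fsubspace_add[OF M.fsubspace_smooth a] a
      linear_form_add[OF N.tangentD(1)[OF w] slice_smooth[OF a(1)] slice_smooth[OF a(2)]]
    by (simp add: embed_def comp_fun_simps)
  show "embed p w (\<lambda>x. \<phi> x * \<psi> x) = \<phi> p * embed p w \<psi> + \<psi> p * embed p w \<phi>"
    using M.smooth_mult[OF a] a N.tangentD(3)[OF w slice_smooth[OF a(1), of p] slice_smooth[OF a(2), of p]]
    by (simp add: embed_def comp_fun_simps del: comp_apply) (simp add: comp_def slice_proj)
next
  fix c \<phi> assume a: "\<phi> \<in> M.SF"
  show "embed p w (\<lambda>x. c * \<phi> x) = c * embed p w \<phi>"
    using fsubspace_scale[OF M.fsubspace_smooth a, of c] a
      linear_form_scale[OF N.tangentD(1)[OF w] slice_smooth[OF a], of c]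
    by (simp add: embed_def comp_fun_simps del: comp_apply)
qed (simp add: embed_def)

lemma push_add: "push (v + w) = push v + push w"
  and push_scale: "push (\<lambda>\<phi>. c * v \<phi>) = (\<lambda>\<phi>. c * push v \<phi>)"
  and embed_add: "embed p (v' + w') = embed p v' + embed p w'"
  and embed_scale: "embed p (\<lambda>\<phi>. c * v' \<phi>) = (\<lambda>\<phi>. c * embed p v' \<phi>)"
  by (auto simp: push_def embed_def fun_eq_iff)

lemma lift_eval: "v \<in> M.TS p \<Longrightarrow> lift \<omega> p v = \<omega> (\<sigma> p) (push v)"
  and lift_outside: "v \<notin> M.TS p \<Longrightarrow> lift \<omega> p v = 0"
  by (simp_all add: pullback_def push_def)

lemma lift_cotangent:
  assumes "\<omega> (\<sigma> p) \<in> N.CS (\<sigma> p)" shows "lift \<omega> p \<in> M.CS p"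
proof -
  have "linear_form (M.TS p) (lift \<omega> p)"
    unfolding linear_form_def
  proof (intro conjI ballI allI)
    fix v w assume a: "v \<in> M.TS p" "w \<in> M.TS p"
    then show "lift \<omega> p (v + w) = lift \<omega> p v + lift \<omega> p w"
      using linear_form_add[OF N.cotangentD(1)[OF assms] push_tangent[OF a(1)] push_tangent[OF a(2)]]
      by (simp add: lift_eval fsubspace_add[OF M.fsubspace_tangent] push_add)
  next
    fix c v assume a: "v \<in> M.TS p"
    then show "lift \<omega> p (\<lambda>x. c * v x) = c * lift \<omega> p v"
      using linear_form_scale[OF N.cotangentD(1)[OF assms] push_tangent[OF a]]
      by (simp add: lift_eval fsubspace_scale[OF M.fsubspace_tangent] push_scale)
  qed
  then show ?thesis by (simp add: cotangent_space_def lift_outside)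
qed

text \<open>A field X on the total space need not project to a field on the base, so smoothness is
  no mere composition. In a frame of the base, \<omega> of the pushed vector is the sum over b of
  X(x_b \<circ> \<sigma>) times \<omega>(Y_b) \<circ> \<sigma>, and each of these is smooth.\<close>

lemma lift_FORM: assumes \<omega>: "N.FORM \<omega>" shows "M.FORM (lift \<omega>)"
proof -
  have "(\<lambda>p. lift \<omega> p (X p)) \<in> M.SF" if X: "M.VF X" for X
  proof (rule M.smooth_functions_local)
    fix p
    obtain \<zeta> W x Y where fr: "N.frame_at (\<sigma> p) \<zeta> W x Y" using N.frame_exists by metis
    note f = N.frame_atD[OF fr]
    have z: "\<zeta> \<circ> \<sigma> \<in> M.SF" by (rule comp_smooth[OF f(1)])
    have "(\<zeta> \<circ> \<sigma>) p > 0" using f(4)[OF f(3)] by simp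
    \<comment> \<open>The square of \<open>u\<close> undoes, near \<open>p\<close>, the cut-off that
      the frame expansion carries.\<close>
    then obtain u V where u: "u \<in> M.SF" "open V" "p \<in> V" "\<And>q. q \<in> V \<Longrightarrow> (u q)\<^sup>2 * (\<zeta> \<circ> \<sigma>) q = 1"
      using M.local_inverse_sqrt[OF z] by metis
    let ?F = "\<lambda>q. (u q * u q) * (\<Sum>b\<in>Basis. X q (x b \<circ> \<sigma>) * ((\<lambda>y. \<omega> y (Y b y)) \<circ> \<sigma>) q)"
    have "?F \<in> M.SF"
      by (intro M.smooth_mult[OF M.smooth_mult[OF u(1) u(1)]] M.smooth_sum
          M.smooth_mult[OF M.VF_smooth[OF X comp_smooth[OF f(5)]] comp_smooth[OF N.FORM_smooth[OF \<omega> f(6)]]])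
    moreover have "lift \<omega> q (X q) = ?F q" if q: "q \<in> V" for q
    proof -
      let ?w = "push (X q)"
      have Xq: "X q \<in> M.TS q" by (rule M.VF_tangent[OF X])
      have w: "?w \<in> N.TS (\<sigma> q)" by (rule push_tangent[OF Xq])
      have "\<zeta> (\<sigma> q) * \<omega> (\<sigma> q) ?w = \<omega> (\<sigma> q) (\<lambda>\<phi>. \<zeta> (\<sigma> q) * ?w \<phi>)"
        by (rule N.FORM_tangent_scale[OF \<omega> w, symmetric])
      also have "\<dots> = \<omega> (\<sigma> q) (\<lambda>\<phi>. \<Sum>b\<in>Basis. ?w (x b) * Y b (\<sigma> q) \<phi>)"
        by (intro arg_cong[of _ _ "\<omega> (\<sigma> q)"] ext f(7) w)
      also have "\<dots> = (\<Sum>b\<in>Basis. ?w (x b) * \<omega> (\<sigma> q) (Y b (\<sigma> q)))"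
        by (rule linear_form_sum[OF N.fsubspace_tangent N.cotangentD(1)[OF N.FORM_cotangent[OF \<omega>]]
              N.VF_tangent[OF f(6)]])
      also have "\<dots> = (\<Sum>b\<in>Basis. X q (x b \<circ> \<sigma>) * ((\<lambda>y. \<omega> y (Y b y)) \<circ> \<sigma>) q)"
        using f(5) by (simp add: push_def)
      finally have "?F q = ((u q)\<^sup>2 * (\<zeta> \<circ> \<sigma>) q) * \<omega> (\<sigma> q) ?w"
        by (simp add: power2_eq_square)
      then show ?thesis using u(4)[OF q] lift_eval[OF Xq] by simp
    qed
    ultimately show "\<exists>W \<psi>. open W \<and> p \<in> W \<and> \<psi> \<in> M.SF \<and> (\<forall>q\<in>W. lift \<omega> q (X q) = \<psi> q)"
      using u(2,3) by (intro exI[of _ V] exI[of _ ?F]) blast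
  qed
  then show ?thesis using lift_cotangent[of \<omega>, OF N.FORM_cotangent[OF \<omega>]] by (simp add: one_form_def)
qed

lemma lift_differential: assumes "\<phi> \<in> N.SF" shows "lift (N.d \<phi>) = M.d (\<phi> \<circ> \<sigma>)"
proof (intro ext)
  fix p v show "lift (N.d \<phi>) p v = M.d (\<phi> \<circ> \<sigma>) p v"
  proof (cases "v \<in> M.TS p")
    case True
    have "lift (N.d \<phi>) p v = push v \<phi>"
      by (simp add: lift_eval[OF True] N.differential_eval[OF push_tangent[OF True]])
    then show ?thesis by (simp add: M.differential_eval[OF True] push_def assms)
  next
    case False
    then show ?thesis by (simp add: lift_outside) (simp add: differential_def)
  qed
qed

lemma lift_add: "lift (\<alpha> + \<beta>) = lift \<alpha> + lift \<beta>"
  and lift_diff: "lift (\<alpha> - \<beta>) = lift \<alpha> - lift \<beta>"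
  and lift_scale: "lift (fscale \<phi> \<alpha>) = fscale (\<phi> \<circ> \<sigma>) (lift \<alpha>)"
  and lift_zero: "lift 0 = 0"
  by (auto simp: pullback_def fscale_def fun_eq_iff)

end

text \<open>A product seen through its projections: the slices of one lie in the fibres of the
  other, and functions pulled back from the factors detect tangent vectors. As no pairs occur,
  exchanging the factors is a mere change of parameters.\<close>

locale two_projections = S: projection A B1 \<sigma> \<iota> + T: projection A B2 \<tau> \<kappa>
  for A :: "('m::{t2_space, second_countable_topology}, 'e::euclidean_space) atlas"
    and B1 :: "('n1::{t2_space, second_countable_topology}, 'd1::euclidean_space) atlas"
    and B2 :: "('n2::{t2_space, second_countable_topology}, 'd2::euclidean_space) atlas"
    and \<sigma> \<iota> \<tau> \<kappa> +
  assumes cross_ST: "\<tau> (\<iota> p y) = \<tau> p" and cross_TS: "\<sigma> (\<kappa> p z) = \<sigma> p"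
    and tangent_zero: "v \<in> S.M.TS p \<Longrightarrow> (\<And>\<phi>. \<phi> \<in> S.N.SF \<Longrightarrow> v (\<phi> \<circ> \<sigma>) = 0) \<Longrightarrow>
      (\<And>\<psi>. \<psi> \<in> T.N.SF \<Longrightarrow> v (\<psi> \<circ> \<tau>) = 0) \<Longrightarrow> v = 0"
begin

lemma tangent_decomposition:
  assumes v: "v \<in> S.M.TS p"
  shows "v = S.embed p (S.push v) + T.embed p (T.push v)"
proof -
  let ?s = "S.embed p (S.push v)" and ?t = "T.embed p (T.push v)"
  have st: "?s \<in> S.M.TS p" "?t \<in> S.M.TS p"
    by (rule S.embed_tangent[OF S.push_tangent[OF v]] T.embed_tangent[OF T.push_tangent[OF v]])+
  have "v - (?s + ?t) = 0"
  proof (rule tangent_zero)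
    show "v - (?s + ?t) \<in> S.M.TS p"
      by (rule fsubspace_diff[OF S.M.fsubspace_tangent v fsubspace_add[OF S.M.fsubspace_tangent st]])
    fix \<phi> assume \<phi>: "\<phi> \<in> S.N.SF"
    \<comment> \<open>A function from the first factor is constant along the slice of the second, so
      the second summand of the decomposition kills it.\<close>
    have "\<phi> \<circ> \<sigma> \<circ> \<iota> p = \<phi>" "\<phi> \<circ> \<sigma> \<circ> \<kappa> p = (\<lambda>_. \<phi> (\<sigma> p))"
      by (simp_all add: fun_eq_iff S.proj_slice cross_TS)
    then show "(v - (?s + ?t)) (\<phi> \<circ> \<sigma>) = 0"
      using S.comp_smooth[OF \<phi>] \<phi> T.N.tangent_const[OF T.push_tangent[OF v]]
      by (simp add: S.embed_def T.embed_def S.push_def)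
  next
    fix \<psi> assume \<psi>: "\<psi> \<in> T.N.SF"
    have "\<psi> \<circ> \<tau> \<circ> \<kappa> p = \<psi>" "\<psi> \<circ> \<tau> \<circ> \<iota> p = (\<lambda>_. \<psi> (\<tau> p))"
      by (simp_all add: fun_eq_iff T.proj_slice cross_ST)
    then show "(v - (?s + ?t)) (\<psi> \<circ> \<tau>) = 0"
      using T.comp_smooth[OF \<psi>] \<psi> S.N.tangent_const[OF S.push_tangent[OF v]]
      by (simp add: S.embed_def T.embed_def T.push_def)
  qed
  then show ?thesis by simp
qed

text \<open>Restrict \<open>a\<close> to the two slices through \<open>p\<close> and extend the
  restrictions to 1-forms on the factors. Statements that depend on forms only through their values
  at a point thereby reduce to lifts.\<close>

lemma cotangent_decomposition:
  assumes a: "a \<in> S.M.CS p"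
  shows "\<exists>\<alpha> \<beta>. S.N.FORM \<alpha> \<and> T.N.FORM \<beta> \<and> a = S.lift \<alpha> p + T.lift \<beta> p"
proof -
  note la = S.M.cotangentD(1)[OF a]
  let ?a1 = "\<lambda>w. if w \<in> S.N.TS (\<sigma> p) then a (S.embed p w) else 0"
  let ?a2 = "\<lambda>w. if w \<in> T.N.TS (\<tau> p) then a (T.embed p w) else 0"
  have "?a1 \<in> S.N.CS (\<sigma> p)"
    using linear_form_add[OF la S.embed_tangent S.embed_tangent] linear_form_scale[OF la S.embed_tangent]
      fsubspace_add[OF S.N.fsubspace_tangent] fsubspace_scale[OF S.N.fsubspace_tangent]
    by (simp add: cotangent_space_def linear_form_def S.embed_add S.embed_scale)
  then obtain \<alpha> where \<alpha>: "S.N.FORM \<alpha>" "\<alpha> (\<sigma> p) = ?a1" by (rule S.N.FORM_extension)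
  have "?a2 \<in> T.N.CS (\<tau> p)"
    using linear_form_add[OF la T.embed_tangent T.embed_tangent] linear_form_scale[OF la T.embed_tangent]
      fsubspace_add[OF T.N.fsubspace_tangent] fsubspace_scale[OF T.N.fsubspace_tangent]
    by (simp add: cotangent_space_def linear_form_def T.embed_add T.embed_scale)
  then obtain \<beta> where \<beta>: "T.N.FORM \<beta>" "\<beta> (\<tau> p) = ?a2" by (rule T.N.FORM_extension)
  have "a = S.lift \<alpha> p + T.lift \<beta> p"
  proof
    fix v show "a v = (S.lift \<alpha> p + T.lift \<beta> p) v"
    proof (cases "v \<in> S.M.TS p")
      case True
      note pt = S.push_tangent[OF True] T.push_tangent[OF True]
      have "a v = a (S.embed p (S.push v) + T.embed p (T.push v))"
        by (rule arg_cong[OF tangent_decomposition[OF True]])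
      also have "\<dots> = a (S.embed p (S.push v)) + a (T.embed p (T.push v))"
        by (rule linear_form_add[OF la S.embed_tangent[OF pt(1)] T.embed_tangent[OF pt(2)]])
      also have "\<dots> = (S.lift \<alpha> p + T.lift \<beta> p) v"
        using True pt \<alpha>(2) \<beta>(2) by (simp add: S.lift_eval T.lift_eval)
      finally show ?thesis .
    qed (simp add: S.M.cotangentD(2)[OF a] S.lift_outside T.lift_outside)
  qed
  then show ?thesis using \<alpha>(1) \<beta>(1) by blast
qed

lemma swapped: "two_projections A B2 B1 \<tau> \<kappa> \<sigma> \<iota>"
  by unfold_locales (use cross_ST cross_TS tangent_zero in blast)+

end

context manifold_product
begin

lemma product_projections:
  "two_projections (prod_atlas A1 A2) A1 A2 fst (\<lambda>p y. (y, snd p)) snd (\<lambda>p z. (fst p, z))"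
proof unfold_locales
  show "\<phi> \<circ> fst \<in> M.SF" if "\<phi> \<in> M1.SF" for \<phi> using that by (rule smooth_comp_fst)
  show "\<psi> \<circ> (\<lambda>y. (y, snd p)) \<in> M1.SF" if "\<psi> \<in> M.SF" for \<psi> and p :: "'m1 \<times> 'm2"
    using that by (rule smooth_slice_fst)
  show "\<phi> \<circ> snd \<in> M.SF" if "\<phi> \<in> M2.SF" for \<phi> using that by (rule smooth_comp_snd)
  show "\<psi> \<circ> (\<lambda>z. (fst p, z)) \<in> M2.SF" if "\<psi> \<in> M.SF" for \<psi> and p :: "'m1 \<times> 'm2"
    using that by (rule smooth_slice_snd)
  show "v = 0" if "v \<in> M.TS p" "\<And>\<phi>. \<phi> \<in> M1.SF \<Longrightarrow> v (\<phi> \<circ> fst) = 0"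
    "\<And>\<psi>. \<psi> \<in> M2.SF \<Longrightarrow> v (\<psi> \<circ> snd) = 0" for v p
    using that by (rule prod_tangent_zero)
qed simp_all

end

section \<open>Warped products\<close>

text \<open>The roles of the two factors are symmetric: on lifts from the \<open>i\<close>-th factor, the bivector field is
  \<open>m\<^sub>i P\<^sub>i\<close> and the metric is \<open>c\<^sub>i g\<^sub>i\<close>.\<close>

locale warped_product = M: metric_manifold A P g + N1: metric_manifold B1 P1 g1
    + N2: metric_manifold B2 P2 g2 + two_projections A B1 B2 \<sigma> \<iota> \<tau> \<kappa>
  for A :: "('m::{t2_space, second_countable_topology}, 'e::euclidean_space) atlas"
    and B1 :: "('n1::{t2_space, second_countable_topology}, 'd1::euclidean_space) atlas"
    and B2 :: "('n2::{t2_space, second_countable_topology}, 'd2::euclidean_space) atlas"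
    and \<sigma> \<iota> \<tau> \<kappa> P g P1 g1 P2 g2 +
  fixes m1 c1 m2 c2 :: "'m \<Rightarrow> real"
  assumes m_smooth: "m1 \<in> M.SF" "m2 \<in> M.SF" and c_smooth: "c1 \<in> M.SF" "c2 \<in> M.SF"
    and m_const: "v \<in> M.TS p \<Longrightarrow> v m1 = 0" "v \<in> M.TS p \<Longrightarrow> v m2 = 0"
    and c_casimir: "M.FORM \<omega> \<Longrightarrow> M.sh \<omega> p c1 = 0" "M.FORM \<omega> \<Longrightarrow> M.sh \<omega> p c2 = 0"
    and c_pos: "c1 p > 0" "c2 p > 0"
    and P_SS: "N1.FORM \<alpha> \<Longrightarrow> N1.FORM \<beta> \<Longrightarrow> P p (S.lift \<alpha> p) (S.lift \<beta> p) = m1 p * P1 (\<sigma> p) (\<alpha> (\<sigma> p)) (\<beta> (\<sigma> p))"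
    and P_TT: "N2.FORM \<alpha>' \<Longrightarrow> N2.FORM \<beta>' \<Longrightarrow> P p (T.lift \<alpha>' p) (T.lift \<beta>' p) = m2 p * P2 (\<tau> p) (\<alpha>' (\<tau> p)) (\<beta>' (\<tau> p))"
    and P_ST: "N1.FORM \<alpha> \<Longrightarrow> N2.FORM \<beta>' \<Longrightarrow> P p (S.lift \<alpha> p) (T.lift \<beta>' p) = 0"
    and g_SS: "N1.FORM \<alpha> \<Longrightarrow> N1.FORM \<beta> \<Longrightarrow> g p (S.lift \<alpha> p) (S.lift \<beta> p) = c1 p * g1 (\<sigma> p) (\<alpha> (\<sigma> p)) (\<beta> (\<sigma> p))"
    and g_TT: "N2.FORM \<alpha>' \<Longrightarrow> N2.FORM \<beta>' \<Longrightarrow> g p (T.lift \<alpha>' p) (T.lift \<beta>' p) = c2 p * g2 (\<tau> p) (\<alpha>' (\<tau> p)) (\<beta>' (\<tau> p))"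
    and g_ST: "N1.FORM \<alpha> \<Longrightarrow> N2.FORM \<beta>' \<Longrightarrow> g p (S.lift \<alpha> p) (T.lift \<beta>' p) = 0"
begin

lemma P_TS: "N2.FORM \<beta> \<Longrightarrow> N1.FORM \<alpha> \<Longrightarrow> P p (T.lift \<beta> p) (S.lift \<alpha> p) = 0"
  using M.P_antisym[OF M.FORM_cotangent[OF T.lift_FORM] M.FORM_cotangent[OF S.lift_FORM]] P_ST by simp

lemma g_TS: "N2.FORM \<beta> \<Longrightarrow> N1.FORM \<alpha> \<Longrightarrow> g p (T.lift \<beta> p) (S.lift \<alpha> p) = 0"
  using M.g_sym[OF M.FORM_cotangent[OF T.lift_FORM] M.FORM_cotangent[OF S.lift_FORM]] g_ST by simp

text \<open>The locale interpreted in itself with the factors exchanged, so that each fact about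
  lifts from the first factor has a mirror image for the second.\<close>

sublocale swap: warped_product A B2 B1 \<tau> \<kappa> \<sigma> \<iota> P g P2 g2 P1 g1 m2 c2 m1 c1
proof -
  interpret two_projections A B2 B1 \<tau> \<kappa> \<sigma> \<iota> by (rule swapped)
  show "warped_product A B2 B1 \<tau> \<kappa> \<sigma> \<iota> P g P2 g2 P1 g1 m2 c2 m1 c1"
    by unfold_locales (fact m_smooth c_smooth m_const c_casimir c_pos P_SS P_TT P_TS g_SS g_TT g_TS)+
qed

section \<open>Anchor maps and Koszul brackets of lifted forms\<close>

lemma sh_m: "M.FORM \<alpha> \<Longrightarrow> M.sh \<alpha> p m1 = 0"
  by (rule m_const(1)[OF M.VF_tangent[OF M.anchor_VF]])

lemma sh_lift: 
  assumes "N1.FORM \<alpha>" "\<phi> \<in> N1.SF"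
  shows "M.sh (S.lift \<alpha>) p (\<phi> \<circ> \<sigma>) = m1 p * N1.sh \<alpha> (\<sigma> p) \<phi>"
  using P_SS[OF assms(1) N1.FORM_differential[OF assms(2)], of p]
  by (simp add: M.anchor_eval[OF S.lift_FORM[OF assms(1)] S.comp_smooth[OF assms(2)]]
      N1.anchor_eval[OF assms] S.lift_differential[OF assms(2)])

lemma sh_lift_cross: 
  assumes "N1.FORM \<alpha>" "\<psi> \<in> N2.SF"
  shows "M.sh (S.lift \<alpha>) p (\<psi> \<circ> \<tau>) = 0"
  using P_ST[OF assms(1) N2.FORM_differential[OF assms(2)], of p]
  by (simp add: M.anchor_eval[OF S.lift_FORM[OF assms(1)] T.comp_smooth[OF assms(2)]]
      T.lift_differential[OF assms(2)])

lemma d_mult_m: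
  assumes "\<phi> \<in> M.SF" shows "M.d (\<lambda>p. m1 p * \<phi> p) = fscale m1 (M.d \<phi>)"
proof (intro ext)
  fix p v show "M.d (\<lambda>p. m1 p * \<phi> p) p v = fscale m1 (M.d \<phi>) p v"
    using M.tangentD(3)[OF _ m_smooth(1) assms, of v p] m_const(1)[of v p]
    by (simp add: differential_def fscale_def)
qed

lemma koszul_lift_exact:
  assumes "\<phi> \<in> N1.SF" "\<psi> \<in> N1.SF"
  shows "M.kb (S.lift (N1.d \<phi>)) (S.lift (N1.d \<psi>)) = fscale m1 (S.lift (N1.kb (N1.d \<phi>) (N1.d \<psi>)))"
proof -
  let ?b = "\<lambda>y. P1 y (N1.d \<phi> y) (N1.d \<psi> y)"
  note F = N1.FORM_differential[OF assms(1)] N1.FORM_differential[OF assms(2)]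
  have b: "?b \<in> N1.SF" by (rule N1.P_smooth[OF F])
  have "M.kb (S.lift (N1.d \<phi>)) (S.lift (N1.d \<psi>)) = M.d (\<lambda>p. P p (S.lift (N1.d \<phi>) p) (S.lift (N1.d \<psi>) p))"
    unfolding S.lift_differential[OF assms(1)] S.lift_differential[OF assms(2)]
    by (rule M.koszul_exact[OF S.comp_smooth[OF assms(1)] S.comp_smooth[OF assms(2)]])
  also have "\<dots> = M.d (\<lambda>p. m1 p * (?b \<circ> \<sigma>) p)" by (simp add: P_SS F)
  also have "\<dots> = fscale m1 (S.lift (N1.d ?b))"
    unfolding S.lift_differential[OF b] by (rule d_mult_m[OF S.comp_smooth[OF b]])
  finally show ?thesis by (simp add: N1.koszul_exact assms)
qed

text \<open>Neither bracket is linear over functions, but the difference is: by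
  \<open>sh_lift\<close> both produce the same derivative of \<open>\<phi>\<close>.\<close>

lemma koszul_lift_scale:
  assumes F: "N1.FORM \<alpha>" "N1.FORM \<beta>" and \<phi>: "\<phi> \<in> N1.SF"
  shows "M.kb (S.lift \<alpha>) (S.lift (fscale \<phi> \<beta>)) p v - fscale m1 (S.lift (N1.kb \<alpha> (fscale \<phi> \<beta>))) p v
    = \<phi> (\<sigma> p) * (M.kb (S.lift \<alpha>) (S.lift \<beta>) p v - fscale m1 (S.lift (N1.kb \<alpha> \<beta>)) p v)"
  unfolding N1.koszul_scale_right[OF F \<phi>] S.lift_add S.lift_scale
    M.koszul_scale_right[OF S.lift_FORM[OF F(1)] S.lift_FORM[OF F(2)] S.comp_smooth[OF \<phi>]] sh_lift[OF F(1) \<phi>]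
  by (simp add: fscale_def algebra_simps)

lemma koszul_lift_add:
  assumes F: "N1.FORM \<alpha>" "N1.FORM \<beta>" "N1.FORM \<gamma>"
  shows "M.kb (S.lift \<alpha>) (S.lift (\<beta> + \<gamma>)) p v - fscale m1 (S.lift (N1.kb \<alpha> (\<beta> + \<gamma>))) p v
    = (M.kb (S.lift \<alpha>) (S.lift \<beta>) p v - fscale m1 (S.lift (N1.kb \<alpha> \<beta>)) p v)
      + (M.kb (S.lift \<alpha>) (S.lift \<gamma>) p v - fscale m1 (S.lift (N1.kb \<alpha> \<gamma>)) p v)"
  unfolding N1.koszul_add_right[OF F] S.lift_add
    M.koszul_add_right[OF S.lift_FORM[OF F(1)] S.lift_FORM[OF F(2)] S.lift_FORM[OF F(3)]]
  by (simp add: fscale_def algebra_simps)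

lemma koszul_lift_antisym:
  assumes F: "N1.FORM \<alpha>" "N1.FORM \<beta>"
  shows "M.kb (S.lift \<alpha>) (S.lift \<beta>) p v - fscale m1 (S.lift (N1.kb \<alpha> \<beta>)) p v
    = - (M.kb (S.lift \<beta>) (S.lift \<alpha>) p v - fscale m1 (S.lift (N1.kb \<beta> \<alpha>)) p v)"
proof -
  have "S.lift (N1.kb \<alpha> \<beta>) = S.lift (0 - N1.kb \<beta> \<alpha>)" using N1.koszul_antisym[OF F] by simp
  then have "S.lift (N1.kb \<alpha> \<beta>) = - S.lift (N1.kb \<beta> \<alpha>)" unfolding S.lift_diff S.lift_zero by simp
  then show ?thesis
    using M.koszul_antisym[OF S.lift_FORM[OF F(1)] S.lift_FORM[OF F(2)]] by (simp add: fscale_def)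
qed

text \<open>The difference of the two sides is antisymmetric, and linear over functions of the
  factor in its second argument; so the two arguments can be reduced to exact forms one after the
  other.\<close>

lemma koszul_lift:
  assumes F: "N1.FORM \<alpha>" "N1.FORM \<beta>"
  shows "M.kb (S.lift \<alpha>) (S.lift \<beta>) = fscale m1 (S.lift (N1.kb \<alpha> \<beta>))"
proof (intro ext)
  fix p v
  let ?F = "\<lambda>\<alpha> \<beta>. M.kb (S.lift \<alpha>) (S.lift \<beta>) p v - fscale m1 (S.lift (N1.kb \<alpha> \<beta>)) p v"
  have z: "?F \<alpha> \<beta> = 0" if "N1.FORM \<alpha>" "N1.FORM \<beta>" "\<And>\<phi>. \<phi> \<in> N1.SF \<Longrightarrow> ?F \<alpha> (N1.d \<phi>) = 0" for \<alpha> \<beta>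
    by (rule N1.form_tensorial_zero[where F = "?F \<alpha>" and p = "\<sigma> p", OF koszul_lift_add[OF that(1)]
          koszul_lift_scale[OF that(1)] that(3,2)])
  have "?F \<beta> (N1.d \<phi>) = 0" if "\<phi> \<in> N1.SF" for \<phi>
  proof -
    note d = N1.FORM_differential[OF that]
    have "?F (N1.d \<phi>) \<beta> = 0"
      by (rule z[OF d F(2)]) (simp add: koszul_lift_exact that)
    then show ?thesis using koszul_lift_antisym[OF F(2) d, of p v] by simp
  qed
  then have "?F \<beta> \<alpha> = 0" by (rule z[OF F(2,1)])
  then show "M.kb (S.lift \<alpha>) (S.lift \<beta>) p v = fscale m1 (S.lift (N1.kb \<alpha> \<beta>)) p v"
    using koszul_lift_antisym[OF F, of p v] by simp
qed

text \<open>The context is reopened, here and below, to make the mirror images \<open>swap\<close> of the preceding lemmas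
  available.\<close>

end

context warped_product
begin

text \<open>The anchor of a lift kills functions from the other factor, so this bracket is itself
  linear over functions of either factor. On exact forms it is the differential of a mixed value of
  \<open>P\<close>, which is 0.\<close>

lemma koszul_lift_cross:
  assumes F: "N1.FORM \<alpha>" "N2.FORM \<beta>"
  shows "M.kb (S.lift \<alpha>) (T.lift \<beta>) = 0"
proof -
  have "M.kb (S.lift \<alpha>) (T.lift \<beta>) p v = 0" for p v
  proof (rule N1.form_tensorial_zero[where F = "\<lambda>\<alpha>. M.kb (S.lift \<alpha>) (T.lift \<beta>) p v" and p = "\<sigma> p", OF _ _ _ F(1)])
    note lb = T.lift_FORM[OF F(2)]
    show "M.kb (S.lift (\<alpha> + \<alpha>')) (T.lift \<beta>) p v = M.kb (S.lift \<alpha>) (T.lift \<beta>) p v + M.kb (S.lift \<alpha>') (T.lift \<beta>) p v"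
      if "N1.FORM \<alpha>" "N1.FORM \<alpha>'" for \<alpha> \<alpha>'
      unfolding S.lift_add M.koszul_add_left[OF S.lift_FORM[OF that(1)] S.lift_FORM[OF that(2)] lb] by simp
    show "M.kb (S.lift (fscale \<phi> \<alpha>)) (T.lift \<beta>) p v = \<phi> (\<sigma> p) * M.kb (S.lift \<alpha>) (T.lift \<beta>) p v"
      if "\<phi> \<in> N1.SF" "N1.FORM \<alpha>" for \<phi> \<alpha>
      unfolding S.lift_scale M.koszul_scale_left[OF S.lift_FORM[OF that(2)] lb S.comp_smooth[OF that(1)]]
        swap.sh_lift_cross[OF F(2) that(1)]
      by (simp add: fscale_def)
    fix \<phi> assume \<phi>: "\<phi> \<in> N1.SF"
    note lf = S.lift_FORM[OF N1.FORM_differential[OF \<phi>]]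
    show "M.kb (S.lift (N1.d \<phi>)) (T.lift \<beta>) p v = 0"
    proof (rule N2.form_tensorial_zero[where F = "\<lambda>\<beta>. M.kb (S.lift (N1.d \<phi>)) (T.lift \<beta>) p v" and p = "\<tau> p", OF _ _ _ F(2)])
      show "M.kb (S.lift (N1.d \<phi>)) (T.lift (\<beta> + \<beta>')) p v
          = M.kb (S.lift (N1.d \<phi>)) (T.lift \<beta>) p v + M.kb (S.lift (N1.d \<phi>)) (T.lift \<beta>') p v"
        if "N2.FORM \<beta>" "N2.FORM \<beta>'" for \<beta> \<beta>'
        unfolding T.lift_add M.koszul_add_right[OF lf T.lift_FORM[OF that(1)] T.lift_FORM[OF that(2)]] by simp
      show "M.kb (S.lift (N1.d \<phi>)) (T.lift (fscale \<psi> \<beta>)) p v = \<psi> (\<tau> p) * M.kb (S.lift (N1.d \<phi>)) (T.lift \<beta>) p v"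
        if "\<psi> \<in> N2.SF" "N2.FORM \<beta>" for \<psi> \<beta>
        unfolding T.lift_scale M.koszul_scale_right[OF lf T.lift_FORM[OF that(2)] T.comp_smooth[OF that(1)]]
          sh_lift_cross[OF N1.FORM_differential[OF \<phi>] that(1)]
        by (simp add: fscale_def)
      fix \<psi> assume \<psi>: "\<psi> \<in> N2.SF"
      have "M.kb (S.lift (N1.d \<phi>)) (T.lift (N2.d \<psi>)) = M.d (\<lambda>p. P p (S.lift (N1.d \<phi>) p) (T.lift (N2.d \<psi>) p))"
        unfolding S.lift_differential[OF \<phi>] T.lift_differential[OF \<psi>]
        by (rule M.koszul_exact[OF S.comp_smooth[OF \<phi>] T.comp_smooth[OF \<psi>]])
      also have "\<dots> = M.d (\<lambda>_. 0)" by (simp add: P_ST N1.FORM_differential N2.FORM_differential \<phi> \<psi>)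
      finally show "M.kb (S.lift (N1.d \<phi>)) (T.lift (N2.d \<psi>)) p v = 0"
        using M.tangent_const[of v p 0] by (simp add: differential_def)
    qed
  qed
  then show ?thesis by (simp add: fun_eq_iff)
qed

section \<open>The metric terms of the Koszul formula on lifts\<close>

lemma G_lift: "N1.FORM \<alpha> \<Longrightarrow> N1.FORM \<beta> \<Longrightarrow> M.G (S.lift \<alpha>) (S.lift \<beta>) = (\<lambda>p. c1 p * (N1.G \<alpha> \<beta> \<circ> \<sigma>) p)"
  by (simp add: fun_eq_iff M.G_def N1.G_def g_SS)

lemma G_lift_cross: "N1.FORM \<alpha> \<Longrightarrow> N2.FORM \<beta> \<Longrightarrow> M.G (S.lift \<alpha>) (T.lift \<beta>) = (\<lambda>_. 0)"
  by (simp add: fun_eq_iff M.G_def g_ST)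

text \<open>Lifts from the two factors span each cotangent space, so a nondegenerate pairing may be
  tested on them.\<close>

lemma form_eqI_lift:
  assumes F: "M.FORM \<alpha>" "M.FORM \<beta>"
    and "\<And>\<gamma>. N1.FORM \<gamma> \<Longrightarrow> M.G \<alpha> (S.lift \<gamma>) p = M.G \<beta> (S.lift \<gamma>) p"
    and "\<And>\<gamma>. N2.FORM \<gamma> \<Longrightarrow> M.G \<alpha> (T.lift \<gamma>) p = M.G \<beta> (T.lift \<gamma>) p"
  shows "\<alpha> p = \<beta> p"
proof (rule M.form_eqI_G[OF F])
  fix \<gamma> assume \<gamma>: "M.FORM \<gamma>"
  obtain \<gamma>1 \<gamma>2 where d: "N1.FORM \<gamma>1" "N2.FORM \<gamma>2" "\<gamma> p = S.lift \<gamma>1 p + T.lift \<gamma>2 p"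
    using cotangent_decomposition[OF M.FORM_cotangent[OF \<gamma>]] by blast
  have "M.G \<delta> \<gamma> p = M.G \<delta> (S.lift \<gamma>1) p + M.G \<delta> (T.lift \<gamma>2) p" if "M.FORM \<delta>" for \<delta>
  proof -
    have "M.G \<delta> \<gamma> p = M.G \<delta> (S.lift \<gamma>1 + T.lift \<gamma>2) p" using d(3) by (simp add: M.G_def)
    then show ?thesis by (simp add: M.G_add_right S.lift_FORM T.lift_FORM d(1,2) that)
  qed
  then show "M.G \<alpha> \<gamma> p = M.G \<beta> \<gamma> p" using F assms(3)[OF d(1)] assms(4)[OF d(2)] by simp
qed

text \<open>The product rule leaves no derivative of \<open>c1\<close>, which is a Casimir
  function.\<close>

lemma sh_G_lift:
  assumes "N1.FORM \<alpha>" "N1.FORM \<beta>" "N1.FORM \<gamma>"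
  shows "M.sh (S.lift \<alpha>) p (M.G (S.lift \<beta>) (S.lift \<gamma>)) = m1 p * c1 p * N1.sh \<alpha> (\<sigma> p) (N1.G \<beta> \<gamma>)"
  unfolding G_lift[OF assms(2,3)]
    M.sh_mult[OF S.lift_FORM[OF assms(1)] c_smooth(1) S.comp_smooth[OF N1.G_smooth[OF assms(2,3)]]]
    sh_lift[OF assms(1) N1.G_smooth[OF assms(2,3)]] c_casimir(1)[OF S.lift_FORM[OF assms(1)]]
  by simp

end

context warped_product
begin

text \<open>Through this term the warping function would couple the two factors. The anchor kills
  \<open>c2\<close> because \<open>c2\<close> is Casimir, and kills the remaining factor because it
  is pulled back from the other side.\<close>

lemma sh_G_lift_cross:
  assumes "N1.FORM \<alpha>" "N2.FORM \<beta>" "N2.FORM \<gamma>"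
  shows "M.sh (S.lift \<alpha>) p (M.G (T.lift \<beta>) (T.lift \<gamma>)) = 0"
  unfolding swap.G_lift[OF assms(2,3)]
    M.sh_mult[OF S.lift_FORM[OF assms(1)] c_smooth(2) T.comp_smooth[OF N2.G_smooth[OF assms(2,3)]]]
    sh_lift_cross[OF assms(1) N2.G_smooth[OF assms(2,3)]] c_casimir(2)[OF S.lift_FORM[OF assms(1)]]
  by simp

lemma G_koszul_lift:
  assumes "N1.FORM \<alpha>" "N1.FORM \<beta>" "N1.FORM \<gamma>"
  shows "M.G (M.kb (S.lift \<alpha>) (S.lift \<beta>)) (S.lift \<gamma>) p = m1 p * c1 p * N1.G (N1.kb \<alpha> \<beta>) \<gamma> (\<sigma> p)"
  unfolding koszul_lift[OF assms(1,2)]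
    M.G_scale_left[OF S.lift_FORM[OF N1.koszul_FORM[OF assms(1,2)]] S.lift_FORM[OF assms(3)]]
    G_lift[OF N1.koszul_FORM[OF assms(1,2)] assms(3)]
  by simp

lemma G_koszul_lift_cross:
  assumes "N1.FORM \<alpha>" "N1.FORM \<beta>" "N2.FORM \<gamma>"
  shows "M.G (M.kb (S.lift \<alpha>) (S.lift \<beta>)) (T.lift \<gamma>) p = 0"
  unfolding koszul_lift[OF assms(1,2)]
    M.G_scale_left[OF S.lift_FORM[OF N1.koszul_FORM[OF assms(1,2)]] T.lift_FORM[OF assms(3)]]
    G_lift_cross[OF N1.koszul_FORM[OF assms(1,2)] assms(3)]
  by simp

lemma G_zero: "M.FORM \<alpha> \<Longrightarrow> M.G 0 \<alpha> p = 0"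
  using M.G_diff_left[OF M.FORM_0 M.FORM_0, of \<alpha>] by simp

end

section \<open>The connection and the curvature on lifted forms\<close>

context warped_product
begin

text \<open>Against lifts from the same factor, every term of the Koszul formula carries the factor
  \<open>m1 p * c1 p\<close>, and \<open>c1\<close> is absorbed by the metric. Against lifts from
  the other factor, every term vanishes.\<close>

lemma D_lift:
  assumes F: "N1.FORM \<alpha>" "N1.FORM \<beta>"
  shows "M.D (S.lift \<alpha>) (S.lift \<beta>) = fscale m1 (S.lift (N1.D \<alpha> \<beta>))"
proof
  fix p
  note l = S.lift_FORM[OF F(1)] S.lift_FORM[OF F(2)]
  note DF = N1.D_FORM[OF F]
  show "M.D (S.lift \<alpha>) (S.lift \<beta>) p = fscale m1 (S.lift (N1.D \<alpha> \<beta>)) p"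
  proof (rule form_eqI_lift[OF M.D_FORM[OF l] M.FORM_scale[OF m_smooth(1) S.lift_FORM[OF DF]]])
    fix \<gamma> assume \<gamma>: "N1.FORM \<gamma>"
    have "2 * M.G (M.D (S.lift \<alpha>) (S.lift \<beta>)) (S.lift \<gamma>) p = m1 p * c1 p * N1.K \<alpha> \<beta> \<gamma> (\<sigma> p)"
      unfolding M.D_koszul[OF l S.lift_FORM[OF \<gamma>]] M.K_def N1.K_def
        sh_G_lift[OF F \<gamma>] sh_G_lift[OF F(2,1) \<gamma>] sh_G_lift[OF \<gamma> F] G_koszul_lift[OF F \<gamma>]
        G_koszul_lift[OF \<gamma> F] G_koszul_lift[OF \<gamma> F(2,1)]
      by (simp add: algebra_simps)
    also have "\<dots> = 2 * M.G (fscale m1 (S.lift (N1.D \<alpha> \<beta>))) (S.lift \<gamma>) p"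
      unfolding N1.D_koszul[OF F \<gamma>, symmetric] M.G_scale_left[OF S.lift_FORM[OF DF] S.lift_FORM[OF \<gamma>]]
        G_lift[OF DF \<gamma>] by simp
    finally show "M.G (M.D (S.lift \<alpha>) (S.lift \<beta>)) (S.lift \<gamma>) p = M.G (fscale m1 (S.lift (N1.D \<alpha> \<beta>))) (S.lift \<gamma>) p"
      by simp
  next
    fix \<gamma> assume \<gamma>: "N2.FORM \<gamma>"
    note lg = T.lift_FORM[OF \<gamma>]
    have "2 * M.G (M.D (S.lift \<alpha>) (S.lift \<beta>)) (T.lift \<gamma>) p = 0"
      unfolding M.D_koszul[OF l lg] M.K_def swap.sh_G_lift_cross[OF \<gamma> F] G_koszul_lift_cross[OF F \<gamma>]
        swap.koszul_lift_cross[OF \<gamma> F(1)] swap.koszul_lift_cross[OF \<gamma> F(2)]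
        G_lift_cross[OF F(1) \<gamma>] G_lift_cross[OF F(2) \<gamma>]
        M.sh_const[OF l(1)] M.sh_const[OF l(2)] G_zero[OF l(1)] G_zero[OF l(2)] by simp
    moreover have "M.G (fscale m1 (S.lift (N1.D \<alpha> \<beta>))) (T.lift \<gamma>) p = 0"
      unfolding M.G_scale_left[OF S.lift_FORM[OF DF] lg] G_lift_cross[OF DF \<gamma>] by simp
    ultimately show "M.G (M.D (S.lift \<alpha>) (S.lift \<beta>)) (T.lift \<gamma>) p = M.G (fscale m1 (S.lift (N1.D \<alpha> \<beta>))) (T.lift \<gamma>) p"
      by simp
  qed
qed

end

context warped_product
begin

text \<open>Each term of the Koszul formula contains a mixed bracket, a mixed pairing, or a
  derivative of one factor's metric along the other factor.\<close>

lemma D_lift_cross: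
  assumes F: "N1.FORM \<alpha>" "N2.FORM \<beta>"
  shows "M.D (S.lift \<alpha>) (T.lift \<beta>) = 0"
proof
  fix p
  note l = S.lift_FORM[OF F(1)] T.lift_FORM[OF F(2)]
  show "M.D (S.lift \<alpha>) (T.lift \<beta>) p = 0 p"
  proof (rule form_eqI_lift[OF M.D_FORM[OF l] M.FORM_0])
    fix \<gamma> assume \<gamma>: "N1.FORM \<gamma>"
    note lg = S.lift_FORM[OF \<gamma>]
    have "2 * M.G (M.D (S.lift \<alpha>) (T.lift \<beta>)) (S.lift \<gamma>) p = 0"
      unfolding M.D_koszul[OF l lg] M.K_def swap.sh_G_lift_cross[OF F(2,1) \<gamma>]
        koszul_lift_cross[OF F] koszul_lift_cross[OF \<gamma> F(2)] G_koszul_lift_cross[OF \<gamma> F]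
        G_lift_cross[OF F] swap.G_lift_cross[OF F(2) \<gamma>]
        M.sh_const[OF l(1)] M.sh_const[OF lg] G_zero[OF l(1)] G_zero[OF lg] by simp
    then show "M.G (M.D (S.lift \<alpha>) (T.lift \<beta>)) (S.lift \<gamma>) p = M.G 0 (S.lift \<gamma>) p"
      using G_zero[OF lg] by simp
  next
    fix \<gamma> assume \<gamma>: "N2.FORM \<gamma>"
    note lg = T.lift_FORM[OF \<gamma>]
    have "2 * M.G (M.D (S.lift \<alpha>) (T.lift \<beta>)) (T.lift \<gamma>) p = 0"
      unfolding M.D_koszul[OF l lg] M.K_def sh_G_lift_cross[OF F \<gamma>]
        koszul_lift_cross[OF F] swap.koszul_lift_cross[OF \<gamma> F(1)] swap.G_koszul_lift_cross[OF \<gamma> F(2,1)]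
        G_lift_cross[OF F] G_lift_cross[OF F(1) \<gamma>]
        M.sh_const[OF l(2)] M.sh_const[OF lg] G_zero[OF l(2)] G_zero[OF lg] by simp
    then show "M.G (M.D (S.lift \<alpha>) (T.lift \<beta>)) (T.lift \<gamma>) p = M.G 0 (T.lift \<gamma>) p"
      using G_zero[OF lg] by simp
  qed
qed

lemma fscale_const_zero: "fscale (\<lambda>_. 0) \<omega> = 0" for \<omega> :: "'m form"
  by (simp add: fscale_def fun_eq_iff)

lemma D_mult_m:
  assumes "M.FORM \<alpha>" "M.FORM \<beta>" shows "M.D \<alpha> (fscale m1 \<beta>) = fscale m1 (M.D \<alpha> \<beta>)"
  unfolding M.D_scale_right[OF m_smooth(1) assms] sh_m[OF assms(1)] fscale_const_zero by simp

text \<open>One factor \<open>m1\<close> comes from each of two derivatives, or from the bracket and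
  one derivative. It passes through \<open>D\<close> because its derivative along every anchor is
  0.\<close>

lemma R_lift:
  assumes F: "N1.FORM \<alpha>" "N1.FORM \<beta>" "N1.FORM \<gamma>"
  shows "M.R (S.lift \<alpha>) (S.lift \<beta>) (S.lift \<gamma>) = fscale m1 (fscale m1 (S.lift (N1.R \<alpha> \<beta> \<gamma>)))"
proof -
  note l = S.lift_FORM[OF F(1)] S.lift_FORM[OF F(2)] S.lift_FORM[OF F(3)]
  have DD: "M.D (S.lift \<alpha>) (M.D (S.lift \<beta>) (S.lift \<gamma>)) = fscale m1 (fscale m1 (S.lift (N1.D \<alpha> (N1.D \<beta> \<gamma>))))"
    if "N1.FORM \<alpha>" "N1.FORM \<beta>" for \<alpha> \<beta>
    unfolding D_lift[OF that(2) F(3)]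
      D_mult_m[OF S.lift_FORM[OF that(1)] S.lift_FORM[OF N1.D_FORM[OF that(2) F(3)]]]
      D_lift[OF that(1) N1.D_FORM[OF that(2) F(3)]] ..
  have "M.D (M.kb (S.lift \<alpha>) (S.lift \<beta>)) (S.lift \<gamma>) = fscale m1 (fscale m1 (S.lift (N1.D (N1.kb \<alpha> \<beta>) \<gamma>)))"
    unfolding koszul_lift[OF F(1,2)] M.D_scale_left[OF m_smooth(1) S.lift_FORM[OF N1.koszul_FORM[OF F(1,2)]] l(3)]
      D_lift[OF N1.koszul_FORM[OF F(1,2)] F(3)] ..
  then show ?thesis
    unfolding M.R_eq N1.R_eq DD[OF F(1,2)] DD[OF F(2,1)] S.lift_diff
    by (simp add: fscale_def fun_eq_iff algebra_simps)
qed

end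

context warped_product
begin

lemma R_lift_cross:
  assumes F: "N1.FORM \<alpha>" "N2.FORM \<beta>" "N2.FORM \<gamma>"
  shows "M.R (S.lift \<alpha>) (T.lift \<beta>) (T.lift \<gamma>) = 0"
proof -
  note l = S.lift_FORM[OF F(1)] T.lift_FORM[OF F(2)] T.lift_FORM[OF F(3)]
  note DF = N2.D_FORM[OF F(2,3)]
  have "M.D (S.lift \<alpha>) (M.D (T.lift \<beta>) (T.lift \<gamma>)) = 0"
    unfolding swap.D_lift[OF F(2,3)] swap.D_mult_m[OF l(1) T.lift_FORM[OF DF]] D_lift_cross[OF F(1) DF]
    by (rule fscale_zero)
  then show ?thesis
    unfolding M.R_eq D_lift_cross[OF F(1,3)] koszul_lift_cross[OF F(1,2)] M.D_zero(1)[OF l(2)] M.D_zero(2)[OF l(3)]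
    by simp
qed

section \<open>The bracket defect of the product\<close>

lemma tor_lift:
  assumes F: "N1.FORM \<alpha>" "N1.FORM \<beta>"
  shows "\<phi> \<in> N1.SF \<Longrightarrow> M.tor (S.lift \<alpha>) (S.lift \<beta>) p (\<phi> \<circ> \<sigma>) = m1 p * (m1 p * N1.tor \<alpha> \<beta> (\<sigma> p) \<phi>)"
    and "\<psi> \<in> N2.SF \<Longrightarrow> M.tor (S.lift \<alpha>) (S.lift \<beta>) p (\<psi> \<circ> \<tau>) = 0"
proof -
  note l = S.lift_FORM[OF F(1)] S.lift_FORM[OF F(2)]
  {
    assume \<phi>: "\<phi> \<in> N1.SF"
    have it: "M.sh (S.lift \<alpha>) p (\<lambda>q. M.sh (S.lift \<beta>) q (\<phi> \<circ> \<sigma>)) = m1 p * (m1 p * N1.sh \<alpha> (\<sigma> p) (\<lambda>y. N1.sh \<beta> y \<phi>))"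
      if F: "N1.FORM \<alpha>" "N1.FORM \<beta>" for \<alpha> \<beta>
    proof -
      note s = N1.sh_smooth[OF F(2) \<phi>]
      have eq: "(\<lambda>q. M.sh (S.lift \<beta>) q (\<phi> \<circ> \<sigma>)) = (\<lambda>q. m1 q * ((\<lambda>y. N1.sh \<beta> y \<phi>) \<circ> \<sigma>) q)"
        by (simp add: sh_lift[OF F(2) \<phi>])
      show ?thesis
        unfolding eq M.sh_mult[OF S.lift_FORM[OF F(1)] m_smooth(1) S.comp_smooth[OF s]]
          sh_lift[OF F(1) s] sh_m[OF S.lift_FORM[OF F(1)]] by simp
    qed
    have "M.sh (M.kb (S.lift \<alpha>) (S.lift \<beta>)) p (\<phi> \<circ> \<sigma>) = m1 p * (m1 p * N1.sh (N1.kb \<alpha> \<beta>) (\<sigma> p) \<phi>)"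
      unfolding koszul_lift[OF F] M.sh_form_scale[OF m_smooth(1) S.lift_FORM[OF N1.koszul_FORM[OF F]]]
        sh_lift[OF N1.koszul_FORM[OF F] \<phi>] ..
    then show "M.tor (S.lift \<alpha>) (S.lift \<beta>) p (\<phi> \<circ> \<sigma>) = m1 p * (m1 p * N1.tor \<alpha> \<beta> (\<sigma> p) \<phi>)"
      unfolding M.tor_eval[OF S.comp_smooth[OF \<phi>]] N1.tor_eval[OF \<phi>] it[OF F] it[OF F(2,1)]
      by (simp add: algebra_simps)
  }
  assume \<psi>: "\<psi> \<in> N2.SF"
  show "M.tor (S.lift \<alpha>) (S.lift \<beta>) p (\<psi> \<circ> \<tau>) = 0"
    unfolding M.tor_eval[OF T.comp_smooth[OF \<psi>]] koszul_lift[OF F] sh_lift_cross[OF F(1) \<psi>] sh_lift_cross[OF F(2) \<psi>]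
      M.sh_const[OF l(1)] M.sh_const[OF l(2)] M.sh_form_scale[OF m_smooth(1) S.lift_FORM[OF N1.koszul_FORM[OF F]]]
      sh_lift_cross[OF N1.koszul_FORM[OF F] \<psi>]
    by simp
qed

end

context warped_product
begin

lemma tor_lift_cross1:
  assumes F: "N1.FORM \<alpha>" "N2.FORM \<beta>" and \<phi>: "\<phi> \<in> N1.SF"
  shows "M.tor (S.lift \<alpha>) (T.lift \<beta>) p (\<phi> \<circ> \<sigma>) = 0"
proof -
  note l = S.lift_FORM[OF F(1)] T.lift_FORM[OF F(2)]
  note s = N1.sh_smooth[OF F(1) \<phi>]
  have eq: "(\<lambda>q. M.sh (S.lift \<alpha>) q (\<phi> \<circ> \<sigma>)) = (\<lambda>q. m1 q * ((\<lambda>y. N1.sh \<alpha> y \<phi>) \<circ> \<sigma>) q)"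
    by (simp add: sh_lift[OF F(1) \<phi>])
  have "M.sh 0 p (\<phi> \<circ> \<sigma>) = 0" using M.sh_form_add[OF M.FORM_0 M.FORM_0, of p "\<phi> \<circ> \<sigma>"] by simp
  then show ?thesis
    unfolding M.tor_eval[OF S.comp_smooth[OF \<phi>]] koszul_lift_cross[OF F] eq
      M.sh_mult[OF l(2) m_smooth(1) S.comp_smooth[OF s]] swap.sh_lift_cross[OF F(2) s]
      swap.sh_lift_cross[OF F(2) \<phi>] sh_m[OF l(2)] M.sh_const[OF l(1)] by simp
qed

end

context warped_product
begin

lemma tor_lift_cross:
  assumes F: "N1.FORM \<alpha>" "N2.FORM \<beta>" shows "M.tor (S.lift \<alpha>) (T.lift \<beta>) p = 0"
proof (rule tangent_zero[OF M.tor_tangent[OF S.lift_FORM[OF F(1)] T.lift_FORM[OF F(2)]]])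
  show "M.tor (S.lift \<alpha>) (T.lift \<beta>) p (\<phi> \<circ> \<sigma>) = 0" if "\<phi> \<in> N1.SF" for \<phi> by (rule tor_lift_cross1[OF F that])
  \<comment> \<open>By antisymmetry this is the mirror image of the case of functions from the first
    factor.\<close>
  show "M.tor (S.lift \<alpha>) (T.lift \<beta>) p (\<psi> \<circ> \<tau>) = 0" if "\<psi> \<in> N2.SF" for \<psi>
    using M.tor_antisym[OF S.lift_FORM[OF F(1)] T.lift_FORM[OF F(2)] T.comp_smooth[OF that], of p]
      swap.tor_lift_cross1[OF F(2,1) that, of p] by simp
qed

lemma tor_lift_zero:
  assumes "\<And>\<phi>. \<phi> \<in> N1.SF \<Longrightarrow> N1.tor \<alpha> \<beta> (\<sigma> p) \<phi> = 0" and F: "N1.FORM \<alpha>" "N1.FORM \<beta>"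
  shows "M.tor (S.lift \<alpha>) (S.lift \<beta>) p = 0"
  by (rule tangent_zero[OF M.tor_tangent[OF S.lift_FORM[OF F(1)] S.lift_FORM[OF F(2)]]])
    (simp_all add: tor_lift[OF F] assms(1))

end

context warped_product
begin

lemma tor_zero:
  assumes z1: "\<And>\<alpha> \<beta> y \<phi>. N1.FORM \<alpha> \<Longrightarrow> N1.FORM \<beta> \<Longrightarrow> \<phi> \<in> N1.SF \<Longrightarrow> N1.tor \<alpha> \<beta> y \<phi> = 0"
    and z2: "\<And>\<alpha> \<beta> y \<phi>. N2.FORM \<alpha> \<Longrightarrow> N2.FORM \<beta> \<Longrightarrow> \<phi> \<in> N2.SF \<Longrightarrow> N2.tor \<alpha> \<beta> y \<phi> = 0"
    and F: "M.FORM \<alpha>" "M.FORM \<beta>" "\<phi> \<in> M.SF"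
  shows "M.tor \<alpha> \<beta> p \<phi> = 0"
proof -
  \<comment> \<open>Splits the form in the first slot into lifts at \<open>p\<close>; antisymmetry
    brings the second slot into the same position.\<close>
  have red: "M.tor \<alpha> \<beta> p \<phi> = 0"
    if F': "M.FORM \<alpha>" "M.FORM \<beta>" and a: "\<And>\<gamma>. N1.FORM \<gamma> \<Longrightarrow> M.tor (S.lift \<gamma>) \<beta> p \<phi> = 0"
      "\<And>\<gamma>. N2.FORM \<gamma> \<Longrightarrow> M.tor (T.lift \<gamma>) \<beta> p \<phi> = 0" for \<alpha> \<beta>
  proof -
    obtain \<gamma>1 \<gamma>2 where d: "N1.FORM \<gamma>1" "N2.FORM \<gamma>2" "\<alpha> p = S.lift \<gamma>1 p + T.lift \<gamma>2 p"
      using cotangent_decomposition[OF M.FORM_cotangent[OF F'(1)]] by blast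
    note l = S.lift_FORM[OF d(1)] T.lift_FORM[OF d(2)]
    have "M.tor \<alpha> \<beta> p \<phi> = M.tor (S.lift \<gamma>1 + T.lift \<gamma>2) \<beta> p \<phi>"
      by (rule M.form_tensorial_cong[where F = "\<lambda>\<alpha>. M.tor \<alpha> \<beta> p \<phi>" and p = p, OF _ _ F'(1) M.FORM_add[OF l]])
        (simp_all add: M.tor_add M.tor_scale F'(2) F(3) d(3))
    then show ?thesis using M.tor_add[OF l F'(2) F(3)] a(1)[OF d(1)] a(2)[OF d(2)] by simp
  qed
  note as = M.tor_antisym[OF _ _ F(3), of _ _ p]
  show ?thesis
  proof (rule red[OF F(1,2)])
    fix \<gamma> assume \<gamma>: "N1.FORM \<gamma>"
    note l = S.lift_FORM[OF \<gamma>]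
    have "M.tor \<beta> (S.lift \<gamma>) p \<phi> = 0"
    proof (rule red[OF F(2) l])
      show "M.tor (S.lift \<delta>) (S.lift \<gamma>) p \<phi> = 0" if "N1.FORM \<delta>" for \<delta>
        using tor_lift_zero[OF z1[OF that \<gamma>] that \<gamma>] by simp
      show "M.tor (T.lift \<delta>) (S.lift \<gamma>) p \<phi> = 0" if "N2.FORM \<delta>" for \<delta>
        using swap.tor_lift_cross[OF that \<gamma>] by simp
    qed
    then show "M.tor (S.lift \<gamma>) \<beta> p \<phi> = 0" using as[OF l F(2)] by simp
  next
    fix \<gamma> assume \<gamma>: "N2.FORM \<gamma>"
    note l = T.lift_FORM[OF \<gamma>]
    have "M.tor \<beta> (T.lift \<gamma>) p \<phi> = 0"
    proof (rule red[OF F(2) l])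
      show "M.tor (T.lift \<delta>) (T.lift \<gamma>) p \<phi> = 0" if "N2.FORM \<delta>" for \<delta>
        using swap.tor_lift_zero[OF z2[OF that \<gamma>] that \<gamma>] by simp
      show "M.tor (S.lift \<delta>) (T.lift \<gamma>) p \<phi> = 0" if "N1.FORM \<delta>" for \<delta>
        using tor_lift_cross[OF that \<gamma>] by simp
    qed
    then show "M.tor (T.lift \<gamma>) \<beta> p \<phi> = 0" using as[OF l F(2)] by simp
  qed
qed

text \<open>Lifts are normalised by \<open>c\<^sub>1\<close> to lift orthonormal frames to orthonormal systems.\<close>

definition u1 :: "'m \<Rightarrow> real" where "u1 p = c1 p powr (- 1/2)"

lemma u_smooth: "u1 \<in> M.SF"
  unfolding u1_def[abs_def] by (rule M.smooth_powr[OF c_smooth(1) c_pos(1)])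

lemma u_sq: "u1 p * (u1 p * c1 p) = 1"
proof -
  have "u1 p * u1 p = c1 p powr (- 1)" unfolding u1_def by (simp add: powr_add[symmetric])
  then show ?thesis using c_pos(1)[of p] by (simp add: mult.assoc[symmetric] powr_minus)
qed

text \<open>Differentiate u1^2 c1 = 1 along the anchor, using that \<open>c1\<close> is
  Casimir.\<close>

lemma u_casimir: assumes "M.FORM \<alpha>" shows "M.sh \<alpha> p u1 = 0"
proof -
  have "M.sh \<alpha> p (\<lambda>q. u1 q * (u1 q * c1 q)) = 0" unfolding u_sq by (rule M.sh_const[OF assms])
  then have "2 * (u1 p * c1 p) * M.sh \<alpha> p u1 = 0"
    by (simp add: M.sh_mult assms u_smooth c_smooth M.smooth_mult c_casimir(1)[OF assms] algebra_simps)
  moreover have "u1 p * c1 p \<noteq> 0" using u_sq[of p] by (metis mult_zero_right zero_neq_one)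
  ultimately show ?thesis by simp
qed

lemma tor_u: assumes "M.FORM \<alpha>" "M.FORM \<beta>" shows "M.tor \<alpha> \<beta> p u1 = 0"
  unfolding M.tor_eval[OF u_smooth] u_casimir[OF assms(1)] u_casimir[OF assms(2)]
    M.sh_const[OF assms(1)] M.sh_const[OF assms(2)] u_casimir[OF M.koszul_FORM[OF assms]] by simp

text \<open>\<open>tor\<close> differentiates along anchors only, so it kills the Casimir function
  \<open>u1\<close>, and the normalising factor can be pulled out of the last argument like out of
  the others.\<close>

lemma R_scale_u:
  assumes F: "M.FORM \<alpha>" "M.FORM \<beta>"
  shows "M.R \<alpha> (fscale u1 \<beta>) (fscale u1 \<beta>) = fscale u1 (fscale u1 (M.R \<alpha> \<beta> \<beta>))"
  unfolding M.R_scale2[OF F M.FORM_scale[OF u_smooth F(2)] u_smooth] M.R_scale3[OF F F(2) u_smooth]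
    tor_u[OF F] fscale_const_zero by simp

text \<open>The normalisation drops out through \<open>u_sq\<close>, once in the sign of the frame
  member and once in the curvature term, where \<open>c1\<close> comes from the pairing with the
  lift of \<open>\<eta>\<close>.\<close>

lemma ricci_summand:
  assumes F: "N1.FORM \<theta>" "N1.FORM e" "N1.FORM \<eta>"
  shows "M.G (fscale u1 (S.lift e)) (fscale u1 (S.lift e)) p
      * M.G (M.R (S.lift \<theta>) (fscale u1 (S.lift e)) (fscale u1 (S.lift e))) (S.lift \<eta>) p
    = m1 p * (m1 p * (N1.G e e (\<sigma> p) * N1.G (N1.R \<theta> e e) \<eta> (\<sigma> p)))"
proof -
  note l = S.lift_FORM[OF F(1)] S.lift_FORM[OF F(2)] S.lift_FORM[OF F(3)]
  note RF = N1.R_FORM[OF F(1,2,2)]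
  have 1: "M.G (fscale u1 (S.lift e)) (fscale u1 (S.lift e)) p = (u1 p * (u1 p * c1 p)) * N1.G e e (\<sigma> p)"
    unfolding M.G_scale_left[OF l(2) M.FORM_scale[OF u_smooth l(2)]] M.G_scale_right[OF u_smooth l(2,2)] G_lift[OF F(2,2)]
    by simp
  have 2: "M.G (M.R (S.lift \<theta>) (fscale u1 (S.lift e)) (fscale u1 (S.lift e))) (S.lift \<eta>) p
      = (u1 p * (u1 p * c1 p)) * (m1 p * (m1 p * N1.G (N1.R \<theta> e e) \<eta> (\<sigma> p)))"
    unfolding R_scale_u[OF l(1,2)] R_lift[OF F(1,2,2)]
    by (simp add: M.G_scale_left M.FORM_scale u_smooth m_smooth S.lift_FORM RF l(3) G_lift[OF RF F(3)])
  show ?thesis unfolding 1 2 u_sq by simp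
qed

lemma ricci_summand_cross:
  assumes F: "N1.FORM \<theta>" "N1.FORM e" "N2.FORM \<eta>"
  shows "M.G (M.R (S.lift \<theta>) (fscale u1 (S.lift e)) (fscale u1 (S.lift e))) (T.lift \<eta>) p = 0"
proof -
  note l = S.lift_FORM[OF F(1)] S.lift_FORM[OF F(2)] T.lift_FORM[OF F(3)]
  note RF = N1.R_FORM[OF F(1,2,2)]
  show ?thesis
    unfolding R_scale_u[OF l(1,2)] R_lift[OF F(1,2,2)]
    by (simp add: M.G_scale_left M.FORM_scale u_smooth m_smooth S.lift_FORM RF l(3) G_lift_cross[OF RF F(3)])
qed

end

context warped_product
begin

lemma ricci_summand_other:
  assumes F: "N2.FORM \<theta>" "N1.FORM e" "M.FORM \<eta>"
  shows "M.G (M.R (T.lift \<theta>) (fscale u1 (S.lift e)) (fscale u1 (S.lift e))) \<eta> p = 0"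
  unfolding R_scale_u[OF T.lift_FORM[OF F(1)] S.lift_FORM[OF F(2)]] swap.R_lift_cross[OF F(1,2,2)]
    fscale_zero by (rule G_zero[OF F(3)])

end

text \<open>Frame indices start at 1. Those beyond \<open>n\<close>, the dimension of the first
  factor, are shifted back by \<open>n\<close> to index the second frame.\<close>

definition product_frame :: "nat \<Rightarrow> ('m \<Rightarrow> real) \<Rightarrow> (nat \<Rightarrow> 'm form) \<Rightarrow> ('m \<Rightarrow> real) \<Rightarrow> (nat \<Rightarrow> 'm form) \<Rightarrow> nat \<Rightarrow> 'm form" where
  "product_frame n u F v H i = (if i \<le> n then fscale u (F i) else fscale v (H (i - n)))"

lemma sum_product_frame:
  "(\<Sum>i\<in>{1..n1 + n2}. f (product_frame n1 u F v H i))
    = (\<Sum>i\<in>{1..n1}. f (fscale u (F i))) + (\<Sum>j\<in>{1..n2}. f (fscale v (H j)) :: real)"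
proof -
  have "(\<Sum>i\<in>{1..n1 + n2}. f (product_frame n1 u F v H i))
      = (\<Sum>i\<in>{1..n1}. f (product_frame n1 u F v H i)) + (\<Sum>i\<in>{n1 + 1..n1 + n2}. f (product_frame n1 u F v H i))"
    by (rule sum.ub_add_nat) simp
  also have "(\<Sum>i\<in>{n1 + 1..n1 + n2}. f (product_frame n1 u F v H i))
      = (\<Sum>j\<in>{1..n2}. f (product_frame n1 u F v H (j + n1)))"
    using sum.shift_bounds_cl_nat_ivl[of "\<lambda>i. f (product_frame n1 u F v H i)" 1 n1 n2] by (simp add: add.commute)
  also have "\<dots> = (\<Sum>j\<in>{1..n2}. f (fscale v (H j)))"
    by (intro sum.cong) (auto simp: product_frame_def)
  also have "(\<Sum>i\<in>{1..n1}. f (product_frame n1 u F v H i)) = (\<Sum>i\<in>{1..n1}. f (fscale u (F i)))"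
    by (intro sum.cong) (auto simp: product_frame_def)
  finally show ?thesis .
qed

section \<open>Ricci curvature in product frames\<close>

context warped_product
begin

abbreviation "lift_frame e e' \<equiv>
  product_frame DIM('d1) u1 (\<lambda>i. S.lift (e i)) swap.u1 (\<lambda>j. T.lift (e' j))"

lemma ricci_lift_frame:
  assumes dim: "DIM('e) = DIM('d1) + DIM('d2)"
    and e: "\<And>i. i \<in> {1..DIM('d1)} \<Longrightarrow> N1.FORM (e i)" and e': "\<And>i. i \<in> {1..DIM('d2)} \<Longrightarrow> N2.FORM (e' i)"
    and F: "N1.FORM \<theta>" "N1.FORM \<eta>" "N2.FORM \<theta>'" "N2.FORM \<eta>'"
  shows "ricci A g P (lift_frame e e') p (S.lift \<theta>) (S.lift \<eta>) = (m1 p)\<^sup>2 * ricci B1 g1 P1 e (\<sigma> p) \<theta> \<eta>"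
    "ricci A g P (lift_frame e e') p (T.lift \<theta>') (T.lift \<eta>') = (m2 p)\<^sup>2 * ricci B2 g2 P2 e' (\<tau> p) \<theta>' \<eta>'"
    "ricci A g P (lift_frame e e') p (S.lift \<theta>) (T.lift \<eta>') = 0"
    "ricci A g P (lift_frame e e') p (T.lift \<theta>') (S.lift \<eta>) = 0"
proof -
  note l = S.lift_FORM[OF F(2)] T.lift_FORM[OF F(4)]
  have exp: "ricci A g P (lift_frame e e') p \<alpha> \<beta>
    = (\<Sum>i\<in>{1..DIM('d1)}. M.G (fscale u1 (S.lift (e i))) (fscale u1 (S.lift (e i))) p
          * M.G (M.R \<alpha> (fscale u1 (S.lift (e i))) (fscale u1 (S.lift (e i)))) \<beta> p)
      + (\<Sum>j\<in>{1..DIM('d2)}. M.G (fscale swap.u1 (T.lift (e' j))) (fscale swap.u1 (T.lift (e' j))) p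
          * M.G (M.R \<alpha> (fscale swap.u1 (T.lift (e' j))) (fscale swap.u1 (T.lift (e' j)))) \<beta> p)" for \<alpha> \<beta>
    unfolding M.ricci_eq dim by (rule sum_product_frame[where f = "\<lambda>E. M.G E E p * M.G (M.R \<alpha> E E) \<beta> p"])
  show "ricci A g P (lift_frame e e') p (S.lift \<theta>) (S.lift \<eta>) = (m1 p)\<^sup>2 * ricci B1 g1 P1 e (\<sigma> p) \<theta> \<eta>"
    unfolding exp N1.ricci_eq
    by (simp add: ricci_summand[OF F(1) e F(2)] swap.ricci_summand_other[OF F(1) e' l(1)]
        sum_distrib_left power2_eq_square mult.assoc)
  show "ricci A g P (lift_frame e e') p (T.lift \<theta>') (T.lift \<eta>') = (m2 p)\<^sup>2 * ricci B2 g2 P2 e' (\<tau> p) \<theta>' \<eta>'"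
    unfolding exp N2.ricci_eq
    by (simp add: swap.ricci_summand[OF F(3) e' F(4)] ricci_summand_other[OF F(3) e l(2)]
        sum_distrib_left power2_eq_square mult.assoc)
  show "ricci A g P (lift_frame e e') p (S.lift \<theta>) (T.lift \<eta>') = 0"
    unfolding exp by (simp add: ricci_summand_cross[OF F(1) e F(4)] swap.ricci_summand_other[OF F(1) e' l(2)])
  show "ricci A g P (lift_frame e e') p (T.lift \<theta>') (S.lift \<eta>) = 0"
    unfolding exp by (simp add: swap.ricci_summand_cross[OF F(3) e' F(2)] ricci_summand_other[OF F(3) e l(1)])
qed

text \<open>The coefficients have to be nonzero at one point above each point of a factor, because
  the Ricci curvature of the factor can be read off at any point above.\<close>

theorem ricci_flat_iff:
  assumes dim: "DIM('e) = DIM('d1) + DIM('d2)"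
    and frame: "\<And>p e e'. orthonormal_frame_at B1 g1 (\<sigma> p) e \<Longrightarrow> orthonormal_frame_at B2 g2 (\<tau> p) e'
      \<Longrightarrow> orthonormal_frame_at A g p (lift_frame e e')"
    and nonzero: "\<And>y. \<exists>p. \<sigma> p = y \<and> m1 p \<noteq> 0" "\<And>z. \<exists>p. \<tau> p = z \<and> m2 p \<noteq> 0"
  shows "ricci_flat A g P \<longleftrightarrow> ricci_flat B1 g1 P1 \<and> ricci_flat B2 g2 P2"
proof (intro iffI conjI)
  have F1: "N1.FORM (e i)" if "orthonormal_frame_at B1 g1 y e" "i \<in> {1..DIM('d1)}" for y e i
    using that unfolding orthonormal_frame_at_def by blast
  have F2: "N2.FORM (e i)" if "orthonormal_frame_at B2 g2 y e" "i \<in> {1..DIM('d2)}" for y e i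
    using that unfolding orthonormal_frame_at_def by blast
  {
    assume flat: "ricci_flat A g P"
    show "ricci_flat B1 g1 P1"
      unfolding ricci_flat_def
    proof (intro allI impI)
      fix y e \<theta> \<eta> assume e: "orthonormal_frame_at B1 g1 y e" and F: "N1.FORM \<theta>" "N1.FORM \<eta>"
      obtain p where p: "\<sigma> p = y" "m1 p \<noteq> 0" using nonzero(1) by blast
      obtain e' where e': "orthonormal_frame_at B2 g2 (\<tau> p) e'" using N2.orthonormal_frame by blast
      have "ricci A g P (lift_frame e e') p (S.lift \<theta>) (S.lift \<eta>) = 0"
        using flat frame[OF e[folded p(1)] e'] S.lift_FORM[OF F(1)] S.lift_FORM[OF F(2)]
        unfolding ricci_flat_def by blast
      then show "ricci B1 g1 P1 e y \<theta> \<eta> = 0"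
        using ricci_lift_frame(1)[where e = e and e' = e' and p = p, OF dim F1[OF e] F2[OF e'] F N2.FORM_0 N2.FORM_0] p
        by simp
    qed
    show "ricci_flat B2 g2 P2"
      unfolding ricci_flat_def
    proof (intro allI impI)
      fix z e' \<theta> \<eta> assume e': "orthonormal_frame_at B2 g2 z e'" and F: "N2.FORM \<theta>" "N2.FORM \<eta>"
      obtain p where p: "\<tau> p = z" "m2 p \<noteq> 0" using nonzero(2) by blast
      obtain e where e: "orthonormal_frame_at B1 g1 (\<sigma> p) e" using N1.orthonormal_frame by blast
      have "ricci A g P (lift_frame e e') p (T.lift \<theta>) (T.lift \<eta>) = 0"
        using flat frame[OF e e'[folded p(1)]] T.lift_FORM[OF F(1)] T.lift_FORM[OF F(2)]
        unfolding ricci_flat_def by blast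
      then show "ricci B2 g2 P2 e' z \<theta> \<eta> = 0"
        using ricci_lift_frame(2)[where e = e and e' = e' and p = p, OF dim F1[OF e] F2[OF e'] N1.FORM_0 N1.FORM_0 F] p
        by simp
    qed
  }
  assume flat: "ricci_flat B1 g1 P1 \<and> ricci_flat B2 g2 P2"
  show "ricci_flat A g P"
    unfolding ricci_flat_def
  proof (intro allI impI)
    fix p e\<^sub>0 \<theta> \<eta> assume e\<^sub>0: "orthonormal_frame_at A g p e\<^sub>0" and F: "M.FORM \<theta>" "M.FORM \<eta>"
    obtain e where e: "orthonormal_frame_at B1 g1 (\<sigma> p) e" using N1.orthonormal_frame by blast
    obtain e' where e': "orthonormal_frame_at B2 g2 (\<tau> p) e'" using N2.orthonormal_frame by blast
    let ?E = "lift_frame e e'"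
    have E: "orthonormal_frame_at A g p ?E" by (rule frame[OF e e'])
    have FE: "M.FORM (?E i)" if "i \<in> {1..DIM('e)}" for i
      using E that unfolding orthonormal_frame_at_def by blast
    obtain \<theta>1 \<theta>2 where t: "N1.FORM \<theta>1" "N2.FORM \<theta>2" "\<theta> p = S.lift \<theta>1 p + T.lift \<theta>2 p"
      using cotangent_decomposition[OF M.FORM_cotangent[OF F(1)]] by blast
    obtain \<eta>1 \<eta>2 where h: "N1.FORM \<eta>1" "N2.FORM \<eta>2" "\<eta> p = S.lift \<eta>1 p + T.lift \<eta>2 p"
      using cotangent_decomposition[OF M.FORM_cotangent[OF F(2)]] by blast
    note lt = S.lift_FORM[OF t(1)] T.lift_FORM[OF t(2)] and lh = S.lift_FORM[OF h(1)] T.lift_FORM[OF h(2)]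
    note lt' = M.FORM_add[OF lt] and lh' = M.FORM_add[OF lh]
    have "ricci A g P e\<^sub>0 p \<theta> \<eta> = ricci A g P ?E p \<theta> \<eta>"
    proof (rule M.ricci_frame_independent[OF _ e\<^sub>0 E F])
      fix \<alpha> \<beta> \<phi> assume "M.FORM \<alpha>" "M.FORM \<beta>" "\<phi> \<in> M.SF"
      then show "M.tor \<alpha> \<beta> p \<phi> = 0"
        using flat by (intro tor_zero N1.ricci_flat_tor N2.ricci_flat_tor) auto
    qed
    also have "\<dots> = ricci A g P ?E p (S.lift \<theta>1 + T.lift \<theta>2) (S.lift \<eta>1 + T.lift \<eta>2)"
      by (rule M.ricci_cong[OF FE F(1) lt' F(2) lh']) (simp_all add: t(3) h(3))
    also have "\<dots> = ricci A g P ?E p (S.lift \<theta>1) (S.lift \<eta>1) + ricci A g P ?E p (S.lift \<theta>1) (T.lift \<eta>2)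
        + (ricci A g P ?E p (T.lift \<theta>2) (S.lift \<eta>1) + ricci A g P ?E p (T.lift \<theta>2) (T.lift \<eta>2))"
      by (simp only: M.ricci_add(1)[where e = ?E, OF FE lt lh' lh'] M.ricci_add(2)[where e = ?E, OF FE lt(1,1) lh]
          M.ricci_add(2)[where e = ?E, OF FE lt(2,2) lh])
    also have "\<dots> = 0"
    proof -
      have "ricci B1 g1 P1 e (\<sigma> p) \<theta>1 \<eta>1 = 0" "ricci B2 g2 P2 e' (\<tau> p) \<theta>2 \<eta>2 = 0"
        using flat e e' t(1,2) h(1,2) unfolding ricci_flat_def by blast+
      moreover have "ricci A g P ?E p (S.lift \<theta>1) (S.lift \<eta>1) = (m1 p)\<^sup>2 * ricci B1 g1 P1 e (\<sigma> p) \<theta>1 \<eta>1"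
        by (rule ricci_lift_frame(1)[OF dim F1[OF e] F2[OF e'] t(1) h(1) t(2) h(2)])
      moreover have "ricci A g P ?E p (T.lift \<theta>2) (T.lift \<eta>2) = (m2 p)\<^sup>2 * ricci B2 g2 P2 e' (\<tau> p) \<theta>2 \<eta>2"
        by (rule ricci_lift_frame(2)[OF dim F1[OF e] F2[OF e'] t(1) h(1) t(2) h(2)])
      moreover have "ricci A g P ?E p (S.lift \<theta>1) (T.lift \<eta>2) = 0"
        by (rule ricci_lift_frame(3)[OF dim F1[OF e] F2[OF e'] t(1) h(1) t(2) h(2)])
      moreover have "ricci A g P ?E p (T.lift \<theta>2) (S.lift \<eta>1) = 0"
        by (rule ricci_lift_frame(4)[OF dim F1[OF e] F2[OF e'] t(1) h(1) t(2) h(2)])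
      ultimately show ?thesis by simp
    qed
    finally show "ricci A g P e\<^sub>0 p \<theta> \<eta> = 0" .
  qed
qed

end

section \<open>Locally constant functions and frames of the product\<close>

context manifold
begin

lemma contravariant_metric_scale:
  assumes g: "contravariant_metric A g" and F: "FORM \<alpha>" "FORM \<beta>"
  shows "g q (fscale u \<alpha> q) (fscale w \<beta> q) = u q * w q * g q (\<alpha> q) (\<beta> q)"
proof -
  have B: "bilinear_form (CS q) (g q)" using g by (simp add: contravariant_metric_def)
  note c = FORM_cotangent[OF F(1), of q] FORM_cotangent[OF F(2), of q]
  have s: "fscale w \<beta> q \<in> CS q" using fsubspace_scale[OF fsubspace_cotangent c(2)] by (simp add: fscale_def)
  show ?thesis
    using linear_form_scale[OF bilinear_form_left[OF B s] c(1), of "u q"]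
      linear_form_scale[OF bilinear_form_right[OF B c(1)] c(2), of "w q"]
    by (simp add: fscale_def)
qed

text \<open>The points of a coordinate ball form a connected set, which lies in one component; hence
  \<open>\<mu>\<close> is constant near \<open>p\<close>.\<close>

lemma essentially_constant_tangent:
  assumes \<mu>: "essentially_constant \<mu>" "\<mu> \<in> SF" and v: "v \<in> TS p"
  shows "v \<mu> = 0"
proof -
  obtain U \<kappa> where U: "(U, \<kappa>) \<in> A" "p \<in> U" by (rule chart_at)
  obtain r where r: "0 < r" "cball (\<kappa> p) r \<subseteq> \<kappa> ` (U \<inter> UNIV)"
    by (rule ball_in_chart[OF U open_UNIV UNIV_I])
  have sub: "ball (\<kappa> p) r \<subseteq> \<kappa> ` U" using r(2) ball_subset_cball[of "\<kappa> p" r] by blast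
  let ?S = "inv_into U \<kappa> ` ball (\<kappa> p) r" and ?C = "connected_component_set UNIV p"
  have conn: "connected ?S"
    by (rule connected_continuous_image[OF continuous_on_subset[OF chart_facts(4)[OF U(1)] sub]
          convex_connected[OF convex_ball]])
  have "p \<in> ?S" using r(1) chart_facts(6)[OF U] by (metis centre_in_ball imageI)
  then have "?S \<subseteq> ?C" by (rule connected_component_maximal[OF _ conn]) simp
  moreover have "\<mu> constant_on ?C"
    using \<mu>(1) componentsI[of p UNIV] unfolding essentially_constant_def by blast
  moreover have "p \<in> ?C" by simp
  ultimately have const: "\<mu> q = \<mu> p" if "q \<in> ?S" for q
    using that unfolding constant_on_def by (metis subsetD)
  have "v \<mu> = v (\<lambda>_. \<mu> p)"
  proof (rule tangent_local[OF v \<mu>(2) smooth_const chart_ball_open[OF U(1), of "\<kappa> p" r]])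
    show "p \<in> {q \<in> U. dist (\<kappa> p) (\<kappa> q) < r}" using U(2) r(1) by simp
    fix q assume "q \<in> {q \<in> U. dist (\<kappa> p) (\<kappa> q) < r}"
    then have "q \<in> ?S" using chart_facts(6)[OF U(1), of q] by (force simp: image_iff)
    then show "\<mu> q = \<mu> p" by (rule const)
  qed
  then show ?thesis using tangent_const[OF v] by simp
qed

end

context manifold_product
begin

sublocale two_projections "prod_atlas A1 A2" A1 A2 fst "\<lambda>p y. (y, snd p)" snd "\<lambda>p z. (fst p, z)"
  by (rule product_projections)

text \<open>Proved before the warped product locale is entered, since that locale presupposes
  orthonormal frames of the product metric, which this lemma supplies.\<close>

lemma orthonormal_product_frame:
  fixes gf :: "'m1 \<times> 'm2 \<Rightarrow> ('m1 \<times> 'm2) covec \<Rightarrow> ('m1 \<times> 'm2) covec \<Rightarrow> real"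
  assumes metric: "contravariant_metric (prod_atlas A1 A2) gf"
    and g11: "\<And>\<alpha> \<beta> q. M1.FORM \<alpha> \<Longrightarrow> M1.FORM \<beta> \<Longrightarrow>
      gf q (hlift A1 A2 \<alpha> q) (hlift A1 A2 \<beta> q) = c1 q * g1 (fst q) (\<alpha> (fst q)) (\<beta> (fst q))"
    and g22: "\<And>\<alpha> \<beta> q. M2.FORM \<alpha> \<Longrightarrow> M2.FORM \<beta> \<Longrightarrow>
      gf q (vlift A1 A2 \<alpha> q) (vlift A1 A2 \<beta> q) = c2 q * g2 (snd q) (\<alpha> (snd q)) (\<beta> (snd q))"
    and g12: "\<And>\<alpha> \<beta> q. M1.FORM \<alpha> \<Longrightarrow> M2.FORM \<beta> \<Longrightarrow> gf q (hlift A1 A2 \<alpha> q) (vlift A1 A2 \<beta> q) = 0"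
    and u: "u1 \<in> M.SF" "u2 \<in> M.SF" "\<And>q. u1 q * (u1 q * c1 q) = 1" "\<And>q. u2 q * (u2 q * c2 q) = 1"
    and e1: "orthonormal_frame_at A1 g1 (fst p) e1" and e2: "orthonormal_frame_at A2 g2 (snd p) e2"
  shows "orthonormal_frame_at (prod_atlas A1 A2) gf p
    (product_frame DIM('e1) u1 (\<lambda>i. hlift A1 A2 (e1 i)) u2 (\<lambda>j. vlift A1 A2 (e2 j)))"
proof -
  let ?E = "product_frame DIM('e1) u1 (\<lambda>i. hlift A1 A2 (e1 i)) u2 (\<lambda>j. vlift A1 A2 (e2 j))"
  let ?I1 = "{1..DIM('e1)}" and ?I2 = "{1..DIM('e2)}"
  obtain U1 where U1: "open U1" "fst p \<in> U1" "\<And>i. i \<in> ?I1 \<Longrightarrow> M1.FORM (e1 i)"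
    "\<And>q i j. q \<in> U1 \<Longrightarrow> i \<in> ?I1 \<Longrightarrow> j \<in> ?I1 \<Longrightarrow>
      if i = j then \<bar>g1 q (e1 i q) (e1 j q)\<bar> = 1 else g1 q (e1 i q) (e1 j q) = 0"
    using e1 unfolding orthonormal_frame_at_def by blast
  obtain U2 where U2: "open U2" "snd p \<in> U2" "\<And>i. i \<in> ?I2 \<Longrightarrow> M2.FORM (e2 i)"
    "\<And>q i j. q \<in> U2 \<Longrightarrow> i \<in> ?I2 \<Longrightarrow> j \<in> ?I2 \<Longrightarrow>
      if i = j then \<bar>g2 q (e2 i q) (e2 j q)\<bar> = 1 else g2 q (e2 i q) (e2 j q) = 0"
    using e2 unfolding orthonormal_frame_at_def by blast
  have l1: "M.FORM (hlift A1 A2 (e1 i))" if "i \<in> ?I1" for i by (rule S.lift_FORM[OF U1(3)[OF that]])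
  have l2: "M.FORM (vlift A1 A2 (e2 i))" if "i \<in> ?I2" for i by (rule T.lift_FORM[OF U2(3)[OF that]])
  note sc = M.contravariant_metric_scale[OF metric]
  have sym: "gf q a b = gf q b a" if "a \<in> M.CS q" "b \<in> M.CS q" for q a b
    using metric that unfolding contravariant_metric_def by blast
  have E11: "gf q (fscale u1 (hlift A1 A2 (e1 i)) q) (fscale u1 (hlift A1 A2 (e1 j)) q) = g1 (fst q) (e1 i (fst q)) (e1 j (fst q))"
    if "i \<in> ?I1" "j \<in> ?I1" for i j q
  proof -
    have "gf q (fscale u1 (hlift A1 A2 (e1 i)) q) (fscale u1 (hlift A1 A2 (e1 j)) q)
        = (u1 q * (u1 q * c1 q)) * g1 (fst q) (e1 i (fst q)) (e1 j (fst q))"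
      unfolding sc[OF l1[OF that(1)] l1[OF that(2)]] g11[OF U1(3)[OF that(1)] U1(3)[OF that(2)]] by simp
    then show ?thesis unfolding u(3) by simp
  qed
  have E22: "gf q (fscale u2 (vlift A1 A2 (e2 i)) q) (fscale u2 (vlift A1 A2 (e2 j)) q) = g2 (snd q) (e2 i (snd q)) (e2 j (snd q))"
    if "i \<in> ?I2" "j \<in> ?I2" for i j q
  proof -
    have "gf q (fscale u2 (vlift A1 A2 (e2 i)) q) (fscale u2 (vlift A1 A2 (e2 j)) q)
        = (u2 q * (u2 q * c2 q)) * g2 (snd q) (e2 i (snd q)) (e2 j (snd q))"
      unfolding sc[OF l2[OF that(1)] l2[OF that(2)]] g22[OF U2(3)[OF that(1)] U2(3)[OF that(2)]] by simp
    then show ?thesis unfolding u(4) by simp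
  qed
  have E12: "gf q (fscale u1 (hlift A1 A2 (e1 i)) q) (fscale u2 (vlift A1 A2 (e2 j)) q) = 0"
    if "i \<in> ?I1" "j \<in> ?I2" for i j q
    unfolding sc[OF l1[OF that(1)] l2[OF that(2)]] g12[OF U1(3)[OF that(1)] U2(3)[OF that(2)]] by simp
  have E21: "gf q (fscale u2 (vlift A1 A2 (e2 j)) q) (fscale u1 (hlift A1 A2 (e1 i)) q) = 0"
    if "i \<in> ?I1" "j \<in> ?I2" for i j q
    using E12[OF that] sym[OF M.FORM_cotangent[OF M.FORM_scale[OF u(2) l2[OF that(2)]]]
        M.FORM_cotangent[OF M.FORM_scale[OF u(1) l1[OF that(1)]]]] by simp
  have split: "i \<in> ?I1 \<or> i - DIM('e1) \<in> ?I2 \<and> \<not> i \<le> DIM('e1)" if "i \<in> {1..DIM('e1 \<times> 'e2)}" for i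
    using that by auto
  show ?thesis
    unfolding orthonormal_frame_at_def
  proof (intro conjI exI[of _ "U1 \<times> U2"] ballI)
    fix i assume "i \<in> {1..DIM('e1 \<times> 'e2)}"
    from split[OF this] show "M.FORM (?E i)"
      using M.FORM_scale[OF u(1) l1] M.FORM_scale[OF u(2) l2] by (auto simp: product_frame_def)
  next
    fix q i j assume q: "q \<in> U1 \<times> U2" and i: "i \<in> {1..DIM('e1 \<times> 'e2)}" and j: "j \<in> {1..DIM('e1 \<times> 'e2)}"
    let ?i = "i - DIM('e1)" and ?j = "j - DIM('e1)"
    have q': "fst q \<in> U1" "snd q \<in> U2" using q by auto
    consider "i \<in> ?I1" "j \<in> ?I1" | "i \<in> ?I1" "?j \<in> ?I2" "\<not> j \<le> DIM('e1)"
      | "?i \<in> ?I2" "\<not> i \<le> DIM('e1)" "j \<in> ?I1" | "?i \<in> ?I2" "\<not> i \<le> DIM('e1)" "?j \<in> ?I2" "\<not> j \<le> DIM('e1)"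
      using split[OF i] split[OF j] by blast
    then show "if i = j then \<bar>gf q (?E i q) (?E j q)\<bar> = 1 else gf q (?E i q) (?E j q) = 0"
    proof cases
      case 1
      then have "?E i = fscale u1 (hlift A1 A2 (e1 i))" "?E j = fscale u1 (hlift A1 A2 (e1 j))"
        by (simp_all add: product_frame_def)
      then show ?thesis using U1(4)[OF q'(1) 1] E11[OF 1, of q] by (cases "i = j") simp_all
    next
      case 2
      then have "?E i = fscale u1 (hlift A1 A2 (e1 i))" "?E j = fscale u2 (vlift A1 A2 (e2 ?j))" "i \<noteq> j"
        by (auto simp: product_frame_def)
      then show ?thesis using E12[OF 2(1,2), of q] by simp
    next
      case 3
      then have "?E i = fscale u2 (vlift A1 A2 (e2 ?i))" "?E j = fscale u1 (hlift A1 A2 (e1 j))" "i \<noteq> j"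
        by (auto simp: product_frame_def)
      then show ?thesis using E21[OF 3(3,1), of q] by simp
    next
      case 4
      then have "?E i = fscale u2 (vlift A1 A2 (e2 ?i))" "?E j = fscale u2 (vlift A1 A2 (e2 ?j))" "i = j \<longleftrightarrow> ?i = ?j"
        by (auto simp: product_frame_def)
      then show ?thesis using U2(4)[OF q'(2) 4(1,3)] E22[OF 4(1,3), of q] by (cases "i = j") simp_all
    qed
  qed (use U1(1,2) U2(1,2) in \<open>auto simp: open_Times mem_Times_iff\<close>)
qed

end

section \<open>Ricci flat warped products\<close>

theorem theorem5p5:
  fixes A1 :: "('m1::{t2_space, second_countable_topology}, 'e1::euclidean_space) atlas"
    and A2 :: "('m2::{t2_space, second_countable_topology}, 'e2::euclidean_space) atlas"
    and gt1 :: "'m1 \<Rightarrow> 'm1 tvec \<Rightarrow> 'm1 tvec \<Rightarrow> real"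
    and gt2 :: "'m2 \<Rightarrow> 'm2 tvec \<Rightarrow> 'm2 tvec \<Rightarrow> real"
    and g1 P1 :: "'m1 \<Rightarrow> 'm1 covec \<Rightarrow> 'm1 covec \<Rightarrow> real"
    and g2 P2 :: "'m2 \<Rightarrow> 'm2 covec \<Rightarrow> 'm2 covec \<Rightarrow> real"
    and gf P\<mu> :: "'m1 \<times> 'm2 \<Rightarrow> ('m1 \<times> 'm2) covec \<Rightarrow> ('m1 \<times> 'm2) covec \<Rightarrow> real"
    and f \<mu> :: "'m1 \<Rightarrow> real"
  assumes "smooth_manifold A1" and "smooth_manifold A2"
    and "pseudo_riemannian_metric A1 gt1" and "pseudo_riemannian_metric A2 gt2"
    and "g1 = cometric A1 gt1" and "g2 = cometric A2 gt2"
    and "bivector_field A1 P1" and "bivector_field A2 P2"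
    and "f \<in> smooth_functions A1" and "\<forall>x. f x > 0"
    and "\<mu> \<in> smooth_functions A1"
    and "warped_bivector A1 A2 P1 P2 \<mu> P\<mu>"
    and "warped_metric A1 A2 g1 g2 f gf"
    and "casimir A1 P1 f"
    and "essentially_constant \<mu>" and "\<exists>x. \<mu> x \<noteq> 0"
  shows "ricci_flat (prod_atlas A1 A2) gf P\<mu> \<longleftrightarrow> ricci_flat A1 g1 P1 \<and> ricci_flat A2 g2 P2"
proof -
  interpret manifold_product A1 A2 by unfold_locales (fact assms(1,2))+
  interpret R1: pseudo_riemannian_manifold A1 gt1 by unfold_locales (fact assms(3))
  interpret R2: pseudo_riemannian_manifold A2 gt2 by unfold_locales (fact assms(4))
  interpret N1: metric_manifold A1 P1 g1
    by unfold_locales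
      (use assms(7) R1.cometric_contravariant R1.cometric_frame in \<open>simp_all add: assms(5)\<close>)
  interpret N2: metric_manifold A2 P2 g2
    by unfold_locales
      (use assms(8) R2.cometric_contravariant R2.cometric_frame in \<open>simp_all add: assms(6)\<close>)
  \<comment> \<open>The first factor is not rescaled, so \<open>?c1\<close> serves as coefficient
    both of its metric and of its bivector field. The second factor has \<open>f\<close> in the
    metric and \<open>\<mu>\<close> in the bivector field.\<close>
  let ?c1 = "\<lambda>_ :: 'm1 \<times> 'm2. 1 :: real" and ?c2 = "f \<circ> fst" and ?m2 = "\<mu> \<circ> fst"
  have metric: "contravariant_metric (prod_atlas A1 A2) gf" using assms(13) by (simp add: warped_metric_def)
  \<comment> \<open>The mixed clause of \<open>warped_metric\<close> pairs with the first of the two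
    forms on the second factor, hence the second instance, in which these two are exchanged.\<close>
  have g_rules: "gf q (hlift A1 A2 \<alpha> q) (hlift A1 A2 \<beta> q) = ?c1 q * g1 (fst q) (\<alpha> (fst q)) (\<beta> (fst q))"
      "gf q (vlift A1 A2 \<alpha>' q) (vlift A1 A2 \<beta>' q) = ?c2 q * g2 (snd q) (\<alpha>' (snd q)) (\<beta>' (snd q))"
      "gf q (hlift A1 A2 \<alpha> q) (vlift A1 A2 \<beta>' q) = 0"
    if "M1.FORM \<alpha>" "M1.FORM \<beta>" "M2.FORM \<alpha>'" "M2.FORM \<beta>'" for \<alpha> \<beta> \<alpha>' \<beta>' q
    using assms(13)[unfolded warped_metric_def, THEN conjunct2, rule_format, OF that, of "fst q" "snd q"]
      assms(13)[unfolded warped_metric_def, THEN conjunct2, rule_format, OF that(1,2,4,3), of "fst q" "snd q"]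
    by simp_all
  have P_rules: "P\<mu> q (hlift A1 A2 \<alpha> q) (hlift A1 A2 \<beta> q) = ?c1 q * P1 (fst q) (\<alpha> (fst q)) (\<beta> (fst q))"
      "P\<mu> q (vlift A1 A2 \<alpha>' q) (vlift A1 A2 \<beta>' q) = ?m2 q * P2 (snd q) (\<alpha>' (snd q)) (\<beta>' (snd q))"
      "P\<mu> q (hlift A1 A2 \<alpha> q) (vlift A1 A2 \<beta>' q) = 0"
    if "M1.FORM \<alpha>" "M1.FORM \<beta>" "M2.FORM \<alpha>'" "M2.FORM \<beta>'" for \<alpha> \<beta> \<alpha>' \<beta>' q
    using assms(12)[unfolded warped_bivector_def, THEN conjunct2, rule_format, OF that, of "fst q" "snd q"]
    by simp_all
  \<comment> \<open>Both definitions quantify over four forms at once; zero forms fill the places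
    that a clause does not mention.\<close>
  note gr = g_rules(1)[OF _ _ M2.FORM_0 M2.FORM_0] g_rules(2)[OF M1.FORM_0 M1.FORM_0] g_rules(3)[OF _ M1.FORM_0 M2.FORM_0]
  note Pr = P_rules(1)[OF _ _ M2.FORM_0 M2.FORM_0] P_rules(2)[OF M1.FORM_0 M1.FORM_0] P_rules(3)[OF _ M1.FORM_0 M2.FORM_0]
  have c2: "?c2 \<in> M.SF" "?c2 q > 0" for q using smooth_comp_fst[OF assms(9)] assms(10) by simp_all
  have frame: "orthonormal_frame_at (prod_atlas A1 A2) gf p
      (product_frame DIM('e1) u1 (\<lambda>i. hlift A1 A2 (e1 i)) u2 (\<lambda>j. vlift A1 A2 (e2 j)))"
    if "orthonormal_frame_at A1 g1 (fst p) e1" "orthonormal_frame_at A2 g2 (snd p) e2" "u1 \<in> M.SF" "u2 \<in> M.SF"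
      "\<And>q. u1 q * (u1 q * ?c1 q) = 1" "\<And>q. u2 q * (u2 q * ?c2 q) = 1"
    for p :: "'m1 \<times> 'm2" and e1 e2 u1 u2
    by (rule orthonormal_product_frame[OF metric gr that(3-6,1,2)])
  interpret M: metric_manifold "prod_atlas A1 A2" P\<mu> gf
  proof unfold_locales
    show "bivector_field (prod_atlas A1 A2) P\<mu>" using assms(12) by (simp add: warped_bivector_def)
    show "contravariant_metric (prod_atlas A1 A2) gf" by (rule metric)
    fix p :: "'m1 \<times> 'm2"
    obtain e1 where e1: "orthonormal_frame_at A1 g1 (fst p) e1" using N1.orthonormal_frame by blast
    obtain e2 where e2: "orthonormal_frame_at A2 g2 (snd p) e2" using N2.orthonormal_frame by blast
    let ?u = "\<lambda>q. ?c2 q powr (- 1/2)"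
    have u: "?u q * (?u q * ?c2 q) = 1" for q
    proof -
      have "?u q * ?u q = ?c2 q powr (- 1)" by (simp only: powr_add[symmetric]) simp
      then show ?thesis using c2(2)[of q] by (simp add: mult.assoc[symmetric] powr_minus)
    qed
    have "orthonormal_frame_at (prod_atlas A1 A2) gf p
        (product_frame DIM('e1) ?c1 (\<lambda>i. hlift A1 A2 (e1 i)) ?u (\<lambda>j. vlift A1 A2 (e2 j)))"
      by (rule frame[OF e1 e2 M.smooth_const M.smooth_powr[OF c2] _ u]) simp
    then show "\<exists>e. orthonormal_frame_at (prod_atlas A1 A2) gf p e" by blast
  qed
  \<comment> \<open>Decompose \<open>\<omega>\<close> at \<open>p\<close>. Its vertical part pairs
    to 0 with the lift of df under \<open>P\<mu>\<close>; its horizontal part gives P1(\<alpha>,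
    df), which is 0 since the anchor of df is 0.\<close>
  have casimir: "M.sh \<omega> p ?c2 = 0" if \<omega>: "M.FORM \<omega>" for \<omega> p
  proof -
    obtain \<alpha> \<beta> where d: "M1.FORM \<alpha>" "M2.FORM \<beta>" "\<omega> p = hlift A1 A2 \<alpha> p + vlift A1 A2 \<beta> p"
      using cotangent_decomposition[OF M.FORM_cotangent[OF \<omega>]] by blast
    note df = M1.FORM_differential[OF assms(9)]
    note l = M.FORM_cotangent[OF S.lift_FORM[OF d(1)], of p] M.FORM_cotangent[OF T.lift_FORM[OF d(2)], of p]
      M.FORM_cotangent[OF S.lift_FORM[OF df], of p]
    have "N1.sh (M1.d f) = 0" using assms(14) by (simp add: casimir_def)
    then have "P1 (fst p) (M1.d f (fst p)) (\<alpha> (fst p)) = \<alpha> (fst p) 0"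
      using N1.FORM_anchor[OF df d(1), of "fst p"] by simp
    also have "\<dots> = 0"
      by (rule linear_form_0[OF M1.fsubspace_tangent M1.cotangentD(1)[OF M1.FORM_cotangent[OF d(1)]]])
    finally have z: "P1 (fst p) (\<alpha> (fst p)) (M1.d f (fst p)) = 0"
      using N1.P_antisym[OF M1.FORM_cotangent[OF d(1)] M1.FORM_cotangent[OF df], of "fst p"] by simp
    have "M.sh \<omega> p ?c2 = P\<mu> p (\<omega> p) (hlift A1 A2 (M1.d f) p)"
      by (simp add: M.anchor_eval[OF \<omega> c2(1)] S.lift_differential[OF assms(9)])
    also have "\<dots> = P\<mu> p (hlift A1 A2 \<alpha> p) (hlift A1 A2 (M1.d f) p)
        + P\<mu> p (vlift A1 A2 \<beta> p) (hlift A1 A2 (M1.d f) p)"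
      unfolding d(3) by (rule M.P_add_left[OF l])
    also have "\<dots> = 0" using z Pr(1)[OF d(1) df, of p] Pr(3)[OF df d(2), of p] M.P_antisym[OF l(2,3)] by simp
    finally show ?thesis .
  qed
  have m2: "v ?m2 = 0" if v: "v \<in> M.TS p" for v p
    using M1.essentially_constant_tangent[OF assms(15,11) S.push_tangent[OF v]] assms(11)
    by (simp add: S.push_def)
  interpret W: warped_product "prod_atlas A1 A2" A1 A2 fst "\<lambda>p y. (y, snd p)" snd "\<lambda>p z. (fst p, z)"
    P\<mu> gf P1 g1 P2 g2 ?c1 ?c1 ?m2 ?c2
  proof unfold_locales
    show "?c1 \<in> M.SF" by (rule M.smooth_const)
    show "?m2 \<in> M.SF" by (rule smooth_comp_fst[OF assms(11)])
    show "?c2 \<in> M.SF" by (rule c2(1))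
    show "v ?c1 = 0" if "v \<in> M.TS p" for v p by (rule M.tangent_const[OF that])
    show "v ?m2 = 0" if "v \<in> M.TS p" for v p by (rule m2[OF that])
    show "M.sh \<omega> p ?c1 = 0" if "M.FORM \<omega>" for \<omega> p by (rule M.sh_const[OF that])
    show "M.sh \<omega> p ?c2 = 0" if "M.FORM \<omega>" for \<omega> p by (rule casimir[OF that])
    show "?c2 p > 0" for p by (rule c2(2))
  qed (fact Pr gr | simp)+
  show ?thesis
  proof (rule W.ricci_flat_iff)
    show "orthonormal_frame_at (prod_atlas A1 A2) gf p (W.lift_frame e e')"
      if "orthonormal_frame_at A1 g1 (fst p) e" "orthonormal_frame_at A2 g2 (snd p) e'"
      for p :: "'m1 \<times> 'm2" and e e'
      by (rule frame[OF that W.u_smooth W.swap.u_smooth W.u_sq W.swap.u_sq])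
    \<comment> \<open>The coefficient depends on the first coordinate only, so one point with
      \<open>\<mu>\<close> nonzero serves every \<open>z\<close>.\<close>
    show "\<exists>p :: 'm1 \<times> 'm2. snd p = z \<and> ?m2 p \<noteq> 0" for z
    proof -
      obtain x where "\<mu> x \<noteq> 0" using assms(16) by blast
      then show ?thesis by (intro exI[of _ "(x, z)"]) simp
    qed
  qed simp_all
qed

end
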